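(* Let $R$ be a commutative Noetherian ring with non-zero identity, let $I$ be an ideal of $R$, and let $S$ be a multiplicatively closed subset of $R$ such that $S\subseteq R\setminus\bigcup\{\mathfrak{p}\mid \mathfrak{p}\in\overline{A^{\ast\ast}}(I)\}$. Then $\overline{I^n}R_S\cap R=\overline{I^n}$ for all integers $n>0$.
   Context: All rings are commutative and Noetherian with non-zero identity. Integral closure of an ideal $J$ of $R$: $\overline{J}$ is the set of $x\in R$ satisfying an equation $x^n+c_1x^{n-1}+\dots+c_n=0$ with $n\ge 1$ and $c_i\in J^i$ for $i=1,\dots,n$. $R_S$ is the localization of $R$ at $S$, and for an ideal $J$ of $R$, $JR_S\cap R$ denotes the preimage of $JR_S$ under the canonical map $R\to R_S$. Graded Rees ring: $\mathscr{R}=R[u,It]=\bigoplus_{n\in\mathbb{Z}}I^nt^n$, where $t$ is an indeterminate, $u=t^{-1}$, and $I^n=R$ for $n\le 0$. It contains $R$ as a subring. Quintasymptotic primes: for a prime $\mathfrak{p}$ of a Noetherian ring $R$, $R_{\mathfrak p}^\ast$ denotes the completion of the local ring $R_{\mathfrak p}$ in its maximal-ideal-adic topology. $\overline{Q^\ast}(I)$ is the set of all $\mathfrak{p}\in\operatorname{Spec}R$ such that $I\subseteq\mathfrak{p}$ and there is a minimal prime $z$ of $R_{\mathfrak p}^\ast$ with $\mathfrak{p}R_{\mathfrak p}^\ast$ minimal over $IR_{\mathfrak p}^\ast+z$. $\overline{A^{\ast\ast}}(I)=\{\mathfrak{q}\cap R \mid \mathfrak{q}\in\overline{Q^\ast}(u\mathscr{R})\}$,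 where $\overline{Q^\ast}(u\mathscr{R})$ is formed in the ring $\mathscr{R}$. *)

theory Defs
  imports "HOL-Algebra.Algebra"
begin

text \<open>The multiplication of \<^const>\<open>ideals_set\<close> is the product of ideals and its unit is the
  whole ring, so that the power with exponent \<open>0\<close> is \<^term>\<open>carrier R\<close>.\<close>

definition ideal_power :: "('a, 'm) ring_scheme \<Rightarrow> 'a set \<Rightarrow> nat \<Rightarrow> 'a set"
  where "ideal_power R J n = J [^]\<^bsub>ideals_set R\<^esub> n"

definition integral_closure :: "('a, 'm) ring_scheme \<Rightarrow> 'a set \<Rightarrow> 'a set"
  where "integral_closure R J =
    {x \<in> carrier R. \<exists>n\<ge>1. \<exists>c :: nat \<Rightarrow> 'a.
       (\<forall>i\<in>{1..n}. c i \<in> ideal_power R J i) \<and>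
       x [^]\<^bsub>R\<^esub> n \<oplus>\<^bsub>R\<^esub> (\<Oplus>\<^bsub>R\<^esub>i\<in>{1..n}. c i \<otimes>\<^bsub>R\<^esub> x [^]\<^bsub>R\<^esub> (n - i)) = \<zero>\<^bsub>R\<^esub>}"

definition minimal_primes_over :: "('a, 'm) ring_scheme \<Rightarrow> 'a set \<Rightarrow> 'a set set"
  where "minimal_primes_over R J =
    {P. primeideal P R \<and> J \<subseteq> P \<and> (\<forall>Q. primeideal Q R \<and> J \<subseteq> Q \<and> Q \<subseteq> P \<longrightarrow> Q = P)}"

definition extended_ideal ::
    "('b, 'm) ring_scheme \<Rightarrow> ('a \<Rightarrow> 'b) \<Rightarrow> 'a set \<Rightarrow> 'b set"
  where "extended_ideal B h J = Idl\<^bsub>B\<^esub> (h ` J)"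

definition contracted_ideal ::
    "('a, 'm) ring_scheme \<Rightarrow> ('a \<Rightarrow> 'b) \<Rightarrow> 'b set \<Rightarrow> 'a set"
  where "contracted_ideal A h K = {a \<in> carrier A. h a \<in> K}"


subsection \<open>Localization\<close>

text \<open>The factor \<open>v\<close> makes this correct also when \<open>S\<close> contains zero divisors, or zero itself.\<close>

definition frac_rel :: "('a, 'm) ring_scheme \<Rightarrow> 'a set \<Rightarrow> (('a \<times> 'a) \<times> ('a \<times> 'a)) set"
  where "frac_rel R S =
    {((a, s), (b, t)) | a s b t. a \<in> carrier R \<and> s \<in> S \<and> b \<in> carrier R \<and> t \<in> S \<and>
       (\<exists>v\<in>S. v \<otimes>\<^bsub>R\<^esub> (a \<otimes>\<^bsub>R\<^esub> t) = v \<otimes>\<^bsub>R\<^esub> (b \<otimes>\<^bsub>R\<^esub> s))}"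

definition loc_frac :: "('a, 'm) ring_scheme \<Rightarrow> 'a set \<Rightarrow> 'a \<Rightarrow> 'a \<Rightarrow> ('a \<times> 'a) set"
  where "loc_frac R S a s = frac_rel R S `` {(a, s)}"

definition localization :: "('a, 'm) ring_scheme \<Rightarrow> 'a set \<Rightarrow> ('a \<times> 'a) set ring"
  where "localization R S =
    \<lparr>carrier = (carrier R \<times> S) // frac_rel R S,
     monoid.mult = (\<lambda>C D. \<Union>(a, s)\<in>C. \<Union>(b, t)\<in>D. loc_frac R S (a \<otimes>\<^bsub>R\<^esub> b) (s \<otimes>\<^bsub>R\<^esub> t)),
     one = loc_frac R S \<one>\<^bsub>R\<^esub> \<one>\<^bsub>R\<^esub>,
     ring.zero = loc_frac R S \<zero>\<^bsub>R\<^esub> \<one>\<^bsub>R\<^esub>,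
     add = (\<lambda>C D. \<Union>(a, s)\<in>C. \<Union>(b, t)\<in>D.
       loc_frac R S ((a \<otimes>\<^bsub>R\<^esub> t) \<oplus>\<^bsub>R\<^esub> (b \<otimes>\<^bsub>R\<^esub> s)) (s \<otimes>\<^bsub>R\<^esub> t))\<rparr>"

definition localization_map :: "('a, 'm) ring_scheme \<Rightarrow> 'a set \<Rightarrow> 'a \<Rightarrow> ('a \<times> 'a) set"
  where "localization_map R S a = loc_frac R S a \<one>\<^bsub>R\<^esub>"


subsection \<open>Adic completion\<close>

text \<open>The completion of \<open>A\<close> in the \<open>J\<close>-adic topology, as the inverse limit of the rings
  \<open>A / J\<^sup>n\<close>. The transition map sends a coset of \<open>J\<^sup>n\<^sup>+\<^sup>1\<close> to the unique coset of \<open>J\<^sup>n\<close> containing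
  it, so compatibility of the components is inclusion.\<close>

definition adic_completion :: "('a, 'm) ring_scheme \<Rightarrow> 'a set \<Rightarrow> (nat \<Rightarrow> 'a set) ring"
  where "adic_completion A J =
    \<lparr>carrier = {f. (\<forall>n. f n \<in> carrier (A Quot ideal_power A J n)) \<and> (\<forall>n. f (Suc n) \<subseteq> f n)},
     monoid.mult = (\<lambda>f g n. f n \<otimes>\<^bsub>A Quot ideal_power A J n\<^esub> g n),
     one = (\<lambda>n. \<one>\<^bsub>A Quot ideal_power A J n\<^esub>),
     ring.zero = (\<lambda>n. \<zero>\<^bsub>A Quot ideal_power A J n\<^esub>),
     add = (\<lambda>f g n. f n \<oplus>\<^bsub>A Quot ideal_power A J n\<^esub> g n)\<rparr>"

definition completion_map :: "('a, 'm) ring_scheme \<Rightarrow> 'a set \<Rightarrow> 'a \<Rightarrow> nat \<Rightarrow> 'a set"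
  where "completion_map A J a = (\<lambda>n. ideal_power A J n +>\<^bsub>A\<^esub> a)"


subsection \<open>Completed local rings and quintasymptotic primes\<close>

definition local_ring_at :: "('a, 'm) ring_scheme \<Rightarrow> 'a set \<Rightarrow> ('a \<times> 'a) set ring"
  where "local_ring_at R P = localization R (carrier R - P)"

definition local_maximal_ideal :: "('a, 'm) ring_scheme \<Rightarrow> 'a set \<Rightarrow> ('a \<times> 'a) set set"
  where "local_maximal_ideal R P =
    extended_ideal (local_ring_at R P) (localization_map R (carrier R - P)) P"

definition completed_local_ring ::
    "('a, 'm) ring_scheme \<Rightarrow> 'a set \<Rightarrow> (nat \<Rightarrow> ('a \<times> 'a) set set) ring"
  where "completed_local_ring R P =
    adic_completion (local_ring_at R P) (local_maximal_ideal R P)"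

definition completed_local_map ::
    "('a, 'm) ring_scheme \<Rightarrow> 'a set \<Rightarrow> 'a \<Rightarrow> nat \<Rightarrow> ('a \<times> 'a) set set"
  where "completed_local_map R P =
    completion_map (local_ring_at R P) (local_maximal_ideal R P) \<circ>
    localization_map R (carrier R - P)"

definition quintasymptotic_primes :: "('a, 'm) ring_scheme \<Rightarrow> 'a set \<Rightarrow> 'a set set"
  where "quintasymptotic_primes R J =
    {P. primeideal P R \<and> J \<subseteq> P \<and>
       (\<exists>z \<in> minimal_primes_over (completed_local_ring R P) {\<zero>\<^bsub>completed_local_ring R P\<^esub>}.
          extended_ideal (completed_local_ring R P) (completed_local_map R P) P
          \<in> minimal_primes_over (completed_local_ring R P)
              (extended_ideal (completed_local_ring R P) (completed_local_map R P) J
                <+>\<^bsub>completed_local_ring R P\<^esub> z))}"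


subsection \<open>The graded Rees ring\<close>

text \<open>The element \<open>\<Sum>n. f n t\<^sup>n\<close> of \<open>R[u, It]\<close> is represented by its coefficient function \<open>f\<close>.
  Since \<^const>\<open>nat\<close> sends negative integers to \<open>0\<close>, the power occurring in \<open>carrier\<close> is
  \<^term>\<open>carrier R\<close> for \<open>n \<le> 0\<close>.\<close>

definition rees_ring :: "('a, 'm) ring_scheme \<Rightarrow> 'a set \<Rightarrow> (int \<Rightarrow> 'a) ring"
  where "rees_ring R I =
    \<lparr>carrier = {f. (\<forall>n. f n \<in> ideal_power R I (nat n)) \<and> finite {n. f n \<noteq> \<zero>\<^bsub>R\<^esub>}},
     monoid.mult = (\<lambda>f g n. \<Oplus>\<^bsub>R\<^esub>k\<in>{k. f k \<noteq> \<zero>\<^bsub>R\<^esub>}. f k \<otimes>\<^bsub>R\<^esub> g (n - k)),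
     one = (\<lambda>n. if n = 0 then \<one>\<^bsub>R\<^esub> else \<zero>\<^bsub>R\<^esub>),
     ring.zero = (\<lambda>_. \<zero>\<^bsub>R\<^esub>),
     add = (\<lambda>f g n. f n \<oplus>\<^bsub>R\<^esub> g n)\<rparr>"

definition rees_const :: "('a, 'm) ring_scheme \<Rightarrow> 'a \<Rightarrow> int \<Rightarrow> 'a"
  where "rees_const R a = (\<lambda>n. if n = 0 then a else \<zero>\<^bsub>R\<^esub>)"

definition rees_u :: "('a, 'm) ring_scheme \<Rightarrow> int \<Rightarrow> 'a"
  where "rees_u R = (\<lambda>n. if n = - 1 then \<one>\<^bsub>R\<^esub> else \<zero>\<^bsub>R\<^esub>)"

definition A_star_star :: "('a, 'm) ring_scheme \<Rightarrow> 'a set \<Rightarrow> 'a set set"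
  where "A_star_star R I =
    {contracted_ideal R (rees_const R) Q | Q.
       Q \<in> quintasymptotic_primes (rees_ring R I) (PIdl\<^bsub>rees_ring R I\<^esub> (rees_u R))}"

end

theory Submission imports Defs begin

text \<open>An element of \<open>R\<close> lies in the integral closure of \<open>I\<^sup>n\<close> iff it is integral over \<open>v = u\<^sup>n\<close> in the
  Rees ring. As \<open>S\<close> avoids the quintasymptotic primes of \<open>(u)\<close> there, it suffices to show, in any
  Noetherian ring: if \<open>x\<close> is not integral over \<open>v = u\<^sup>n\<close>, then some quintasymptotic prime of \<open>(u)\<close>
  contains \<open>{a. \<exists>e. a x\<^bsup>e+1\<^esup> \<in> v (x, v)\<^sup>e}\<close>. Every prime \<open>P\<close> minimal over this ideal is one.

  Let \<open>C\<close> be the completion of the local ring at \<open>P\<close>. By the choice of \<open>P\<close> and Krull's intersection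
  theorem, no \<open>x\<^bsup>e+1\<^esup> + v f\<close> with \<open>f \<in> (x, v)\<^sup>e\<close> vanishes in \<open>C\<close>, so these elements avoid a minimal
  prime \<open>z\<close> of \<open>C\<close>. If \<open>v \<notin> z\<close>, put \<open>w = v / x\<close> in \<open>K = Frac (C / z)\<close>, and let \<open>M \<subseteq> K\<close> be the ring obtained
  from \<open>B = (C / z)[w]\<close> by inverting \<open>1 + w B\<close>. Then \<open>w\<close> lies in the Jacobson radical of \<open>M\<close>, and a power of
  every element of \<open>P\<close> lies in \<open>w M\<close>, so that \<open>M / w M\<close> has finite length. As in Krull's principal
  ideal theorem, \<open>w\<^sup>k \<in> v M\<close> for some \<open>k\<close>. Completeness now makes \<open>M\<close> a finite \<open>C\<close>-module, whence a
  power of \<open>P C\<close> lies in \<open>v C + z\<close>, that is, \<open>P C\<close> is minimal over \<open>u C + z\<close>.\<close>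

section \<open>Ideals and primes in Noetherian rings\<close>

text \<open>The Rees ring trades the powers of \<open>I\<close> for the powers of one regular
  element, so that only principal ideals are left. The set \<open>S\<close> enters through the
  conductor: if q x is integral over v, then q^(e+1) x^(e+1) lies in v (x, v)^e for some e, so every
  prime that contains the ideal of the overview contains q. Integral closures of domains, which may
  fail to be Noetherian, are avoided by working with the inverse fraction w = v / x. Non-integrality
  keeps 0 out of 1 + w B, so that inverting this set does not collapse the ring, and the ring
  obtained stays Noetherian. Completion serves twice: its topology carries non-integrality from the
  local ring over to \<open>C\<close>, and convergence of series turns finiteness modulo v into
  finiteness. Passing to a minimal prime z gives a domain, in which x may be inverted and v
  cancelled. If v lies in z there is nothing to invert, and the relations that define the conductor
  already put a power of every element of P into z.\<close>

context cring
begin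

lemma cring_idealI:
  assumes "J \<subseteq> carrier R" "\<zero> \<in> J"
    and "\<And>a b. a \<in> J \<Longrightarrow> b \<in> J \<Longrightarrow> a \<oplus> b \<in> J"
    and "\<And>a r. a \<in> J \<Longrightarrow> r \<in> carrier R \<Longrightarrow> r \<otimes> a \<in> J"
  shows "ideal J R"
proof (rule idealI)
  show "ring R" by (rule ring_axioms)
  show "subgroup J (add_monoid R)"
  proof (rule add.subgroupI)
    show "J \<subseteq> carrier R" "J \<noteq> {}" using assms by auto
    show "a \<oplus> b \<in> J" if "a \<in> J" "b \<in> J" for a b using assms(3) that by auto
    show "\<ominus> a \<in> J" if "a \<in> J" for a
    proof -
      have "\<ominus> a = (\<ominus> \<one>) \<otimes> a" using that assms(1) by (auto simp: l_minus)
      then show ?thesis using assms(4)[OF that, of "\<ominus> \<one>"] by simp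
    qed
  qed
  show "x \<otimes> a \<in> J" "a \<otimes> x \<in> J" if "a \<in> J" "x \<in> carrier R" for a x
    using assms(4)[OF that] m_comm[of a x] that assms(1) by auto
qed

lemma ideal_minus_closed:
  assumes "ideal J R" "a \<in> J" "b \<in> J"
  shows "a \<ominus> b \<in> J"
  using assms unfolding a_minus_def
  by (simp add: additive_subgroup.a_closed additive_subgroup.a_inv_closed ideal.axioms(1))

lemma ideal_add_cancel:
  assumes "ideal J R" "a \<in> J" "b \<in> carrier R" "a \<oplus> b \<in> J"
  shows "b \<in> J"
proof -
  have "a \<in> carrier R" using assms ideal.Icarr by fastforce
  then have "b = (a \<oplus> b) \<ominus> a" using assms(3) by algebra
  then show ?thesis using ideal_minus_closed[OF assms(1,4,2)] by simp
qed

lemma ideal_pow_closed: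
  assumes "ideal J R" "a \<in> J"
  shows "a [^] Suc k \<in> J"
  using assms ideal.I_l_closed[OF assms(1,2)] by (simp add: ideal.Icarr)

lemma ideal_adjoin:
  assumes "ideal H R" "g \<in> carrier R"
  defines "G \<equiv> {h \<oplus> r \<otimes> g | h r. h \<in> H \<and> r \<in> carrier R}"
  shows "ideal G R" "H \<subseteq> G" "g \<in> G"
proof -
  interpret H: ideal H R by fact
  have "h \<in> G" if "h \<in> H" for h
    unfolding G_def using that assms(2) by (force intro: exI[of _ \<zero>])
  then show HG: "H \<subseteq> G" by auto
  have "g = \<zero> \<oplus> \<one> \<otimes> g" using assms(2) by simp
  then show "g \<in> G" unfolding G_def using H.zero_closed by (intro CollectI exI conjI) (assumption, auto)
  show "ideal G R"
  proof (rule cring_idealI)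
    show "G \<subseteq> carrier R" unfolding G_def using assms(2) H.Icarr by auto
    show "\<zero> \<in> G" using HG by auto
    fix a assume "a \<in> G"
    then obtain h r where a: "a = h \<oplus> r \<otimes> g" "h \<in> H" "r \<in> carrier R" by (auto simp: G_def)
    show "a \<oplus> b \<in> G" if bG: "b \<in> G" for b
    proof -
      obtain h' r' where b: "b = h' \<oplus> r' \<otimes> g" "h' \<in> H" "r' \<in> carrier R"
        using bG unfolding G_def by blast
      have "a \<oplus> b = (h \<oplus> h') \<oplus> (r \<oplus> r') \<otimes> g" unfolding a(1) b(1)
        using assms(2) H.Icarr[OF a(2)] a(3) H.Icarr[OF b(2)] b(3) by algebra
      then show ?thesis unfolding G_def using a b by blast
    qed
    show "s \<otimes> a \<in> G" if s: "s \<in> carrier R" for s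
    proof -
      have "s \<otimes> a = s \<otimes> h \<oplus> (s \<otimes> r) \<otimes> g" unfolding a(1)
        using assms(2) H.Icarr[OF a(2)] a(3) s by algebra
      then show ?thesis unfolding G_def using a H.I_l_closed s by blast
    qed
  qed
qed

lemma ideal_colon:
  assumes "ideal H R" "g \<in> carrier R"
  shows "ideal {a \<in> carrier R. a \<otimes> g \<in> H} R"
proof -
  interpret H: ideal H R by fact
  show ?thesis
    by (rule cring_idealI) (use assms in \<open>auto simp: l_distr m_assoc H.I_l_closed\<close>)
qed

text \<open>If one member of the chain misses \<open>a\<close> and another misses \<open>b\<close>,
  the smaller of the two misses both, against its primality.\<close>

lemma Inter_prime_chain:
  assumes ne: "F \<noteq> {}" and prime: "\<And>P. P \<in> F \<Longrightarrow> primeideal P R"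
    and chain: "\<And>P Q. P \<in> F \<Longrightarrow> Q \<in> F \<Longrightarrow> P \<subseteq> Q \<or> Q \<subseteq> P"
  shows "primeideal (\<Inter>F) R"
proof (rule primeidealI)
  obtain P0 where P0: "P0 \<in> F" using ne by auto
  show "cring R" by (rule is_cring)
  show "ideal (\<Inter>F) R" using i_Intersect ne prime primeideal.axioms(1) by blast
  have "\<one> \<notin> P0" using prime[OF P0] primeideal.I_notcarr ideal.one_imp_carrier primeideal.axioms(1) by blast
  then show "carrier R \<noteq> \<Inter>F" using P0 one_closed by blast
  fix a b assume ab: "a \<in> carrier R" "b \<in> carrier R" "a \<otimes> b \<in> \<Inter>F"
  show "a \<in> \<Inter>F \<or> b \<in> \<Inter>F"
  proof (rule ccontr)
    assume "\<not> ?thesis"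
    then obtain P Q where PQ: "P \<in> F" "a \<notin> P" "Q \<in> F" "b \<notin> Q" by blast
    then obtain P' where P': "P' \<in> F" "a \<notin> P'" "b \<notin> P'" using chain[OF PQ(1,3)] by blast
    moreover have "a \<otimes> b \<in> P'" using P'(1) ab(3) by blast
    ultimately show False using primeideal.I_prime[OF prime[OF P'(1)] ab(1,2)] by blast
  qed
qed

lemma minimal_prime_exists:
  assumes Q: "primeideal Q R" "J \<subseteq> Q"
  obtains P where "P \<in> minimal_primes_over R J" "P \<subseteq> Q"
proof -
  define F where "F = {P. primeideal P R \<and> J \<subseteq> P \<and> P \<subseteq> Q}"
  \<comment> \<open>Inclusion is reversed: the maximal element given by Zorn's lemma is then a
    minimal prime, and upper bounds of chains are intersections.\<close>
  define r where "r = {(P, P'). P \<in> F \<and> P' \<in> F \<and> P' \<subseteq> P}"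
  have po: "Partial_order r"
    unfolding partial_order_on_def preorder_on_def refl_on_def trans_on_def antisym_on_def r_def Field_def
    by auto
  have Fr: "Field r = F" unfolding Field_def r_def by auto
  have "\<exists>m\<in>Field r. \<forall>a\<in>Field r. (m, a) \<in> r \<longrightarrow> a = m"
  proof (rule Zorns_po_lemma[OF po])
    fix C assume C: "C \<in> Chains r"
    show "\<exists>u\<in>Field r. \<forall>a\<in>C. (a, u) \<in> r"
    proof (cases "C = {}")
      case True
      then show ?thesis using Q Fr unfolding F_def by blast
    next
      case False
      have CF: "C \<subseteq> F" using C unfolding Chains_def r_def by blast
      have "primeideal (\<Inter>C) R"
      proof (rule Inter_prime_chain[OF False])
        show "primeideal P R" if "P \<in> C" for P using that CF unfolding F_def by blast
        show "P \<subseteq> P' \<or> P' \<subseteq> P" if "P \<in> C" "P' \<in> C" for P P'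
          using that C unfolding Chains_def r_def by blast
      qed
      moreover have "J \<subseteq> \<Inter>C" "\<Inter>C \<subseteq> Q" using CF False unfolding F_def by auto
      ultimately have "\<Inter>C \<in> F" unfolding F_def by blast
      then show ?thesis using CF Fr unfolding r_def by blast
    qed
  qed
  then obtain P where "P \<in> F" "\<forall>a\<in>F. (P, a) \<in> r \<longrightarrow> a = P" unfolding Fr by blast
  then have P: "P \<in> F" "\<And>P'. P' \<in> F \<Longrightarrow> P' \<subseteq> P \<Longrightarrow> P' = P" unfolding r_def by auto
  \<comment> \<open>A prime below \<open>P\<close> is also below \<open>Q\<close>, so minimality
    within \<open>F\<close> is minimality among all primes over \<open>J\<close>.\<close>
  have "P \<in> minimal_primes_over R J"
    unfolding minimal_primes_over_def
  proof (intro CollectI conjI allI impI)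
    show "primeideal P R" "J \<subseteq> P" using P(1) unfolding F_def by auto
    fix P' assume "primeideal P' R \<and> J \<subseteq> P' \<and> P' \<subseteq> P"
    then show "P' = P" using P unfolding F_def by blast
  qed
  then show thesis using that P(1) unfolding F_def by blast
qed

lemma primeideal_pow:
  assumes "primeideal P R" "a \<in> carrier R" "a [^] (k::nat) \<in> P"
  shows "a \<in> P"
  using assms(3)
proof (induction k)
  case 0
  then show ?case using primeideal.I_notcarr[OF assms(1)] ideal.one_imp_carrier primeideal.axioms(1)[OF assms(1)]
    by fastforce
next
  case (Suc k)
  then show ?case using primeideal.I_prime[OF assms(1), of "a [^] k" a] assms(2) by auto
qed

lemma primeideal_one:
  assumes "primeideal P R" shows "\<one> \<notin> P"
  using assms primeideal.I_notcarr ideal.one_imp_carrier primeideal.axioms(1) by blast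

end

section \<open>Chain conditions and prime ideals\<close>

context noetherian_ring
begin

lemma ideal_maximal:
  assumes "F \<noteq> {}" "\<And>J. J \<in> F \<Longrightarrow> ideal J R"
  obtains M where "M \<in> F" "\<And>J. J \<in> F \<Longrightarrow> M \<subseteq> J \<Longrightarrow> J = M"
proof -
  have "\<exists>M\<in>F. \<forall>Y\<in>F. M \<subseteq> Y \<longrightarrow> Y = M"
  proof (rule subset_Zorn_nonempty[OF assms(1)])
    fix C assume C: "C \<noteq> {}" "subset.chain F C"
    then have "subset.chain {I. ideal I R} C" using assms(2) unfolding subset.chain_def by auto
    then have "\<Union>C \<in> C" using ideal_chain_is_trivial C by auto
    then show "\<Union>C \<in> F" using C(2) unfolding subset.chain_def by auto
  qed
  then show thesis using that by blast
qed

lemma ideal_acc: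
  assumes "\<And>i. ideal (J i) R" "\<And>i::nat. J i \<subseteq> J (Suc i)"
  shows "\<exists>N. \<forall>i\<ge>N. J i = J N"
proof -
  have mono: "J i \<subseteq> J j" if "i \<le> j" for i j using lift_Suc_mono_le[of J] assms(2) that by blast
  obtain M where M: "M \<in> range J" "\<And>J'. J' \<in> range J \<Longrightarrow> M \<subseteq> J' \<Longrightarrow> J' = M"
    using ideal_maximal[of "range J"] assms(1) by blast
  then obtain N where "M = J N" by auto
  then have "\<forall>i\<ge>N. J i = J N" using M(2) mono by auto
  then show ?thesis ..
qed

end

text \<open>A chain of ideals that does not contain its union has no largest member, so dependent
  choice extracts a strictly ascending sequence from it.\<close>

lemma (in ring) noetherian_ring_if_acc:
  assumes "\<And>J::nat \<Rightarrow> 'a set. (\<And>i. ideal (J i) R) \<Longrightarrow> (\<And>i. J i \<subseteq> J (Suc i)) \<Longrightarrow> \<exists>N. J (Suc N) = J N"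
  shows "noetherian_ring R"
proof (rule trivial_ideal_chain_imp_noetherian)
  fix C assume C: "C \<noteq> {}" "subset.chain {I. ideal I R} C"
  show "\<Union>C \<in> C"
  proof (rule ccontr)
    assume contr: "\<Union>C \<notin> C"
    have step: "\<exists>Z. Z \<in> C \<and> Y \<subset> Z" if Y: "Y \<in> C" for Y
    proof (rule ccontr)
      assume no: "\<not> ?thesis"
      have "Z \<subseteq> Y" if Z: "Z \<in> C" for Z
      proof -
        have "Z \<subseteq> Y \<or> Y \<subseteq> Z" using C(2) Y Z unfolding subset.chain_def by auto
        moreover have "\<not> Y \<subset> Z" using no Z by blast
        ultimately show ?thesis by auto
      qed
      then have "\<Union>C = Y" using Y by auto
      then show False using contr Y by simp
    qed
    obtain X0 where "X0 \<in> C" using C(1) by auto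
    then have "\<exists>J. \<forall>n::nat. J n \<in> C \<and> J n \<subset> J (Suc n)"
      by (intro dependent_nat_choice[of "\<lambda>n Y. Y \<in> C" "\<lambda>n Y Z. Y \<subset> Z"] exI step)
    then obtain J where J: "\<And>n::nat. J n \<in> C" "\<And>n. J n \<subset> J (Suc n)" by metis
    have "ideal (J n) R" for n using J(1)[of n] C(2) unfolding subset.chain_def by auto
    moreover have "J n \<subseteq> J (Suc n)" for n using J(2)[of n] by simp
    ultimately obtain N where "J (Suc N) = J N" using assms[of J] by auto
    then show False using J(2)[of N] by simp
  qed
qed

locale noetherian_cring = cring + noetherian_ring
begin

text \<open>An ideal \<open>M\<close> maximal among those over \<open>J\<close> that miss
  \<open>T\<close> is prime: for \<open>a\<close> and \<open>b\<close> outside \<open>M\<close>,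
  both M + R a and M + R b meet \<open>T\<close>, and if a b were in \<open>M\<close>, the product
  of the two common elements would lie in \<open>M\<close> and in \<open>T\<close>.\<close>

lemma prime_avoiding:
  assumes J: "ideal J R" and T: "T \<subseteq> carrier R" "\<one> \<in> T" "\<And>a b. a \<in> T \<Longrightarrow> b \<in> T \<Longrightarrow> a \<otimes> b \<in> T"
    and disj: "J \<inter> T = {}"
  obtains P where "primeideal P R" "J \<subseteq> P" "P \<inter> T = {}"
proof -
  define F where "F = {I. ideal I R \<and> J \<subseteq> I \<and> I \<inter> T = {}}"
  have "F \<noteq> {}" unfolding F_def using J disj by auto
  then obtain M where M: "M \<in> F" "\<And>I. I \<in> F \<Longrightarrow> M \<subseteq> I \<Longrightarrow> I = M"
    using ideal_maximal[of F] unfolding F_def by blast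
  interpret M: ideal M R using M unfolding F_def by auto
  have ext: "\<exists>h r. h \<in> M \<and> r \<in> carrier R \<and> h \<oplus> r \<otimes> g \<in> T" if "g \<in> carrier R" "g \<notin> M" for g
  proof -
    note adj = ideal_adjoin[OF M.ideal_axioms that(1)]
    show ?thesis using M(2)[OF _ adj(2)] adj M(1) that unfolding F_def by blast
  qed
  have "primeideal M R"
  proof (rule primeidealI[OF M.ideal_axioms is_cring])
    show "carrier R \<noteq> M" using M(1) T(2) unfolding F_def by auto
    fix a b assume ab: "a \<in> carrier R" "b \<in> carrier R" "a \<otimes> b \<in> M"
    show "a \<in> M \<or> b \<in> M"
    proof (rule ccontr)
      assume "\<not> ?thesis"
      then obtain h r h' r' where h: "h \<in> M" "r \<in> carrier R" "h \<oplus> r \<otimes> a \<in> T"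
        "h' \<in> M" "r' \<in> carrier R" "h' \<oplus> r' \<otimes> b \<in> T" using ext ab by meson
      note [simp] = ab h M.Icarr
      have "(h \<oplus> r \<otimes> a) \<otimes> (h' \<oplus> r' \<otimes> b) = (h' \<oplus> r' \<otimes> b) \<otimes> h \<oplus> ((r \<otimes> a) \<otimes> h' \<oplus> (r \<otimes> r') \<otimes> (a \<otimes> b))"
        using M.Icarr[OF h(1)] M.Icarr[OF h(4)] ab(1,2) h(2,5) by algebra
      also have "\<dots> \<in> M"
        by (rule M.a_closed[OF M.I_l_closed[OF h(1)] M.a_closed[OF M.I_l_closed[OF h(4)] M.I_l_closed[OF ab(3)]]])
          (use ab h M.Icarr in auto)
      finally show False using T(3)[OF h(3,6)] M(1) unfolding F_def by blast
    qed
  qed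
  then show thesis using that M(1) unfolding F_def by blast
qed

text \<open>Locally at \<open>P\<close>, the radical of \<open>J\<close> is \<open>P\<close>. The
  elements t a^k with t outside \<open>P\<close> form a multiplicative set; if it missed
  \<open>J\<close>, some prime over \<open>J\<close> would avoid it, hence lie in \<open>P\<close>,
  hence equal \<open>P\<close>, and yet not contain \<open>a\<close>.\<close>

lemma minimal_prime_nilpotent:
  assumes P: "P \<in> minimal_primes_over R J" and J: "ideal J R" and a: "a \<in> P"
  obtains t k where "t \<in> carrier R - P" "t \<otimes> a [^] (k::nat) \<in> J"
proof (rule ccontr)
  assume no: "\<not> thesis"
  note result = that
  interpret P: primeideal P R using P unfolding minimal_primes_over_def by auto
  define T where "T = {t \<otimes> a [^] (k::nat) | t k. t \<in> carrier R - P}"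
  have ac: "a \<in> carrier R" using a P.Icarr by auto
  have one: "\<one> \<in> carrier R - P" using primeideal_one[OF P.primeideal_axioms] by auto
  \<comment> \<open>The exponent 0 puts the complement of \<open>P\<close> into \<open>T\<close>,
    which forces a prime avoiding \<open>T\<close> to lie in \<open>P\<close>.\<close>
  have T0: "t \<in> T" if "t \<in> carrier R - P" for t
  proof -
    have "t = t \<otimes> a [^] (0::nat)" using that by simp
    then show ?thesis unfolding T_def using that by (intro CollectI exI conjI)
  qed
  have "a = \<one> \<otimes> a [^] (1::nat)" using ac by simp
  then have aT: "a \<in> T" unfolding T_def using one by (intro CollectI exI conjI)
  obtain P' where P': "primeideal P' R" "J \<subseteq> P'" "P' \<inter> T = {}"
  proof (rule prime_avoiding[OF J])
    show "T \<subseteq> carrier R" unfolding T_def using ac by auto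
    show "\<one> \<in> T" using T0 one by auto
    show "J \<inter> T = {}"
    proof (rule ccontr)
      assume "J \<inter> T \<noteq> {}"
      then obtain t k where "t \<in> carrier R - P" "t \<otimes> a [^] (k::nat) \<in> J" unfolding T_def by blast
      then show False using no result by auto
    qed
    fix x y assume "x \<in> T" "y \<in> T"
    then obtain t k t' k' where x: "x = t \<otimes> a [^] (k::nat)" "t \<in> carrier R - P"
      and y: "y = t' \<otimes> a [^] (k'::nat)" "t' \<in> carrier R - P"
      unfolding T_def by blast
    have "x \<otimes> y = (t \<otimes> t') \<otimes> (a [^] k \<otimes> a [^] k')"
      unfolding x y using x(2) y(2) ac by (simp add: m_ac)
    also have "\<dots> = (t \<otimes> t') \<otimes> a [^] (k + k')" using ac by (simp add: nat_pow_mult)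
    moreover have "t \<otimes> t' \<in> carrier R - P" using P.I_prime x(2) y(2) by auto
    ultimately show "x \<otimes> y \<in> T" unfolding T_def by auto
  qed
  have "P' \<subseteq> P" using P' T0 ideal.Icarr[OF primeideal.axioms(1)[OF P'(1)]] by blast
  then have "P' = P" using P P' unfolding minimal_primes_over_def by blast
  then show False using a aT P' by auto
qed

text \<open>A maximal member (H : g) of the family of proper colon ideals is prime: if a b lies in
  it and b does not, then (H : b g) belongs to the family and contains (H : g), so both agree, and
  (H : b g) contains a.\<close>

lemma associated_prime_exists:
  assumes H: "ideal H R" "H \<noteq> carrier R"
  obtains g where "g \<in> carrier R - H" "primeideal {a \<in> carrier R. a \<otimes> g \<in> H} R"
proof -
  interpret H: ideal H R by fact
  define F where "F = {{a \<in> carrier R. a \<otimes> g \<in> H} | g. g \<in> carrier R - H}"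
  have "F \<noteq> {}" unfolding F_def using H H.Icarr by blast
  then obtain M where M: "M \<in> F" "\<And>I. I \<in> F \<Longrightarrow> M \<subseteq> I \<Longrightarrow> I = M"
    using ideal_maximal[of F] ideal_colon[OF H(1)] unfolding F_def by blast
  then obtain g where g: "g \<in> carrier R - H" "M = {a \<in> carrier R. a \<otimes> g \<in> H}" unfolding F_def by auto
  have "primeideal M R"
  proof (rule primeidealI)
    show "ideal M R" using ideal_colon[OF H(1)] g by auto
    show "cring R" by (rule is_cring)
    have "\<one> \<notin> M" using g by auto
    then show "carrier R \<noteq> M" by auto
    fix a b assume ab: "a \<in> carrier R" "b \<in> carrier R" "a \<otimes> b \<in> M"
    show "a \<in> M \<or> b \<in> M"
    proof (rule ccontr)
      assume n: "\<not> ?thesis"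
      let ?N = "{x \<in> carrier R. x \<otimes> (b \<otimes> g) \<in> H}"
      have "b \<otimes> g \<in> carrier R - H" using n g ab by auto
      then have "?N \<in> F" unfolding F_def by blast
      moreover have "M \<subseteq> ?N"
      proof
        fix x assume "x \<in> M"
        then have "b \<otimes> (x \<otimes> g) \<in> H" "x \<in> carrier R" using g ab H.I_l_closed by auto
        then show "x \<in> ?N" using g ab by (auto simp: m_lcomm)
      qed
      ultimately have "?N = M" using M by auto
      moreover have "a \<in> ?N" using ab g by (auto simp: m_assoc)
      ultimately show False using n by auto
    qed
  qed
  then show thesis using that g by auto
qed

end

lemma (in cring) noetherian_cringI: "noetherian_ring R \<Longrightarrow> noetherian_cring R"
  by (simp add: noetherian_cring_def is_cring)

section \<open>Integrality over a principal ideal\<close>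

text \<open>\<open>forms R x v e\<close> is the ideal \<open>(x, v)\<^sup>e\<close>. For an equation of integral dependence of \<open>x\<close> on \<open>v R\<close>, all
  terms but the leading one are collected into \<open>v (x, v)\<^sup>e\<close>.\<close>

fun forms :: "('a, 'm) ring_scheme \<Rightarrow> 'a \<Rightarrow> 'a \<Rightarrow> nat \<Rightarrow> 'a set" where
  "forms R x v 0 = carrier R"
| "forms R x v (Suc e) = {x \<otimes>\<^bsub>R\<^esub> f \<oplus>\<^bsub>R\<^esub> v \<otimes>\<^bsub>R\<^esub> g | f g. f \<in> forms R x v e \<and> g \<in> forms R x v e}"

definition integral_over :: "('a, 'm) ring_scheme \<Rightarrow> 'a \<Rightarrow> 'a \<Rightarrow> bool" where
  "integral_over R v x \<longleftrightarrow> (\<exists>e. \<exists>f\<in>forms R x v e. x [^]\<^bsub>R\<^esub> Suc e = v \<otimes>\<^bsub>R\<^esub> f)"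

declare forms.simps(2) [simp del]

lemma forms_SucE:
  assumes "f \<in> forms R x v (Suc e)"
  obtains g h where "f = x \<otimes>\<^bsub>R\<^esub> g \<oplus>\<^bsub>R\<^esub> v \<otimes>\<^bsub>R\<^esub> h" "g \<in> forms R x v e" "h \<in> forms R x v e"
  using assms by (auto simp: forms.simps)

lemma forms_SucI:
  assumes "g \<in> forms R x v e" "h \<in> forms R x v e"
  shows "x \<otimes>\<^bsub>R\<^esub> g \<oplus>\<^bsub>R\<^esub> v \<otimes>\<^bsub>R\<^esub> h \<in> forms R x v (Suc e)"
  using assms by (auto simp: forms.simps)

context cring
begin

context
  fixes x v assumes xv [simp]: "x \<in> carrier R" "v \<in> carrier R"
begin

lemma forms_ideal: "ideal (forms R x v e) R"
proof (induction e)
  case 0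
  then show ?case using oneideal by simp
next
  case (Suc e)
  interpret ideal "forms R x v e" R by fact
  show ?case
  proof (rule cring_idealI)
    show "forms R x v (Suc e) \<subseteq> carrier R" by (auto elim!: forms_SucE simp: Icarr)
    have "\<zero> = x \<otimes> \<zero> \<oplus> v \<otimes> \<zero>" by simp
    then show "\<zero> \<in> forms R x v (Suc e)" using forms_SucI[OF zero_closed zero_closed] by metis
  next
    fix a b assume "a \<in> forms R x v (Suc e)" "b \<in> forms R x v (Suc e)"
    then obtain g h g' h' where eq: "a = x \<otimes> g \<oplus> v \<otimes> h" "b = x \<otimes> g' \<oplus> v \<otimes> h'"
      and mem: "g \<in> forms R x v e" "h \<in> forms R x v e" "g' \<in> forms R x v e" "h' \<in> forms R x v e"
      by (elim forms_SucE)
    have "a \<oplus> b = x \<otimes> (g \<oplus> g') \<oplus> v \<otimes> (h \<oplus> h')"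
      unfolding eq using mem[THEN Icarr] xv by algebra
    then show "a \<oplus> b \<in> forms R x v (Suc e)" using forms_SucI mem a_closed by metis
  next
    fix a r assume "a \<in> forms R x v (Suc e)" and r: "r \<in> carrier R"
    then obtain g h where eq: "a = x \<otimes> g \<oplus> v \<otimes> h"
      and mem: "g \<in> forms R x v e" "h \<in> forms R x v e"
      by (elim forms_SucE)
    have "r \<otimes> a = x \<otimes> (r \<otimes> g) \<oplus> v \<otimes> (r \<otimes> h)"
      unfolding eq using mem[THEN Icarr] xv r by algebra
    then show "r \<otimes> a \<in> forms R x v (Suc e)" using forms_SucI mem I_l_closed r by metis
  qed
qed

lemma forms_closed [intro]: "f \<in> forms R x v e \<Longrightarrow> f \<in> carrier R"
  using forms_ideal ideal.Icarr by metis

lemma forms_add: "f \<in> forms R x v e \<Longrightarrow> g \<in> forms R x v e \<Longrightarrow> f \<oplus> g \<in> forms R x v e"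
  using forms_ideal additive_subgroup.a_closed ideal.axioms(1) by metis

lemma forms_minus: "f \<in> forms R x v e \<Longrightarrow> g \<in> forms R x v e \<Longrightarrow> f \<ominus> g \<in> forms R x v e"
  using forms_ideal ideal_minus_closed by metis

lemma forms_zero: "\<zero> \<in> forms R x v e"
  using forms_ideal additive_subgroup.zero_closed ideal.axioms(1) by metis

lemma forms_scale: "f \<in> forms R x v e \<Longrightarrow> r \<in> carrier R \<Longrightarrow> r \<otimes> f \<in> forms R x v e"
  using forms_ideal ideal.I_l_closed by metis

lemma forms_x: assumes "f \<in> forms R x v e" shows "x \<otimes> f \<in> forms R x v (Suc e)"
proof -
  have "x \<otimes> f = x \<otimes> f \<oplus> v \<otimes> \<zero>" using assms by (simp add: forms_closed)
  then show ?thesis using forms_SucI[OF assms forms_zero] by metis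
qed

lemma forms_v: assumes "f \<in> forms R x v e" shows "v \<otimes> f \<in> forms R x v (Suc e)"
proof -
  have "v \<otimes> f = x \<otimes> \<zero> \<oplus> v \<otimes> f" using assms by (simp add: forms_closed)
  then show ?thesis using forms_SucI[OF forms_zero assms] by metis
qed

lemma forms_pow: "x [^] e \<in> forms R x v e"
proof (induction e)
  case (Suc e)
  then show ?case using forms_x[OF Suc] by (simp add: m_comm)
qed simp

lemma forms_mult:
  assumes "f \<in> forms R x v e" "h \<in> forms R x v d"
  shows "f \<otimes> h \<in> forms R x v (e + d)"
  using assms(1)
proof (induction e arbitrary: f)
  case 0
  then show ?case using forms_scale[OF assms(2)] by simp
next
  case (Suc e)
  from Suc(2) obtain g k where eq: "f = x \<otimes> g \<oplus> v \<otimes> k"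
    and mem: "g \<in> forms R x v e" "k \<in> forms R x v e" by (rule forms_SucE)
  have "f \<otimes> h = x \<otimes> (g \<otimes> h) \<oplus> v \<otimes> (k \<otimes> h)"
    unfolding eq using mem[THEN forms_closed] assms(2)[THEN forms_closed] xv by algebra
  then show ?case using forms_SucI[OF Suc.IH[OF mem(1)] Suc.IH[OF mem(2)]] by simp
qed

text \<open>Every monomial of degree e + 1 in \<open>x\<close> and \<open>v\<close> except x^(e+1)
  is divisible by \<open>v\<close>. Splitting off this one term lets a relation x^(e+1) = v f be
  substituted.\<close>

lemma forms_decomp:
  assumes "f \<in> forms R x v (Suc e)"
  obtains c g where "c \<in> carrier R" "g \<in> forms R x v e" "f = c \<otimes> x [^] Suc e \<oplus> v \<otimes> g"
proof -
  have "\<exists>c g. c \<in> carrier R \<and> g \<in> forms R x v e \<and> f = c \<otimes> x [^] Suc e \<oplus> v \<otimes> g"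
    using assms
  proof (induction e arbitrary: f)
    case 0
    then obtain g h where "f = x \<otimes> g \<oplus> v \<otimes> h" "g \<in> carrier R" "h \<in> carrier R"
      by (rule forms_SucE) auto
    then show ?case by (intro exI[of _ g] exI[of _ h]) (auto simp: m_comm)
  next
    case (Suc e)
    from Suc(2) obtain g h where eq: "f = x \<otimes> g \<oplus> v \<otimes> h"
      and mem: "g \<in> forms R x v (Suc e)" "h \<in> forms R x v (Suc e)" by (rule forms_SucE)
    obtain c k where c: "c \<in> carrier R" "k \<in> forms R x v e" "g = c \<otimes> x [^] Suc e \<oplus> v \<otimes> k"
      using Suc(1)[OF mem(1)] by auto
    have "f = c \<otimes> (x [^] Suc e \<otimes> x) \<oplus> v \<otimes> (x \<otimes> k \<oplus> h)"
      unfolding eq c(3) using c(1) forms_closed[OF c(2)] forms_closed[OF mem(2)] xv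
        nat_pow_closed[OF xv(1), of "Suc e"] by algebra
    moreover have "x \<otimes> k \<oplus> h \<in> forms R x v (Suc e)" using forms_add forms_x c(2) mem(2) by auto
    ultimately show ?case using c(1) by (intro exI[of _ c] exI[of _ "x \<otimes> k \<oplus> h"]) simp
  qed
  then show thesis using that by auto
qed

text \<open>An equation of integral dependence of degree e + 1 for \<open>x\<close> over v R means
  that x^(e+1) lies in v (x, v)^e. Since this is an ideal, its terms can be collected one by one,
  and Krull's intersection theorem applies to it.\<close>

lemma vforms_ideal: "ideal {v \<otimes> f | f. f \<in> forms R x v e} R"
proof (rule cring_idealI)
  show "{v \<otimes> f | f. f \<in> forms R x v e} \<subseteq> carrier R" by auto
  show "\<zero> \<in> {v \<otimes> f | f. f \<in> forms R x v e}" using forms_zero r_null[OF xv(2)] by force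
  show "a \<oplus> b \<in> {v \<otimes> f | f. f \<in> forms R x v e}"
    if a: "a \<in> {v \<otimes> f | f. f \<in> forms R x v e}" and b: "b \<in> {v \<otimes> f | f. f \<in> forms R x v e}" for a b
  proof -
    from a b obtain f g where "a = v \<otimes> f" "b = v \<otimes> g" "f \<in> forms R x v e" "g \<in> forms R x v e" by auto
    then show ?thesis by (auto intro!: exI[of _ "f \<oplus> g"] forms_add simp: r_distr forms_closed)
  qed
  show "r \<otimes> a \<in> {v \<otimes> f | f. f \<in> forms R x v e}"
    if a: "a \<in> {v \<otimes> f | f. f \<in> forms R x v e}" and r: "r \<in> carrier R" for a r
  proof -
    from a obtain f where "a = v \<otimes> f" "f \<in> forms R x v e" by auto
    then show ?thesis using r by (auto intro!: exI[of _ "r \<otimes> f"] forms_scale simp: m_lcomm forms_closed)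
  qed
qed

end

end

lemma (in ring_hom_cring) forms_hom:
  assumes "x \<in> carrier R" "v \<in> carrier R" "f \<in> forms R x v e"
  shows "h f \<in> forms S (h x) (h v) e"
  using assms(3)
proof (induction e arbitrary: f)
  case 0 then show ?case by simp
next
  case (Suc e)
  from Suc(2) obtain g k where eq: "f = x \<otimes> g \<oplus> v \<otimes> k"
    and mem: "g \<in> forms R x v e" "k \<in> forms R x v e" by (rule forms_SucE)
  then have "h f = h x \<otimes>\<^bsub>S\<^esub> h g \<oplus>\<^bsub>S\<^esub> h v \<otimes>\<^bsub>S\<^esub> h k"
    using assms mem[THEN R.forms_closed[OF assms(1,2)]] by simp
  then show ?case using forms_SucI[OF Suc(1)[OF mem(1)] Suc(1)[OF mem(2)]] by simp
qed

section \<open>The Noetherian property along a homomorphism\<close>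

locale noetherian_hom = ring_hom_cring R S h for R (structure) and S (structure) and h +
  assumes noetherian: "noetherian_ring R"

sublocale noetherian_hom \<subseteq> R: noetherian_cring R
  by (intro R.noetherian_cringI noetherian)

context noetherian_hom
begin

lemma ideal_vimage: "ideal J S \<Longrightarrow> ideal {c \<in> carrier R. h c \<in> J} R"
proof (rule R.cring_idealI)
  assume J: "ideal J S"
  interpret J: ideal J S by fact
  show "\<zero> \<in> {c \<in> carrier R. h c \<in> J}" by simp
qed (auto intro: ideal.I_l_closed simp: additive_subgroup.a_closed ideal.axioms(1))

text \<open>Contraction of ideals to \<open>R\<close> is injective, because every element of
  \<open>S\<close> has a unit multiple in the image of \<open>h\<close>. This covers localizations,
  homomorphic images (with \<open>s\<close> = 1) and the blow-up chart below.\<close>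

lemma noetherian_fractions:
  assumes frac: "\<And>k. k \<in> carrier S \<Longrightarrow> \<exists>s\<in>carrier R. \<exists>c\<in>carrier R. h s \<in> Units S \<and> h s \<otimes>\<^bsub>S\<^esub> k = h c"
  shows "noetherian_ring S"
proof (rule S.noetherian_ring_if_acc)
  fix J :: "nat \<Rightarrow> _ set" assume J: "\<And>i. ideal (J i) S" "\<And>i. J i \<subseteq> J (Suc i)"
  let ?J = "\<lambda>i. {c \<in> carrier R. h c \<in> J i}"
  have 1: "ideal (?J i) R" for i using ideal_vimage[OF J(1)] .
  have 2: "?J i \<subseteq> ?J (Suc i)" for i using J(2)[of i] by auto
  obtain N where N: "\<And>i. i \<ge> N \<Longrightarrow> ?J i = ?J N" using R.ideal_acc[of ?J, OF 1 2] by blast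
  have "J (Suc N) \<subseteq> J N"
  proof
    fix k assume k: "k \<in> J (Suc N)"
    then have kS: "k \<in> carrier S" using ideal.Icarr[OF J(1)] by auto
    then obtain s c where s: "s \<in> carrier R" "c \<in> carrier R" "h s \<in> Units S" "h s \<otimes>\<^bsub>S\<^esub> k = h c"
      using frac by blast
    have "h c \<in> J (Suc N)" using ideal.I_l_closed[OF J(1) k, of "h s"] s by simp
    then have "c \<in> ?J N" using N[of "Suc N"] s(2) by auto
    then have "inv\<^bsub>S\<^esub> (h s) \<otimes>\<^bsub>S\<^esub> h c \<in> J N" using ideal.I_l_closed[OF J(1)] s(3) by auto
    moreover have "inv\<^bsub>S\<^esub> (h s) \<otimes>\<^bsub>S\<^esub> h c = k"
      unfolding s(4)[symmetric] using s(1,3) kS by (simp flip: S.m_assoc)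
    ultimately show "k \<in> J N" by simp
  qed
  then have "J (Suc N) = J N" using J(2)[of N] by simp
  then show "\<exists>N. J (Suc N) = J N" ..
qed

end

section \<open>Polynomial expressions in one element\<close>

text \<open>The degree bound is strict: the index \<open>n\<close> allows the powers \<open>b\<^sup>0, \<dots>, b\<^bsup>n-1\<^esup>\<close>.\<close>

fun pols :: "('a, 'm) ring_scheme \<Rightarrow> ('b, 'n) ring_scheme \<Rightarrow> ('a \<Rightarrow> 'b) \<Rightarrow> 'b \<Rightarrow> nat \<Rightarrow> 'b set" where
  "pols R S h b 0 = {\<zero>\<^bsub>S\<^esub>}"
| "pols R S h b (Suc n) = {h c \<oplus>\<^bsub>S\<^esub> b \<otimes>\<^bsub>S\<^esub> f | c f. c \<in> carrier R \<and> f \<in> pols R S h b n}"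

declare pols.simps(2) [simp del]

lemma pols_SucE:
  assumes "f \<in> pols R S h b (Suc n)"
  obtains c g where "c \<in> carrier R" "g \<in> pols R S h b n" "f = h c \<oplus>\<^bsub>S\<^esub> b \<otimes>\<^bsub>S\<^esub> g"
  using assms by (auto simp: pols.simps)

lemma pols_SucI:
  assumes "c \<in> carrier R" "g \<in> pols R S h b n"
  shows "h c \<oplus>\<^bsub>S\<^esub> b \<otimes>\<^bsub>S\<^esub> g \<in> pols R S h b (Suc n)"
  using assms by (auto simp: pols.simps)

context ring_hom_cring
begin

context
  fixes b assumes b [simp]: "b \<in> carrier S"
begin

lemma pols_closed [intro]: "f \<in> pols R S h b n \<Longrightarrow> f \<in> carrier S"
proof (induction n arbitrary: f)
  case (Suc n)
  from Suc(2) obtain c g where "c \<in> carrier R" "g \<in> pols R S h b n" "f = h c \<oplus>\<^bsub>S\<^esub> b \<otimes>\<^bsub>S\<^esub> g"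
    by (rule pols_SucE)
  then show ?case using Suc(1)[of g] by simp
qed simp

lemma pols_zero: "\<zero>\<^bsub>S\<^esub> \<in> pols R S h b n"
proof (induction n)
  case (Suc n)
  have "\<zero>\<^bsub>S\<^esub> = h \<zero> \<oplus>\<^bsub>S\<^esub> b \<otimes>\<^bsub>S\<^esub> \<zero>\<^bsub>S\<^esub>" by simp
  then show ?case using pols_SucI[OF R.zero_closed Suc] by metis
qed simp

lemma pols_add: "f \<in> pols R S h b n \<Longrightarrow> g \<in> pols R S h b n \<Longrightarrow> f \<oplus>\<^bsub>S\<^esub> g \<in> pols R S h b n"
proof (induction n arbitrary: f g)
  case (Suc n)
  from Suc(2,3) obtain c f' d g' where *: "c \<in> carrier R" "f' \<in> pols R S h b n" "f = h c \<oplus>\<^bsub>S\<^esub> b \<otimes>\<^bsub>S\<^esub> f'"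
    "d \<in> carrier R" "g' \<in> pols R S h b n" "g = h d \<oplus>\<^bsub>S\<^esub> b \<otimes>\<^bsub>S\<^esub> g'" by (elim pols_SucE)
  have "f \<oplus>\<^bsub>S\<^esub> g = (h c \<oplus>\<^bsub>S\<^esub> h d) \<oplus>\<^bsub>S\<^esub> b \<otimes>\<^bsub>S\<^esub> (f' \<oplus>\<^bsub>S\<^esub> g')"
    unfolding *(3,6) using pols_closed[OF *(2)] pols_closed[OF *(5)] b hom_closed[OF *(1)] hom_closed[OF *(4)] by algebra
  also have "\<dots> = h (c \<oplus> d) \<oplus>\<^bsub>S\<^esub> b \<otimes>\<^bsub>S\<^esub> (f' \<oplus>\<^bsub>S\<^esub> g')" using * by simp
  finally show ?case using pols_SucI[OF R.add.m_closed[OF *(1,4)] Suc(1)[OF *(2,5)]] by simp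
qed simp

lemma pols_scale: "f \<in> pols R S h b n \<Longrightarrow> r \<in> carrier R \<Longrightarrow> h r \<otimes>\<^bsub>S\<^esub> f \<in> pols R S h b n"
proof (induction n arbitrary: f)
  case (Suc n)
  from Suc(2) obtain c f' where *: "c \<in> carrier R" "f' \<in> pols R S h b n" "f = h c \<oplus>\<^bsub>S\<^esub> b \<otimes>\<^bsub>S\<^esub> f'"
    by (rule pols_SucE)
  have "h r \<otimes>\<^bsub>S\<^esub> f = h r \<otimes>\<^bsub>S\<^esub> h c \<oplus>\<^bsub>S\<^esub> b \<otimes>\<^bsub>S\<^esub> (h r \<otimes>\<^bsub>S\<^esub> f')"
    unfolding *(3) using pols_closed[OF *(2)] b hom_closed[OF *(1)] hom_closed[OF Suc(3)] by algebra
  also have "\<dots> = h (r \<otimes> c) \<oplus>\<^bsub>S\<^esub> b \<otimes>\<^bsub>S\<^esub> (h r \<otimes>\<^bsub>S\<^esub> f')" using * Suc(3) by simp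
  finally show ?case using pols_SucI[OF R.m_closed[OF Suc(3) *(1)] Suc(1)[OF *(2) Suc(3)]] by simp
qed simp

lemma pols_const: "c \<in> carrier R \<Longrightarrow> h c \<in> pols R S h b (Suc n)"
  using pols_SucI[OF _ pols_zero, of c n] by simp

lemma pols_shift: assumes "f \<in> pols R S h b n" shows "b \<otimes>\<^bsub>S\<^esub> f \<in> pols R S h b (Suc n)"
proof -
  have "b \<otimes>\<^bsub>S\<^esub> f = h \<zero> \<oplus>\<^bsub>S\<^esub> b \<otimes>\<^bsub>S\<^esub> f" using assms pols_closed by simp
  then show ?thesis using pols_SucI[OF R.zero_closed assms] by metis
qed

lemma pols_Suc: "pols R S h b n \<subseteq> pols R S h b (Suc n)"
proof (induction n)
  case 0
  then show ?case using pols_zero by auto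
next
  case (Suc n)
  show ?case
  proof
    fix f assume "f \<in> pols R S h b (Suc n)"
    then obtain c f' where "c \<in> carrier R" "f' \<in> pols R S h b n" "f = h c \<oplus>\<^bsub>S\<^esub> b \<otimes>\<^bsub>S\<^esub> f'" by (rule pols_SucE)
    then show "f \<in> pols R S h b (Suc (Suc n))" using pols_SucI[of c R f' S h b "Suc n"] Suc by auto
  qed
qed

lemma pols_mono: "n \<le> m \<Longrightarrow> pols R S h b n \<subseteq> pols R S h b m"
  using lift_Suc_mono_le[of "pols R S h b"] pols_Suc by blast

text \<open>The recursion of \<open>pols\<close> peels off the constant coefficient, whereas the
  argument of Hilbert's basis theorem needs the leading one.\<close>

lemma pols_decomp:
  assumes "f \<in> pols R S h b (Suc n)"
  obtains c g where "c \<in> carrier R" "g \<in> pols R S h b n" "f = h c \<otimes>\<^bsub>S\<^esub> b [^]\<^bsub>S\<^esub> n \<oplus>\<^bsub>S\<^esub> g"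
proof -
  have "\<exists>c g. c \<in> carrier R \<and> g \<in> pols R S h b n \<and> f = h c \<otimes>\<^bsub>S\<^esub> b [^]\<^bsub>S\<^esub> n \<oplus>\<^bsub>S\<^esub> g"
    using assms
  proof (induction n arbitrary: f)
    case 0
    then obtain c where "c \<in> carrier R" "f = h c" by (auto elim!: pols_SucE)
    then show ?case by (intro exI[of _ c] exI[of _ "\<zero>\<^bsub>S\<^esub>"]) auto
  next
    case (Suc n)
    from Suc(2) obtain c f' where *: "c \<in> carrier R" "f' \<in> pols R S h b (Suc n)" "f = h c \<oplus>\<^bsub>S\<^esub> b \<otimes>\<^bsub>S\<^esub> f'"
      by (rule pols_SucE)
    obtain d g where d: "d \<in> carrier R" "g \<in> pols R S h b n" "f' = h d \<otimes>\<^bsub>S\<^esub> b [^]\<^bsub>S\<^esub> n \<oplus>\<^bsub>S\<^esub> g"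
      using Suc(1)[OF *(2)] by auto
    have "f = h d \<otimes>\<^bsub>S\<^esub> (b [^]\<^bsub>S\<^esub> n \<otimes>\<^bsub>S\<^esub> b) \<oplus>\<^bsub>S\<^esub> (h c \<oplus>\<^bsub>S\<^esub> b \<otimes>\<^bsub>S\<^esub> g)"
      unfolding *(3) d(3) using pols_closed[OF d(2)] b hom_closed[OF *(1)] hom_closed[OF d(1)]
        S.nat_pow_closed[OF b, of n] by algebra
    then show ?case using d(1) pols_SucI[OF *(1) d(2)]
      by (intro exI[of _ d] exI[of _ "h c \<oplus>\<^bsub>S\<^esub> b \<otimes>\<^bsub>S\<^esub> g"]) simp
  qed
  then show thesis using that by auto
qed

end

end

context noetherian_hom
begin

lemma pols_minus:
  assumes "b \<in> carrier S" "f \<in> pols R S h b n" "g \<in> pols R S h b n"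
  shows "f \<ominus>\<^bsub>S\<^esub> g \<in> pols R S h b n"
proof -
  have "h (\<ominus> \<one>) \<otimes>\<^bsub>S\<^esub> g \<in> pols R S h b n" by (rule pols_scale[OF assms(1,3)]) simp
  moreover have "h (\<ominus> \<one>) \<otimes>\<^bsub>S\<^esub> g = \<ominus>\<^bsub>S\<^esub> g" using pols_closed[OF assms(1,3)] by (simp add: S.l_minus)
  ultimately show ?thesis using pols_add[OF assms(1,2), of "h (\<ominus> \<one>) \<otimes>\<^bsub>S\<^esub> g"] by (simp add: a_minus_def)
qed

text \<open>Hilbert's basis theorem, argued in the ring R[b] itself. The expression of an element in
  powers of \<open>b\<close> need not be unique; this does no harm, since a leading coefficient is
  one of some expression.\<close>

theorem noetherian_adjoin:
  assumes b [simp]: "b \<in> carrier S" and gen: "\<And>f. f \<in> carrier S \<Longrightarrow> \<exists>n. f \<in> pols R S h b n"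
  shows "noetherian_ring S"
proof (rule S.noetherian_ring_if_acc)
  fix J :: "nat \<Rightarrow> _ set" assume J: "\<And>i. ideal (J i) S" "\<And>i. J i \<subseteq> J (Suc i)"
  \<comment> \<open>\<open>L d i\<close> collects the coefficients of b^d in those elements of
    \<open>J i\<close> that can be written with powers up to b^d. It grows with both
    indices.\<close>
  define L where "L = (\<lambda>d i. {c \<in> carrier R. \<exists>f\<in>pols R S h b d. h c \<otimes>\<^bsub>S\<^esub> b [^]\<^bsub>S\<^esub> d \<oplus>\<^bsub>S\<^esub> f \<in> J i})"
  note pc = pols_closed[OF b]
  have bd [simp]: "b [^]\<^bsub>S\<^esub> d \<in> carrier S" for d :: nat by simp
  have Jmono: "J i \<subseteq> J j" if "i \<le> j" for i j using lift_Suc_mono_le[of J] J(2) that by blast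
  have Lid: "ideal (L d i) R" for d i
  proof (rule R.cring_idealI)
    interpret J: ideal "J i" S by (rule J)
    show "L d i \<subseteq> carrier R" unfolding L_def by auto
    have "h \<zero> \<otimes>\<^bsub>S\<^esub> b [^]\<^bsub>S\<^esub> d \<oplus>\<^bsub>S\<^esub> \<zero>\<^bsub>S\<^esub> \<in> J i" by simp
    then show "\<zero> \<in> L d i" unfolding L_def using pols_zero[OF b] by blast
    fix c assume "c \<in> L d i"
    then obtain f where c: "c \<in> carrier R" "f \<in> pols R S h b d" "h c \<otimes>\<^bsub>S\<^esub> b [^]\<^bsub>S\<^esub> d \<oplus>\<^bsub>S\<^esub> f \<in> J i"
      unfolding L_def by auto
    note fc = pc[OF c(2)]
    show "c \<oplus> c' \<in> L d i" if c': "c' \<in> L d i" for c'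
    proof -
      obtain f' where d: "c' \<in> carrier R" "f' \<in> pols R S h b d" "h c' \<otimes>\<^bsub>S\<^esub> b [^]\<^bsub>S\<^esub> d \<oplus>\<^bsub>S\<^esub> f' \<in> J i"
        using c' unfolding L_def by auto
      note f'c = pc[OF d(2)]
      have "h (c \<oplus> c') \<otimes>\<^bsub>S\<^esub> b [^]\<^bsub>S\<^esub> d \<oplus>\<^bsub>S\<^esub> (f \<oplus>\<^bsub>S\<^esub> f')
        = (h c \<oplus>\<^bsub>S\<^esub> h c') \<otimes>\<^bsub>S\<^esub> b [^]\<^bsub>S\<^esub> d \<oplus>\<^bsub>S\<^esub> (f \<oplus>\<^bsub>S\<^esub> f')" using c d by simp
      also have "\<dots> = (h c \<otimes>\<^bsub>S\<^esub> b [^]\<^bsub>S\<^esub> d \<oplus>\<^bsub>S\<^esub> f) \<oplus>\<^bsub>S\<^esub> (h c' \<otimes>\<^bsub>S\<^esub> b [^]\<^bsub>S\<^esub> d \<oplus>\<^bsub>S\<^esub> f')"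
        using fc f'c bd hom_closed[OF c(1)] hom_closed[OF d(1)] by algebra
      also have "\<dots> \<in> J i" using c(3) d(3) by simp
      finally show ?thesis unfolding L_def using c(1) d(1) pols_add[OF b c(2) d(2)] by auto
    qed
    show "r \<otimes> c \<in> L d i" if r: "r \<in> carrier R" for r
    proof -
      have "h (r \<otimes> c) \<otimes>\<^bsub>S\<^esub> b [^]\<^bsub>S\<^esub> d \<oplus>\<^bsub>S\<^esub> h r \<otimes>\<^bsub>S\<^esub> f = h r \<otimes>\<^bsub>S\<^esub> h c \<otimes>\<^bsub>S\<^esub> b [^]\<^bsub>S\<^esub> d \<oplus>\<^bsub>S\<^esub> h r \<otimes>\<^bsub>S\<^esub> f"
        using c r by simp
      also have "\<dots> = h r \<otimes>\<^bsub>S\<^esub> (h c \<otimes>\<^bsub>S\<^esub> b [^]\<^bsub>S\<^esub> d \<oplus>\<^bsub>S\<^esub> f)"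
        using fc bd hom_closed[OF c(1)] hom_closed[OF r] by algebra
      also have "\<dots> \<in> J i" using c(3) r J.I_l_closed by simp
      finally show ?thesis unfolding L_def using c(1) r pols_scale[OF b c(2) r] by auto
    qed
  qed
  have Ld: "L d i \<subseteq> L (Suc d) i" for d i
  proof
    fix c assume "c \<in> L d i"
    then obtain f where c: "c \<in> carrier R" "f \<in> pols R S h b d" "h c \<otimes>\<^bsub>S\<^esub> b [^]\<^bsub>S\<^esub> d \<oplus>\<^bsub>S\<^esub> f \<in> J i"
      unfolding L_def by auto
    have "h c \<otimes>\<^bsub>S\<^esub> (b [^]\<^bsub>S\<^esub> d \<otimes>\<^bsub>S\<^esub> b) \<oplus>\<^bsub>S\<^esub> b \<otimes>\<^bsub>S\<^esub> f = b \<otimes>\<^bsub>S\<^esub> (h c \<otimes>\<^bsub>S\<^esub> b [^]\<^bsub>S\<^esub> d \<oplus>\<^bsub>S\<^esub> f)"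
      using pc[OF c(2)] b bd hom_closed[OF c(1)] by algebra
    also have "\<dots> \<in> J i" using ideal.I_l_closed[OF J(1) c(3) b] .
    finally show "c \<in> L (Suc d) i" unfolding L_def using c(1) pols_shift[OF b c(2)] by auto
  qed
  have Li: "L d i \<subseteq> L d (Suc i)" for d i unfolding L_def using J(2)[of i] by blast
  have Lmono: "L d i \<subseteq> L d' i'" if "d \<le> d'" "i \<le> i'" for d d' i i'
  proof -
    have "L d i \<subseteq> L d' i" using lift_Suc_mono_le[of "\<lambda>d. L d i"] Ld that by blast
    also have "\<dots> \<subseteq> L d' i'" using lift_Suc_mono_le[of "\<lambda>i. L d' i"] Li that by blast
    finally show ?thesis .
  qed
  \<comment> \<open>The diagonal settles all degrees from \<open>N\<close> on at once; the finitely
    many degrees below \<open>N\<close> are settled one at a time by \<open>M\<close>, and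
    \<open>K\<close> is beyond all these bounds.\<close>
  have "\<exists>N. \<forall>i\<ge>N. L i i = L N N"
    using R.ideal_acc[of "\<lambda>i. L i i", OF Lid Lmono] by simp
  then obtain N where N: "\<And>i. i \<ge> N \<Longrightarrow> L i i = L N N" by blast
  have "\<exists>M. \<forall>i\<ge>M. L d i = L d M" for d
    using R.ideal_acc[of "L d", OF Lid Lmono] by simp
  then obtain M where M: "\<And>d i. i \<ge> M d \<Longrightarrow> L d i = L d (M d)" by metis
  define K where "K = N + (\<Sum>d<N. M d)"
  have LK: "L d (Suc K) \<subseteq> L d K" for d
  proof (cases "d < N")
    case True
    then have "M d \<le> K" unfolding K_def using member_le_sum[of d "{..<N}" M] by auto
    then show ?thesis using M[of d K] M[of d "Suc K"] by simp
  next
    case False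
    let ?D = "max d (Suc K)"
    have "L d (Suc K) \<subseteq> L ?D ?D" by (rule Lmono) auto
    also have "\<dots> = L N N" by (rule N) (use False in auto)
    also have "\<dots> \<subseteq> L d K" by (rule Lmono) (use False K_def in auto)
    finally show ?thesis .
  qed
  \<comment> \<open>By induction on the length: subtracting an element of \<open>J K\<close> with
    the same leading coefficient leaves a shorter expression, still in
    \<open>J (Suc K)\<close>.\<close>
  have "f \<in> J K" if "f \<in> pols R S h b n" "f \<in> J (Suc K)" for n f
    using that
  proof (induction n arbitrary: f)
    case 0
    then show ?case using additive_subgroup.zero_closed[OF ideal.axioms(1)[OF J(1)]] by simp
  next
    case (Suc n)
    from pols_decomp[OF b Suc(2)] obtain c g where
      f: "c \<in> carrier R" "g \<in> pols R S h b n" "f = h c \<otimes>\<^bsub>S\<^esub> b [^]\<^bsub>S\<^esub> n \<oplus>\<^bsub>S\<^esub> g" .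
    then have "c \<in> L n (Suc K)" unfolding L_def using Suc(3) by auto
    then have "c \<in> L n K" using LK by auto
    then obtain g' where g': "g' \<in> pols R S h b n" "h c \<otimes>\<^bsub>S\<^esub> b [^]\<^bsub>S\<^esub> n \<oplus>\<^bsub>S\<^esub> g' \<in> J K"
      unfolding L_def by auto
    have "g \<ominus>\<^bsub>S\<^esub> g' = f \<ominus>\<^bsub>S\<^esub> (h c \<otimes>\<^bsub>S\<^esub> b [^]\<^bsub>S\<^esub> n \<oplus>\<^bsub>S\<^esub> g')"
      unfolding f(3) using pc[OF f(2)] pc[OF g'(1)] bd hom_closed[OF f(1)] by algebra
    also have "\<dots> \<in> J (Suc K)"
      using S.ideal_minus_closed[OF J(1) Suc(3)] J(2) g'(2) by blast
    finally have "g \<ominus>\<^bsub>S\<^esub> g' \<in> J K" using Suc(1)[OF pols_minus[OF b f(2) g'(1)]] by simp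
    then have "(h c \<otimes>\<^bsub>S\<^esub> b [^]\<^bsub>S\<^esub> n \<oplus>\<^bsub>S\<^esub> g') \<oplus>\<^bsub>S\<^esub> (g \<ominus>\<^bsub>S\<^esub> g') \<in> J K"
      using additive_subgroup.a_closed[OF ideal.axioms(1)[OF J(1)] g'(2)] by simp
    moreover have "(h c \<otimes>\<^bsub>S\<^esub> b [^]\<^bsub>S\<^esub> n \<oplus>\<^bsub>S\<^esub> g') \<oplus>\<^bsub>S\<^esub> (g \<ominus>\<^bsub>S\<^esub> g') = f"
      unfolding f(3) using pc[OF f(2)] pc[OF g'(1)] bd hom_closed[OF f(1)] by algebra
    ultimately show ?case by simp
  qed
  then have "J (Suc K) \<subseteq> J K" using gen ideal.Icarr[OF J(1)] by blast
  then have "J (Suc K) = J K" using J(2)[of K] by simp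
  then show "\<exists>N. J (Suc N) = J N" ..
qed

end

section \<open>Integrality from powers with a common denominator\<close>

fun seq_span :: "('a, 'm) ring_scheme \<Rightarrow> (nat \<Rightarrow> 'a) \<Rightarrow> nat \<Rightarrow> 'a set" where
  "seq_span R e 0 = {\<zero>\<^bsub>R\<^esub>}"
| "seq_span R e (Suc k) = {s \<oplus>\<^bsub>R\<^esub> d \<otimes>\<^bsub>R\<^esub> e k | s d. s \<in> seq_span R e k \<and> d \<in> carrier R}"

declare seq_span.simps(2) [simp del]

lemma (in noetherian_cring) seq_in_span:
  fixes e :: "nat \<Rightarrow> 'a"
  assumes e: "\<And>k. e k \<in> carrier R"
  obtains n where "e (Suc n) \<in> seq_span R e (Suc n)"
proof -
  have id: "ideal (seq_span R e k) R" for k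
    by (induction k) (simp_all add: zeroideal ideal_adjoin(1) e seq_span.simps(2))
  have "\<exists>N. \<forall>i\<ge>N. seq_span R e i = seq_span R e N"
    by (rule ideal_acc[OF id]) (simp only: seq_span.simps(2), rule ideal_adjoin(2)[OF id e])
  then obtain N where N: "\<And>i. i \<ge> N \<Longrightarrow> seq_span R e i = seq_span R e N" by blast
  \<comment> \<open>The index is one past \<open>N\<close>, so that the span contains at least
    \<open>e 0\<close> and the monic equation obtained from it has positive degree.\<close>
  have "e (Suc N) \<in> seq_span R e (Suc (Suc N))" unfolding seq_span.simps(2)[of R e "Suc N"] by (rule ideal_adjoin(3)[OF id e])
  also have "\<dots> = seq_span R e (Suc N)" using N[of "Suc N"] N[of "Suc (Suc N)"] by simp
  finally show thesis using that by blast
qed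

text \<open>The determinant trick is replaced by a chain argument: \<open>e (n + 1)\<close> is a combination of
  \<open>e 0, \<dots>, e n\<close>, and \<open>e k = c (a / v)\<^sup>k\<close>, which gives a monic equation for \<open>a / v\<close>.\<close>

lemma (in noetherian_hom) integral_if_fraction_powers:
  assumes c: "a \<in> carrier R" "v \<in> carrier R" "c \<in> carrier R" and e: "\<And>k. e k \<in> carrier R"
    and eq: "\<And>k::nat. h (v [^] k \<otimes> e k) = h (c \<otimes> a [^] k)"
    and regv: "\<And>y. y \<in> carrier S \<Longrightarrow> h v \<otimes>\<^bsub>S\<^esub> y = \<zero>\<^bsub>S\<^esub> \<Longrightarrow> y = \<zero>\<^bsub>S\<^esub>"
    and regc: "\<And>y. y \<in> carrier S \<Longrightarrow> h c \<otimes>\<^bsub>S\<^esub> y = \<zero>\<^bsub>S\<^esub> \<Longrightarrow> y = \<zero>\<^bsub>S\<^esub>"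
  shows "\<exists>k. \<exists>f\<in>forms R a v k. h (a [^] Suc k) = h (v \<otimes> f)"
proof -
  have span_closed: "s \<in> carrier R" if "s \<in> seq_span R e k" for s k
    using that
  proof (induction k arbitrary: s)
    case (Suc k)
    then obtain s' d where "s = s' \<oplus> d \<otimes> e k" "s' \<in> seq_span R e k" "d \<in> carrier R"
      unfolding seq_span.simps(2) by blast
    then show ?case using Suc(1)[of s'] e[of k] by simp
  qed simp
  have eq': "h v [^]\<^bsub>S\<^esub> k \<otimes>\<^bsub>S\<^esub> h (e k) = h c \<otimes>\<^bsub>S\<^esub> h a [^]\<^bsub>S\<^esub> k" for k
  proof -
    have "h (v [^] k \<otimes> e k) = h v [^]\<^bsub>S\<^esub> k \<otimes>\<^bsub>S\<^esub> h (e k)" using c e[of k] by (simp add: ring.hom_nat_pow)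
    moreover have "h (c \<otimes> a [^] k) = h c \<otimes>\<^bsub>S\<^esub> h a [^]\<^bsub>S\<^esub> k" using c by (simp add: ring.hom_nat_pow)
    ultimately show ?thesis using eq[of k] by metis
  qed
  \<comment> \<open>Multiplication by v^k turns e i = c (a / v)^i, for i \<le> k, into c a^i
    v^(k-i), which is \<open>c\<close> times a form of degree \<open>k\<close>. These identities
    hold only after applying \<open>h\<close>, which need not be injective; hence regularity is
    required in \<open>S\<close>.\<close>
  have claim: "\<exists>g\<in>forms R a v k. h (v [^] k \<otimes> s) = h (c \<otimes> g)" if "s \<in> seq_span R e (Suc k)" for k s
    using that
  proof (induction k arbitrary: s)
    case 0
    then obtain d where d: "d \<in> carrier R" "s = \<zero> \<oplus> d \<otimes> e 0" by (auto simp: seq_span.simps(2))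
    have "h (v [^] (0::nat) \<otimes> s) = h d \<otimes>\<^bsub>S\<^esub> h (e 0)" using d e[of 0] by simp
    also have "h (e 0) = h c" using eq'[of 0] e[of 0] c by simp
    finally show ?case using d c by (auto intro!: bexI[of _ d] simp: S.m_comm)
  next
    case (Suc k)
    then obtain s' d where d: "d \<in> carrier R" "s = s' \<oplus> d \<otimes> e (Suc k)" "s' \<in> seq_span R e (Suc k)"
      by (auto simp: seq_span.simps(2)[of R e "Suc k"])
    obtain g' where g': "g' \<in> forms R a v k" "h (v [^] k \<otimes> s') = h (c \<otimes> g')" using Suc(1)[OF d(3)] by auto
    note cc = span_closed[OF d(3)] R.forms_closed[OF c(1,2) g'(1)]
    have hc: "h v \<in> carrier S" "h a \<in> carrier S" "h c \<in> carrier S" "h d \<in> carrier S" "h s' \<in> carrier S"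
      "h (e (Suc k)) \<in> carrier S" "h g' \<in> carrier S" "h v [^]\<^bsub>S\<^esub> k \<in> carrier S" "h a [^]\<^bsub>S\<^esub> k \<in> carrier S"
      using c d cc e by auto
    have g'': "h v [^]\<^bsub>S\<^esub> k \<otimes>\<^bsub>S\<^esub> h s' = h c \<otimes>\<^bsub>S\<^esub> h g'"
      using g'(2) c cc by (simp add: ring.hom_nat_pow)
    let ?g = "a \<otimes> (d \<otimes> a [^] k) \<oplus> v \<otimes> g'"
    have "h (v [^] Suc k \<otimes> s) = (h v [^]\<^bsub>S\<^esub> k \<otimes>\<^bsub>S\<^esub> h v) \<otimes>\<^bsub>S\<^esub> (h s' \<oplus>\<^bsub>S\<^esub> h d \<otimes>\<^bsub>S\<^esub> h (e (Suc k)))"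
      using c d cc e by (simp add: ring.hom_nat_pow)
    also have "\<dots> = h v \<otimes>\<^bsub>S\<^esub> (h v [^]\<^bsub>S\<^esub> k \<otimes>\<^bsub>S\<^esub> h s') \<oplus>\<^bsub>S\<^esub> h d \<otimes>\<^bsub>S\<^esub> ((h v [^]\<^bsub>S\<^esub> k \<otimes>\<^bsub>S\<^esub> h v) \<otimes>\<^bsub>S\<^esub> h (e (Suc k)))"
      using hc by algebra
    also have "(h v [^]\<^bsub>S\<^esub> k \<otimes>\<^bsub>S\<^esub> h v) \<otimes>\<^bsub>S\<^esub> h (e (Suc k)) = h c \<otimes>\<^bsub>S\<^esub> (h a [^]\<^bsub>S\<^esub> k \<otimes>\<^bsub>S\<^esub> h a)"
      using eq'[of "Suc k"] by simp
    also have "h v \<otimes>\<^bsub>S\<^esub> (h v [^]\<^bsub>S\<^esub> k \<otimes>\<^bsub>S\<^esub> h s') \<oplus>\<^bsub>S\<^esub> h d \<otimes>\<^bsub>S\<^esub> (h c \<otimes>\<^bsub>S\<^esub> (h a [^]\<^bsub>S\<^esub> k \<otimes>\<^bsub>S\<^esub> h a))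
      = h c \<otimes>\<^bsub>S\<^esub> (h a \<otimes>\<^bsub>S\<^esub> (h d \<otimes>\<^bsub>S\<^esub> h a [^]\<^bsub>S\<^esub> k) \<oplus>\<^bsub>S\<^esub> h v \<otimes>\<^bsub>S\<^esub> h g')"
      unfolding g'' using hc by algebra
    also have "\<dots> = h (c \<otimes> ?g)" using c d cc by (simp add: ring.hom_nat_pow)
    finally have "h (v [^] Suc k \<otimes> s) = h (c \<otimes> ?g)" .
    moreover have "?g \<in> forms R a v (Suc k)"
      by (rule forms_SucI[OF R.forms_scale[OF c(1,2) R.forms_pow[OF c(1,2)] d(1)] g'(1)])
    ultimately show ?case by blast
  qed
  obtain n where n: "e (Suc n) \<in> seq_span R e (Suc n)" using R.seq_in_span e by blast
  obtain g where g: "g \<in> forms R a v n" "h (v [^] n \<otimes> e (Suc n)) = h (c \<otimes> g)" using claim[OF n] by auto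
  have gc: "g \<in> carrier R" using R.forms_closed[OF c(1,2) g(1)] .
  have hc: "h v \<in> carrier S" "h a [^]\<^bsub>S\<^esub> Suc n \<in> carrier S" "h c \<in> carrier S" "h g \<in> carrier S"
    "h (e (Suc n)) \<in> carrier S" "h v [^]\<^bsub>S\<^esub> n \<in> carrier S"
    using c gc e by auto
  \<comment> \<open>Membership in the span gives c a^(n+1) = v^(n+1) e (n+1) = c v g with a form
    \<open>g\<close> of degree \<open>n\<close>; it remains to cancel \<open>c\<close>.\<close>
  have "h c \<otimes>\<^bsub>S\<^esub> h a [^]\<^bsub>S\<^esub> Suc n = (h v [^]\<^bsub>S\<^esub> n \<otimes>\<^bsub>S\<^esub> h v) \<otimes>\<^bsub>S\<^esub> h (e (Suc n))"
    using eq'[of "Suc n"] by simp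
  also have "\<dots> = h v \<otimes>\<^bsub>S\<^esub> (h v [^]\<^bsub>S\<^esub> n \<otimes>\<^bsub>S\<^esub> h (e (Suc n)))" using hc by algebra
  also have "h v [^]\<^bsub>S\<^esub> n \<otimes>\<^bsub>S\<^esub> h (e (Suc n)) = h c \<otimes>\<^bsub>S\<^esub> h g" using g(2) c gc e by (simp add: ring.hom_nat_pow)
  finally have "h c \<otimes>\<^bsub>S\<^esub> (h a [^]\<^bsub>S\<^esub> Suc n \<ominus>\<^bsub>S\<^esub> h v \<otimes>\<^bsub>S\<^esub> h g) = h v \<otimes>\<^bsub>S\<^esub> (h c \<otimes>\<^bsub>S\<^esub> h g) \<ominus>\<^bsub>S\<^esub> h c \<otimes>\<^bsub>S\<^esub> (h v \<otimes>\<^bsub>S\<^esub> h g)"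
    using hc by (metis S.m_closed S.minus_eq S.r_distr S.r_minus S.a_inv_closed)
  also have "\<dots> = \<zero>\<^bsub>S\<^esub>" using hc by algebra
  finally have "h a [^]\<^bsub>S\<^esub> Suc n \<ominus>\<^bsub>S\<^esub> h v \<otimes>\<^bsub>S\<^esub> h g = \<zero>\<^bsub>S\<^esub>" by (rule regc[rotated]) (use hc in simp)
  then have "h a [^]\<^bsub>S\<^esub> Suc n = h v \<otimes>\<^bsub>S\<^esub> h g" using hc by simp
  then have "h (a [^] Suc n) = h (v \<otimes> g)" using c gc by (simp add: ring.hom_nat_pow)
  then show ?thesis using g(1) by blast
qed

context noetherian_cring
begin

text \<open>This says that x / v is almost integral: all its powers have the common denominator v^N.
  In a Noetherian ring this is the same as integrality, and unlike an equation it is easily combined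
  for two elements.\<close>

lemma integral_over_iff:
  assumes v: "v \<in> carrier R" and regv: "\<And>y. y \<in> carrier R \<Longrightarrow> v \<otimes> y = \<zero> \<Longrightarrow> y = \<zero>"
    and x: "x \<in> carrier R"
  shows "integral_over R v x \<longleftrightarrow> (\<exists>N::nat. \<forall>k::nat. \<exists>e\<in>carrier R. v [^] N \<otimes> x [^] k = v [^] k \<otimes> e)"
proof
  assume "\<exists>N::nat. \<forall>k::nat. \<exists>e\<in>carrier R. v [^] N \<otimes> x [^] k = v [^] k \<otimes> e"
  then obtain N :: nat and e where e: "\<And>k. e k \<in> carrier R" "\<And>k::nat. v [^] N \<otimes> x [^] k = v [^] k \<otimes> e k"
    by metis
  interpret H: noetherian_hom R R id
    by (intro noetherian_hom.intro ring_hom_cring.intro ring_hom_cring_axioms.intro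
        noetherian_hom_axioms.intro id_ring_hom is_cring noetherian_ring_axioms)
  have regN: "y = \<zero>" if "y \<in> carrier R" "id (v [^] N) \<otimes> y = \<zero>" for y
    using that(2) unfolding id_apply
  proof (induction N)
    case (Suc N)
    have "v \<otimes> (v [^] N \<otimes> y) = \<zero>" using Suc(2) v that(1) by (simp add: m_ac)
    then have "v [^] N \<otimes> y = \<zero>" by (rule regv[rotated]) (use v that(1) in simp)
    then show ?case by (rule Suc(1))
  qed (use that in simp)
  have "\<exists>k. \<exists>f\<in>forms R x v k. id (x [^] Suc k) = id (v \<otimes> f)"
    using v x e(1)
  proof (intro H.integral_if_fraction_powers[of x v "v [^] N" e])
    show "id (v [^] k \<otimes> e k) = id (v [^] N \<otimes> x [^] k)" for k using e(2)[of k] by simp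
    show "y = \<zero>" if "y \<in> carrier R" "id (v [^] N) \<otimes> y = \<zero>" for y using regN that .
    show "y = \<zero>" if "y \<in> carrier R" "id v \<otimes> y = \<zero>" for y using regv[of y] that by simp
  qed simp_all
  then show "integral_over R v x" unfolding integral_over_def by simp
next
  assume "integral_over R v x"
  then obtain e f where f: "f \<in> forms R x v e" "x [^] Suc e = v \<otimes> f" unfolding integral_over_def by auto
  note fc = forms_closed[OF x v]
  \<comment> \<open>The relation x^(e+1) = v f makes v R a reduction of (x, v): from degree e on,
    (x, v)^(e+k+1) = v (x, v)^(e+k). Iteration puts (x, v)^(e+k) into v^k R.\<close>
  have step: "\<exists>g'\<in>forms R x v (e + k). g = v \<otimes> g'" if "g \<in> forms R x v (Suc (e + k))" for k g
    using that
  proof (induction k arbitrary: g)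
    case 0
    then obtain c g' where c: "c \<in> carrier R" "g' \<in> forms R x v e" "g = c \<otimes> x [^] Suc e \<oplus> v \<otimes> g'"
      using forms_decomp[OF x v] by (metis add_0_right)
    have "g = v \<otimes> (c \<otimes> f \<oplus> g')" unfolding c(3) f(2) using c(1) fc[OF c(2)] fc[OF f(1)] v by algebra
    then show ?case using forms_add[OF x v forms_scale[OF x v f(1) c(1)] c(2)] by auto
  next
    case (Suc k)
    from Suc(2) obtain a b where ab: "g = x \<otimes> a \<oplus> v \<otimes> b" "a \<in> forms R x v (Suc (e + k))" "b \<in> forms R x v (Suc (e + k))"
      by (auto elim: forms_SucE)
    obtain a' where a': "a' \<in> forms R x v (e + k)" "a = v \<otimes> a'" using Suc(1)[OF ab(2)] by auto
    have "g = v \<otimes> (x \<otimes> a' \<oplus> b)" unfolding ab(1) a'(2) using fc[OF ab(3)] fc[OF a'(1)] x v by algebra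
    moreover have "x \<otimes> a' \<oplus> b \<in> forms R x v (e + Suc k)"
      using forms_add[OF x v forms_x[OF x v a'(1)] ab(3)] by simp
    ultimately show ?case by blast
  qed
  have pow: "\<exists>g'\<in>carrier R. g = v [^] k \<otimes> g'" if "g \<in> forms R x v (e + k)" for k g
    using that
  proof (induction k arbitrary: g)
    case 0
    then show ?case using fc by auto
  next
    case (Suc k)
    obtain g1 where g1: "g1 \<in> forms R x v (e + k)" "g = v \<otimes> g1" using step[of g k] Suc(2) by auto
    then obtain g2 where "g2 \<in> carrier R" "g1 = v [^] k \<otimes> g2" using Suc(1) by auto
    then show ?case using g1(2) v by (auto intro!: bexI[of _ g2] simp: m_ac)
  qed
  \<comment> \<open>The exponent N = e works: for k \<le> e, v^e itself is divisible by v^k; for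
    larger k, x^k lies in (x, v)^k, hence in v^(k-e) R.\<close>
  have "\<exists>y\<in>carrier R. v [^] e \<otimes> x [^] k = v [^] k \<otimes> y" for k :: nat
  proof (cases "k \<le> e")
    case True
    have "v [^] e = v [^] k \<otimes> v [^] (e - k)" using True v by (simp add: nat_pow_mult)
    then show ?thesis using x v by (intro bexI[of _ "v [^] (e - k) \<otimes> x [^] k"]) (simp_all add: m_ac)
  next
    case False
    then have "x [^] k \<in> forms R x v (e + (k - e))" using forms_pow[OF x v, of k] by simp
    then obtain y where y: "y \<in> carrier R" "x [^] k = v [^] (k - e) \<otimes> y" using pow by blast
    have "v [^] k = v [^] e \<otimes> v [^] (k - e)" using False v by (simp add: nat_pow_mult)
    then show ?thesis using y v by (intro bexI[of _ y]) (simp_all add: m_ac)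
  qed
  then show "\<exists>N::nat. \<forall>k::nat. \<exists>e\<in>carrier R. v [^] N \<otimes> x [^] k = v [^] k \<otimes> e" by blast
qed

lemma integral_over_ideal:
  assumes v: "v \<in> carrier R" and regv: "\<And>y. y \<in> carrier R \<Longrightarrow> v \<otimes> y = \<zero> \<Longrightarrow> y = \<zero>"
  shows "ideal {x \<in> carrier R. integral_over R v x} R"
proof (rule cring_idealI)
  have iff: "x \<in> {x \<in> carrier R. integral_over R v x} \<longleftrightarrow>
    x \<in> carrier R \<and> (\<exists>N::nat. \<forall>k::nat. \<exists>e\<in>carrier R. v [^] N \<otimes> x [^] k = v [^] k \<otimes> e)" for x
    using integral_over_iff[OF v regv] by blast
  show "{x \<in> carrier R. integral_over R v x} \<subseteq> carrier R" by auto
  have "\<zero> [^] Suc 0 = v \<otimes> \<zero>" "\<zero> \<in> forms R \<zero> v 0" using v by auto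
  then show "\<zero> \<in> {x \<in> carrier R. integral_over R v x}" unfolding integral_over_def by blast
  fix x assume "x \<in> {x \<in> carrier R. integral_over R v x}"
  then have x: "x \<in> carrier R" and "\<exists>N::nat. \<forall>k::nat. \<exists>e\<in>carrier R. v [^] N \<otimes> x [^] k = v [^] k \<otimes> e"
    using iff by auto
  then obtain N :: nat and e where e: "\<And>k. e k \<in> carrier R" "\<And>k::nat. v [^] N \<otimes> x [^] k = v [^] k \<otimes> e k" by metis
  show "r \<otimes> x \<in> {x \<in> carrier R. integral_over R v x}" if r: "r \<in> carrier R" for r
  proof -
    have "v [^] N \<otimes> (r \<otimes> x) [^] k = v [^] k \<otimes> (r [^] k \<otimes> e k)" for k :: nat
    proof -
      have "v [^] N \<otimes> (r \<otimes> x) [^] k = r [^] k \<otimes> (v [^] N \<otimes> x [^] k)"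
        using r x v by (simp add: nat_pow_distrib m_ac)
      then show ?thesis unfolding e(2) using r e(1)[of k] v by (simp add: m_ac)
    qed
    moreover have "r [^] k \<otimes> e k \<in> carrier R" for k using r e(1) by simp
    ultimately show ?thesis unfolding iff using r x by blast
  qed
  fix y assume "y \<in> {x \<in> carrier R. integral_over R v x}"
  then have y: "y \<in> carrier R" and "\<exists>N::nat. \<forall>k::nat. \<exists>e\<in>carrier R. v [^] N \<otimes> y [^] k = v [^] k \<otimes> e"
    using iff by auto
  then obtain M :: nat and d where d: "\<And>k. d k \<in> carrier R" "\<And>k::nat. v [^] M \<otimes> y [^] k = v [^] k \<otimes> d k" by metis
  \<comment> \<open>Carrying the factor x^i y^j along replaces the binomial expansion: each step
    distributes a single factor x + y. The exponent N + M clears the denominators of both kinds of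
    powers.\<close>
  have "\<exists>z\<in>carrier R. v [^] (N + M) \<otimes> ((x \<oplus> y) [^] k \<otimes> (x [^] i \<otimes> y [^] j)) = v [^] (k + i + j) \<otimes> z" for k i j :: nat
  proof (induction k arbitrary: i j)
    case 0
    have "v [^] (N + M) \<otimes> (x [^] i \<otimes> y [^] j) = (v [^] N \<otimes> x [^] i) \<otimes> (v [^] M \<otimes> y [^] j)"
      using v x y by (simp add: m_ac flip: nat_pow_mult)
    also have "\<dots> = v [^] (i + j) \<otimes> (e i \<otimes> d j)"
      unfolding e(2) d(2) using v e(1)[of i] d(1)[of j] by (simp add: m_ac flip: nat_pow_mult)
    finally show ?case using x y e(1)[of i] d(1)[of j] by (intro bexI[of _ "e i \<otimes> d j"]) auto
  next
    case (Suc k)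
    obtain z1 where z1: "z1 \<in> carrier R"
      "v [^] (N + M) \<otimes> ((x \<oplus> y) [^] k \<otimes> (x [^] Suc i \<otimes> y [^] j)) = v [^] (k + Suc i + j) \<otimes> z1" using Suc by blast
    obtain z2 where z2: "z2 \<in> carrier R"
      "v [^] (N + M) \<otimes> ((x \<oplus> y) [^] k \<otimes> (x [^] i \<otimes> y [^] Suc j)) = v [^] (k + i + Suc j) \<otimes> z2" using Suc by blast
    have cl: "v [^] (N + M) \<in> carrier R" "(x \<oplus> y) [^] k \<in> carrier R" "x [^] i \<in> carrier R" "y [^] j \<in> carrier R"
      using v x y by auto
    have "v [^] (N + M) \<otimes> ((x \<oplus> y) [^] Suc k \<otimes> (x [^] i \<otimes> y [^] j)) =
      v [^] (N + M) \<otimes> ((x \<oplus> y) [^] k \<otimes> (x [^] Suc i \<otimes> y [^] j)) \<oplus> v [^] (N + M) \<otimes> ((x \<oplus> y) [^] k \<otimes> (x [^] i \<otimes> y [^] Suc j))"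
      unfolding nat_pow_Suc using cl x y by algebra
    also have "\<dots> = v [^] (Suc k + i + j) \<otimes> (z1 \<oplus> z2)"
      unfolding z1(2) z2(2) using z1(1) z2(1) v by (simp add: r_distr)
    finally show ?case using z1(1) z2(1) by blast
  qed
  from this[of _ 0 0] have "\<exists>z\<in>carrier R. v [^] (N + M) \<otimes> (x \<oplus> y) [^] k = v [^] k \<otimes> z" for k :: nat
    using x y by simp
  then show "x \<oplus> y \<in> {x \<in> carrier R. integral_over R v x}" unfolding iff using x y by blast
qed

text \<open>The hypothesis \<open>sub\<close> says that G = H + w G, and \<open>w\<close> lies in
  the Jacobson radical. If G were larger than H, take \<open>N\<close> maximal among the ideals over
  H properly inside G; then G = N + R g, and g = h + w (n + a g) with h in H and n in N puts (1 - w
  a) g, hence g, into \<open>N\<close>.\<close>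

lemma nakayama:
  assumes w: "w \<in> carrier R" and unit: "\<And>b. b \<in> carrier R \<Longrightarrow> \<one> \<oplus> w \<otimes> b \<in> Units R"
    and G: "ideal G R" and H: "ideal H R" "H \<subseteq> G"
    and sub: "\<And>y. y \<in> G \<Longrightarrow> \<exists>z\<in>G. y \<ominus> w \<otimes> z \<in> H"
  shows "H = G"
proof (rule ccontr)
  assume ne: "H \<noteq> G"
  define F where "F = {N. ideal N R \<and> H \<subseteq> N \<and> N \<subseteq> G \<and> N \<noteq> G}"
  have "H \<in> F" unfolding F_def using H ne by auto
  then obtain N where N: "N \<in> F" "\<And>I. I \<in> F \<Longrightarrow> N \<subseteq> I \<Longrightarrow> I = N"
    using ideal_maximal[of F] unfolding F_def by (metis (no_types, lifting) empty_iff mem_Collect_eq)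
  interpret N: ideal N R using N(1) unfolding F_def by auto
  interpret G: ideal G R by fact
  obtain g where g: "g \<in> G" "g \<notin> N" using N(1) unfolding F_def by blast
  have gc: "g \<in> carrier R" using g G.Icarr by auto
  let ?A = "{h \<oplus> r \<otimes> g | h r. h \<in> N \<and> r \<in> carrier R}"
  note adj = ideal_adjoin[OF N.ideal_axioms gc]
  have "?A \<subseteq> G" using N(1) g G.I_l_closed unfolding F_def by auto
  then have "?A = G" using N(2)[OF _ adj(2)] adj N(1) g unfolding F_def by blast
  obtain z where z: "z \<in> G" "g \<ominus> w \<otimes> z \<in> H" using sub g by auto
  then obtain n a where na: "z = n \<oplus> a \<otimes> g" "n \<in> N" "a \<in> carrier R" using \<open>?A = G\<close> by blast
  have "(\<one> \<oplus> w \<otimes> (\<ominus> a)) \<otimes> g = (g \<ominus> w \<otimes> z) \<oplus> w \<otimes> n"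
    unfolding na(1) using na(3) N.Icarr[OF na(2)] gc w by algebra
  also have "\<dots> \<in> N" using z(2) N(1) na(2) w N.I_l_closed unfolding F_def by auto
  finally have *: "(\<one> \<oplus> w \<otimes> (\<ominus> a)) \<otimes> g \<in> N" .
  have un: "\<one> \<oplus> w \<otimes> (\<ominus> a) \<in> Units R" using unit na(3) by simp
  have "inv (\<one> \<oplus> w \<otimes> (\<ominus> a)) \<otimes> ((\<one> \<oplus> w \<otimes> (\<ominus> a)) \<otimes> g) \<in> N" using N.I_l_closed[OF * Units_inv_closed[OF un]] .
  also have "inv (\<one> \<oplus> w \<otimes> (\<ominus> a)) \<otimes> ((\<one> \<oplus> w \<otimes> (\<ominus> a)) \<otimes> g) = g"
    using un gc Units_closed[OF un] by (simp flip: m_assoc)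
  finally show False using g by simp
qed

end

section \<open>A one-dimensional ring over a complete ring\<close>

text \<open>The descending chain condition for ideals of the quotient ring of \<open>R\<close> by \<open>H\<close>, phrased in \<open>R\<close>.\<close>

definition chain_stable :: "('a, 'm) ring_scheme \<Rightarrow> 'a set \<Rightarrow> bool" where
  "chain_stable R H \<longleftrightarrow> (\<forall>J::nat \<Rightarrow> 'a set. (\<forall>j. ideal (J j) R) \<and> (\<forall>j. J (Suc j) \<subseteq> J j) \<longrightarrow>
     (\<exists>N. \<forall>j\<ge>N. \<forall>y\<in>J N. \<exists>y'\<in>J j. y \<ominus>\<^bsub>R\<^esub> y' \<in> H))"

text \<open>The assumption \<open>complete\<close> says that the series \<open>a 0 + v (a 1) + v\<^sup>2 (a 2) + \<dots>\<close> converges: \<open>s n\<close> is the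
  tail from \<open>n\<close> on, divided by \<open>v\<^sup>n\<close>.\<close>

locale complete_core = noetherian_hom R S h + S: domain S
  for R (structure) and S (structure) and h +
  fixes v x w G
  assumes S_noetherian: "noetherian_ring S"
    and v [simp]: "v \<in> carrier R" and x [simp]: "x \<in> carrier R" and w [simp]: "w \<in> carrier S"
    and xw: "h x \<otimes>\<^bsub>S\<^esub> w = h v"
    and hv_nz: "h v \<noteq> \<zero>\<^bsub>S\<^esub>"
    and unit: "\<And>b. b \<in> carrier S \<Longrightarrow> \<one>\<^bsub>S\<^esub> \<oplus>\<^bsub>S\<^esub> w \<otimes>\<^bsub>S\<^esub> b \<in> Units S"
    and split: "\<And>k. k \<in> carrier S \<Longrightarrow> \<exists>c\<in>carrier R. \<exists>b\<in>carrier S. k = h c \<oplus>\<^bsub>S\<^esub> w \<otimes>\<^bsub>S\<^esub> b"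
    and complete: "\<And>a :: nat \<Rightarrow> 'a. (\<And>n. a n \<in> carrier R) \<Longrightarrow>
      \<exists>s. \<forall>n. s n \<in> carrier R \<and> s n = a n \<oplus> v \<otimes> s (Suc n)"
    and G: "G \<subseteq> carrier R"
    and G_pow: "\<And>a. a \<in> G \<Longrightarrow> \<exists>j::nat. \<exists>b\<in>carrier S. h a [^]\<^bsub>S\<^esub> j = w \<otimes>\<^bsub>S\<^esub> b"
    and G_max: "\<And>c. c \<in> carrier R \<Longrightarrow> c \<notin> Idl G \<Longrightarrow> \<exists>c'\<in>carrier R. c \<otimes> c' \<ominus> \<one> \<in> Idl G"
begin

sublocale S: noetherian_cring S
  by (intro S.noetherian_cringI S_noetherian)

lemma hv [simp]: "h v \<in> carrier S" and hx [simp]: "h x \<in> carrier S" by simp_all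

lemma hx_nz: "h x \<noteq> \<zero>\<^bsub>S\<^esub>" using xw hv_nz by auto

lemma pow_nz:
  assumes "y \<in> carrier S" "y \<noteq> \<zero>\<^bsub>S\<^esub>"
  shows "y [^]\<^bsub>S\<^esub> (n::nat) \<noteq> \<zero>\<^bsub>S\<^esub>"
  by (induction n) (use assms S.integral_iff in auto)

text \<open>This is the finite length of \<open>S\<close> modulo \<open>w\<close>, by Noetherian
  induction. For an unstable \<open>M\<close> that is maximal, an associated prime of S / M yields
  \<open>g\<close> such that (M + S g) / M is simple: modulo \<open>M\<close>, the ideal
  \<open>Idl G\<close> and \<open>w\<close> annihilate g, and \<open>split\<close> reduces the
  scalars to the residue ring of \<open>R\<close>. Stability then descends from M + S g to
  \<open>M\<close>.\<close>

lemma chain_stable_above_w: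
  assumes "ideal H S" "w \<in> H"
  shows "chain_stable S H"
proof (rule ccontr)
  assume contr: "\<not> chain_stable S H"
  define F where "F = {H. ideal H S \<and> w \<in> H \<and> \<not> chain_stable S H}"
  have "H \<in> F" unfolding F_def using assms contr by simp
  then have "F \<noteq> {}" by auto
  then obtain M where M: "M \<in> F" "\<And>I. I \<in> F \<Longrightarrow> M \<subseteq> I \<Longrightarrow> I = M"
    by (rule S.ideal_maximal) (simp_all add: F_def)
  interpret M: ideal M S using M(1) unfolding F_def by simp
  have wM: "w \<in> M" and not_stable: "\<not> chain_stable S M" using M(1) unfolding F_def by auto
  have wbM: "w \<otimes>\<^bsub>S\<^esub> b \<in> M" if "b \<in> carrier S" for b using M.I_r_closed[OF wM that] .
  have "chain_stable S (carrier S)"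
    unfolding chain_stable_def
  proof (intro allI impI exI ballI)
    fix J :: "nat \<Rightarrow> 'c set" and j :: nat and y
    assume J: "(\<forall>j. ideal (J j) S) \<and> (\<forall>j. J (Suc j) \<subseteq> J j)" and "0 \<le> j" "y \<in> J 0"
    have "\<zero>\<^bsub>S\<^esub> \<in> J j" using J additive_subgroup.zero_closed ideal.axioms(1) by metis
    moreover have "y \<in> carrier S" using J \<open>y \<in> J 0\<close> ideal.Icarr by metis
    ultimately show "\<exists>y'\<in>J j. y \<ominus>\<^bsub>S\<^esub> y' \<in> carrier S" by blast
  qed
  then have "M \<noteq> carrier S" using not_stable by metis
  then obtain g where g: "g \<in> carrier S - M" and Q: "primeideal {a \<in> carrier S. a \<otimes>\<^bsub>S\<^esub> g \<in> M} S"
    using S.associated_prime_exists[OF M.ideal_axioms] by metis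
  define Q where "Q = {a \<in> carrier S. a \<otimes>\<^bsub>S\<^esub> g \<in> M}"
  have gc: "g \<in> carrier S" using g by simp
  \<comment> \<open>A power of h a lies in w S, which is contained in \<open>M\<close>; so the prime
    \<open>Q\<close> contains the image of \<open>G\<close> and with it that of
    \<open>Idl G\<close>.\<close>
  have "h a \<in> Q" if "a \<in> G" for a
  proof -
    obtain j :: nat and b where jb: "b \<in> carrier S" "h a [^]\<^bsub>S\<^esub> j = w \<otimes>\<^bsub>S\<^esub> b" using G_pow[OF \<open>a \<in> G\<close>] by metis
    have "(w \<otimes>\<^bsub>S\<^esub> b) \<otimes>\<^bsub>S\<^esub> g \<in> M" using M.I_r_closed[OF wbM[OF jb(1)] gc] .
    then have "h a [^]\<^bsub>S\<^esub> j \<in> Q" unfolding Q_def jb(2) using jb(1) by simp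
    moreover have "h a \<in> carrier S" using G that by auto
    ultimately show ?thesis using S.primeideal_pow Q unfolding Q_def by metis
  qed
  then have "G \<subseteq> {c \<in> carrier R. h c \<in> Q}" using G by auto
  then have IQ: "Idl G \<subseteq> {c \<in> carrier R. h c \<in> Q}"
    using R.genideal_minimal[OF ideal_vimage[OF primeideal.axioms(1)[OF Q]]] unfolding Q_def by simp
  have cG: "h c \<otimes>\<^bsub>S\<^esub> g \<in> M" if "c \<in> Idl G" for c using IQ that unfolding Q_def by auto
  let ?M' = "{m \<oplus>\<^bsub>S\<^esub> r \<otimes>\<^bsub>S\<^esub> g | m r. m \<in> M \<and> r \<in> carrier S}"
  note adj = S.ideal_adjoin[OF M.ideal_axioms gc]
  have "?M' \<notin> F" using M(2)[of ?M'] adj(2,3) g by auto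
  then have M'_stable: "chain_stable S ?M'" unfolding F_def using adj wM by blast
  have "chain_stable S M"
    unfolding chain_stable_def
  proof (intro allI impI)
    fix J :: "nat \<Rightarrow> 'c set"
    assume JJ: "(\<forall>j. ideal (J j) S) \<and> (\<forall>j. J (Suc j) \<subseteq> J j)"
    then have J: "ideal (J j) S" and Jdec: "J (Suc j) \<subseteq> J j" for j by blast+
    have Jmono: "J j \<subseteq> J i" if "i \<le> j" for i j by (rule lift_Suc_antimono_le[of J, OF Jdec that])
    note Jc = ideal.Icarr[OF J]
    obtain N where N: "\<And>j y. j \<ge> N \<Longrightarrow> y \<in> J N \<Longrightarrow> \<exists>y'\<in>J j. y \<ominus>\<^bsub>S\<^esub> y' \<in> ?M'"
      using M'_stable[unfolded chain_stable_def, THEN spec[of _ J], THEN mp, OF JJ] by blast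
    \<comment> \<open>Two cases, as (M + S g) / M is simple. If every \<open>J j\<close> represents
      g modulo \<open>M\<close>, a multiple of such a representative corrects the error r g.
      Otherwise g is not represented from \<open>N1\<close> on, and then the error r g already lies
      in \<open>M\<close>.\<close>
    show "\<exists>N. \<forall>j\<ge>N. \<forall>y\<in>J N. \<exists>y'\<in>J j. y \<ominus>\<^bsub>S\<^esub> y' \<in> M"
    proof (cases "\<forall>j. \<exists>p\<in>J j. g \<ominus>\<^bsub>S\<^esub> p \<in> M")
      case True
      show ?thesis
      proof (intro exI[of _ N] allI impI ballI)
        fix j y assume j: "j \<ge> N" and y: "y \<in> J N"
        obtain y' where y': "y' \<in> J j" "y \<ominus>\<^bsub>S\<^esub> y' \<in> ?M'" using N[OF j y] by auto
        then obtain m r where m: "y \<ominus>\<^bsub>S\<^esub> y' = m \<oplus>\<^bsub>S\<^esub> r \<otimes>\<^bsub>S\<^esub> g" "m \<in> M" "r \<in> carrier S" by auto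
        obtain p where p: "p \<in> J j" "g \<ominus>\<^bsub>S\<^esub> p \<in> M" using True by auto
        have "y \<ominus>\<^bsub>S\<^esub> (y' \<oplus>\<^bsub>S\<^esub> r \<otimes>\<^bsub>S\<^esub> p) = (y \<ominus>\<^bsub>S\<^esub> y') \<ominus>\<^bsub>S\<^esub> r \<otimes>\<^bsub>S\<^esub> p"
          using Jc[OF y] Jc[OF y'(1)] Jc[OF p(1)] m(3) by algebra
        also have "\<dots> = m \<oplus>\<^bsub>S\<^esub> r \<otimes>\<^bsub>S\<^esub> (g \<ominus>\<^bsub>S\<^esub> p)"
          unfolding m(1) using Jc[OF p(1)] m(3) gc M.Icarr[OF m(2)] by algebra
        also have "\<dots> \<in> M" using m p M.I_l_closed by simp
        finally have "y \<ominus>\<^bsub>S\<^esub> (y' \<oplus>\<^bsub>S\<^esub> r \<otimes>\<^bsub>S\<^esub> p) \<in> M" .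
        moreover have "y' \<oplus>\<^bsub>S\<^esub> r \<otimes>\<^bsub>S\<^esub> p \<in> J j"
          using additive_subgroup.a_closed[OF ideal.axioms(1)[OF J] y'(1) ideal.I_l_closed[OF J p(1) m(3)]] .
        ultimately show "\<exists>y'\<in>J j. y \<ominus>\<^bsub>S\<^esub> y' \<in> M" by blast
      qed
    next
      case False
      then obtain N1 where N1: "\<And>p. p \<in> J N1 \<Longrightarrow> g \<ominus>\<^bsub>S\<^esub> p \<notin> M" by auto
      show ?thesis
      proof (intro exI[of _ "max N N1"] allI impI ballI)
        fix j y assume j: "j \<ge> max N N1" and y: "y \<in> J (max N N1)"
        have yN: "y \<in> J N" "y \<in> J N1" using y Jmono[of N "max N N1"] Jmono[of N1 "max N N1"] by auto
        obtain y' where y': "y' \<in> J j" "y \<ominus>\<^bsub>S\<^esub> y' \<in> ?M'" using N[OF _ yN(1)] j by fastforce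
        then obtain m r where m: "y \<ominus>\<^bsub>S\<^esub> y' = m \<oplus>\<^bsub>S\<^esub> r \<otimes>\<^bsub>S\<^esub> g" "m \<in> M" "r \<in> carrier S" by auto
        obtain c b where cb: "c \<in> carrier R" "b \<in> carrier S" "r = h c \<oplus>\<^bsub>S\<^esub> w \<otimes>\<^bsub>S\<^esub> b" using split[OF m(3)] by auto
        have hc: "h c \<in> carrier S" using cb by simp
        have "y' \<in> J N1" using y'(1) Jmono[of N1 j] j by auto
        then have dJ: "y \<ominus>\<^bsub>S\<^esub> y' \<in> J N1" using S.ideal_minus_closed[OF J yN(2)] by simp
        \<comment> \<open>Otherwise \<open>c\<close> has an inverse c' modulo \<open>Idl G\<close>,
          and c' (y - y'), an element of \<open>J N1\<close>, agrees with g modulo \<open>M\<close>,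
          against the choice of \<open>N1\<close>.\<close>
        have "c \<in> Idl G"
        proof (rule ccontr)
          assume "c \<notin> Idl G"
          then obtain c' where c': "c' \<in> carrier R" "c \<otimes> c' \<ominus> \<one> \<in> Idl G" using G_max[OF cb(1)] by auto
          have hc': "h c' \<in> carrier S" using c' by simp
          have "h (c \<otimes> c' \<ominus> \<one>) = h c \<otimes>\<^bsub>S\<^esub> h c' \<ominus>\<^bsub>S\<^esub> \<one>\<^bsub>S\<^esub>" using cb(1) c'(1) by (simp add: a_minus_def)
          then have 1: "(h c \<otimes>\<^bsub>S\<^esub> h c' \<ominus>\<^bsub>S\<^esub> \<one>\<^bsub>S\<^esub>) \<otimes>\<^bsub>S\<^esub> g \<in> M" using cG[OF c'(2)] by simp
          have 2: "h c' \<otimes>\<^bsub>S\<^esub> m \<in> M" using M.I_l_closed[OF m(2) hc'] .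
          have 3: "w \<otimes>\<^bsub>S\<^esub> (b \<otimes>\<^bsub>S\<^esub> (h c' \<otimes>\<^bsub>S\<^esub> g)) \<in> M" using wbM cb(2) hc' gc by simp
          have "g \<ominus>\<^bsub>S\<^esub> h c' \<otimes>\<^bsub>S\<^esub> (y \<ominus>\<^bsub>S\<^esub> y') =
            \<ominus>\<^bsub>S\<^esub> ((h c \<otimes>\<^bsub>S\<^esub> h c' \<ominus>\<^bsub>S\<^esub> \<one>\<^bsub>S\<^esub>) \<otimes>\<^bsub>S\<^esub> g \<oplus>\<^bsub>S\<^esub> h c' \<otimes>\<^bsub>S\<^esub> m \<oplus>\<^bsub>S\<^esub> w \<otimes>\<^bsub>S\<^esub> (b \<otimes>\<^bsub>S\<^esub> (h c' \<otimes>\<^bsub>S\<^esub> g)))"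
            unfolding m(1) cb(3) using hc hc' gc w cb(2) M.Icarr[OF m(2)] by algebra
          also have "\<dots> \<in> M" using 1 2 3 by simp
          finally show False using N1[OF ideal.I_l_closed[OF J dJ hc']] by simp
        qed
        then have "h c \<otimes>\<^bsub>S\<^esub> g \<in> M" by (rule cG)
        moreover have "w \<otimes>\<^bsub>S\<^esub> (b \<otimes>\<^bsub>S\<^esub> g) \<in> M" using wbM cb(2) gc by simp
        ultimately have "m \<oplus>\<^bsub>S\<^esub> (h c \<otimes>\<^bsub>S\<^esub> g \<oplus>\<^bsub>S\<^esub> w \<otimes>\<^bsub>S\<^esub> (b \<otimes>\<^bsub>S\<^esub> g)) \<in> M" using m(2) by simp
        moreover have "m \<oplus>\<^bsub>S\<^esub> (h c \<otimes>\<^bsub>S\<^esub> g \<oplus>\<^bsub>S\<^esub> w \<otimes>\<^bsub>S\<^esub> (b \<otimes>\<^bsub>S\<^esub> g)) = y \<ominus>\<^bsub>S\<^esub> y'"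
          unfolding m(1) cb(3) using hc gc w cb(2) M.Icarr[OF m(2)] by algebra
        ultimately show "\<exists>y'\<in>J j. y \<ominus>\<^bsub>S\<^esub> y' \<in> M" using y'(1) by auto
      qed
    qed
  qed
  then show False using not_stable by simp
qed

text \<open>As in Krull's principal ideal theorem, via the chain of the ideals
  \<open>A j = {y. \<exists>k. w\<^sup>k y \<in> v\<^sup>j S}\<close>.\<close>

lemma w_power_in_v: "\<exists>k::nat. \<exists>y\<in>carrier S. w [^]\<^bsub>S\<^esub> k = h v \<otimes>\<^bsub>S\<^esub> y"
proof -
  define A where "A = (\<lambda>j::nat. {y \<in> carrier S. \<exists>k::nat. \<exists>z\<in>carrier S. w [^]\<^bsub>S\<^esub> k \<otimes>\<^bsub>S\<^esub> y = h v [^]\<^bsub>S\<^esub> j \<otimes>\<^bsub>S\<^esub> z})"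
  have Aid: "ideal (A j) S" for j
  proof (rule S.cring_idealI)
    show "A j \<subseteq> carrier S" unfolding A_def by auto
    have "w [^]\<^bsub>S\<^esub> (0::nat) \<otimes>\<^bsub>S\<^esub> \<zero>\<^bsub>S\<^esub> = h v [^]\<^bsub>S\<^esub> j \<otimes>\<^bsub>S\<^esub> \<zero>\<^bsub>S\<^esub>" by simp
    then show "\<zero>\<^bsub>S\<^esub> \<in> A j" unfolding A_def using S.zero_closed by blast
    fix a assume "a \<in> A j"
    then obtain k :: nat and z where a: "a \<in> carrier S" "z \<in> carrier S" "w [^]\<^bsub>S\<^esub> k \<otimes>\<^bsub>S\<^esub> a = h v [^]\<^bsub>S\<^esub> j \<otimes>\<^bsub>S\<^esub> z"
      unfolding A_def by auto
    show "r \<otimes>\<^bsub>S\<^esub> a \<in> A j" if r: "r \<in> carrier S" for r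
    proof -
      have "w [^]\<^bsub>S\<^esub> k \<otimes>\<^bsub>S\<^esub> (r \<otimes>\<^bsub>S\<^esub> a) = r \<otimes>\<^bsub>S\<^esub> (w [^]\<^bsub>S\<^esub> k \<otimes>\<^bsub>S\<^esub> a)" using a(1) r by (simp add: S.m_ac)
      also have "\<dots> = h v [^]\<^bsub>S\<^esub> j \<otimes>\<^bsub>S\<^esub> (r \<otimes>\<^bsub>S\<^esub> z)" unfolding a(3) using a(2) r by (simp add: S.m_ac)
      finally show ?thesis unfolding A_def using a(1,2) r S.m_closed by blast
    qed
    fix b assume "b \<in> A j"
    then obtain l :: nat and y where b: "b \<in> carrier S" "y \<in> carrier S" "w [^]\<^bsub>S\<^esub> l \<otimes>\<^bsub>S\<^esub> b = h v [^]\<^bsub>S\<^esub> j \<otimes>\<^bsub>S\<^esub> y"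
      unfolding A_def by auto
    have cl: "w [^]\<^bsub>S\<^esub> l \<in> carrier S" "w [^]\<^bsub>S\<^esub> k \<in> carrier S" "h v [^]\<^bsub>S\<^esub> j \<in> carrier S" by auto
    have "w [^]\<^bsub>S\<^esub> (k + l) \<otimes>\<^bsub>S\<^esub> (a \<oplus>\<^bsub>S\<^esub> b) = w [^]\<^bsub>S\<^esub> k \<otimes>\<^bsub>S\<^esub> w [^]\<^bsub>S\<^esub> l \<otimes>\<^bsub>S\<^esub> (a \<oplus>\<^bsub>S\<^esub> b)" by (simp add: S.nat_pow_mult)
    also have "\<dots> = w [^]\<^bsub>S\<^esub> l \<otimes>\<^bsub>S\<^esub> (w [^]\<^bsub>S\<^esub> k \<otimes>\<^bsub>S\<^esub> a) \<oplus>\<^bsub>S\<^esub> w [^]\<^bsub>S\<^esub> k \<otimes>\<^bsub>S\<^esub> (w [^]\<^bsub>S\<^esub> l \<otimes>\<^bsub>S\<^esub> b)"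
      using cl a(1) b(1) by algebra
    also have "\<dots> = h v [^]\<^bsub>S\<^esub> j \<otimes>\<^bsub>S\<^esub> (w [^]\<^bsub>S\<^esub> l \<otimes>\<^bsub>S\<^esub> z \<oplus>\<^bsub>S\<^esub> w [^]\<^bsub>S\<^esub> k \<otimes>\<^bsub>S\<^esub> y)"
      unfolding a(3) b(3) using cl a(2) b(2) by algebra
    finally show "a \<oplus>\<^bsub>S\<^esub> b \<in> A j" unfolding A_def
      using a b cl by (intro CollectI conjI exI[of _ "k + l"] bexI[of _ "w [^]\<^bsub>S\<^esub> l \<otimes>\<^bsub>S\<^esub> z \<oplus>\<^bsub>S\<^esub> w [^]\<^bsub>S\<^esub> k \<otimes>\<^bsub>S\<^esub> y"]) auto
  qed
  have Adec: "A (Suc j) \<subseteq> A j" for j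
  proof
    fix a assume "a \<in> A (Suc j)"
    then obtain k :: nat and z where a: "a \<in> carrier S" "z \<in> carrier S" "w [^]\<^bsub>S\<^esub> k \<otimes>\<^bsub>S\<^esub> a = h v [^]\<^bsub>S\<^esub> Suc j \<otimes>\<^bsub>S\<^esub> z"
      unfolding A_def by blast
    then have "w [^]\<^bsub>S\<^esub> k \<otimes>\<^bsub>S\<^esub> a = h v [^]\<^bsub>S\<^esub> j \<otimes>\<^bsub>S\<^esub> (h v \<otimes>\<^bsub>S\<^esub> z)" by (simp add: S.m_assoc)
    then show "a \<in> A j" unfolding A_def using a(1,2) S.m_closed hv by blast
  qed
  have "ideal (PIdl\<^bsub>S\<^esub> w) S" by (rule S.cgenideal_ideal) simp
  moreover have "w \<in> PIdl\<^bsub>S\<^esub> w" by (rule S.cgenideal_self) simp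
  ultimately have "chain_stable S (PIdl\<^bsub>S\<^esub> w)" by (rule chain_stable_above_w)
  then have "\<exists>N. \<forall>j\<ge>N. \<forall>y\<in>A N. \<exists>y'\<in>A j. y \<ominus>\<^bsub>S\<^esub> y' \<in> PIdl\<^bsub>S\<^esub> w"
    unfolding chain_stable_def using Aid Adec by simp
  then obtain N where N: "\<And>y. y \<in> A N \<Longrightarrow> \<exists>y'\<in>A (Suc N). y \<ominus>\<^bsub>S\<^esub> y' \<in> PIdl\<^bsub>S\<^esub> w" by (metis le_SucI order_refl)
  \<comment> \<open>Stability gives y = y' + b w with y' in A (N+1). Since the ideals A j are
    saturated with respect to \<open>w\<close>, the cofactor b is again in A N. So A N = A (N+1) + w
    A N, and Nakayama's lemma applies.\<close>
  have "A (Suc N) = A N"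
  proof (rule S.nakayama[OF w unit Aid Aid Adec])
    fix y assume y: "y \<in> A N"
    obtain y' where y': "y' \<in> A (Suc N)" "y \<ominus>\<^bsub>S\<^esub> y' \<in> PIdl\<^bsub>S\<^esub> w" using N[OF y] by auto
    then obtain b where b: "b \<in> carrier S" "y \<ominus>\<^bsub>S\<^esub> y' = b \<otimes>\<^bsub>S\<^esub> w" unfolding cgenideal_def by auto
    have yc: "y \<in> carrier S" "y' \<in> carrier S" using ideal.Icarr[OF Aid] y y'(1) by auto
    have "y \<ominus>\<^bsub>S\<^esub> y' \<in> A N" using S.ideal_minus_closed[OF Aid y] y'(1) Adec by blast
    then obtain k :: nat and z where z: "z \<in> carrier S" "w [^]\<^bsub>S\<^esub> k \<otimes>\<^bsub>S\<^esub> (b \<otimes>\<^bsub>S\<^esub> w) = h v [^]\<^bsub>S\<^esub> N \<otimes>\<^bsub>S\<^esub> z"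
      unfolding A_def b(2) by auto
    have "w [^]\<^bsub>S\<^esub> Suc k \<otimes>\<^bsub>S\<^esub> b = h v [^]\<^bsub>S\<^esub> N \<otimes>\<^bsub>S\<^esub> z" unfolding z(2)[symmetric] using b(1) by (simp add: S.m_ac)
    then have bA: "b \<in> A N" unfolding A_def using b(1) z(1) by blast
    have "y \<ominus>\<^bsub>S\<^esub> w \<otimes>\<^bsub>S\<^esub> b = y'"
    proof -
      have "y \<ominus>\<^bsub>S\<^esub> w \<otimes>\<^bsub>S\<^esub> b = y \<ominus>\<^bsub>S\<^esub> (y \<ominus>\<^bsub>S\<^esub> y')" unfolding b(2) using b(1) by (simp add: S.m_comm)
      also have "\<dots> = y'" using yc by algebra
      finally show ?thesis .
    qed
    then show "\<exists>z\<in>A N. y \<ominus>\<^bsub>S\<^esub> w \<otimes>\<^bsub>S\<^esub> z \<in> A (Suc N)" using bA y'(1) by metis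
  qed
  \<comment> \<open>v^N lies in A N with exponent k = 0, hence in A (N+1); this means w^k v^N =
    v^(N+1) z for some k, and v^N may be cancelled in a domain.\<close>
  have "w [^]\<^bsub>S\<^esub> (0::nat) \<otimes>\<^bsub>S\<^esub> h v [^]\<^bsub>S\<^esub> N = h v [^]\<^bsub>S\<^esub> N \<otimes>\<^bsub>S\<^esub> \<one>\<^bsub>S\<^esub>" by simp
  then have "h v [^]\<^bsub>S\<^esub> N \<in> A N" unfolding A_def using S.nat_pow_closed[OF hv] S.one_closed by blast
  then have "h v [^]\<^bsub>S\<^esub> N \<in> A (Suc N)" using \<open>A (Suc N) = A N\<close> by simp
  then obtain k :: nat and z where z: "z \<in> carrier S" "w [^]\<^bsub>S\<^esub> k \<otimes>\<^bsub>S\<^esub> h v [^]\<^bsub>S\<^esub> N = h v [^]\<^bsub>S\<^esub> Suc N \<otimes>\<^bsub>S\<^esub> z"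
    unfolding A_def by blast
  have "h v [^]\<^bsub>S\<^esub> N \<otimes>\<^bsub>S\<^esub> w [^]\<^bsub>S\<^esub> k = h v [^]\<^bsub>S\<^esub> N \<otimes>\<^bsub>S\<^esub> (h v \<otimes>\<^bsub>S\<^esub> z)"
    using z(2) z(1) by (simp add: S.m_ac)
  moreover have "h v [^]\<^bsub>S\<^esub> N \<noteq> \<zero>\<^bsub>S\<^esub>" by (rule pow_nz[OF hv hv_nz])
  ultimately have "w [^]\<^bsub>S\<^esub> k = h v \<otimes>\<^bsub>S\<^esub> z" using S.m_lcancel[of "h v [^]\<^bsub>S\<^esub> N"] z(1) by simp
  then show ?thesis using z(1) by blast
qed

text \<open>A series of polynomial expressions in \<open>w\<close> is summed coefficient by
  coefficient. The bound \<open>k\<close> is essential: only finitely many series over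
  \<open>R\<close> have to be summed.\<close>

lemma pols_complete:
  assumes "\<And>n::nat. f n \<in> pols R S h w k"
  shows "\<exists>s. \<forall>n. s n \<in> pols R S h w k \<and> s n = f n \<oplus>\<^bsub>S\<^esub> h v \<otimes>\<^bsub>S\<^esub> s (Suc n)"
  using assms
proof (induction k arbitrary: f)
  case 0
  then show ?case by (intro exI[of _ "\<lambda>_. \<zero>\<^bsub>S\<^esub>"]) simp
next
  case (Suc k)
  have "\<forall>n. \<exists>c g. c \<in> carrier R \<and> g \<in> pols R S h w k \<and> f n = h c \<oplus>\<^bsub>S\<^esub> w \<otimes>\<^bsub>S\<^esub> g"
    using Suc(2) pols_SucE[of _ R S h w k] by metis
  then obtain c g where cg: "\<And>n. c n \<in> carrier R" "\<And>n. g n \<in> pols R S h w k" "\<And>n. f n = h (c n) \<oplus>\<^bsub>S\<^esub> w \<otimes>\<^bsub>S\<^esub> g n"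
    by metis
  obtain t where t: "\<And>n. t n \<in> carrier R" "\<And>n. t n = c n \<oplus> v \<otimes> t (Suc n)" using complete[of c] cg(1) by metis
  obtain s where s: "\<And>n. s n \<in> pols R S h w k" "\<And>n. s n = g n \<oplus>\<^bsub>S\<^esub> h v \<otimes>\<^bsub>S\<^esub> s (Suc n)" using Suc(1)[of g] cg(2) by metis
  note pc = pols_closed[OF w]
  show ?case
  proof (intro exI[of _ "\<lambda>n. h (t n) \<oplus>\<^bsub>S\<^esub> w \<otimes>\<^bsub>S\<^esub> s n"] allI conjI)
    fix n
    show "h (t n) \<oplus>\<^bsub>S\<^esub> w \<otimes>\<^bsub>S\<^esub> s n \<in> pols R S h w (Suc k)" using t s by (intro pols_SucI)
    have "h (t n) = h (c n \<oplus> v \<otimes> t (Suc n))" using t(2)[of n] by simp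
    also have "\<dots> = h (c n) \<oplus>\<^bsub>S\<^esub> h v \<otimes>\<^bsub>S\<^esub> h (t (Suc n))" using t(1)[of "Suc n"] cg(1)[of n] by simp
    finally have ht: "h (t n) = h (c n) \<oplus>\<^bsub>S\<^esub> h v \<otimes>\<^bsub>S\<^esub> h (t (Suc n))" .
    have "h (t n) \<oplus>\<^bsub>S\<^esub> w \<otimes>\<^bsub>S\<^esub> s n =
      (h (c n) \<oplus>\<^bsub>S\<^esub> h v \<otimes>\<^bsub>S\<^esub> h (t (Suc n))) \<oplus>\<^bsub>S\<^esub> w \<otimes>\<^bsub>S\<^esub> (g n \<oplus>\<^bsub>S\<^esub> h v \<otimes>\<^bsub>S\<^esub> s (Suc n))"
      using ht s(2)[of n] by metis
    also have "\<dots> = (h (c n) \<oplus>\<^bsub>S\<^esub> w \<otimes>\<^bsub>S\<^esub> g n) \<oplus>\<^bsub>S\<^esub> h v \<otimes>\<^bsub>S\<^esub> (h (t (Suc n)) \<oplus>\<^bsub>S\<^esub> w \<otimes>\<^bsub>S\<^esub> s (Suc n))"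
      using hom_closed[OF cg(1)[of n]] hom_closed[OF t(1)[of "Suc n"]] pc[OF cg(2)[of n]] pc[OF s(1)[of "Suc n"]] hv w
      by algebra
    finally show "h (t n) \<oplus>\<^bsub>S\<^esub> w \<otimes>\<^bsub>S\<^esub> s n = f n \<oplus>\<^bsub>S\<^esub> h v \<otimes>\<^bsub>S\<^esub> (h (t (Suc n)) \<oplus>\<^bsub>S\<^esub> w \<otimes>\<^bsub>S\<^esub> s (Suc n))"
      unfolding cg(3) .
  qed
qed

text \<open>The ideals generated by the d n ascend, so that d (N+1) = r d N = r v d (N+1) for some
  N. Since v = x w, the factor 1 - r v is a unit, hence d (N+1) = 0, and the recursion carries this
  down to d 0.\<close>

lemma separated:
  assumes d: "\<And>n::nat. d n \<in> carrier S" "\<And>n. d n = h v \<otimes>\<^bsub>S\<^esub> d (Suc n)"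
  shows "d 0 = \<zero>\<^bsub>S\<^esub>"
proof -
  have id: "ideal (PIdl\<^bsub>S\<^esub> (d n)) S" for n by (rule S.cgenideal_ideal[OF d(1)])
  have "d n \<in> PIdl\<^bsub>S\<^esub> (d (Suc n))" for n
    unfolding cgenideal_def using d(2)[of n] hv by blast
  then have "PIdl\<^bsub>S\<^esub> (d n) \<subseteq> PIdl\<^bsub>S\<^esub> (d (Suc n))" for n by (rule S.cgenideal_minimal[OF id])
  from S.ideal_acc[of "\<lambda>n. PIdl\<^bsub>S\<^esub> (d n)", OF id this] obtain N where "PIdl\<^bsub>S\<^esub> (d (Suc N)) = PIdl\<^bsub>S\<^esub> (d N)"
    by (metis le_SucI order_refl)
  then have "d (Suc N) \<in> PIdl\<^bsub>S\<^esub> (d N)" using S.cgenideal_self[OF d(1)[of "Suc N"]] by simp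
  then obtain r where r: "r \<in> carrier S" "d (Suc N) = r \<otimes>\<^bsub>S\<^esub> d N" unfolding cgenideal_def by blast
  have "(\<one>\<^bsub>S\<^esub> \<oplus>\<^bsub>S\<^esub> w \<otimes>\<^bsub>S\<^esub> (\<ominus>\<^bsub>S\<^esub> (h x \<otimes>\<^bsub>S\<^esub> r))) \<otimes>\<^bsub>S\<^esub> d (Suc N) = d (Suc N) \<ominus>\<^bsub>S\<^esub> r \<otimes>\<^bsub>S\<^esub> ((h x \<otimes>\<^bsub>S\<^esub> w) \<otimes>\<^bsub>S\<^esub> d (Suc N))"
    using d(1)[of "Suc N"] r(1) hx w by algebra
  also have "\<dots> = d (Suc N) \<ominus>\<^bsub>S\<^esub> r \<otimes>\<^bsub>S\<^esub> d N" unfolding xw using d(2)[of N] by metis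
  also have "\<dots> = \<zero>\<^bsub>S\<^esub>" using r(2) d(1)[of "Suc N"] by (metis S.r_right_minus_eq)
  finally have *: "(\<one>\<^bsub>S\<^esub> \<oplus>\<^bsub>S\<^esub> w \<otimes>\<^bsub>S\<^esub> (\<ominus>\<^bsub>S\<^esub> (h x \<otimes>\<^bsub>S\<^esub> r))) \<otimes>\<^bsub>S\<^esub> d (Suc N) = \<zero>\<^bsub>S\<^esub>" .
  have un: "\<one>\<^bsub>S\<^esub> \<oplus>\<^bsub>S\<^esub> w \<otimes>\<^bsub>S\<^esub> (\<ominus>\<^bsub>S\<^esub> (h x \<otimes>\<^bsub>S\<^esub> r)) \<in> Units S" by (rule unit) (use r in simp)
  have "\<zero>\<^bsub>S\<^esub> \<notin> Units S" using S.zero_not_one by (auto simp: Units_def)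
  then have dN: "d (Suc N) = \<zero>\<^bsub>S\<^esub>" using S.integral[OF * S.Units_closed[OF un] d(1)] un by auto
  have "d (Suc N - i) = \<zero>\<^bsub>S\<^esub>" if "i \<le> Suc N" for i
    using that
  proof (induction i)
    case (Suc i)
    have eq: "Suc (Suc N - Suc i) = Suc N - i" using Suc(2) by simp
    show ?case using d(2)[of "Suc N - Suc i"] Suc(1,2) unfolding eq by simp
  qed (use dN in simp)
  from this[of "Suc N"] show ?thesis by simp
qed

text \<open>By \<open>split\<close>, every element is a polynomial expression of length
  \<open>k\<close> plus a multiple of w^k, and w^k is a multiple of \<open>v\<close> for a suitable
  \<open>k\<close>. So \<open>S\<close> is finitely generated over \<open>R\<close> modulo
  \<open>v\<close>; since \<open>v\<close>-adic series of such expressions converge and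
  \<open>S\<close> is \<open>v\<close>-adically separated, the same elements generate
  \<open>S\<close>.\<close>

lemma finite_span: "\<exists>k. carrier S \<subseteq> pols R S h w k"
proof -
  obtain k :: nat and u where u: "u \<in> carrier S" "w [^]\<^bsub>S\<^esub> k = h v \<otimes>\<^bsub>S\<^esub> u" using w_power_in_v by auto
  note pc = pols_closed[OF w]
  have ex: "\<exists>f\<in>pols R S h w n. \<exists>z\<in>carrier S. y = f \<oplus>\<^bsub>S\<^esub> w [^]\<^bsub>S\<^esub> n \<otimes>\<^bsub>S\<^esub> z" if "y \<in> carrier S" for y n
    using that
  proof (induction n arbitrary: y)
    case 0
    then show ?case by (intro bexI[of _ "\<zero>\<^bsub>S\<^esub>"] bexI[of _ y]) auto
  next
    case (Suc n)
    obtain c b where cb: "c \<in> carrier R" "b \<in> carrier S" "y = h c \<oplus>\<^bsub>S\<^esub> w \<otimes>\<^bsub>S\<^esub> b" using split[OF Suc(2)] by auto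
    obtain f z where fz: "f \<in> pols R S h w n" "z \<in> carrier S" "b = f \<oplus>\<^bsub>S\<^esub> w [^]\<^bsub>S\<^esub> n \<otimes>\<^bsub>S\<^esub> z" using Suc(1)[OF cb(2)] by auto
    have "y = (h c \<oplus>\<^bsub>S\<^esub> w \<otimes>\<^bsub>S\<^esub> f) \<oplus>\<^bsub>S\<^esub> (w [^]\<^bsub>S\<^esub> n \<otimes>\<^bsub>S\<^esub> w) \<otimes>\<^bsub>S\<^esub> z"
      unfolding cb(3) fz(3) using pc[OF fz(1)] fz(2) hom_closed[OF cb(1)] w S.nat_pow_closed[OF w, of n] by algebra
    then have "y = (h c \<oplus>\<^bsub>S\<^esub> w \<otimes>\<^bsub>S\<^esub> f) \<oplus>\<^bsub>S\<^esub> w [^]\<^bsub>S\<^esub> Suc n \<otimes>\<^bsub>S\<^esub> z" by simp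
    then show ?case using pols_SucI[OF cb(1) fz(1)] fz(2) by (intro bexI)
  qed
  have step: "\<exists>fz. fst fz \<in> pols R S h w k \<and> snd fz \<in> carrier S \<and> y = fst fz \<oplus>\<^bsub>S\<^esub> h v \<otimes>\<^bsub>S\<^esub> snd fz" if y: "y \<in> carrier S" for y
  proof -
    obtain f z where fz: "f \<in> pols R S h w k" "z \<in> carrier S" "y = f \<oplus>\<^bsub>S\<^esub> w [^]\<^bsub>S\<^esub> k \<otimes>\<^bsub>S\<^esub> z" using ex[OF y, of k] by auto
    have "y = f \<oplus>\<^bsub>S\<^esub> h v \<otimes>\<^bsub>S\<^esub> (u \<otimes>\<^bsub>S\<^esub> z)" unfolding fz(3) u(2) using u(1) fz(2) by (simp add: S.m_assoc)
    then show ?thesis using fz u(1) by (intro exI[of _ "(f, u \<otimes>\<^bsub>S\<^esub> z)"]) simp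
  qed
  \<comment> \<open>Choosing head and tail once for each element makes the expansion of y along the
    powers of \<open>v\<close> the iteration \<open>Y\<close>.\<close>
  define F where "F = (\<lambda>y. SOME fz. fst fz \<in> pols R S h w k \<and> snd fz \<in> carrier S \<and> y = fst fz \<oplus>\<^bsub>S\<^esub> h v \<otimes>\<^bsub>S\<^esub> snd fz)"
  have F: "fst (F y) \<in> pols R S h w k \<and> snd (F y) \<in> carrier S \<and> y = fst (F y) \<oplus>\<^bsub>S\<^esub> h v \<otimes>\<^bsub>S\<^esub> snd (F y)"
    if "y \<in> carrier S" for y
    unfolding F_def by (rule someI_ex[OF step[OF that]])
  have "y \<in> pols R S h w k" if y: "y \<in> carrier S" for y
  proof -
    define Y where "Y = (\<lambda>n::nat. ((snd \<circ> F) ^^ n) y)"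
    have Y0: "Y 0 = y" and YS: "Y (Suc n) = snd (F (Y n))" for n unfolding Y_def by simp_all
    have Yc: "Y n \<in> carrier S" for n by (induction n) (use Y0 YS y F in auto)
    have Yf: "fst (F (Y n)) \<in> pols R S h w k" for n using F[OF Yc] by simp
    have Yeq: "Y n = fst (F (Y n)) \<oplus>\<^bsub>S\<^esub> h v \<otimes>\<^bsub>S\<^esub> Y (Suc n)" for n unfolding YS using F[OF Yc[of n]] by simp
    obtain s where s: "\<And>n. s n \<in> pols R S h w k" "\<And>n. s n = fst (F (Y n)) \<oplus>\<^bsub>S\<^esub> h v \<otimes>\<^bsub>S\<^esub> s (Suc n)"
      using pols_complete[of "\<lambda>n. fst (F (Y n))" k] Yf by metis
    \<comment> \<open>The tails of y and the sums of the corresponding series of heads obey the same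
      recursion, so the inhomogeneous terms cancel in the difference, as \<open>separated\<close>
      requires.\<close>
    have "Y n \<ominus>\<^bsub>S\<^esub> s n = h v \<otimes>\<^bsub>S\<^esub> (Y (Suc n) \<ominus>\<^bsub>S\<^esub> s (Suc n))" for n
    proof -
      have "Y n \<ominus>\<^bsub>S\<^esub> s n = (fst (F (Y n)) \<oplus>\<^bsub>S\<^esub> h v \<otimes>\<^bsub>S\<^esub> Y (Suc n)) \<ominus>\<^bsub>S\<^esub> (fst (F (Y n)) \<oplus>\<^bsub>S\<^esub> h v \<otimes>\<^bsub>S\<^esub> s (Suc n))"
        using Yeq[of n] s(2)[of n] by metis
      also have "\<dots> = h v \<otimes>\<^bsub>S\<^esub> (Y (Suc n) \<ominus>\<^bsub>S\<^esub> s (Suc n))"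
        using pc[OF Yf[of n]] Yc[of "Suc n"] pc[OF s(1)[of "Suc n"]] hv by algebra
      finally show ?thesis .
    qed
    moreover have "Y n \<ominus>\<^bsub>S\<^esub> s n \<in> carrier S" for n using Yc[of n] pc[OF s(1)[of n]] by simp
    ultimately have "Y 0 \<ominus>\<^bsub>S\<^esub> s 0 = \<zero>\<^bsub>S\<^esub>" by (rule separated[of "\<lambda>n. Y n \<ominus>\<^bsub>S\<^esub> s n", rotated])
    then have "Y 0 = s 0" using Yc[of 0] pc[OF s(1)[of 0]] by simp
    then show ?thesis using Y0 s(1)[of 0] by simp
  qed
  then show ?thesis by auto
qed

lemma pols_denominator:
  "f \<in> pols R S h w n \<Longrightarrow> \<exists>e\<in>carrier R. h (x [^] n) \<otimes>\<^bsub>S\<^esub> f = h e"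
proof (induction n arbitrary: f)
  case 0
  then show ?case by (intro bexI[of _ \<zero>]) auto
next
  case (Suc n)
  from Suc(2) obtain c g where cg: "c \<in> carrier R" "g \<in> pols R S h w n" "f = h c \<oplus>\<^bsub>S\<^esub> w \<otimes>\<^bsub>S\<^esub> g" by (rule pols_SucE)
  obtain e where e: "e \<in> carrier R" "h (x [^] n) \<otimes>\<^bsub>S\<^esub> g = h e" using Suc(1)[OF cg(2)] by auto
  have xn: "h (x [^] n) \<in> carrier S" by simp
  have "h (x [^] Suc n) \<otimes>\<^bsub>S\<^esub> f = (h (x [^] n) \<otimes>\<^bsub>S\<^esub> h x) \<otimes>\<^bsub>S\<^esub> (h c \<oplus>\<^bsub>S\<^esub> w \<otimes>\<^bsub>S\<^esub> g)" unfolding cg(3) by simp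
  also have "\<dots> = (h (x [^] n) \<otimes>\<^bsub>S\<^esub> h x) \<otimes>\<^bsub>S\<^esub> h c \<oplus>\<^bsub>S\<^esub> (h x \<otimes>\<^bsub>S\<^esub> w) \<otimes>\<^bsub>S\<^esub> (h (x [^] n) \<otimes>\<^bsub>S\<^esub> g)"
    using xn hx w pols_closed[OF w cg(2)] hom_closed[OF cg(1)] by algebra
  also have "\<dots> = h (x [^] Suc n \<otimes> c \<oplus> v \<otimes> e)" unfolding xw e(2) using cg(1) e(1) by simp
  finally show ?case using cg(1) e(1) by (intro bexI[of _ "x [^] Suc n \<otimes> c \<oplus> v \<otimes> e"]) auto
qed

text \<open>Some power of \<open>a\<close> maps to v y with y in \<open>S\<close>. As
  \<open>S\<close> is spanned by w^0, ..., w^(k-1), the element x^k is a common denominator of all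
  powers of y, so y is integral over the image of \<open>R\<close>. Multiplying the integral
  equation of y by a power of \<open>v\<close> expresses a further power of \<open>a\<close> as a
  multiple of \<open>v\<close>, up to the kernel of \<open>h\<close>.\<close>

theorem power_in_v:
  assumes a: "a \<in> G"
  shows "\<exists>i::nat. \<exists>f\<in>carrier R. h (a [^] i) = h (v \<otimes> f)"
proof -
  have ac [simp]: "a \<in> carrier R" using a G by auto
  obtain k where k: "carrier S \<subseteq> pols R S h w k" using finite_span by auto
  obtain l :: nat and u where u: "u \<in> carrier S" "w [^]\<^bsub>S\<^esub> l = h v \<otimes>\<^bsub>S\<^esub> u" using w_power_in_v by auto
  obtain j :: nat and b where b: "b \<in> carrier S" "h a [^]\<^bsub>S\<^esub> j = w \<otimes>\<^bsub>S\<^esub> b" using G_pow[OF a] by auto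
  let ?a = "a [^] (j * l)"
  define y where "y = u \<otimes>\<^bsub>S\<^esub> b [^]\<^bsub>S\<^esub> l"
  have yc [simp]: "y \<in> carrier S" unfolding y_def using u b by simp
  have "h ?a = (w \<otimes>\<^bsub>S\<^esub> b) [^]\<^bsub>S\<^esub> l" using b(2) by (simp add: ring.hom_nat_pow flip: S.nat_pow_pow)
  also have "\<dots> = h v \<otimes>\<^bsub>S\<^esub> y" unfolding y_def using u b(1) by (simp add: S.nat_pow_distrib S.m_assoc)
  finally have ay: "h ?a = h v \<otimes>\<^bsub>S\<^esub> y" .
  have "\<exists>e\<in>carrier R. h (x [^] k) \<otimes>\<^bsub>S\<^esub> y [^]\<^bsub>S\<^esub> i = h e" for i :: nat
    by (rule pols_denominator) (use k in auto)
  then obtain e where e: "\<And>i::nat. e i \<in> carrier R" "\<And>i. h (x [^] k) \<otimes>\<^bsub>S\<^esub> y [^]\<^bsub>S\<^esub> i = h (e i)" by metis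
  have "\<exists>n. \<exists>f\<in>forms R ?a v n. h (?a [^] Suc n) = h (v \<otimes> f)"
  proof (rule integral_if_fraction_powers[where c = "x [^] k" and e = e])
    fix i :: nat
    have "h (v [^] i \<otimes> e i) = h v [^]\<^bsub>S\<^esub> i \<otimes>\<^bsub>S\<^esub> (h (x [^] k) \<otimes>\<^bsub>S\<^esub> y [^]\<^bsub>S\<^esub> i)"
      unfolding e(2) using e(1)[of i] by (simp add: ring.hom_nat_pow)
    also have "\<dots> = h (x [^] k) \<otimes>\<^bsub>S\<^esub> (h v \<otimes>\<^bsub>S\<^esub> y) [^]\<^bsub>S\<^esub> i" by (simp add: S.nat_pow_distrib S.m_ac)
    also have "\<dots> = h (x [^] k \<otimes> ?a [^] i)" unfolding ay[symmetric] by (simp add: ring.hom_nat_pow)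
    finally show "h (v [^] i \<otimes> e i) = h (x [^] k \<otimes> ?a [^] i)" .
  next
    fix z assume z: "z \<in> carrier S"
    show "z = \<zero>\<^bsub>S\<^esub>" if "h v \<otimes>\<^bsub>S\<^esub> z = \<zero>\<^bsub>S\<^esub>" using S.integral[OF that hv z] hv_nz by simp
    have "h (x [^] k) \<noteq> \<zero>\<^bsub>S\<^esub>" using pow_nz[OF hx hx_nz] by (simp add: ring.hom_nat_pow)
    then show "z = \<zero>\<^bsub>S\<^esub>" if "h (x [^] k) \<otimes>\<^bsub>S\<^esub> z = \<zero>\<^bsub>S\<^esub>" using S.integral[OF that _ z] by simp
  qed (use e in simp_all)
  then obtain n f where f: "f \<in> forms R ?a v n" "h (?a [^] Suc n) = h (v \<otimes> f)" by auto
  have "f \<in> carrier R" using R.forms_closed[of ?a v f n] f(1) by simp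
  moreover have "?a [^] Suc n = a [^] (j * l * Suc n)" by (rule R.nat_pow_pow) simp
  ultimately show ?thesis using f(2) by metis
qed

end

section \<open>Localization\<close>

locale localizing = cring R for R (structure) + fixes S
  assumes S_sub: "submonoid S R"
begin

abbreviation "L \<equiv> localization R S"

lemma S_closed [simp]: "s \<in> S \<Longrightarrow> s \<in> carrier R"
  using S_sub submonoid.subset by blast

lemma S_one [simp]: "\<one> \<in> S" using S_sub submonoid.one_closed by auto

lemma S_mult [simp]: "s \<in> S \<Longrightarrow> t \<in> S \<Longrightarrow> s \<otimes> t \<in> S" by (rule submonoid.m_closed[OF S_sub])

lemma frac_rel_iff: "((a, s), (b, t)) \<in> frac_rel R S \<longleftrightarrow> a \<in> carrier R \<and> s \<in> S \<and> b \<in> carrier R \<and> t \<in> S \<and>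
   (\<exists>v\<in>S. v \<otimes> (a \<otimes> t) = v \<otimes> (b \<otimes> s))"
  unfolding frac_rel_def by auto

lemma frac_rel_equiv: "equiv (carrier R \<times> S) (frac_rel R S)"
proof (rule equivI)
  show "frac_rel R S \<subseteq> (carrier R \<times> S) \<times> (carrier R \<times> S)" unfolding frac_rel_def by auto
  show "refl_on (carrier R \<times> S) (frac_rel R S)"
    unfolding refl_on_def using S_one by (auto simp: frac_rel_iff)
  show "sym (frac_rel R S)"
  proof (rule symI)
    fix p q assume pq: "(p, q) \<in> frac_rel R S"
    obtain a s b t where e: "p = (a, s)" "q = (b, t)" by fastforce
    obtain v where "v \<in> S" "v \<otimes> (a \<otimes> t) = v \<otimes> (b \<otimes> s)" using pq unfolding e frac_rel_iff by auto
    then show "(q, p) \<in> frac_rel R S" using pq unfolding e frac_rel_iff by metis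
  qed
  show "trans (frac_rel R S)"
  proof (rule transI)
    fix p q r assume pq: "(p, q) \<in> frac_rel R S" and qr: "(q, r) \<in> frac_rel R S"
    obtain a s b t c u where e: "p = (a, s)" "q = (b, t)" "r = (c, u)" by (metis surj_pair)
    obtain v where v: "v \<in> S" "v \<otimes> (a \<otimes> t) = v \<otimes> (b \<otimes> s)" using pq unfolding e frac_rel_iff by auto
    obtain v' where v': "v' \<in> S" "v' \<otimes> (b \<otimes> u) = v' \<otimes> (c \<otimes> t)" using qr unfolding e frac_rel_iff by auto
    have c: "a \<in> carrier R" "s \<in> S" "b \<in> carrier R" "t \<in> S" "c \<in> carrier R" "u \<in> S"
      using pq qr unfolding e frac_rel_iff by auto
    note cl = c(1,3,5) S_closed[OF c(2)] S_closed[OF c(4)] S_closed[OF c(6)] S_closed[OF v(1)] S_closed[OF v'(1)]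
    \<comment> \<open>The middle denominator \<open>t\<close> has to join the multipliers, since it
      may be a zero divisor.\<close>
    have "(v \<otimes> v' \<otimes> t) \<otimes> (a \<otimes> u) = (v' \<otimes> u) \<otimes> (v \<otimes> (a \<otimes> t))" using cl by algebra
    also have "\<dots> = (v \<otimes> s) \<otimes> (v' \<otimes> (b \<otimes> u))" unfolding v(2) using cl by algebra
    also have "\<dots> = (v \<otimes> v' \<otimes> t) \<otimes> (c \<otimes> s)" unfolding v'(2) using cl by algebra
    finally have eq: "(v \<otimes> v' \<otimes> t) \<otimes> (a \<otimes> u) = (v \<otimes> v' \<otimes> t) \<otimes> (c \<otimes> s)" .
    have "v \<otimes> v' \<otimes> t \<in> S" using v v' c by simp
    then show "(p, r) \<in> frac_rel R S" unfolding e frac_rel_iff using c eq by blast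
  qed
qed

lemma frac_eq_iff:
  assumes "a \<in> carrier R" "s \<in> S" "b \<in> carrier R" "t \<in> S"
  shows "loc_frac R S a s = loc_frac R S b t \<longleftrightarrow> (\<exists>v\<in>S. v \<otimes> (a \<otimes> t) = v \<otimes> (b \<otimes> s))"
  unfolding loc_frac_def using eq_equiv_class_iff[OF frac_rel_equiv, of "(a, s)" "(b, t)"] assms
  by (simp add: frac_rel_iff)

lemma loc_frac_mem_iff:
  assumes "a \<in> carrier R" "s \<in> S"
  shows "(b, t) \<in> loc_frac R S a s \<longleftrightarrow> b \<in> carrier R \<and> t \<in> S \<and> loc_frac R S b t = loc_frac R S a s"
proof -
  have "(b, t) \<in> loc_frac R S a s \<longleftrightarrow> ((a, s), (b, t)) \<in> frac_rel R S" unfolding loc_frac_def by simp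
  also have "\<dots> \<longleftrightarrow> b \<in> carrier R \<and> t \<in> S \<and> loc_frac R S a s = loc_frac R S b t"
    using assms frac_eq_iff[OF assms] by (auto simp: frac_rel_iff)
  finally show ?thesis by auto
qed

lemma loc_frac_self: "a \<in> carrier R \<Longrightarrow> s \<in> S \<Longrightarrow> (a, s) \<in> loc_frac R S a s"
  by (simp add: loc_frac_mem_iff)

lemma carrier_L: "carrier L = {loc_frac R S a s | a s. a \<in> carrier R \<and> s \<in> S}"
  unfolding localization_def loc_frac_def quotient_def by auto

lemma frac_in [simp]: "a \<in> carrier R \<Longrightarrow> s \<in> S \<Longrightarrow> loc_frac R S a s \<in> carrier L"
  unfolding carrier_L by auto

lemma fracE:
  assumes "k \<in> carrier L"
  obtains a s where "a \<in> carrier R" "s \<in> S" "k = loc_frac R S a s"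
  using assms unfolding carrier_L by auto

text \<open>The operations of \<open>localization\<close> are unions over all representatives. Once
  the value is independent of them, the union over two non-empty classes collapses to that
  value.\<close>

lemma frac_Union:
  assumes a: "a \<in> carrier R" "s \<in> S" and b: "b \<in> carrier R" "t \<in> S"
    and f: "\<And>a' s' b' t'. a' \<in> carrier R \<Longrightarrow> s' \<in> S \<Longrightarrow> b' \<in> carrier R \<Longrightarrow> t' \<in> S \<Longrightarrow>
      loc_frac R S a' s' = loc_frac R S a s \<Longrightarrow> loc_frac R S b' t' = loc_frac R S b t \<Longrightarrow> f a' s' b' t' = c"
  shows "(\<Union>(a', s')\<in>loc_frac R S a s. \<Union>(b', t')\<in>loc_frac R S b t. f a' s' b' t') = c"
proof -
  have ne: "loc_frac R S a s \<noteq> {}" "loc_frac R S b t \<noteq> {}" using loc_frac_self a b by blast+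
  have inner: "(\<Union>(b', t')\<in>loc_frac R S b t. f a' s' b' t') = c" if "(a', s') \<in> loc_frac R S a s" for a' s'
  proof (rule SUP_eq_const[OF ne(2)])
    fix q assume "q \<in> loc_frac R S b t"
    then show "(case q of (b', t') \<Rightarrow> f a' s' b' t') = c"
      using that loc_frac_mem_iff[OF a] loc_frac_mem_iff[OF b] f by (cases q) simp
  qed
  show ?thesis
  proof (rule SUP_eq_const[OF ne(1)])
    fix p assume p: "p \<in> loc_frac R S a s"
    show "(case p of (a', s') \<Rightarrow> \<Union>(b', t')\<in>loc_frac R S b t. f a' s' b' t') = c"
      using p inner[of "fst p" "snd p"] unfolding case_prod_unfold by simp
  qed
qed

lemma frac_mult [simp]:
  assumes a: "a \<in> carrier R" "s \<in> S" and b: "b \<in> carrier R" "t \<in> S"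
  shows "loc_frac R S a s \<otimes>\<^bsub>L\<^esub> loc_frac R S b t = loc_frac R S (a \<otimes> b) (s \<otimes> t)"
proof -
  have "(\<Union>(a', s')\<in>loc_frac R S a s. \<Union>(b', t')\<in>loc_frac R S b t. loc_frac R S (a' \<otimes> b') (s' \<otimes> t')) = loc_frac R S (a \<otimes> b) (s \<otimes> t)"
  proof (rule frac_Union[OF a b])
    fix a' s' b' t' assume c: "a' \<in> carrier R" "s' \<in> S" "b' \<in> carrier R" "t' \<in> S"
      and e: "loc_frac R S a' s' = loc_frac R S a s" "loc_frac R S b' t' = loc_frac R S b t"
    obtain v where v: "v \<in> S" "v \<otimes> (a' \<otimes> s) = v \<otimes> (a \<otimes> s')" using e(1) frac_eq_iff c a by auto
    obtain w where w: "w \<in> S" "w \<otimes> (b' \<otimes> t) = w \<otimes> (b \<otimes> t')" using e(2) frac_eq_iff c b by auto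
    note cl = a(1) b(1) c(1,3) S_closed[OF a(2)] S_closed[OF b(2)] S_closed[OF c(2)] S_closed[OF c(4)]
      S_closed[OF v(1)] S_closed[OF w(1)]
    have "(v \<otimes> w) \<otimes> ((a' \<otimes> b') \<otimes> (s \<otimes> t)) = (v \<otimes> (a' \<otimes> s)) \<otimes> (w \<otimes> (b' \<otimes> t))" using cl by algebra
    also have "\<dots> = (v \<otimes> w) \<otimes> ((a \<otimes> b) \<otimes> (s' \<otimes> t'))" unfolding v(2) w(2) using cl by algebra
    finally show "loc_frac R S (a' \<otimes> b') (s' \<otimes> t') = loc_frac R S (a \<otimes> b) (s \<otimes> t)"
      using frac_eq_iff a b c v(1) w(1) S_mult m_closed by metis
  qed
  then show ?thesis unfolding localization_def by simp
qed

lemma frac_add [simp]: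
  assumes a: "a \<in> carrier R" "s \<in> S" and b: "b \<in> carrier R" "t \<in> S"
  shows "loc_frac R S a s \<oplus>\<^bsub>L\<^esub> loc_frac R S b t = loc_frac R S (a \<otimes> t \<oplus> b \<otimes> s) (s \<otimes> t)"
proof -
  have "(\<Union>(a', s')\<in>loc_frac R S a s. \<Union>(b', t')\<in>loc_frac R S b t. loc_frac R S (a' \<otimes> t' \<oplus> b' \<otimes> s') (s' \<otimes> t'))
    = loc_frac R S (a \<otimes> t \<oplus> b \<otimes> s) (s \<otimes> t)"
  proof (rule frac_Union[OF a b])
    fix a' s' b' t' assume c: "a' \<in> carrier R" "s' \<in> S" "b' \<in> carrier R" "t' \<in> S"
      and e: "loc_frac R S a' s' = loc_frac R S a s" "loc_frac R S b' t' = loc_frac R S b t"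
    obtain v where v: "v \<in> S" "v \<otimes> (a' \<otimes> s) = v \<otimes> (a \<otimes> s')" using e(1) frac_eq_iff c a by auto
    obtain w where w: "w \<in> S" "w \<otimes> (b' \<otimes> t) = w \<otimes> (b \<otimes> t')" using e(2) frac_eq_iff c b by auto
    note cl = a(1) b(1) c(1,3) S_closed[OF a(2)] S_closed[OF b(2)] S_closed[OF c(2)] S_closed[OF c(4)]
      S_closed[OF v(1)] S_closed[OF w(1)]
    have "(v \<otimes> w) \<otimes> ((a' \<otimes> t' \<oplus> b' \<otimes> s') \<otimes> (s \<otimes> t)) =
      (v \<otimes> (a' \<otimes> s)) \<otimes> (w \<otimes> (t \<otimes> t')) \<oplus> (w \<otimes> (b' \<otimes> t)) \<otimes> (v \<otimes> (s \<otimes> s'))" using cl by algebra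
    also have "\<dots> = (v \<otimes> w) \<otimes> ((a \<otimes> t \<oplus> b \<otimes> s) \<otimes> (s' \<otimes> t'))" unfolding v(2) w(2) using cl by algebra
    finally have "\<exists>u\<in>S. u \<otimes> ((a' \<otimes> t' \<oplus> b' \<otimes> s') \<otimes> (s \<otimes> t)) = u \<otimes> ((a \<otimes> t \<oplus> b \<otimes> s) \<otimes> (s' \<otimes> t'))"
      using v(1) w(1) S_mult by blast
    then show "loc_frac R S (a' \<otimes> t' \<oplus> b' \<otimes> s') (s' \<otimes> t') = loc_frac R S (a \<otimes> t \<oplus> b \<otimes> s) (s \<otimes> t)"
      using a b c by (subst frac_eq_iff) auto
  qed
  then show ?thesis unfolding localization_def by simp
qed

lemma frac_one: "\<one>\<^bsub>L\<^esub> = loc_frac R S \<one> \<one>" and frac_zero: "\<zero>\<^bsub>L\<^esub> = loc_frac R S \<zero> \<one>"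
  unfolding localization_def by simp_all

lemma frac_eqI:
  assumes "a \<in> carrier R" "s \<in> S" "b \<in> carrier R" "t \<in> S" "a \<otimes> t = b \<otimes> s"
  shows "loc_frac R S a s = loc_frac R S b t"
proof -
  have "\<one> \<otimes> (a \<otimes> t) = \<one> \<otimes> (b \<otimes> s)" using assms(5) by simp
  then show ?thesis using frac_eq_iff[OF assms(1-4)] S_one by blast
qed

lemma localization_cring: "cring L"
proof (rule cringI)
  show "abelian_group L"
  proof (rule abelian_groupI)
    fix x y z assume "x \<in> carrier L" "y \<in> carrier L" "z \<in> carrier L"
    then obtain a s b t c u where e: "x = loc_frac R S a s" "y = loc_frac R S b t" "z = loc_frac R S c u"
      and c: "a \<in> carrier R" "s \<in> S" "b \<in> carrier R" "t \<in> S" "c \<in> carrier R" "u \<in> S" by (metis fracE)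
    note cl = c(1,3,5) S_closed[OF c(2)] S_closed[OF c(4)] S_closed[OF c(6)]
    show "x \<oplus>\<^bsub>L\<^esub> y \<in> carrier L" unfolding e using c by simp
    have "(a \<otimes> t \<oplus> b \<otimes> s) \<otimes> u \<oplus> c \<otimes> (s \<otimes> t) = a \<otimes> (t \<otimes> u) \<oplus> (b \<otimes> u \<oplus> c \<otimes> t) \<otimes> s"
      "s \<otimes> t \<otimes> u = s \<otimes> (t \<otimes> u)" using cl by algebra+
    then show "x \<oplus>\<^bsub>L\<^esub> y \<oplus>\<^bsub>L\<^esub> z = x \<oplus>\<^bsub>L\<^esub> (y \<oplus>\<^bsub>L\<^esub> z)" unfolding e using c by simp
    have "a \<otimes> t \<oplus> b \<otimes> s = b \<otimes> s \<oplus> a \<otimes> t" "s \<otimes> t = t \<otimes> s" using cl by algebra+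
    then show "x \<oplus>\<^bsub>L\<^esub> y = y \<oplus>\<^bsub>L\<^esub> x" unfolding e using c by simp
  next
    show "\<zero>\<^bsub>L\<^esub> \<in> carrier L" by (simp add: frac_zero)
    fix x assume "x \<in> carrier L"
    then obtain a s where e: "x = loc_frac R S a s" and c: "a \<in> carrier R" "s \<in> S" by (metis fracE)
    show "\<zero>\<^bsub>L\<^esub> \<oplus>\<^bsub>L\<^esub> x = x" unfolding e frac_zero using c by simp
    have "loc_frac R S (\<ominus> a) s \<oplus>\<^bsub>L\<^esub> loc_frac R S a s = loc_frac R S \<zero> \<one>"
    proof -
      have "loc_frac R S (\<ominus> a) s \<oplus>\<^bsub>L\<^esub> loc_frac R S a s = loc_frac R S (\<ominus> a \<otimes> s \<oplus> a \<otimes> s) (s \<otimes> s)"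
        by (rule frac_add) (use c in simp_all)
      also have "\<ominus> a \<otimes> s \<oplus> a \<otimes> s = \<zero>" using c(1) S_closed[OF c(2)] by algebra
      also have "loc_frac R S \<zero> (s \<otimes> s) = loc_frac R S \<zero> \<one>" by (rule frac_eqI) (use c in simp_all)
      finally show ?thesis .
    qed
    then show "\<exists>y\<in>carrier L. y \<oplus>\<^bsub>L\<^esub> x = \<zero>\<^bsub>L\<^esub>" unfolding e frac_zero
      by (rule bexI) (use c in simp)
  qed
  show "comm_monoid L"
  proof (rule comm_monoidI)
    show "\<one>\<^bsub>L\<^esub> \<in> carrier L" by (simp add: frac_one)
    fix x y z assume "x \<in> carrier L" "y \<in> carrier L" "z \<in> carrier L"
    then obtain a s b t c u where e: "x = loc_frac R S a s" "y = loc_frac R S b t" "z = loc_frac R S c u"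
      and c: "a \<in> carrier R" "s \<in> S" "b \<in> carrier R" "t \<in> S" "c \<in> carrier R" "u \<in> S" by (metis fracE)
    show "x \<otimes>\<^bsub>L\<^esub> y \<in> carrier L" unfolding e using c by simp
    show "x \<otimes>\<^bsub>L\<^esub> y \<otimes>\<^bsub>L\<^esub> z = x \<otimes>\<^bsub>L\<^esub> (y \<otimes>\<^bsub>L\<^esub> z)" unfolding e using c by (simp add: m_assoc)
    show "x \<otimes>\<^bsub>L\<^esub> y = y \<otimes>\<^bsub>L\<^esub> x" unfolding e using c by (simp add: m_comm)
    show "\<one>\<^bsub>L\<^esub> \<otimes>\<^bsub>L\<^esub> x = x" unfolding e frac_one using c by simp
  qed
  fix x y z assume "x \<in> carrier L" "y \<in> carrier L" "z \<in> carrier L"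
  then obtain a s b t c u where e: "x = loc_frac R S a s" "y = loc_frac R S b t" "z = loc_frac R S c u"
    and c: "a \<in> carrier R" "s \<in> S" "b \<in> carrier R" "t \<in> S" "c \<in> carrier R" "u \<in> S" by (metis fracE)
  note cl = c(1,3,5) S_closed[OF c(2)] S_closed[OF c(4)] S_closed[OF c(6)]
  have "((a \<otimes> t \<oplus> b \<otimes> s) \<otimes> c) \<otimes> ((s \<otimes> u) \<otimes> (t \<otimes> u)) = ((a \<otimes> c) \<otimes> (t \<otimes> u) \<oplus> (b \<otimes> c) \<otimes> (s \<otimes> u)) \<otimes> ((s \<otimes> t) \<otimes> u)"
    using cl by algebra
  then show "(x \<oplus>\<^bsub>L\<^esub> y) \<otimes>\<^bsub>L\<^esub> z = x \<otimes>\<^bsub>L\<^esub> z \<oplus>\<^bsub>L\<^esub> y \<otimes>\<^bsub>L\<^esub> z" unfolding e using c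
    by simp (rule frac_eqI, simp_all)
qed

sublocale L: cring L by (rule localization_cring)

lemma loc_map_hom: "ring_hom_cring R L (localization_map R S)"
proof (intro ring_hom_cring.intro ring_hom_cring_axioms.intro is_cring localization_cring ring_hom_memI)
qed (simp_all add: localization_map_def frac_one)

sublocale H: ring_hom_cring R L "localization_map R S" by (rule loc_map_hom)

lemma loc_map_frac: "a \<in> carrier R \<Longrightarrow> s \<in> S \<Longrightarrow> localization_map R S s \<otimes>\<^bsub>L\<^esub> loc_frac R S a s = localization_map R S a"
  unfolding localization_map_def by simp (rule frac_eqI, simp_all add: m_comm)

lemma loc_map_unit: "s \<in> S \<Longrightarrow> localization_map R S s \<in> Units L"
proof -
  assume s: "s \<in> S"
  have "localization_map R S s \<otimes>\<^bsub>L\<^esub> loc_frac R S \<one> s = \<one>\<^bsub>L\<^esub>"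
    using loc_map_frac[OF one_closed s] by simp
  then show ?thesis 
    using s L.m_comm[of "localization_map R S s" "loc_frac R S \<one> s"] unfolding Units_def
    by (intro CollectI conjI bexI[of _ "loc_frac R S \<one> s"]) simp_all
qed

lemma loc_map_eq_iff: "a \<in> carrier R \<Longrightarrow> b \<in> carrier R \<Longrightarrow>
  localization_map R S a = localization_map R S b \<longleftrightarrow> (\<exists>v\<in>S. v \<otimes> a = v \<otimes> b)"
  unfolding localization_map_def by (simp add: frac_eq_iff)

lemma frac_eq_inv: "a \<in> carrier R \<Longrightarrow> s \<in> S \<Longrightarrow>
  loc_frac R S a s = inv\<^bsub>L\<^esub> (localization_map R S s) \<otimes>\<^bsub>L\<^esub> localization_map R S a"
  using loc_map_unit[of s] loc_map_frac[of a s, symmetric] by (simp flip: L.m_assoc)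

lemma localization_noetherian:
  assumes "noetherian_ring R" shows "noetherian_ring L"
proof -
  interpret N: noetherian_hom R L "localization_map R S"
    by (intro noetherian_hom.intro loc_map_hom noetherian_hom_axioms.intro assms)
  show ?thesis
  proof (rule N.noetherian_fractions)
    fix k assume "k \<in> carrier L"
    then obtain a s where "a \<in> carrier R" "s \<in> S" "k = loc_frac R S a s" by (rule fracE)
    then show "\<exists>s\<in>carrier R. \<exists>c\<in>carrier R. localization_map R S s \<in> Units L \<and>
        localization_map R S s \<otimes>\<^bsub>L\<^esub> k = localization_map R S c"
      using loc_map_unit loc_map_frac by (intro bexI[of _ s] bexI[of _ a]) simp_all
  qed
qed

text \<open>A sum of fractions with numerators in \<open>J\<close> can be put over a common
  denominator, so such fractions already form an ideal.\<close>

lemma mem_extended_ideal_iff: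
  assumes J: "ideal J R"
  shows "extended_ideal L (localization_map R S) J = {loc_frac R S a s | a s. a \<in> J \<and> s \<in> S}"
proof -
  interpret J: ideal J R by fact
  let ?E = "{loc_frac R S a s | a s. a \<in> J \<and> s \<in> S}"
  have EI: "loc_frac R S a s \<in> ?E" if "a \<in> J" "s \<in> S" for a s using that by auto
  have EE: "\<exists>a s. x = loc_frac R S a s \<and> a \<in> J \<and> s \<in> S" if "x \<in> ?E" for x
    using that unfolding mem_Collect_eq .
  have E: "ideal ?E L"
  proof (rule L.cring_idealI)
    show "?E \<subseteq> carrier L"
    proof
      fix x assume "x \<in> ?E"
      from EE[OF this] obtain a s where x: "x = loc_frac R S a s" "a \<in> J" "s \<in> S" by (elim exE conjE)
      show "x \<in> carrier L" unfolding x(1) using x(2,3) J.Icarr by simp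
    qed
    show "\<zero>\<^bsub>L\<^esub> \<in> ?E" unfolding frac_zero by (rule EI) simp_all
    fix x assume "x \<in> ?E"
    from EE[OF this] obtain a s where x: "x = loc_frac R S a s" "a \<in> J" "s \<in> S" by (elim exE conjE)
    show "r \<otimes>\<^bsub>L\<^esub> x \<in> ?E" if "r \<in> carrier L" for r
    proof -
      obtain b t where r: "b \<in> carrier R" "t \<in> S" "r = loc_frac R S b t" by (rule fracE[OF \<open>r \<in> carrier L\<close>])
      have "r \<otimes>\<^bsub>L\<^esub> x = loc_frac R S (b \<otimes> a) (t \<otimes> s)" unfolding x(1) r(3) using x r J.Icarr by simp
      also have "\<dots> \<in> ?E" by (rule EI[OF J.I_l_closed]) (use x r in simp_all)
      finally show ?thesis .
    qed
    fix y assume "y \<in> ?E"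
    from EE[OF this] obtain b t where y: "y = loc_frac R S b t" "b \<in> J" "t \<in> S" by (elim exE conjE)
    have "x \<oplus>\<^bsub>L\<^esub> y = loc_frac R S (a \<otimes> t \<oplus> b \<otimes> s) (s \<otimes> t)" unfolding x(1) y(1) using x y J.Icarr by simp
    also have "\<dots> \<in> ?E" by (rule EI[OF J.a_closed[OF J.I_r_closed J.I_r_closed]]) (use x y in simp_all)
    finally show "x \<oplus>\<^bsub>L\<^esub> y \<in> ?E" .
  qed
  have im: "localization_map R S ` J \<subseteq> carrier L" by (rule image_subsetI) (simp add: J.Icarr)
  let ?I = "extended_ideal L (localization_map R S) J"
  have I: "ideal ?I L" unfolding extended_ideal_def by (rule L.genideal_ideal[OF im])
  have "localization_map R S ` J \<subseteq> ?E"
  proof (rule image_subsetI)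
    show "localization_map R S a \<in> ?E" if "a \<in> J" for a unfolding localization_map_def by (rule EI[OF that S_one])
  qed
  then have "?I \<subseteq> ?E" unfolding extended_ideal_def by (rule L.genideal_minimal[OF E])
  moreover have "?E \<subseteq> ?I"
  proof
    fix x assume "x \<in> ?E"
    from EE[OF this] obtain a s where x: "x = loc_frac R S a s" "a \<in> J" "s \<in> S" by (elim exE conjE)
    have "localization_map R S a \<in> ?I" unfolding extended_ideal_def
      by (rule subsetD[OF L.genideal_self[OF im] imageI[OF x(2)]])
    then have "inv\<^bsub>L\<^esub> (localization_map R S s) \<otimes>\<^bsub>L\<^esub> localization_map R S a \<in> ?I"
      by (rule ideal.I_l_closed[OF I]) (use loc_map_unit[OF x(3)] in simp)
    then show "x \<in> ?I" unfolding x(1) using frac_eq_inv[of a s] x(2,3) J.Icarr by simp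
  qed
  ultimately show ?thesis by auto
qed

end

lemma (in primeideal) complement_submonoid: "submonoid (carrier R - I) R"
  using I_prime primeideal_one[OF primeideal_axioms] by (unfold_locales) auto

section \<open>Subrings generated by one further element\<close>

context noetherian_hom
begin

lemma pols_mult:
  assumes b: "b \<in> carrier S" and f: "f \<in> pols R S h b n" and g: "g \<in> pols R S h b m"
  shows "f \<otimes>\<^bsub>S\<^esub> g \<in> pols R S h b (n + m)"
  using f
proof (induction n arbitrary: f)
  case 0
  then show ?case using pols_zero[OF b] pols_closed[OF b g] by simp
next
  case (Suc n)
  from Suc(2) obtain c f' where f: "c \<in> carrier R" "f' \<in> pols R S h b n" "f = h c \<oplus>\<^bsub>S\<^esub> b \<otimes>\<^bsub>S\<^esub> f'" by (rule pols_SucE)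
  have "f \<otimes>\<^bsub>S\<^esub> g = h c \<otimes>\<^bsub>S\<^esub> g \<oplus>\<^bsub>S\<^esub> b \<otimes>\<^bsub>S\<^esub> (f' \<otimes>\<^bsub>S\<^esub> g)"
    unfolding f(3) using pols_closed[OF b f(2)] pols_closed[OF b g] b hom_closed[OF f(1)] by algebra
  moreover have "h c \<otimes>\<^bsub>S\<^esub> g \<in> pols R S h b (Suc (n + m))"
    using pols_scale[OF b g f(1)] pols_mono[OF b, of m "Suc (n + m)"] by auto
  moreover have "b \<otimes>\<^bsub>S\<^esub> (f' \<otimes>\<^bsub>S\<^esub> g) \<in> pols R S h b (Suc (n + m))"
    by (rule pols_shift[OF b Suc(1)[OF f(2)]])
  ultimately show ?case using pols_add[OF b] by simp
qed

text \<open>\<open>noetherian_adjoin\<close> requires that \<open>b\<close> generate the whole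
  target, which is achieved by cutting the carrier down to R[b]. Working inside a fixed ring
  \<open>S\<close> allows the step to be repeated for several elements.\<close>

lemma noetherian_adjoin_subring:
  assumes b: "b \<in> carrier S"
  defines "C \<equiv> (\<Union>n. pols R S h b n)"
  shows "subcring C S" "noetherian_ring (S\<lparr>carrier := C\<rparr>)" "b \<in> C" "h ` carrier R \<subseteq> C"
proof -
  have CI: "f \<in> C" if "f \<in> pols R S h b n" for f n using that unfolding C_def by blast
  have CE: "\<exists>n. f \<in> pols R S h b n" if "f \<in> C" for f using that unfolding C_def by blast
  show hC: "h ` carrier R \<subseteq> C"
    by (rule image_subsetI, rule CI, rule pols_const[OF b])
  have "b \<otimes>\<^bsub>S\<^esub> h \<one> \<in> C" by (rule CI[OF pols_shift[OF b pols_const[OF b]]]) simp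
  then show "b \<in> C" using b by simp
  have CC: "C \<subseteq> carrier S" using CE pols_closed[OF b] by blast
  show sub: "subcring C S"
  proof (rule S.subcringI'[OF S.subringI])
    show "C \<subseteq> carrier S" by (rule CC)
    show "\<one>\<^bsub>S\<^esub> \<in> C" using hC hom_one R.one_closed by (metis image_subset_iff)
    fix f assume "f \<in> C"
    then obtain n where n: "f \<in> pols R S h b n" using CE by auto
    have "\<zero>\<^bsub>S\<^esub> \<ominus>\<^bsub>S\<^esub> f \<in> C" by (rule CI[OF pols_minus[OF b pols_zero[OF b] n]])
    then show "\<ominus>\<^bsub>S\<^esub> f \<in> C" using pols_closed[OF b n] by (simp add: a_minus_def)
    fix g assume "g \<in> C"
    then obtain m where m: "g \<in> pols R S h b m" using CE by auto
    show "f \<otimes>\<^bsub>S\<^esub> g \<in> C" by (rule CI[OF pols_mult[OF b n m]])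
    have "f \<in> pols R S h b (n + m)" "g \<in> pols R S h b (n + m)"
      using n m pols_mono[OF b, of n "n + m"] pols_mono[OF b, of m "n + m"] by auto
    then show "f \<oplus>\<^bsub>S\<^esub> g \<in> C" by (rule CI[OF pols_add[OF b]])
  qed
  have C_cring: "cring (S\<lparr>carrier := C\<rparr>)" using S.subcring_iff[OF CC] sub by simp
  have hom: "h \<in> ring_hom R (S\<lparr>carrier := C\<rparr>)"
    by (rule ring_hom_memI) (use hC in auto)
  interpret N: noetherian_hom R "S\<lparr>carrier := C\<rparr>" h
    by (intro noetherian_hom.intro ring_hom_cring.intro ring_hom_cring_axioms.intro
        noetherian_hom_axioms.intro R.is_cring C_cring hom noetherian)
  have pe: "pols R (S\<lparr>carrier := C\<rparr>) h b n = pols R S h b n" for n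
    by (induction n) (simp_all add: pols.simps)
  show "noetherian_ring (S\<lparr>carrier := C\<rparr>)"
    by (rule N.noetherian_adjoin[of b]) (use \<open>b \<in> C\<close> CE in \<open>simp_all add: pe\<close>)
qed

end

section \<open>Finite sums in ideals and powers of ideals\<close>

context cring
begin

lemma finsum_ideal:
  assumes J: "ideal J R" and f: "\<And>k. k \<in> A \<Longrightarrow> f k \<in> J"
  shows "(\<Oplus>k\<in>A. f k) \<in> J"
proof (cases "finite A")
  case True
  then show ?thesis using f
  proof (induction A)
    case empty
    then show ?case using additive_subgroup.zero_closed[OF ideal.axioms(1)[OF J]] by simp
  next
    case (insert a A)
    have fa: "f k \<in> carrier R" if "k \<in> insert a A" for k using insert(4)[OF that] ideal.Icarr[OF J] by simp
    have "(\<Oplus>k\<in>insert a A. f k) = f a \<oplus> (\<Oplus>k\<in>A. f k)"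
      by (rule finsum_insert) (use insert(1,2) fa in auto)
    then show ?case using additive_subgroup.a_closed[OF ideal.axioms(1)[OF J]] insert(3,4) by simp
  qed
next
  case False
  then show ?thesis using additive_subgroup.zero_closed[OF ideal.axioms(1)[OF J]] by simp
qed

lemma ideal_power_0: "ideal_power R J 0 = carrier R"
  and ideal_power_Suc: "ideal_power R J (Suc n) = ideal_prod R (ideal_power R J n) J"
  unfolding ideal_power_def by (simp_all add: nat_pow_def ideals_set_def)

context
  fixes J assumes J: "ideal J R"
begin

lemma ideal_power_ideal: "ideal (ideal_power R J n) R"
  by (induction n) (simp_all add: ideal_power_0 ideal_power_Suc oneideal ideal_prod_is_ideal J)

lemma ideal_power_1: "ideal_power R J 1 = J"
proof -
  interpret I: comm_monoid "ideals_set R" by (rule ideals_set_is_comm_monoid)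
  show ?thesis unfolding ideal_power_def by (rule I.nat_pow_eone) (use J in \<open>simp add: ideals_set_def\<close>)
qed

lemma ideal_power_Suc_subset: "ideal_power R J (Suc n) \<subseteq> ideal_power R J n"
  unfolding ideal_power_Suc using ideal_prod_inter[OF ideal_power_ideal J] by blast

lemma ideal_power_antimono: "m \<le> n \<Longrightarrow> ideal_power R J n \<subseteq> ideal_power R J m"
  by (rule lift_Suc_antimono_le[of "ideal_power R J", OF ideal_power_Suc_subset])

lemma ideal_power_mult:
  assumes "a \<in> ideal_power R J m" "b \<in> ideal_power R J n"
  shows "a \<otimes> b \<in> ideal_power R J (m + n)"
proof -
  interpret I: comm_monoid "ideals_set R" by (rule ideals_set_is_comm_monoid)
  have "J \<in> carrier (ideals_set R)" using J by (simp add: ideals_set_def)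
  from I.nat_pow_mult[OF this, of m n] have "ideal_prod R (ideal_power R J m) (ideal_power R J n) = ideal_power R J (m + n)"
    unfolding ideal_power_def by (simp add: ideals_set_def)
  then show ?thesis using ideal_prod.prod[OF assms, of R] by simp
qed

lemma ideal_power_closed: "a \<in> ideal_power R J n \<Longrightarrow> a \<in> carrier R"
  using ideal.Icarr[OF ideal_power_ideal] .

lemma ideal_power_add: "a \<in> ideal_power R J n \<Longrightarrow> b \<in> ideal_power R J n \<Longrightarrow> a \<oplus> b \<in> ideal_power R J n"
  using additive_subgroup.a_closed[OF ideal.axioms(1)[OF ideal_power_ideal]] .

lemma ideal_power_zero: "\<zero> \<in> ideal_power R J n"
  using additive_subgroup.zero_closed[OF ideal.axioms(1)[OF ideal_power_ideal]] .

lemma ideal_power_uminus: "a \<in> ideal_power R J n \<Longrightarrow> \<ominus> a \<in> ideal_power R J n"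
  using additive_subgroup.a_inv_closed[OF ideal.axioms(1)[OF ideal_power_ideal]] .

text \<open>Truncation gives nat (m + n) \<le> nat m + nat n, and powers of an ideal decrease. So
  the product rule persists for negative exponents, where the power is the whole ring.\<close>

lemma ideal_power_nat_mult:
  assumes "a \<in> ideal_power R J (nat m)" "b \<in> ideal_power R J (nat n)"
  shows "a \<otimes> b \<in> ideal_power R J (nat (m + n))"
proof -
  have "nat (m + n) \<le> nat m + nat n" by auto
  then show ?thesis using ideal_power_mult[OF assms] ideal_power_antimono by blast
qed

end

end

section \<open>The Rees ring\<close>

locale rees = cring R for R (structure) + fixes I
  assumes I: "ideal I R"
begin

abbreviation "A \<equiv> rees_ring R I"
abbreviation "Ip n \<equiv> ideal_power R I (nat n)"

text \<open>The homogeneous element a t^i; \<open>rees_const\<close> and \<open>rees_u\<close> are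
  special cases.\<close>

definition mono where "mono a i = (\<lambda>n::int. if n = i then a else \<zero>)"

lemma A_mem: "f \<in> carrier A \<longleftrightarrow> (\<forall>n. f n \<in> Ip n) \<and> finite {n. f n \<noteq> \<zero>}"
  and A_mult: "f \<otimes>\<^bsub>A\<^esub> g = (\<lambda>n. \<Oplus>k\<in>{k. f k \<noteq> \<zero>}. f k \<otimes> g (n - k))"
  and A_add: "f \<oplus>\<^bsub>A\<^esub> g = (\<lambda>n. f n \<oplus> g n)"
  and A_one: "\<one>\<^bsub>A\<^esub> = mono \<one> 0"
  and A_zero: "\<zero>\<^bsub>A\<^esub> = (\<lambda>_. \<zero>)"
  unfolding rees_ring_def mono_def by simp_all

lemma coeff_Ip: "f \<in> carrier A \<Longrightarrow> f n \<in> Ip n" and finite_supp: "f \<in> carrier A \<Longrightarrow> finite {n. f n \<noteq> \<zero>}"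
  by (simp_all add: A_mem)

lemma coeff_closed [simp]: "f \<in> carrier A \<Longrightarrow> f n \<in> carrier R"
  using coeff_Ip ideal_power_closed[OF I] by blast

lemma mono_closed: "a \<in> Ip i \<Longrightarrow> mono a i \<in> carrier A"
  unfolding A_mem mono_def by (auto simp: ideal_power_zero[OF I])

lemma add_closed: assumes "f \<in> carrier A" "g \<in> carrier A" shows "f \<oplus>\<^bsub>A\<^esub> g \<in> carrier A"
proof -
  have "{n. f n \<oplus> g n \<noteq> \<zero>} \<subseteq> {n. f n \<noteq> \<zero>} \<union> {n. g n \<noteq> \<zero>}" by auto
  then have "finite {n. f n \<oplus> g n \<noteq> \<zero>}" using finite_supp assms by (meson finite_UnI finite_subset)
  then show ?thesis unfolding A_mem A_add using ideal_power_add[OF I] coeff_Ip assms by auto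
qed

text \<open>The product is a sum over the support of the left factor, which changes with that
  factor. Comparing two products requires one finite index set for both.\<close>

lemma mult_support:
  assumes f: "f \<in> carrier A" and g: "g \<in> carrier A" and W: "finite W" "{k. f k \<noteq> \<zero>} \<subseteq> W"
  shows "(f \<otimes>\<^bsub>A\<^esub> g) n = (\<Oplus>k\<in>W. f k \<otimes> g (n - k))"
  unfolding A_mult by (rule add.finprod_mono_neutral_cong_left[OF W]) (use f g in auto)

lemma mult_closed: assumes f: "f \<in> carrier A" and g: "g \<in> carrier A" shows "f \<otimes>\<^bsub>A\<^esub> g \<in> carrier A"
proof -
  have "(f \<otimes>\<^bsub>A\<^esub> g) n \<in> Ip n" for n
    unfolding A_mult
  proof (rule finsum_ideal[OF ideal_power_ideal[OF I]])
    fix k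
    show "f k \<otimes> g (n - k) \<in> Ip n" using ideal_power_nat_mult[OF I coeff_Ip[OF f, of k] coeff_Ip[OF g, of "n - k"]] by simp
  qed
  moreover have "{n. (f \<otimes>\<^bsub>A\<^esub> g) n \<noteq> \<zero>} \<subseteq> (\<lambda>(i, j). i + j) ` ({k. f k \<noteq> \<zero>} \<times> {k. g k \<noteq> \<zero>})"
  proof
    fix n assume "n \<in> {n. (f \<otimes>\<^bsub>A\<^esub> g) n \<noteq> \<zero>}"
    then have nz: "(\<Oplus>k\<in>{k. f k \<noteq> \<zero>}. f k \<otimes> g (n - k)) \<noteq> \<zero>" unfolding A_mult by simp
    have "\<exists>k\<in>{k. f k \<noteq> \<zero>}. f k \<otimes> g (n - k) \<noteq> \<zero>"
    proof (rule ccontr)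
      assume "\<not> ?thesis"
      then have "(\<Oplus>k\<in>{k. f k \<noteq> \<zero>}. f k \<otimes> g (n - k)) = \<zero>" by (intro add.finprod_one_eqI) auto
      then show False using nz by simp
    qed
    then obtain k where k: "f k \<noteq> \<zero>" "f k \<otimes> g (n - k) \<noteq> \<zero>" by auto
    have "g (n - k) \<noteq> \<zero>" using k(2) f by auto
    then have "(k, n - k) \<in> {k. f k \<noteq> \<zero>} \<times> {k. g k \<noteq> \<zero>}" using k(1) by simp
    then show "n \<in> (\<lambda>(i, j). i + j) ` ({k. f k \<noteq> \<zero>} \<times> {k. g k \<noteq> \<zero>})" by (rule rev_image_eqI) simp
  qed
  then have "finite {n. (f \<otimes>\<^bsub>A\<^esub> g) n \<noteq> \<zero>}"
    by (rule finite_subset) (intro finite_imageI finite_cartesian_product finite_supp f g)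
  ultimately show ?thesis unfolding A_mem by simp
qed

lemma mono_coeff_mult:
  assumes a: "a \<in> Ip i" and g: "g \<in> carrier A"
  shows "(mono a i \<otimes>\<^bsub>A\<^esub> g) n = a \<otimes> g (n - i)"
proof -
  have ac: "a \<in> carrier R" using ideal_power_closed[OF I a] .
  have "(mono a i \<otimes>\<^bsub>A\<^esub> g) n = (\<Oplus>k\<in>{i}. mono a i k \<otimes> g (n - k))"
    by (rule mult_support[OF mono_closed[OF a] g]) (auto simp: mono_def)
  also have "\<dots> = a \<otimes> g (n - i)"
    using ac g by (subst finsum_insert) (auto simp: mono_def)
  finally show ?thesis .
qed

lemma mult_mono_coeff:
  assumes a: "a \<in> Ip i" and g: "g \<in> carrier A"
  shows "(g \<otimes>\<^bsub>A\<^esub> mono a i) n = g (n - i) \<otimes> a"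
proof -
  have ac: "a \<in> carrier R" using ideal_power_closed[OF I a] .
  let ?W = "insert (n - i) {k. g k \<noteq> \<zero>}"
  have fin: "finite ?W" using finite_supp[OF g] by simp
  have "(g \<otimes>\<^bsub>A\<^esub> mono a i) n = (\<Oplus>k\<in>?W. g k \<otimes> mono a i (n - k))"
    by (rule mult_support[OF g mono_closed[OF a] fin]) auto
  also have "\<dots> = (\<Oplus>k\<in>?W. if n - i = k then g k \<otimes> a else \<zero>)"
    by (rule finsum_cong') (use g ac in \<open>auto simp: mono_def\<close>)
  also have "\<dots> = g (n - i) \<otimes> a"
    by (rule add.finprod_singleton[of "n - i" ?W "\<lambda>k. g k \<otimes> a"]) (use fin g ac in auto)
  finally show ?thesis .
qed

lemma r_distr_A:
  assumes f: "f \<in> carrier A" and g: "g \<in> carrier A" and g': "g' \<in> carrier A"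
  shows "f \<otimes>\<^bsub>A\<^esub> (g \<oplus>\<^bsub>A\<^esub> g') = f \<otimes>\<^bsub>A\<^esub> g \<oplus>\<^bsub>A\<^esub> f \<otimes>\<^bsub>A\<^esub> g'"
proof
  fix n
  have "(f \<otimes>\<^bsub>A\<^esub> (g \<oplus>\<^bsub>A\<^esub> g')) n = (\<Oplus>k\<in>{k. f k \<noteq> \<zero>}. f k \<otimes> g (n - k) \<oplus> f k \<otimes> g' (n - k))"
    unfolding A_mult A_add by (rule finsum_cong') (use f g g' in \<open>auto simp: r_distr\<close>)
  also have "\<dots> = (f \<otimes>\<^bsub>A\<^esub> g \<oplus>\<^bsub>A\<^esub> f \<otimes>\<^bsub>A\<^esub> g') n"
    unfolding A_mult A_add by (rule finsum_addf) (use f g g' in auto)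
  finally show "(f \<otimes>\<^bsub>A\<^esub> (g \<oplus>\<^bsub>A\<^esub> g')) n = (f \<otimes>\<^bsub>A\<^esub> g \<oplus>\<^bsub>A\<^esub> f \<otimes>\<^bsub>A\<^esub> g') n" .
qed

lemma l_distr_A:
  assumes f: "f \<in> carrier A" and f': "f' \<in> carrier A" and g: "g \<in> carrier A"
  shows "(f \<oplus>\<^bsub>A\<^esub> f') \<otimes>\<^bsub>A\<^esub> g = f \<otimes>\<^bsub>A\<^esub> g \<oplus>\<^bsub>A\<^esub> f' \<otimes>\<^bsub>A\<^esub> g"
proof
  fix n
  let ?W = "{k. f k \<noteq> \<zero>} \<union> {k. f' k \<noteq> \<zero>}"
  have fin: "finite ?W" using finite_supp f f' by simp
  have "((f \<oplus>\<^bsub>A\<^esub> f') \<otimes>\<^bsub>A\<^esub> g) n = (\<Oplus>k\<in>?W. (f \<oplus>\<^bsub>A\<^esub> f') k \<otimes> g (n - k))"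
    by (rule mult_support[OF add_closed[OF f f'] g fin]) (auto simp: A_add)
  also have "\<dots> = (\<Oplus>k\<in>?W. f k \<otimes> g (n - k) \<oplus> f' k \<otimes> g (n - k))"
    unfolding A_add by (rule finsum_cong') (use f f' g in \<open>auto simp: l_distr\<close>)
  also have "\<dots> = (\<Oplus>k\<in>?W. f k \<otimes> g (n - k)) \<oplus> (\<Oplus>k\<in>?W. f' k \<otimes> g (n - k))"
    by (rule finsum_addf) (use f f' g in auto)
  also have "(\<Oplus>k\<in>?W. f k \<otimes> g (n - k)) = (f \<otimes>\<^bsub>A\<^esub> g) n"
    by (rule mult_support[OF f g fin, symmetric]) auto
  also have "(\<Oplus>k\<in>?W. f' k \<otimes> g (n - k)) = (f' \<otimes>\<^bsub>A\<^esub> g) n"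
    by (rule mult_support[OF f' g fin, symmetric]) auto
  finally show "((f \<oplus>\<^bsub>A\<^esub> f') \<otimes>\<^bsub>A\<^esub> g) n = (f \<otimes>\<^bsub>A\<^esub> g \<oplus>\<^bsub>A\<^esub> f' \<otimes>\<^bsub>A\<^esub> g) n" by (simp add: A_add)
qed

text \<open>With a homogeneous factor the convolution is a single product. Reducing commutativity
  and associativity to this case by additivity avoids rearranging double sums.\<close>

lemma rees_induct [consumes 1, case_names zero add]:
  assumes f: "f \<in> carrier A" and zero: "P \<zero>\<^bsub>A\<^esub>"
    and add: "\<And>a i g. a \<in> Ip i \<Longrightarrow> g \<in> carrier A \<Longrightarrow> P g \<Longrightarrow> P (mono a i \<oplus>\<^bsub>A\<^esub> g)"
  shows "P f"
proof -
  have "P f" if "finite F" "{n. f n \<noteq> \<zero>} \<subseteq> F" "f \<in> carrier A" for F f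
    using that
  proof (induction F arbitrary: f)
    case empty
    then have "f = \<zero>\<^bsub>A\<^esub>" by (auto simp: A_zero)
    then show ?case using zero by simp
  next
    case (insert i F)
    let ?g = "f(i := \<zero>)"
    have g: "?g \<in> carrier A"
    proof -
      have "{n. ?g n \<noteq> \<zero>} \<subseteq> {n. f n \<noteq> \<zero>}" by auto
      then have "finite {n. ?g n \<noteq> \<zero>}" using finite_supp[OF insert(5)] finite_subset by blast
      then show ?thesis unfolding A_mem using coeff_Ip[OF insert(5)] ideal_power_zero[OF I] by simp
    qed
    have "P ?g" by (rule insert(3)[OF _ g]) (use insert(4) in auto)
    then have "P (mono (f i) i \<oplus>\<^bsub>A\<^esub> ?g)" by (rule add[OF coeff_Ip[OF insert(5)] g])
    moreover have "mono (f i) i \<oplus>\<^bsub>A\<^esub> ?g = f" using insert(5) by (auto simp: A_add mono_def)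
    ultimately show ?case by simp
  qed
  then show ?thesis using f finite_supp by blast
qed

lemma zero_closed_A: "\<zero>\<^bsub>A\<^esub> \<in> carrier A" unfolding A_mem A_zero using ideal_power_zero[OF I] by simp

lemma mult_zero_A: "f \<otimes>\<^bsub>A\<^esub> \<zero>\<^bsub>A\<^esub> = \<zero>\<^bsub>A\<^esub>" "\<zero>\<^bsub>A\<^esub> \<otimes>\<^bsub>A\<^esub> f = \<zero>\<^bsub>A\<^esub>" if "f \<in> carrier A"
proof -
  show "f \<otimes>\<^bsub>A\<^esub> \<zero>\<^bsub>A\<^esub> = \<zero>\<^bsub>A\<^esub>"
  proof
    show "(f \<otimes>\<^bsub>A\<^esub> \<zero>\<^bsub>A\<^esub>) n = \<zero>\<^bsub>A\<^esub> n" for n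
      unfolding A_mult A_zero by (rule add.finprod_one_eqI) (use that in auto)
  qed
  show "\<zero>\<^bsub>A\<^esub> \<otimes>\<^bsub>A\<^esub> f = \<zero>\<^bsub>A\<^esub>" by (simp add: A_mult A_zero)
qed

lemma mult_comm_A:
  assumes f: "f \<in> carrier A" and g: "g \<in> carrier A"
  shows "f \<otimes>\<^bsub>A\<^esub> g = g \<otimes>\<^bsub>A\<^esub> f"
  using g
proof (induction rule: rees_induct)
  case zero
  then show ?case using mult_zero_A[OF f] by simp
next
  case (add a i g)
  have "f \<otimes>\<^bsub>A\<^esub> mono a i = mono a i \<otimes>\<^bsub>A\<^esub> f"
  proof
    show "(f \<otimes>\<^bsub>A\<^esub> mono a i) n = (mono a i \<otimes>\<^bsub>A\<^esub> f) n" for n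
      unfolding mult_mono_coeff[OF add(1) f] mono_coeff_mult[OF add(1) f]
      by (rule m_comm) (use f ideal_power_closed[OF I add(1)] in auto)
  qed
  then show ?case
    using r_distr_A[OF f mono_closed[OF add(1)] add(2)] l_distr_A[OF mono_closed[OF add(1)] add(2) f] add(3) by simp
qed

lemma mult_assoc_A:
  assumes f: "f \<in> carrier A" and g: "g \<in> carrier A" and h: "h \<in> carrier A"
  shows "(f \<otimes>\<^bsub>A\<^esub> g) \<otimes>\<^bsub>A\<^esub> h = f \<otimes>\<^bsub>A\<^esub> (g \<otimes>\<^bsub>A\<^esub> h)"
  using h
proof (induction rule: rees_induct)
  case zero
  then show ?case using mult_zero_A mult_closed f g by simp
next
  case (add a i h)
  have ac: "a \<in> carrier R" using ideal_power_closed[OF I add(1)] .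
  note fg = mult_closed[OF f g]
  have "(f \<otimes>\<^bsub>A\<^esub> g) \<otimes>\<^bsub>A\<^esub> mono a i = f \<otimes>\<^bsub>A\<^esub> (g \<otimes>\<^bsub>A\<^esub> mono a i)"
  proof
    fix n
    have "(f \<otimes>\<^bsub>A\<^esub> g \<otimes>\<^bsub>A\<^esub> mono a i) n = (\<Oplus>k\<in>{k. f k \<noteq> \<zero>}. f k \<otimes> g (n - i - k)) \<otimes> a"
      unfolding mult_mono_coeff[OF add(1) fg] unfolding A_mult ..
    also have "\<dots> = (\<Oplus>k\<in>{k. f k \<noteq> \<zero>}. f k \<otimes> g (n - i - k) \<otimes> a)"
      by (rule finsum_ldistr) (use finite_supp[OF f] f g ac in auto)
    also have "\<dots> = (\<Oplus>k\<in>{k. f k \<noteq> \<zero>}. f k \<otimes> (g \<otimes>\<^bsub>A\<^esub> mono a i) (n - k))"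
    proof (rule finsum_cong'[OF refl])
      show "(\<lambda>k. f k \<otimes> (g \<otimes>\<^bsub>A\<^esub> mono a i) (n - k)) \<in> {k. f k \<noteq> \<zero>} \<rightarrow> carrier R"
        using f mult_closed[OF g mono_closed[OF add(1)]] by auto
      fix k
      have e: "n - i - k = n - k - i" by simp
      show "f k \<otimes> g (n - i - k) \<otimes> a = f k \<otimes> (g \<otimes>\<^bsub>A\<^esub> mono a i) (n - k)"
        unfolding mult_mono_coeff[OF add(1) g] e using f g ac by (simp add: m_assoc)
    qed
    also have "\<dots> = (f \<otimes>\<^bsub>A\<^esub> (g \<otimes>\<^bsub>A\<^esub> mono a i)) n" unfolding A_mult[of f] ..
    finally show "(f \<otimes>\<^bsub>A\<^esub> g \<otimes>\<^bsub>A\<^esub> mono a i) n = (f \<otimes>\<^bsub>A\<^esub> (g \<otimes>\<^bsub>A\<^esub> mono a i)) n" .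
  qed
  then show ?case
    using r_distr_A[OF fg mono_closed[OF add(1)] add(2)] r_distr_A[OF g mono_closed[OF add(1)] add(2)]
      r_distr_A[OF f mult_closed[OF g mono_closed[OF add(1)]] mult_closed[OF g add(2)]] add(3) by simp
qed

lemma rees_cring: "cring A"
proof (rule cringI)
  show "abelian_group A"
  proof (rule abelian_groupI)
    show "\<zero>\<^bsub>A\<^esub> \<in> carrier A" by (rule zero_closed_A)
    fix f g h assume f: "f \<in> carrier A" and g: "g \<in> carrier A" and h: "h \<in> carrier A"
    show "f \<oplus>\<^bsub>A\<^esub> g \<in> carrier A" by (rule add_closed[OF f g])
    show "f \<oplus>\<^bsub>A\<^esub> g \<oplus>\<^bsub>A\<^esub> h = f \<oplus>\<^bsub>A\<^esub> (g \<oplus>\<^bsub>A\<^esub> h)" using f g h by (simp add: A_add a_assoc)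
    show "f \<oplus>\<^bsub>A\<^esub> g = g \<oplus>\<^bsub>A\<^esub> f" using f g by (simp add: A_add a_comm)
    show "\<zero>\<^bsub>A\<^esub> \<oplus>\<^bsub>A\<^esub> f = f" using f by (simp add: A_add A_zero)
    have "{n. \<ominus> (f n) \<noteq> \<zero>} \<subseteq> {n. f n \<noteq> \<zero>}" by auto
    then have "finite {n. \<ominus> (f n) \<noteq> \<zero>}" using finite_supp[OF f] finite_subset by blast
    then have "(\<lambda>n. \<ominus> (f n)) \<in> carrier A" unfolding A_mem using ideal_power_uminus[OF I coeff_Ip[OF f]] by simp
    moreover have "(\<lambda>n. \<ominus> (f n)) \<oplus>\<^bsub>A\<^esub> f = \<zero>\<^bsub>A\<^esub>" using f by (simp add: A_add A_zero l_neg)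
    ultimately show "\<exists>g\<in>carrier A. g \<oplus>\<^bsub>A\<^esub> f = \<zero>\<^bsub>A\<^esub>" by (intro bexI[of _ "\<lambda>n. \<ominus> (f n)"])
  qed
  show "comm_monoid A"
  proof (rule comm_monoidI)
    have one: "\<one> \<in> Ip 0" by (simp add: ideal_power_0)
    show "\<one>\<^bsub>A\<^esub> \<in> carrier A" unfolding A_one by (rule mono_closed[OF one])
    fix f g h assume f: "f \<in> carrier A" and g: "g \<in> carrier A" and h: "h \<in> carrier A"
    show "f \<otimes>\<^bsub>A\<^esub> g \<in> carrier A" by (rule mult_closed[OF f g])
    show "f \<otimes>\<^bsub>A\<^esub> g \<otimes>\<^bsub>A\<^esub> h = f \<otimes>\<^bsub>A\<^esub> (g \<otimes>\<^bsub>A\<^esub> h)" by (rule mult_assoc_A[OF f g h])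
    show "f \<otimes>\<^bsub>A\<^esub> g = g \<otimes>\<^bsub>A\<^esub> f" by (rule mult_comm_A[OF f g])
    show "\<one>\<^bsub>A\<^esub> \<otimes>\<^bsub>A\<^esub> f = f"
    proof
      show "(\<one>\<^bsub>A\<^esub> \<otimes>\<^bsub>A\<^esub> f) n = f n" for n unfolding A_one mono_coeff_mult[OF one f] using f by simp
    qed
  qed
  show "(f \<oplus>\<^bsub>A\<^esub> g) \<otimes>\<^bsub>A\<^esub> h = f \<otimes>\<^bsub>A\<^esub> h \<oplus>\<^bsub>A\<^esub> g \<otimes>\<^bsub>A\<^esub> h"
    if "f \<in> carrier A" "g \<in> carrier A" "h \<in> carrier A" for f g h
    by (rule l_distr_A[OF that])
qed

sublocale A: cring A by (rule rees_cring)

lemma mono_mult_mono: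
  assumes a: "a \<in> Ip i" and b: "b \<in> Ip j"
  shows "mono a i \<otimes>\<^bsub>A\<^esub> mono b j = mono (a \<otimes> b) (i + j)"
proof
  show "(mono a i \<otimes>\<^bsub>A\<^esub> mono b j) n = mono (a \<otimes> b) (i + j) n" for n
    unfolding mono_coeff_mult[OF a mono_closed[OF b]] using ideal_power_closed[OF I a] by (auto simp: mono_def)
qed

lemma mono_add_mono: "mono a i \<oplus>\<^bsub>A\<^esub> mono b i = mono (a \<oplus> b) i"
  by (auto simp: A_add mono_def)

lemma rees_const_mono: "rees_const R a = mono a 0" and rees_u_mono: "rees_u R = mono \<one> (-1)"
  by (auto simp: rees_const_def rees_u_def mono_def)

lemma mono_Ip0: "a \<in> carrier R \<Longrightarrow> i \<le> 0 \<Longrightarrow> a \<in> Ip i" by (simp add: ideal_power_0)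

lemma rees_const_hom: "ring_hom_cring R A (rees_const R)"
proof (intro ring_hom_cring.intro ring_hom_cring_axioms.intro is_cring rees_cring ring_hom_memI)
  show "rees_const R \<one> = \<one>\<^bsub>A\<^esub>" unfolding rees_const_mono A_one ..
  fix a b assume a: "a \<in> carrier R" and b: "b \<in> carrier R"
  show "rees_const R a \<in> carrier A" unfolding rees_const_mono by (rule mono_closed[OF mono_Ip0[OF a]]) simp
  show "rees_const R (a \<otimes> b) = rees_const R a \<otimes>\<^bsub>A\<^esub> rees_const R b"
    unfolding rees_const_mono using mono_mult_mono[OF mono_Ip0[OF a] mono_Ip0[OF b], of 0 0] by simp
  show "rees_const R (a \<oplus> b) = rees_const R a \<oplus>\<^bsub>A\<^esub> rees_const R b"
    unfolding rees_const_mono mono_add_mono ..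
qed

sublocale H: ring_hom_cring R A "rees_const R" by (rule rees_const_hom)

lemma rees_u_closed: "rees_u R \<in> carrier A"
  unfolding rees_u_mono by (rule mono_closed[OF mono_Ip0]) auto

lemma rees_u_pow: "rees_u R [^]\<^bsub>A\<^esub> n = mono \<one> (- int n)"
proof (induction n)
  case 0
  then show ?case by (simp add: A_one)
next
  case (Suc n)
  have "rees_u R [^]\<^bsub>A\<^esub> Suc n = mono \<one> (- int n) \<otimes>\<^bsub>A\<^esub> mono \<one> (-1)" using Suc by (simp add: rees_u_mono)
  also have "\<dots> = mono (\<one> \<otimes> \<one>) (- int n + - 1)" by (rule mono_mult_mono) (auto simp: ideal_power_0)
  also have "- int n + - 1 = - int (Suc n)" by simp
  finally show ?case by simp
qed

text \<open>The Rees ring is generated over \<open>R\<close> by u and the elements b t for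
  generators b of \<open>I\<close>: linearity yields I t, products yield I^n t^n, and powers of u
  yield the negative degrees.\<close>

lemma subring_contains_all:
  assumes C: "subcring C A" and const: "rees_const R ` carrier R \<subseteq> C" and u: "rees_u R \<in> C"
    and B: "I = Idl B" "B \<subseteq> carrier R" and t: "\<And>b. b \<in> B \<Longrightarrow> mono b 1 \<in> C"
  shows "carrier A \<subseteq> C"
proof -
  have Csub: "C \<subseteq> carrier A" using subcringE(1)[OF C] .
  note Cmult = subcringE(6)[OF C] and Cadd = subcringE(7)[OF C]
  have IpI: "Ip 1 = I" using ideal_power_1[OF I] by simp
  have mI: "mono a 1 \<in> C" if "a \<in> I" for a
  proof -
    have "ideal {a \<in> I. mono a 1 \<in> C} R"
    proof (rule cring_idealI)
      interpret I: ideal I R by (rule I)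
      show "{a \<in> I. mono a 1 \<in> C} \<subseteq> carrier R" using I.a_subset by blast
      have "mono \<zero> 1 = \<zero>\<^bsub>A\<^esub>" by (auto simp: mono_def A_zero)
      then show "\<zero> \<in> {a \<in> I. mono a 1 \<in> C}" using subcringE(2)[OF C] by simp
      show "a \<oplus> b \<in> {a \<in> I. mono a 1 \<in> C}" if "a \<in> {a \<in> I. mono a 1 \<in> C}" "b \<in> {a \<in> I. mono a 1 \<in> C}" for a b
        using that Cadd[of "mono a 1" "mono b 1"] by (simp add: mono_add_mono)
      show "r \<otimes> a \<in> {a \<in> I. mono a 1 \<in> C}" if a: "a \<in> {a \<in> I. mono a 1 \<in> C}" and r: "r \<in> carrier R" for a r
      proof -
        have "mono r 0 \<in> C" using const r unfolding rees_const_mono by blast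
        then have "mono r 0 \<otimes>\<^bsub>A\<^esub> mono a 1 \<in> C" using Cmult a by blast
        moreover have "mono r 0 \<otimes>\<^bsub>A\<^esub> mono a 1 = mono (r \<otimes> a) (0 + 1)"
          by (rule mono_mult_mono[OF mono_Ip0[OF r]]) (use a IpI in auto)
        ultimately show ?thesis using a r I.I_l_closed by simp
      qed
    qed
    moreover have "B \<subseteq> {a \<in> I. mono a 1 \<in> C}" using t genideal_self[OF B(2)] B(1) by auto
    ultimately have "Idl B \<subseteq> {a \<in> I. mono a 1 \<in> C}" by (rule genideal_minimal)
    then show ?thesis using that B(1) by auto
  qed
  have mpos: "mono a (int n) \<in> C" if "a \<in> ideal_power R I n" for a n
    using that
  proof (induction n arbitrary: a)
    case 0
    then show ?case using const unfolding rees_const_mono by (auto simp: ideal_power_0)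
  next
    case (Suc n)
    from Suc(2)[unfolded ideal_power_Suc] show ?case
    proof (induction rule: ideal_prod.induct)
      case (prod i j)
      have "mono i (int n) \<otimes>\<^bsub>A\<^esub> mono j 1 = mono (i \<otimes> j) (int n + 1)"
        by (rule mono_mult_mono) (use prod IpI in auto)
      moreover have "mono i (int n) \<otimes>\<^bsub>A\<^esub> mono j 1 \<in> C" using Cmult[OF Suc(1)[OF prod(1)] mI[OF prod(2)]] .
      ultimately show ?case by (simp add: add.commute)
    next
      case (sum a b)
      then show ?case using Cadd[OF sum(3,4)] by (simp add: mono_add_mono)
    qed
  qed
  have mneg: "mono a (- int n) \<in> C" if "a \<in> carrier R" for a n
  proof -
    have "rees_u R [^]\<^bsub>A\<^esub> n \<in> C"
      by (induction n) (use subcringE(3)[OF C] Cmult u in auto)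
    then have "mono a 0 \<otimes>\<^bsub>A\<^esub> mono \<one> (- int n) \<in> C"
      using Cmult const that unfolding rees_const_mono rees_u_pow by blast
    moreover have "mono a 0 \<otimes>\<^bsub>A\<^esub> mono \<one> (- int n) = mono (a \<otimes> \<one>) (0 + - int n)"
      by (rule mono_mult_mono) (use that in \<open>auto simp: ideal_power_0\<close>)
    ultimately show ?thesis using that by simp
  qed
  show ?thesis
  proof
    fix f assume "f \<in> carrier A"
    then show "f \<in> C"
    proof (induction rule: rees_induct)
      case zero
      then show ?case using subcringE(2)[OF C] .
    next
      case (add a i g)
      have "mono a i \<in> C"
      proof (cases "i \<ge> 0")
        case True
        then show ?thesis using mpos[of a "nat i"] add(1) by simp
      next
        case False
        then show ?thesis using mneg[of a "nat (- i)"] ideal_power_closed[OF I add(1)] by simp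
      qed
      then show ?case using Cadd add(3) by simp
    qed
  qed
qed

text \<open>The finitely many generators are adjoined one at a time inside the Rees ring, starting
  from the image of \<open>R\<close>, whose Noetherian property is the case of fractions with
  denominator 1.\<close>

lemma rees_noetherian:
  assumes noeth: "noetherian_ring R"
  shows "noetherian_ring A"
proof -
  obtain B where B: "B \<subseteq> carrier R" "finite B" "I = Idl B" using noetherian_ring.finetely_gen[OF noeth I] by auto
  have Bt: "mono b 1 \<in> carrier A" if "b \<in> B" for b
    by (rule mono_closed) (use that genideal_self[OF B(1)] B(3) ideal_power_1[OF I] in auto)
  have claim: "\<exists>C. subcring C A \<and> noetherian_ring (A\<lparr>carrier := C\<rparr>) \<and> rees_const R ` carrier R \<subseteq> C \<and> F \<subseteq> C"
    if "finite F" "F \<subseteq> carrier A" for F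
    using that
  proof (induction F)
    case empty
    define C where "C = rees_const R ` carrier R"
    have C: "subcring C A" unfolding C_def
      using A.subcringI' H.ring.img_is_subring[OF carrier_is_subring] by blast
    have Cc: "cring (A\<lparr>carrier := C\<rparr>)" using A.subcring_iff[OF subcringE(1)[OF C]] C by simp
    have hom: "rees_const R \<in> ring_hom R (A\<lparr>carrier := C\<rparr>)"
      by (rule ring_hom_memI) (auto simp: C_def)
    interpret N: noetherian_hom R "A\<lparr>carrier := C\<rparr>" "rees_const R"
      by (intro noetherian_hom.intro ring_hom_cring.intro ring_hom_cring_axioms.intro
          noetherian_hom_axioms.intro is_cring Cc hom noeth)
    have "noetherian_ring (A\<lparr>carrier := C\<rparr>)"
    proof (rule N.noetherian_fractions)
      fix k assume "k \<in> carrier (A\<lparr>carrier := C\<rparr>)"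
      then obtain c where c: "c \<in> carrier R" "k = rees_const R c" unfolding C_def by auto
      have "rees_const R \<one> \<in> Units (A\<lparr>carrier := C\<rparr>)" using N.S.Units_one_closed N.hom_one by metis
      moreover have "rees_const R \<one> \<otimes>\<^bsub>A\<lparr>carrier := C\<rparr>\<^esub> k = rees_const R c" unfolding c(2) using c(1) by simp
      ultimately show "\<exists>s\<in>carrier R. \<exists>c\<in>carrier R. rees_const R s \<in> Units (A\<lparr>carrier := C\<rparr>) \<and>
          rees_const R s \<otimes>\<^bsub>A\<lparr>carrier := C\<rparr>\<^esub> k = rees_const R c" using c(1) one_closed by blast
    qed
    then show ?case using C unfolding C_def by blast
  next
    case (insert b F)
    then obtain C where C: "subcring C A" "noetherian_ring (A\<lparr>carrier := C\<rparr>)" "rees_const R ` carrier R \<subseteq> C" "F \<subseteq> C" by auto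
    have Cc: "cring (A\<lparr>carrier := C\<rparr>)" using A.subcring_iff[OF subcringE(1)[OF C(1)]] C(1) by simp
    have hom: "id \<in> ring_hom (A\<lparr>carrier := C\<rparr>) A"
      by (rule ring_hom_memI) (use subcringE(1)[OF C(1)] in auto)
    interpret N: noetherian_hom "A\<lparr>carrier := C\<rparr>" A id
      by (intro noetherian_hom.intro ring_hom_cring.intro ring_hom_cring_axioms.intro
          noetherian_hom_axioms.intro Cc rees_cring hom C(2))
    have b: "b \<in> carrier A" using insert(4) by simp
    note adj = N.noetherian_adjoin_subring[OF b]
    have "C \<subseteq> (\<Union>n. pols (A\<lparr>carrier := C\<rparr>) A id b n)" using adj(4) by simp
    then have "rees_const R ` carrier R \<subseteq> (\<Union>n. pols (A\<lparr>carrier := C\<rparr>) A id b n)"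
      "insert b F \<subseteq> (\<Union>n. pols (A\<lparr>carrier := C\<rparr>) A id b n)" using C(3,4) adj(3) by auto
    then show ?case using adj(1,2) by blast
  qed
  have "\<exists>C. subcring C A \<and> noetherian_ring (A\<lparr>carrier := C\<rparr>) \<and> rees_const R ` carrier R \<subseteq> C
      \<and> insert (rees_u R) ((\<lambda>b. mono b 1) ` B) \<subseteq> C"
    by (rule claim) (use B(2) Bt rees_u_closed in auto)
  then obtain C where C: "subcring C A" "noetherian_ring (A\<lparr>carrier := C\<rparr>)" "rees_const R ` carrier R \<subseteq> C"
    "insert (rees_u R) ((\<lambda>b. mono b 1) ` B) \<subseteq> C" by blast
  have "carrier A \<subseteq> C" by (rule subring_contains_all[OF C(1,3) _ B(3,1)]) (use C(4) in auto)
  then have "C = carrier A" using subcringE(1)[OF C(1)] by auto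
  then have "A\<lparr>carrier := C\<rparr> = A" by simp
  then show ?thesis using C(2) by simp
qed

end

section \<open>Linear combinations with coefficients in prescribed ideals\<close>

context cring
begin

lemma minus_add_eq:
  assumes "a \<in> carrier R" "b \<in> carrier R" "c \<in> carrier R"
  shows "a \<ominus> (b \<oplus> c) = a \<ominus> b \<ominus> c"
  using assms by algebra

text \<open>Each generator has its own ideal of coefficients. The homogeneous parts of a finitely
  generated homogeneous ideal have this shape, the degree of a coefficient depending on the degree
  of its generator.\<close>

definition lincomb :: "'p set \<Rightarrow> ('p \<Rightarrow> 'a) \<Rightarrow> ('p \<Rightarrow> 'a set) \<Rightarrow> 'a set" where
  "lincomb P v D = {\<Oplus>p\<in>P. c p \<otimes> v p | c. \<forall>p\<in>P. c p \<in> D p}"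

lemma lincombI: "(\<And>p. p \<in> P \<Longrightarrow> c p \<in> D p) \<Longrightarrow> (\<Oplus>p\<in>P. c p \<otimes> v p) \<in> lincomb P v D"
  unfolding lincomb_def by auto

lemma lincombE:
  assumes "y \<in> lincomb P v D"
  obtains c where "\<And>p. p \<in> P \<Longrightarrow> c p \<in> D p" "y = (\<Oplus>p\<in>P. c p \<otimes> v p)"
  using assms unfolding lincomb_def by auto

context
  fixes P :: "'p set" and v :: "'p \<Rightarrow> 'a"
  assumes P: "finite P" and v: "\<And>p. p \<in> P \<Longrightarrow> v p \<in> carrier R"
begin

lemma lincomb_scale:
  assumes y: "y \<in> lincomb P v D" and r: "r \<in> carrier R"
    and D: "\<And>p. p \<in> P \<Longrightarrow> D p \<subseteq> carrier R" and D': "\<And>p c. p \<in> P \<Longrightarrow> c \<in> D p \<Longrightarrow> r \<otimes> c \<in> D' p"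
  shows "r \<otimes> y \<in> lincomb P v D'"
proof -
  obtain c where c: "\<And>p. p \<in> P \<Longrightarrow> c p \<in> D p" "y = (\<Oplus>p\<in>P. c p \<otimes> v p)" using y by (rule lincombE) blast
  have cc: "c p \<in> carrier R" if "p \<in> P" for p using c(1)[OF that] D[OF that] by auto
  have "r \<otimes> y = (\<Oplus>p\<in>P. r \<otimes> (c p \<otimes> v p))"
    unfolding c(2) by (rule finsum_rdistr[OF P r]) (use cc v in auto)
  also have "\<dots> = (\<Oplus>p\<in>P. (r \<otimes> c p) \<otimes> v p)"
  proof (rule finsum_cong'[OF refl])
    show "r \<otimes> (c p \<otimes> v p) = r \<otimes> c p \<otimes> v p" if "p \<in> P" for p using cc[OF that] v[OF that] r by (simp add: m_assoc)
  qed (use cc v r in auto)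
  also have "\<dots> \<in> lincomb P v D'" by (rule lincombI) (use c(1) D' in auto)
  finally show ?thesis .
qed

lemma lincomb_ideal:
  assumes D: "\<And>p. p \<in> P \<Longrightarrow> ideal (D p) R"
  shows "ideal (lincomb P v D) R"
proof (rule cring_idealI)
  have Dc: "c \<in> carrier R" if "p \<in> P" "c \<in> D p" for p c using ideal.Icarr[OF D[OF that(1)] that(2)] .
  have D0: "\<zero> \<in> D p" if "p \<in> P" for p using additive_subgroup.zero_closed[OF ideal.axioms(1)[OF D[OF that]]] .
  show "lincomb P v D \<subseteq> carrier R"
  proof
    fix y assume "y \<in> lincomb P v D"
    then obtain c where c: "\<And>p. p \<in> P \<Longrightarrow> c p \<in> D p" "y = (\<Oplus>p\<in>P. c p \<otimes> v p)" by (rule lincombE) blast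
    show "y \<in> carrier R" unfolding c(2) by (rule finsum_closed) (use c(1) Dc v in auto)
  qed
  have "(\<Oplus>p\<in>P. \<zero> \<otimes> v p) = \<zero>" by (rule add.finprod_one_eqI) (use v in auto)
  moreover have "(\<Oplus>p\<in>P. \<zero> \<otimes> v p) \<in> lincomb P v D" by (rule lincombI[of P "\<lambda>_. \<zero>"]) (rule D0)
  ultimately show "\<zero> \<in> lincomb P v D" by simp
  fix y assume y: "y \<in> lincomb P v D"
  show "r \<otimes> y \<in> lincomb P v D" if r: "r \<in> carrier R" for r
    by (rule lincomb_scale[OF y r]) (use Dc ideal.I_l_closed[OF D _ r] in auto)
  fix z assume "z \<in> lincomb P v D"
  then obtain d where d: "\<And>p. p \<in> P \<Longrightarrow> d p \<in> D p" "z = (\<Oplus>p\<in>P. d p \<otimes> v p)" by (rule lincombE) blast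
  obtain c where c: "\<And>p. p \<in> P \<Longrightarrow> c p \<in> D p" "y = (\<Oplus>p\<in>P. c p \<otimes> v p)" using y by (rule lincombE) blast
  have cc: "c p \<in> carrier R" "d p \<in> carrier R" if "p \<in> P" for p using Dc c(1) d(1) that by auto
  have "y \<oplus> z = (\<Oplus>p\<in>P. c p \<otimes> v p \<oplus> d p \<otimes> v p)"
    unfolding c(2) d(2) by (rule finsum_addf[symmetric]) (use cc v in auto)
  also have "\<dots> = (\<Oplus>p\<in>P. (c p \<oplus> d p) \<otimes> v p)"
  proof (rule finsum_cong'[OF refl])
    show "c p \<otimes> v p \<oplus> d p \<otimes> v p = (c p \<oplus> d p) \<otimes> v p" if "p \<in> P" for p using cc[OF that] v[OF that] by (simp add: l_distr)
  qed (use cc v in auto)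
  also have "\<dots> \<in> lincomb P v D"
    by (rule lincombI) (use c(1) d(1) additive_subgroup.a_closed[OF ideal.axioms(1)[OF D]] in auto)
  finally show "y \<oplus> z \<in> lincomb P v D" .
qed

lemma lincomb_single:
  assumes p: "p \<in> P" and c: "c \<in> D p" "c \<in> carrier R" and D: "\<And>p. p \<in> P \<Longrightarrow> \<zero> \<in> D p"
  shows "c \<otimes> v p \<in> lincomb P v D"
proof -
  have "(\<Oplus>q\<in>P. (if p = q then c else \<zero>) \<otimes> v q) = (\<Oplus>q\<in>P. if p = q then c \<otimes> v q else \<zero>)"
    by (rule finsum_cong') (use v c(2) in auto)
  also have "\<dots> = c \<otimes> v p" by (rule finsum_singleton[OF p P]) (use v c(2) in auto)
  finally have eq: "(\<Oplus>q\<in>P. (if p = q then c else \<zero>) \<otimes> v q) = c \<otimes> v p" .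
  have "(\<Oplus>q\<in>P. (if p = q then c else \<zero>) \<otimes> v q) \<in> lincomb P v D"
    by (rule lincombI) (use D c(1) in auto)
  then show ?thesis unfolding eq .
qed

end

end

section \<open>Adic completion\<close>

locale adic = noetherian_cring R for R (structure) + fixes m
  assumes m: "ideal m R"
begin

abbreviation "C \<equiv> adic_completion R m"
abbreviation "mp n \<equiv> ideal_power R m n"
abbreviation "Q n \<equiv> R Quot mp n"
abbreviation "cls n a \<equiv> mp n +> a"
abbreviation "\<phi> \<equiv> completion_map R m"

lemma mp_ideal: "ideal (mp n) R" by (rule ideal_power_ideal[OF m])
lemma Q_cring: "cring (Q n)" using ideal.quotient_is_cring[OF mp_ideal is_cring] .

lemma cls_eq_iff: "a \<in> carrier R \<Longrightarrow> b \<in> carrier R \<Longrightarrow> cls n a = cls n b \<longleftrightarrow> a \<ominus> b \<in> mp n"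
  using quotient_eq_iff_same_a_r_cos[OF mp_ideal] by auto

lemma cls_closed: "a \<in> carrier R \<Longrightarrow> cls n a \<in> carrier (Q n)"
  and cls_mult: "a \<in> carrier R \<Longrightarrow> b \<in> carrier R \<Longrightarrow> cls n (a \<otimes> b) = cls n a \<otimes>\<^bsub>Q n\<^esub> cls n b"
  and cls_add: "a \<in> carrier R \<Longrightarrow> b \<in> carrier R \<Longrightarrow> cls n (a \<oplus> b) = cls n a \<oplus>\<^bsub>Q n\<^esub> cls n b"
  and cls_one: "cls n \<one> = \<one>\<^bsub>Q n\<^esub>"
  using ideal.rcos_ring_hom[OF mp_ideal, of n] unfolding ring_hom_def by auto

lemma cls_zero: "cls n \<zero> = \<zero>\<^bsub>Q n\<^esub>"
  using ring_hom_zero[OF ideal.rcos_ring_hom[OF mp_ideal] ring_axioms cring.axioms(1)[OF Q_cring]] .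

lemma cls_surj: assumes "y \<in> carrier (Q n)" obtains a where "a \<in> carrier R" "y = cls n a"
  using assms unfolding FactRing_def A_RCOSETS_def' by auto

lemma cls_subset_iff:
  assumes "a \<in> carrier R" "b \<in> carrier R"
  shows "cls (Suc n) a \<subseteq> cls n b \<longleftrightarrow> a \<ominus> b \<in> mp n"
proof
  assume "cls (Suc n) a \<subseteq> cls n b"
  moreover have "a \<in> cls (Suc n) a" using abelian_subgroup.a_rcos_self[OF ideal.axioms(1)[THEN abelian_subgroupI3, OF mp_ideal is_abelian_group] assms(1)] .
  ultimately have "a \<in> cls n b" by auto
  then obtain j where "j \<in> mp n" "a = j \<oplus> b" unfolding a_r_coset_def' by auto
  moreover then have "j \<in> carrier R" using ideal.Icarr[OF mp_ideal] by blast
  moreover have "(j \<oplus> b) \<ominus> b = j" using \<open>j \<in> carrier R\<close> assms(2) by algebra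
  ultimately show "a \<ominus> b \<in> mp n" by simp
next
  assume "a \<ominus> b \<in> mp n"
  then have "cls n a = cls n b" using cls_eq_iff assms by simp
  moreover have "cls (Suc n) a \<subseteq> cls n a" unfolding a_r_coset_def' using ideal_power_Suc_subset[OF m, of n] by auto
  ultimately show "cls (Suc n) a \<subseteq> cls n b" by simp
qed

lemma C_mem: "f \<in> carrier C \<longleftrightarrow> (\<forall>n. f n \<in> carrier (Q n)) \<and> (\<forall>n. f (Suc n) \<subseteq> f n)"
  and C_mult: "f \<otimes>\<^bsub>C\<^esub> g = (\<lambda>n. f n \<otimes>\<^bsub>Q n\<^esub> g n)"
  and C_add: "f \<oplus>\<^bsub>C\<^esub> g = (\<lambda>n. f n \<oplus>\<^bsub>Q n\<^esub> g n)"
  and C_one: "\<one>\<^bsub>C\<^esub> = (\<lambda>n. \<one>\<^bsub>Q n\<^esub>)"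
  and C_zero: "\<zero>\<^bsub>C\<^esub> = (\<lambda>n. \<zero>\<^bsub>Q n\<^esub>)"
  unfolding adic_completion_def by simp_all

lemma rep_exists:
  assumes "f \<in> carrier C" obtains a where "a \<in> carrier R" "f n = cls n a"
  using assms cls_surj unfolding C_mem by metis

lemma rep_Suc:
  assumes f: "f \<in> carrier C" and a: "a \<in> carrier R" "f (Suc n) = cls (Suc n) a"
  shows "f n = cls n a"
proof -
  obtain b where b: "b \<in> carrier R" "f n = cls n b" using rep_exists[OF f] .
  have "cls (Suc n) a \<subseteq> cls n b" using f a(2) b(2) unfolding C_mem by metis
  then have "cls n a = cls n b" using cls_subset_iff[OF a(1) b(1), of n] cls_eq_iff[OF a(1) b(1), of n] by simp
  then show ?thesis using b(2) by simp
qed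

lemma C_memI:
  assumes "\<And>n. a n \<in> carrier R" "\<And>n. f n = cls n (a n)" "\<And>n. f n = cls n (a (Suc n))"
  shows "f \<in> carrier C"
  unfolding C_mem
proof (intro conjI allI)
  fix n
  show "f n \<in> carrier (Q n)" using cls_closed assms(1,2) by simp
  have "cls (Suc n) (a (Suc n)) \<subseteq> cls n (a (Suc n))"
    using cls_subset_iff[OF assms(1) assms(1), of n "Suc n" "Suc n"] cls_eq_iff[OF assms(1) assms(1), of n "Suc n" "Suc n"] by simp
  then show "f (Suc n) \<subseteq> f n" using assms(2)[of "Suc n"] assms(3)[of n] by simp
qed

lemma reps:
  assumes f: "f \<in> carrier C"
  obtains a where "\<And>n. a n \<in> carrier R" "\<And>n. f n = cls n (a n)" "\<And>n. f n = cls n (a (Suc n))"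
proof -
  have "\<forall>n. \<exists>a. a \<in> carrier R \<and> f n = cls n a" using rep_exists[OF f] by metis
  then obtain a where a: "\<And>n. a n \<in> carrier R" "\<And>n. f n = cls n (a n)" by metis
  then show thesis using that[of a] rep_Suc[OF f a(1) a(2)] by simp
qed

lemma completion_cring: "cring C"
proof (rule cringI)
  have add: "f \<oplus>\<^bsub>C\<^esub> g \<in> carrier C" if f: "f \<in> carrier C" and g: "g \<in> carrier C" for f g
  proof -
    obtain a where a: "\<And>n. a n \<in> carrier R" "\<And>n. f n = cls n (a n)" "\<And>n. f n = cls n (a (Suc n))" using reps[OF f] by metis
    obtain b where b: "\<And>n. b n \<in> carrier R" "\<And>n. g n = cls n (b n)" "\<And>n. g n = cls n (b (Suc n))" using reps[OF g] by metis
    show ?thesis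
    proof (rule C_memI[of "\<lambda>n. a n \<oplus> b n"])
      show "a n \<oplus> b n \<in> carrier R" for n using a b by simp
      show "(f \<oplus>\<^bsub>C\<^esub> g) n = cls n (a n \<oplus> b n)" for n using a(1,2)[of n] b(1,2)[of n] by (simp add: C_add cls_add)
      show "(f \<oplus>\<^bsub>C\<^esub> g) n = cls n (a (Suc n) \<oplus> b (Suc n))" for n
        using a(1)[of "Suc n"] b(1)[of "Suc n"] a(3)[of n] b(3)[of n] by (simp add: C_add cls_add)
    qed
  qed
  have mult: "f \<otimes>\<^bsub>C\<^esub> g \<in> carrier C" if f: "f \<in> carrier C" and g: "g \<in> carrier C" for f g
  proof -
    obtain a where a: "\<And>n. a n \<in> carrier R" "\<And>n. f n = cls n (a n)" "\<And>n. f n = cls n (a (Suc n))" using reps[OF f] by metis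
    obtain b where b: "\<And>n. b n \<in> carrier R" "\<And>n. g n = cls n (b n)" "\<And>n. g n = cls n (b (Suc n))" using reps[OF g] by metis
    show ?thesis
    proof (rule C_memI[of "\<lambda>n. a n \<otimes> b n"])
      show "a n \<otimes> b n \<in> carrier R" for n using a b by simp
      show "(f \<otimes>\<^bsub>C\<^esub> g) n = cls n (a n \<otimes> b n)" for n using a(1,2)[of n] b(1,2)[of n] by (simp add: C_mult cls_mult)
      show "(f \<otimes>\<^bsub>C\<^esub> g) n = cls n (a (Suc n) \<otimes> b (Suc n))" for n
        using a(1)[of "Suc n"] b(1)[of "Suc n"] a(3)[of n] b(3)[of n] by (simp add: C_mult cls_mult)
    qed
  qed
  have at: "f n \<in> carrier (Q n)" if "f \<in> carrier C" for f n using that by (simp add: C_mem)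
  show "abelian_group C"
  proof (rule abelian_groupI)
    show "\<zero>\<^bsub>C\<^esub> \<in> carrier C" by (rule C_memI[of "\<lambda>_. \<zero>"]) (simp_all add: C_zero cls_zero)
    fix f g h assume f: "f \<in> carrier C" and g: "g \<in> carrier C" and h: "h \<in> carrier C"
    show "f \<oplus>\<^bsub>C\<^esub> g \<in> carrier C" by (rule add[OF f g])
    show "f \<oplus>\<^bsub>C\<^esub> g \<oplus>\<^bsub>C\<^esub> h = f \<oplus>\<^bsub>C\<^esub> (g \<oplus>\<^bsub>C\<^esub> h)" unfolding C_add
    proof
      fix n interpret Q: cring "Q n" by (rule Q_cring)
      show "f n \<oplus>\<^bsub>Q n\<^esub> g n \<oplus>\<^bsub>Q n\<^esub> h n = f n \<oplus>\<^bsub>Q n\<^esub> (g n \<oplus>\<^bsub>Q n\<^esub> h n)" using Q.a_assoc[OF at[OF f] at[OF g] at[OF h]] .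
    qed
    show "f \<oplus>\<^bsub>C\<^esub> g = g \<oplus>\<^bsub>C\<^esub> f" unfolding C_add
    proof
      fix n interpret Q: cring "Q n" by (rule Q_cring)
      show "f n \<oplus>\<^bsub>Q n\<^esub> g n = g n \<oplus>\<^bsub>Q n\<^esub> f n" using Q.a_comm[OF at[OF f] at[OF g]] .
    qed
    show "\<zero>\<^bsub>C\<^esub> \<oplus>\<^bsub>C\<^esub> f = f" unfolding C_add C_zero
    proof
      fix n interpret Q: cring "Q n" by (rule Q_cring)
      show "\<zero>\<^bsub>Q n\<^esub> \<oplus>\<^bsub>Q n\<^esub> f n = f n" using Q.l_zero[OF at[OF f]] .
    qed
    obtain a where a: "\<And>n. a n \<in> carrier R" "\<And>n. f n = cls n (a n)" "\<And>n. f n = cls n (a (Suc n))" using reps[OF f] by metis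
    let ?g = "\<lambda>n. cls n (\<ominus> (a n))"
    have "?g \<in> carrier C"
    proof (rule C_memI[of "\<lambda>n. \<ominus> (a n)"])
      fix n
      have "a n \<ominus> a (Suc n) \<in> mp n" using a cls_eq_iff by metis
      then have "\<ominus> (a n \<ominus> a (Suc n)) \<in> mp n" by (rule ideal_power_uminus[OF m])
      moreover have "\<ominus> (a n \<ominus> a (Suc n)) = (\<ominus> (a n)) \<ominus> (\<ominus> (a (Suc n)))" using a(1)[of n] a(1)[of "Suc n"] by algebra
      ultimately show "cls n (\<ominus> (a n)) = cls n (\<ominus> (a (Suc n)))"
        using cls_eq_iff[of "\<ominus> (a n)" "\<ominus> (a (Suc n))" n] a(1)[of n] a(1)[of "Suc n"] by simp
    qed (use a(1) in simp_all)
    moreover have "?g \<oplus>\<^bsub>C\<^esub> f = \<zero>\<^bsub>C\<^esub>" unfolding C_add C_zero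
    proof
      fix n
      have "cls n (\<ominus> a n) \<oplus>\<^bsub>Q n\<^esub> f n = cls n (\<ominus> a n \<oplus> a n)" using a(1,2)[of n] by (simp add: cls_add)
      also have "\<dots> = \<zero>\<^bsub>Q n\<^esub>" using a(1)[of n] by (simp add: l_neg cls_zero)
      finally show "cls n (\<ominus> a n) \<oplus>\<^bsub>Q n\<^esub> f n = \<zero>\<^bsub>Q n\<^esub>" .
    qed
    ultimately show "\<exists>g\<in>carrier C. g \<oplus>\<^bsub>C\<^esub> f = \<zero>\<^bsub>C\<^esub>" by (intro bexI[of _ ?g])
  qed
  show "comm_monoid C"
  proof (rule comm_monoidI)
    show "\<one>\<^bsub>C\<^esub> \<in> carrier C" by (rule C_memI[of "\<lambda>_. \<one>"]) (simp_all add: C_one cls_one)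
    fix f g h assume f: "f \<in> carrier C" and g: "g \<in> carrier C" and h: "h \<in> carrier C"
    show "f \<otimes>\<^bsub>C\<^esub> g \<in> carrier C" by (rule mult[OF f g])
    show "f \<otimes>\<^bsub>C\<^esub> g \<otimes>\<^bsub>C\<^esub> h = f \<otimes>\<^bsub>C\<^esub> (g \<otimes>\<^bsub>C\<^esub> h)" unfolding C_mult
    proof
      fix n interpret Q: cring "Q n" by (rule Q_cring)
      show "f n \<otimes>\<^bsub>Q n\<^esub> g n \<otimes>\<^bsub>Q n\<^esub> h n = f n \<otimes>\<^bsub>Q n\<^esub> (g n \<otimes>\<^bsub>Q n\<^esub> h n)" using Q.m_assoc[OF at[OF f] at[OF g] at[OF h]] .
    qed
    show "f \<otimes>\<^bsub>C\<^esub> g = g \<otimes>\<^bsub>C\<^esub> f" unfolding C_mult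
    proof
      fix n interpret Q: cring "Q n" by (rule Q_cring)
      show "f n \<otimes>\<^bsub>Q n\<^esub> g n = g n \<otimes>\<^bsub>Q n\<^esub> f n" using Q.m_comm[OF at[OF f] at[OF g]] .
    qed
    show "\<one>\<^bsub>C\<^esub> \<otimes>\<^bsub>C\<^esub> f = f" unfolding C_mult C_one
    proof
      fix n interpret Q: cring "Q n" by (rule Q_cring)
      show "\<one>\<^bsub>Q n\<^esub> \<otimes>\<^bsub>Q n\<^esub> f n = f n" using Q.l_one[OF at[OF f]] .
    qed
  qed
  fix f g h assume f: "f \<in> carrier C" and g: "g \<in> carrier C" and h: "h \<in> carrier C"
  show "(f \<oplus>\<^bsub>C\<^esub> g) \<otimes>\<^bsub>C\<^esub> h = f \<otimes>\<^bsub>C\<^esub> h \<oplus>\<^bsub>C\<^esub> g \<otimes>\<^bsub>C\<^esub> h" unfolding C_mult C_add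
  proof
    fix n interpret Q: cring "Q n" by (rule Q_cring)
    show "(f n \<oplus>\<^bsub>Q n\<^esub> g n) \<otimes>\<^bsub>Q n\<^esub> h n = f n \<otimes>\<^bsub>Q n\<^esub> h n \<oplus>\<^bsub>Q n\<^esub> g n \<otimes>\<^bsub>Q n\<^esub> h n" using Q.l_distr[OF at[OF f] at[OF g] at[OF h]] .
  qed
qed

sublocale C: cring C by (rule completion_cring)

lemma phi_apply: "\<phi> a n = cls n a" by (simp add: completion_map_def)

lemma phi_hom: "ring_hom_cring R C \<phi>"
proof (intro ring_hom_cring.intro ring_hom_cring_axioms.intro is_cring completion_cring ring_hom_memI)
  show "\<phi> \<one> = \<one>\<^bsub>C\<^esub>" by (auto simp: phi_apply C_one cls_one)
  fix a b assume a: "a \<in> carrier R" and b: "b \<in> carrier R"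
  show "\<phi> (a \<otimes> b) = \<phi> a \<otimes>\<^bsub>C\<^esub> \<phi> b" using a b by (auto simp: phi_apply C_mult cls_mult)
  show "\<phi> (a \<oplus> b) = \<phi> a \<oplus>\<^bsub>C\<^esub> \<phi> b" using a b by (auto simp: phi_apply C_add cls_add)
next
  show "\<phi> a \<in> carrier C" if "a \<in> carrier R" for a
    by (rule C_memI[of "\<lambda>_. a"]) (use that in \<open>simp_all add: phi_apply\<close>)
qed

sublocale H: ring_hom_cring R C \<phi> by (rule phi_hom)

text \<open>The kernel of the projection to R / m^n. These ideals define the topology of
  \<open>C\<close>. That \<open>F 1\<close> is the extension of \<open>m\<close> is a fact that
  needs finite generation of \<open>m\<close> and completeness; it is
  \<open>F_one_generated\<close>.\<close>

definition "F n = {f \<in> carrier C. f n = cls n \<zero>}"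

lemma F_rep_iff: "f \<in> carrier C \<Longrightarrow> a \<in> carrier R \<Longrightarrow> f n = cls n a \<Longrightarrow> f \<in> F n \<longleftrightarrow> a \<in> mp n"
  unfolding F_def using cls_eq_iff[of a \<zero> n] by (simp add: minus_eq)

lemma F_phi_iff: "a \<in> carrier R \<Longrightarrow> \<phi> a \<in> F n \<longleftrightarrow> a \<in> mp n"
  using F_rep_iff[of "\<phi> a" a n] by (simp add: phi_apply)

lemma F_closed: "f \<in> F n \<Longrightarrow> f \<in> carrier C" unfolding F_def by simp

lemma F_ideal: "ideal (F n) C"
proof (rule C.cring_idealI)
  interpret Q: cring "Q n" by (rule Q_cring)
  show "F n \<subseteq> carrier C" unfolding F_def by auto
  show "\<zero>\<^bsub>C\<^esub> \<in> F n" unfolding F_def by (simp add: cls_zero C_zero[THEN fun_cong])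
  show "f \<oplus>\<^bsub>C\<^esub> g \<in> F n" if "f \<in> F n" "g \<in> F n" for f g
    using that unfolding F_def by (simp add: C_add[THEN fun_cong] cls_zero)
  show "r \<otimes>\<^bsub>C\<^esub> f \<in> F n" if "f \<in> F n" "r \<in> carrier C" for f r
  proof -
    have "r n \<in> carrier (Q n)" using that(2) C_mem by auto
    then show ?thesis using that unfolding F_def by (simp add: C_mult[THEN fun_cong] cls_zero)
  qed
qed

lemma F_approx:
  assumes f: "f \<in> carrier C" obtains a where "a \<in> carrier R" "f \<ominus>\<^bsub>C\<^esub> \<phi> a \<in> F n"
proof -
  obtain a where a: "a \<in> carrier R" "f n = cls n a" using rep_exists[OF f] .
  have "(f \<ominus>\<^bsub>C\<^esub> \<phi> a) n = f n \<oplus>\<^bsub>Q n\<^esub> cls n (\<ominus> a)"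
    using a(1) by (simp add: a_minus_def C_add phi_apply flip: H.hom_a_inv)
  also have "\<dots> = cls n (a \<oplus> \<ominus> a)" using a by (simp add: cls_add)
  also have "\<dots> = cls n \<zero>" using a(1) by (simp add: r_neg)
  finally have "f \<ominus>\<^bsub>C\<^esub> \<phi> a \<in> F n" using f a(1) unfolding F_def by simp
  then show thesis using that a(1) by simp
qed

lemma F_diff_iff:
  assumes f: "f \<in> carrier C" and g: "g \<in> carrier C"
  shows "f \<ominus>\<^bsub>C\<^esub> g \<in> F n \<longleftrightarrow> f n = g n"
proof -
  interpret Q: cring "Q n" by (rule Q_cring)
  have c: "f n \<in> carrier (Q n)" "g n \<in> carrier (Q n)" "(f \<ominus>\<^bsub>C\<^esub> g) n \<in> carrier (Q n)" using f g C.minus_closed C_mem by blast+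
  have "(f \<ominus>\<^bsub>C\<^esub> g) \<oplus>\<^bsub>C\<^esub> g = f" using f g by algebra
  then have eq: "(f \<ominus>\<^bsub>C\<^esub> g) n \<oplus>\<^bsub>Q n\<^esub> g n = f n" by (simp add: C_add fun_eq_iff)
  show ?thesis
  proof
    assume "f \<ominus>\<^bsub>C\<^esub> g \<in> F n"
    then have "(f \<ominus>\<^bsub>C\<^esub> g) n = \<zero>\<^bsub>Q n\<^esub>" unfolding F_def by (simp add: cls_zero)
    then show "f n = g n" using eq c(2) by simp
  next
    assume "f n = g n"
    then have "(f \<ominus>\<^bsub>C\<^esub> g) n \<oplus>\<^bsub>Q n\<^esub> g n = \<zero>\<^bsub>Q n\<^esub> \<oplus>\<^bsub>Q n\<^esub> g n" using eq c(2) by simp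
    then have "(f \<ominus>\<^bsub>C\<^esub> g) n = \<zero>\<^bsub>Q n\<^esub>" by (rule Q.add.r_cancel[OF _ c(3) Q.zero_closed c(2)])
    then show "f \<ominus>\<^bsub>C\<^esub> g \<in> F n" unfolding F_def using f g by (simp add: cls_zero)
  qed
qed

lemma F_Suc: "F (Suc n) \<subseteq> F n"
  unfolding F_def using rep_Suc[OF _ zero_closed] by auto

lemma F_antimono: "i \<le> j \<Longrightarrow> F j \<subseteq> F i"
  by (rule lift_Suc_antimono_le[of F, OF F_Suc])

lemma F_0: "F 0 = carrier C"
proof -
  have "f \<in> F 0" if f: "f \<in> carrier C" for f
  proof -
    obtain a where "a \<in> carrier R" "f 0 = cls 0 a" using rep_exists[OF f] .
    then show ?thesis using F_rep_iff[OF f] by (simp add: ideal_power_0)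
  qed
  then show ?thesis using F_closed by blast
qed

lemma F_zero: assumes f: "\<And>n. f \<in> F n" shows "f = \<zero>\<^bsub>C\<^esub>"
  using assms unfolding F_def C_zero by (auto simp: cls_zero)

text \<open>Representatives are taken at level i + j, where the product has to be tested; they
  represent the components at the lower levels i and j as well.\<close>

lemma F_mult:
  assumes f: "f \<in> F i" and g: "g \<in> F j"
  shows "f \<otimes>\<^bsub>C\<^esub> g \<in> F (i + j)"
proof -
  note c = F_closed[OF f] F_closed[OF g]
  obtain a where a: "a \<in> carrier R" "f (i + j) = cls (i + j) a" using rep_exists[OF c(1)] .
  obtain b where b: "b \<in> carrier R" "g (i + j) = cls (i + j) b" using rep_exists[OF c(2)] .
  have low: "k n = cls n d" if "k \<in> carrier C" "d \<in> carrier R" "k (n + l) = cls (n + l) d" for k d n l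
    using that(3) by (induction l) (use rep_Suc[OF that(1,2)] in auto)
  have "f i = cls i a" "g j = cls j b" using low[of f a i j] low[of g b j i] a b c by (simp_all add: add.commute)
  then have "a \<in> mp i" "b \<in> mp j" using F_rep_iff c a(1) b(1) f g by blast+
  then have "a \<otimes> b \<in> mp (i + j)" by (rule ideal_power_mult[OF m])
  moreover have "(f \<otimes>\<^bsub>C\<^esub> g) (i + j) = cls (i + j) (a \<otimes> b)" using a b by (simp add: C_mult cls_mult)
  ultimately show ?thesis using F_rep_iff[of "f \<otimes>\<^bsub>C\<^esub> g" "a \<otimes> b"] a(1) b(1) c by simp
qed

text \<open>The limit is the diagonal: component \<open>l\<close> no longer changes from T l
  on.\<close>

lemma limit_exists:
  assumes T: "\<And>l::nat. T l \<in> carrier C" "\<And>l. T (Suc l) \<ominus>\<^bsub>C\<^esub> T l \<in> F l"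
  obtains s where "s \<in> carrier C" "\<And>l. s \<ominus>\<^bsub>C\<^esub> T l \<in> F l"
proof -
  define s where "s = (\<lambda>l. T l l)"
  have "\<forall>l. \<exists>a. a \<in> carrier R \<and> T l l = cls l a" using rep_exists[OF T(1)] by metis
  then obtain a where a: "\<And>l. a l \<in> carrier R" "\<And>l. T l l = cls l (a l)" by metis
  have "s \<in> carrier C"
  proof (rule C_memI[OF a(1)])
    show "s n = cls n (a n)" for n unfolding s_def using a(2) .
    show "s n = cls n (a (Suc n))" for n
      unfolding s_def using T(2)[of n] F_diff_iff[OF T(1) T(1)] rep_Suc[OF T(1) a(1) a(2)] by simp
  qed
  moreover have "s \<ominus>\<^bsub>C\<^esub> T l \<in> F l" for l using F_diff_iff[OF \<open>s \<in> carrier C\<close> T(1)] unfolding s_def by simp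
  ultimately show thesis using that by simp
qed

text \<open>Since \<open>v\<close> is in \<open>F 1\<close>, adding one more term alters a partial
  sum of \<open>l\<close> terms only within F l. All tails are built simultaneously because the
  recursion ties s n to s (n+1).\<close>

lemma v_complete:
  assumes v: "v \<in> F 1" and a: "\<And>n::nat. a n \<in> carrier C"
  shows "\<exists>s. \<forall>n. s n \<in> carrier C \<and> s n = a n \<oplus>\<^bsub>C\<^esub> v \<otimes>\<^bsub>C\<^esub> s (Suc n)"
proof -
  note vc = F_closed[OF v]
  \<comment> \<open>\<open>T l n\<close> is the sum of the first \<open>l\<close> terms of the
    series that starts at index \<open>n\<close>.\<close>
  define T where "T = rec_nat (\<lambda>n. \<zero>\<^bsub>C\<^esub>) (\<lambda>l t n. a n \<oplus>\<^bsub>C\<^esub> v \<otimes>\<^bsub>C\<^esub> t (Suc n))"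
  have T0: "T 0 n = \<zero>\<^bsub>C\<^esub>" and TS: "T (Suc l) n = a n \<oplus>\<^bsub>C\<^esub> v \<otimes>\<^bsub>C\<^esub> T l (Suc n)" for n l unfolding T_def by simp_all
  have Tc: "T l n \<in> carrier C" for l n by (induction l arbitrary: n) (use T0 TS a vc in auto)
  have step: "T (Suc l) n \<ominus>\<^bsub>C\<^esub> T l n \<in> F l" for l n
  proof (induction l arbitrary: n)
    case 0
    then show ?case unfolding F_0 using Tc by simp
  next
    case (Suc l)
    have "T (Suc (Suc l)) n \<ominus>\<^bsub>C\<^esub> T (Suc l) n = v \<otimes>\<^bsub>C\<^esub> (T (Suc l) (Suc n) \<ominus>\<^bsub>C\<^esub> T l (Suc n))"
      unfolding TS[of "Suc l" n] TS[of l n] using a[of n] vc Tc[of "Suc l" "Suc n"] Tc[of l "Suc n"] by algebra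
    also have "\<dots> \<in> F (1 + l)" by (rule F_mult[OF v Suc])
    finally show ?case by simp
  qed
  have "\<exists>s. s \<in> carrier C \<and> (\<forall>l. s \<ominus>\<^bsub>C\<^esub> T l n \<in> F l)" for n
    using limit_exists[of "\<lambda>l. T l n"] Tc step by metis
  then obtain s where s: "\<And>n. s n \<in> carrier C" "\<And>n l. s n \<ominus>\<^bsub>C\<^esub> T l n \<in> F l" by metis
  have "s n = a n \<oplus>\<^bsub>C\<^esub> v \<otimes>\<^bsub>C\<^esub> s (Suc n)" for n
  proof -
    have rhs: "a n \<oplus>\<^bsub>C\<^esub> v \<otimes>\<^bsub>C\<^esub> s (Suc n) \<in> carrier C" using a s(1) vc by simp
    have "s n \<ominus>\<^bsub>C\<^esub> (a n \<oplus>\<^bsub>C\<^esub> v \<otimes>\<^bsub>C\<^esub> s (Suc n)) \<in> F l" for l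
    proof -
      have "s n \<ominus>\<^bsub>C\<^esub> (a n \<oplus>\<^bsub>C\<^esub> v \<otimes>\<^bsub>C\<^esub> s (Suc n)) =
        (s n \<ominus>\<^bsub>C\<^esub> T (Suc l) n) \<ominus>\<^bsub>C\<^esub> v \<otimes>\<^bsub>C\<^esub> (s (Suc n) \<ominus>\<^bsub>C\<^esub> T l (Suc n))"
        unfolding TS[of l n] using a[of n] vc Tc[of l "Suc n"] s(1)[of n] s(1)[of "Suc n"] by algebra
      moreover have "v \<otimes>\<^bsub>C\<^esub> (s (Suc n) \<ominus>\<^bsub>C\<^esub> T l (Suc n)) \<in> F l" by (rule ideal.I_l_closed[OF F_ideal s(2) vc])
      moreover have "s n \<ominus>\<^bsub>C\<^esub> T (Suc l) n \<in> F l" using s(2)[of n "Suc l"] F_Suc by blast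
      ultimately show ?thesis using C.ideal_minus_closed[OF F_ideal] by simp
    qed
    then have "s n \<ominus>\<^bsub>C\<^esub> (a n \<oplus>\<^bsub>C\<^esub> v \<otimes>\<^bsub>C\<^esub> s (Suc n)) = \<zero>\<^bsub>C\<^esub>" by (rule F_zero)
    then show ?thesis using C.r_right_minus_eq[OF s(1) rhs] by simp
  qed
  then show ?thesis using s(1) by blast
qed


text \<open>Successive approximation. The number k p plays the part of the order of the generator g
  p: a remainder in F n is corrected with coefficients in m^(n - k p), so that the coefficients of
  each generator form a Cauchy sequence. The truncated difference means no condition while n is
  below k p.\<close>

lemma ideal_generated_if_graded:
  fixes g :: "'p \<Rightarrow> nat \<Rightarrow> 'a set" and k :: "'p \<Rightarrow> nat"
  assumes P: "finite P" and J: "ideal J C" and g: "\<And>p. p \<in> P \<Longrightarrow> g p \<in> J"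
    and approx: "\<And>n f. f \<in> J \<Longrightarrow> f \<in> F n \<Longrightarrow>
      \<exists>a. (\<forall>p\<in>P. a p \<in> mp (n - k p)) \<and> f \<ominus>\<^bsub>C\<^esub> (\<Oplus>\<^bsub>C\<^esub>p\<in>P. \<phi> (a p) \<otimes>\<^bsub>C\<^esub> g p) \<in> F (Suc n)"
  shows "J = Idl\<^bsub>C\<^esub> (g ` P)"
proof
  interpret J: ideal J C by fact
  have gc: "g p \<in> carrier C" if "p \<in> P" for p using J.Icarr[OF g[OF that]] .
  have gsub: "g ` P \<subseteq> carrier C" using gc by blast
  show "Idl\<^bsub>C\<^esub> (g ` P) \<subseteq> J" by (rule C.genideal_minimal[OF J]) (use g in blast)
  have mpc: "a \<in> carrier R" if "a \<in> mp n" for a n using ideal_power_closed[OF m that] .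
  define comb where "comb c = (\<Oplus>\<^bsub>C\<^esub>p\<in>P. c p \<otimes>\<^bsub>C\<^esub> g p)" for c
  have comb_closed: "comb c \<in> carrier C" if "\<And>p. p \<in> P \<Longrightarrow> c p \<in> carrier C" for c
    unfolding comb_def by (rule C.finsum_closed) (use that gc in auto)
  have comb_J: "comb c \<in> J" if "\<And>p. p \<in> P \<Longrightarrow> c p \<in> carrier C" for c
    unfolding comb_def by (rule C.finsum_ideal[OF J]) (use that g J.I_l_closed in auto)
  have comb_add: "comb (\<lambda>p. c p \<oplus>\<^bsub>C\<^esub> d p) = comb c \<oplus>\<^bsub>C\<^esub> comb d"
    if c: "\<And>p. p \<in> P \<Longrightarrow> c p \<in> carrier C" and d: "\<And>p. p \<in> P \<Longrightarrow> d p \<in> carrier C" for c d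
  proof -
    have "comb (\<lambda>p. c p \<oplus>\<^bsub>C\<^esub> d p) = (\<Oplus>\<^bsub>C\<^esub>p\<in>P. c p \<otimes>\<^bsub>C\<^esub> g p \<oplus>\<^bsub>C\<^esub> d p \<otimes>\<^bsub>C\<^esub> g p)"
      unfolding comb_def
    proof (rule C.finsum_cong'[OF refl])
      show "(c p \<oplus>\<^bsub>C\<^esub> d p) \<otimes>\<^bsub>C\<^esub> g p = c p \<otimes>\<^bsub>C\<^esub> g p \<oplus>\<^bsub>C\<^esub> d p \<otimes>\<^bsub>C\<^esub> g p" if "p \<in> P" for p
        by (rule C.l_distr[OF c[OF that] d[OF that] gc[OF that]])
    qed (use c d gc in auto)
    also have "\<dots> = comb c \<oplus>\<^bsub>C\<^esub> comb d"
      unfolding comb_def by (rule C.finsum_addf) (use c d gc in auto)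
    finally show ?thesis .
  qed
  have comb_F: "comb c \<in> F n" if "\<And>p. p \<in> P \<Longrightarrow> c p \<in> F n" for c n
    unfolding comb_def
  proof (rule C.finsum_ideal[OF F_ideal])
    show "c p \<otimes>\<^bsub>C\<^esub> g p \<in> F n" if "p \<in> P" for p
      by (rule ideal.I_r_closed[OF F_ideal \<open>\<And>p. p \<in> P \<Longrightarrow> c p \<in> F n\<close>[OF that] gc[OF that]])
  qed
  show "J \<subseteq> Idl\<^bsub>C\<^esub> (g ` P)"
  proof
    fix f assume f: "f \<in> J"
    have fc: "f \<in> carrier C" using J.Icarr[OF f] .
    \<comment> \<open>\<open>q n p\<close> is the coefficient of g p after \<open>n\<close>
      corrections; the last condition bounds the following correction.\<close>
    have "\<exists>q. \<forall>n. ((\<forall>p\<in>P. q n p \<in> carrier R) \<and> f \<ominus>\<^bsub>C\<^esub> comb (\<lambda>p. \<phi> (q n p)) \<in> F n)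
      \<and> (\<forall>p\<in>P. q (Suc n) p \<ominus> q n p \<in> mp (n - k p))"
    proof (rule dependent_nat_choice)
      show "\<exists>q. (\<forall>p\<in>P. q p \<in> carrier R) \<and> f \<ominus>\<^bsub>C\<^esub> comb (\<lambda>p. \<phi> (q p)) \<in> F 0"
        unfolding F_0 using fc comb_closed[of "\<lambda>p. \<phi> \<zero>"] by (intro exI[of _ "\<lambda>_. \<zero>"]) simp
      fix q n assume q: "(\<forall>p\<in>P. q p \<in> carrier R) \<and> f \<ominus>\<^bsub>C\<^esub> comb (\<lambda>p. \<phi> (q p)) \<in> F n"
      let ?r = "f \<ominus>\<^bsub>C\<^esub> comb (\<lambda>p. \<phi> (q p))"
      have cq: "\<And>p. p \<in> P \<Longrightarrow> \<phi> (q p) \<in> carrier C" using q by simp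
      have rF: "?r \<in> F n" using q by simp
      have rJ: "?r \<in> J" using C.ideal_minus_closed[OF J f comb_J[of "\<lambda>p. \<phi> (q p)"]] cq by simp
      obtain a where a: "\<forall>p\<in>P. a p \<in> mp (n - k p)"
        "?r \<ominus>\<^bsub>C\<^esub> comb (\<lambda>p. \<phi> (a p)) \<in> F (Suc n)"
        using approx[OF rJ rF] unfolding comb_def by blast
      have ac: "a p \<in> carrier R" if "p \<in> P" for p using a(1) mpc that by blast
      have ca: "\<And>p. p \<in> P \<Longrightarrow> \<phi> (a p) \<in> carrier C" using ac by simp
      have "comb (\<lambda>p. \<phi> (q p \<oplus> a p)) = comb (\<lambda>p. \<phi> (q p) \<oplus>\<^bsub>C\<^esub> \<phi> (a p))"
        unfolding comb_def
        by (rule C.finsum_cong'[OF refl]) (use q ac gc in auto)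
      also have "\<dots> = comb (\<lambda>p. \<phi> (q p)) \<oplus>\<^bsub>C\<^esub> comb (\<lambda>p. \<phi> (a p))" by (rule comb_add[OF cq ca])
      finally have eq: "comb (\<lambda>p. \<phi> (q p \<oplus> a p)) = comb (\<lambda>p. \<phi> (q p)) \<oplus>\<^bsub>C\<^esub> comb (\<lambda>p. \<phi> (a p))" .
      have "f \<ominus>\<^bsub>C\<^esub> comb (\<lambda>p. \<phi> (q p \<oplus> a p)) = ?r \<ominus>\<^bsub>C\<^esub> comb (\<lambda>p. \<phi> (a p))"
        unfolding eq by (rule C.minus_add_eq[OF fc comb_closed[of "\<lambda>p. \<phi> (q p)", OF cq] comb_closed[of "\<lambda>p. \<phi> (a p)", OF ca]])
      then have 1: "f \<ominus>\<^bsub>C\<^esub> comb (\<lambda>p. \<phi> (q p \<oplus> a p)) \<in> F (Suc n)" using a(2) by simp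
      have 2: "q p \<oplus> a p \<ominus> q p \<in> mp (n - k p)" if "p \<in> P" for p
      proof -
        have "q p \<in> carrier R" using q that by simp
        then have "q p \<oplus> a p \<ominus> q p = a p" using ac[OF that] by algebra
        then show ?thesis using a(1) that by simp
      qed
      show "\<exists>q'. ((\<forall>p\<in>P. q' p \<in> carrier R) \<and> f \<ominus>\<^bsub>C\<^esub> comb (\<lambda>p. \<phi> (q' p)) \<in> F (Suc n))
        \<and> (\<forall>p\<in>P. q' p \<ominus> q p \<in> mp (n - k p))"
        by (rule exI[of _ "\<lambda>p. q p \<oplus> a p"]) (use 1 2 q ac in simp)
    qed
    then obtain q where q: "\<And>n p. p \<in> P \<Longrightarrow> q n p \<in> carrier R" "\<And>n. f \<ominus>\<^bsub>C\<^esub> comb (\<lambda>p. \<phi> (q n p)) \<in> F n"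
      "\<And>n p. p \<in> P \<Longrightarrow> q (Suc n) p \<ominus> q n p \<in> mp (n - k p)" by metis
    \<comment> \<open>Starting the sequence at index k p compensates for the order of the generator:
      the differences then lie in m^l, as \<open>limit_exists\<close> demands.\<close>
    have "\<exists>s. s \<in> carrier C \<and> (\<forall>l. s \<ominus>\<^bsub>C\<^esub> \<phi> (q (l + k p) p) \<in> F l)" if p: "p \<in> P" for p
    proof -
      have "\<phi> (q (Suc l + k p) p) \<ominus>\<^bsub>C\<^esub> \<phi> (q (l + k p) p) \<in> F l" for l
      proof -
        have "q (Suc l + k p) p \<ominus> q (l + k p) p \<in> mp l" using q(3)[OF p, of "l + k p"] by simp
        then have "\<phi> (q (Suc l + k p) p \<ominus> q (l + k p) p) \<in> F l"
          by (rule F_phi_iff[THEN iffD2, rotated]) (use q(1)[OF p] in simp)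
        moreover have "\<phi> (q (Suc l + k p) p \<ominus> q (l + k p) p) = \<phi> (q (Suc l + k p) p) \<ominus>\<^bsub>C\<^esub> \<phi> (q (l + k p) p)"
          using q(1)[OF p] by (simp add: a_minus_def)
        ultimately show ?thesis by simp
      qed
      moreover have "\<phi> (q (l + k p) p) \<in> carrier C" for l using q(1)[OF p] by simp
      ultimately show ?thesis using limit_exists[of "\<lambda>l. \<phi> (q (l + k p) p)"] by metis
    qed
    then obtain s where s: "\<And>p. p \<in> P \<Longrightarrow> s p \<in> carrier C" "\<And>p l. p \<in> P \<Longrightarrow> s p \<ominus>\<^bsub>C\<^esub> \<phi> (q (l + k p) p) \<in> F l" by metis
    have "f \<ominus>\<^bsub>C\<^esub> comb s \<in> F l" for l
    proof -
      \<comment> \<open>The sum of all k p guarantees n - k p \<ge> l for every generator, so that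
        all coefficients are within F l of their limits at the same stage.\<close>
      define n where "n = l + (\<Sum>p\<in>P. k p)"
      have n: "n - k p \<ge> l" "n \<ge> k p" if "p \<in> P" for p using member_le_sum[OF that, of k] P unfolding n_def by simp_all
      have cq: "\<And>p. p \<in> P \<Longrightarrow> \<phi> (q n p) \<in> carrier C" using q(1) by simp
      let ?d = "\<lambda>p. s p \<ominus>\<^bsub>C\<^esub> \<phi> (q n p)"
      have dF: "?d p \<in> F l" if "p \<in> P" for p
        using s(2)[OF that, of "n - k p"] n[OF that] F_antimono[OF n(1)[OF that]] by auto
      have cd: "\<And>p. p \<in> P \<Longrightarrow> ?d p \<in> carrier C" using dF F_closed by blast
      have "comb s = comb (\<lambda>p. \<phi> (q n p) \<oplus>\<^bsub>C\<^esub> ?d p)"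
        unfolding comb_def
      proof (rule C.finsum_cong'[OF refl])
        fix p assume p: "p \<in> P"
        have "\<phi> (q n p) \<oplus>\<^bsub>C\<^esub> ?d p = s p" using s(1)[OF p] cq[OF p] by algebra
        then show "s p \<otimes>\<^bsub>C\<^esub> g p = (\<phi> (q n p) \<oplus>\<^bsub>C\<^esub> ?d p) \<otimes>\<^bsub>C\<^esub> g p" by simp
      qed (use cq cd gc in auto)
      also have "\<dots> = comb (\<lambda>p. \<phi> (q n p)) \<oplus>\<^bsub>C\<^esub> comb ?d" by (rule comb_add[OF cq cd])
      finally have eq: "comb s = comb (\<lambda>p. \<phi> (q n p)) \<oplus>\<^bsub>C\<^esub> comb ?d" .
      have "f \<ominus>\<^bsub>C\<^esub> comb s = (f \<ominus>\<^bsub>C\<^esub> comb (\<lambda>p. \<phi> (q n p))) \<ominus>\<^bsub>C\<^esub> comb ?d"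
        unfolding eq by (rule C.minus_add_eq[OF fc comb_closed[of "\<lambda>p. \<phi> (q n p)", OF cq] comb_closed[of ?d, OF cd]])
      moreover have "f \<ominus>\<^bsub>C\<^esub> comb (\<lambda>p. \<phi> (q n p)) \<in> F l" using q(2)[of n] F_antimono[of l n] unfolding n_def by auto
      moreover have "comb ?d \<in> F l" by (rule comb_F[OF dF])
      ultimately show ?thesis using C.ideal_minus_closed[OF F_ideal] by simp
    qed
    then have "f \<ominus>\<^bsub>C\<^esub> comb s = \<zero>\<^bsub>C\<^esub>" by (rule F_zero)
    then have "f = comb s" using C.r_right_minus_eq[OF fc comb_closed[of s, OF s(1)]] by simp
    also have "\<dots> \<in> Idl\<^bsub>C\<^esub> (g ` P)"
      unfolding comb_def
    proof (rule C.finsum_ideal[OF C.genideal_ideal[OF gsub]])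
      show "s p \<otimes>\<^bsub>C\<^esub> g p \<in> Idl\<^bsub>C\<^esub> (g ` P)" if p: "p \<in> P" for p
        by (rule ideal.I_l_closed[OF C.genideal_ideal[OF gsub] _ s(1)[OF p]])
          (rule subsetD[OF C.genideal_self[OF gsub] imageI[OF p]])
    qed
    finally show "f \<in> Idl\<^bsub>C\<^esub> (g ` P)" .
  qed
qed

text \<open>The generators of \<open>m\<close> have order 1, and m^(n+1) consists of the
  combinations of them with coefficients in m^n. So every element of \<open>F 1\<close> can be
  approximated as \<open>ideal_generated_if_graded\<close> requires.\<close>

lemma F_one_generated: "F 1 = Idl\<^bsub>C\<^esub> (\<phi> ` m)"
proof -
  obtain B where B: "B \<subseteq> carrier R" "finite B" "m = Idl B" using finetely_gen[OF m] by auto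
  have Bm: "B \<subseteq> m" using genideal_self[OF B(1)] B(3) by simp
  have mp1: "mp 1 = m" by (rule ideal_power_1[OF m])
  have Bv: "\<And>p. p \<in> B \<Longrightarrow> p \<in> carrier R" using B(1) by auto
  have in_lincomb: "a \<in> lincomb B (\<lambda>p. p) (\<lambda>_. mp n)" if "a \<in> mp (Suc n)" for a n
    using that unfolding ideal_power_Suc
  proof (induction rule: ideal_prod.induct)
    case (prod i j)
    have ic: "i \<in> carrier R" using ideal_power_closed[OF m prod(1)] .
    let ?L = "lincomb B (\<lambda>p. p) (\<lambda>_. mp n)"
    have L: "ideal ?L R" by (rule lincomb_ideal[OF B(2) Bv mp_ideal])
    have "B \<subseteq> {a \<in> carrier R. a \<otimes> i \<in> ?L}"
    proof
      fix p assume p: "p \<in> B"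
      have "i \<otimes> p \<in> ?L" by (rule lincomb_single[OF B(2) Bv p prod(1) ic ideal_power_zero[OF m]])
      then show "p \<in> {a \<in> carrier R. a \<otimes> i \<in> ?L}" using Bv[OF p] ic by (simp add: m_comm)
    qed
    then have "Idl B \<subseteq> {a \<in> carrier R. a \<otimes> i \<in> ?L}" by (rule genideal_minimal[OF ideal_colon[OF L ic]])
    moreover have "j \<in> Idl B" by (subst B(3)[symmetric]) (rule prod(2))
    ultimately have "j \<in> {a \<in> carrier R. a \<otimes> i \<in> ?L}" by (rule subsetD)
    then have "j \<in> carrier R" "j \<otimes> i \<in> ?L" by simp_all
    then show ?case using m_comm[OF ic \<open>j \<in> carrier R\<close>] by simp
  next
    case (sum a b)
    show ?case
      by (rule additive_subgroup.a_closed[OF ideal.axioms(1)[OF lincomb_ideal[OF B(2) Bv mp_ideal]] sum(3,4)])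
  qed
  have "F 1 = Idl\<^bsub>C\<^esub> (\<phi> ` B)"
  proof (rule ideal_generated_if_graded[where k = "\<lambda>_. 1", OF B(2) F_ideal])
    show "\<phi> p \<in> F 1" if "p \<in> B" for p using that Bm Bv F_phi_iff mp1 by blast
    fix n f assume f1: "f \<in> F 1" and fn: "f \<in> F n"
    have fc: "f \<in> carrier C" using F_closed[OF f1] .
    show "\<exists>a. (\<forall>p\<in>B. a p \<in> mp (n - 1)) \<and> f \<ominus>\<^bsub>C\<^esub> (\<Oplus>\<^bsub>C\<^esub>p\<in>B. \<phi> (a p) \<otimes>\<^bsub>C\<^esub> \<phi> p) \<in> F (Suc n)"
    proof (cases n)
      \<comment> \<open>At level 0 the remainder only has to lie in \<open>F 1\<close>, where f
        itself already is; all coefficients are zero.\<close>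
      case 0
      have z: "(\<Oplus>\<^bsub>C\<^esub>p\<in>B. \<phi> \<zero> \<otimes>\<^bsub>C\<^esub> \<phi> p) = \<zero>\<^bsub>C\<^esub>" by (rule C.add.finprod_one_eqI) (use Bv in auto)
      have "f \<ominus>\<^bsub>C\<^esub> \<zero>\<^bsub>C\<^esub> = f" using fc by algebra
      then show ?thesis using 0 f1 z by (intro exI[of _ "\<lambda>_. \<zero>"]) (simp add: ideal_power_zero[OF m])
    next
      case (Suc n')
      obtain a where a: "a \<in> carrier R" "f \<ominus>\<^bsub>C\<^esub> \<phi> a \<in> F (Suc n)" using F_approx[OF fc] .
      have "f \<ominus>\<^bsub>C\<^esub> \<phi> a \<in> F n" using a(2) F_Suc by blast
      then have "f \<ominus>\<^bsub>C\<^esub> (f \<ominus>\<^bsub>C\<^esub> \<phi> a) \<in> F n" using C.ideal_minus_closed[OF F_ideal fn] by simp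
      moreover have "f \<ominus>\<^bsub>C\<^esub> (f \<ominus>\<^bsub>C\<^esub> \<phi> a) = \<phi> a" using fc H.hom_closed[OF a(1)] by algebra
      ultimately have "a \<in> mp (Suc n')" using F_phi_iff[OF a(1)] Suc by simp
      then obtain c where c: "\<And>p. p \<in> B \<Longrightarrow> c p \<in> mp n'" "a = (\<Oplus>p\<in>B. c p \<otimes> p)"
        using lincombE[OF in_lincomb] by metis
      have cc: "c p \<in> carrier R" if "p \<in> B" for p using ideal_power_closed[OF m c(1)[OF that]] .
      have "\<phi> a = (\<Oplus>\<^bsub>C\<^esub>p\<in>B. \<phi> (c p \<otimes> p))" unfolding c(2)
        by (subst H.hom_finsum) (use cc Bv in \<open>auto simp: comp_def\<close>)
      also have "\<dots> = (\<Oplus>\<^bsub>C\<^esub>p\<in>B. \<phi> (c p) \<otimes>\<^bsub>C\<^esub> \<phi> p)"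
        by (rule C.finsum_cong'[OF refl]) (use cc Bv in auto)
      finally show ?thesis using a(2) c(1) Suc by (intro exI[of _ c]) simp
    qed
  qed
  moreover have "Idl\<^bsub>C\<^esub> (\<phi> ` B) \<subseteq> Idl\<^bsub>C\<^esub> (\<phi> ` m)"
    by (rule C.subset_Idl_subset) (use Bm ideal.Icarr[OF m] in auto)
  moreover have "Idl\<^bsub>C\<^esub> (\<phi> ` m) \<subseteq> F 1"
    by (rule C.genideal_minimal[OF F_ideal]) (use F_phi_iff mp1 ideal.Icarr[OF m] in auto)
  ultimately show ?thesis by blast
qed

section \<open>The Rees ring of the ideal of definition and its consequences\<close>

sublocale Rees: rees R m by (intro rees.intro rees_axioms.intro is_cring m)

lemma Rees_noetherian: "noetherian_cring (rees_ring R m)"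
  by (rule Rees.A.noetherian_cringI[OF Rees.rees_noetherian[OF noetherian_ring_axioms]])

text \<open>Packs a graded family of ideals of \<open>R\<close> into one homogeneous ideal, to which
  finite generation and the chain condition of the Rees ring can be applied.\<close>

lemma Rees_graded_ideal:
  assumes Y: "\<And>n. ideal (Y n) R"
    and mult: "\<And>i j a y. a \<in> mp (nat i) \<Longrightarrow> y \<in> Y j \<Longrightarrow> a \<otimes> y \<in> Y (i + j)"
  shows "ideal {f \<in> carrier (rees_ring R m). \<forall>n. f n \<in> Y n} (rees_ring R m)"
proof (rule Rees.A.cring_idealI)
  let ?X = "{f \<in> carrier (rees_ring R m). \<forall>n. f n \<in> Y n}"
  show "?X \<subseteq> carrier (rees_ring R m)" by blast
  show "\<zero>\<^bsub>rees_ring R m\<^esub> \<in> ?X"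
    using Rees.zero_closed_A additive_subgroup.zero_closed[OF ideal.axioms(1)[OF Y]] by (simp add: Rees.A_zero)
  fix f assume f: "f \<in> ?X"
  show "f \<oplus>\<^bsub>rees_ring R m\<^esub> g \<in> ?X" if "g \<in> ?X" for g
    using Rees.add_closed f that additive_subgroup.a_closed[OF ideal.axioms(1)[OF Y]] by (simp add: Rees.A_add)
  show "r \<otimes>\<^bsub>rees_ring R m\<^esub> f \<in> ?X" if r: "r \<in> carrier (rees_ring R m)" for r
  proof -
    have "(r \<otimes>\<^bsub>rees_ring R m\<^esub> f) n \<in> Y n" for n
      unfolding Rees.A_mult
    proof (rule finsum_ideal[OF Y])
      fix i
      have "r i \<otimes> f (n - i) \<in> Y (i + (n - i))" by (rule mult[OF Rees.coeff_Ip[OF r]]) (use f in simp)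
      then show "r i \<otimes> f (n - i) \<in> Y n" by simp
    qed
    then show ?thesis using Rees.mult_closed[OF r] f by simp
  qed
qed

text \<open>The initial forms of the elements of \<open>J\<close> generate an ideal of the Rees ring of \<open>m\<close>; lifts of finitely
  many generators generate \<open>J\<close>.\<close>

theorem completion_noetherian: "noetherian_ring C"
proof (rule C.noetherian_ringI)
  fix J assume J: "ideal J C"
  interpret J: ideal J C by fact
  let ?A = "rees_ring R m"
  \<comment> \<open>The preimage in m^n of the initial forms of degree \<open>n\<close> in m^n /
    m^(n+1). Taking f = 0 shows that it contains m^(n+1).\<close>
  define Gr where "Gr n = {a \<in> mp n. \<exists>f\<in>J \<inter> F n. f \<ominus>\<^bsub>C\<^esub> \<phi> a \<in> F (Suc n)}" for n
  have mpc: "a \<in> carrier R" if "a \<in> mp n" for a n using ideal_power_closed[OF m that] .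
  have Gr_ideal: "ideal (Gr n) R" for n
  proof (rule cring_idealI)
    show "Gr n \<subseteq> carrier R" unfolding Gr_def using mpc by blast
    have F0: "\<zero>\<^bsub>C\<^esub> \<in> F i" for i by (rule additive_subgroup.zero_closed[OF ideal.axioms(1)[OF F_ideal]])
    have "\<zero>\<^bsub>C\<^esub> \<ominus>\<^bsub>C\<^esub> \<phi> \<zero> \<in> F (Suc n)" using F0 by (simp add: a_minus_def)
    then show "\<zero> \<in> Gr n" unfolding Gr_def using ideal_power_zero[OF m] J.zero_closed F0 by blast
    fix a assume "a \<in> Gr n"
    then obtain f where a: "a \<in> mp n" "f \<in> J" "f \<in> F n" "f \<ominus>\<^bsub>C\<^esub> \<phi> a \<in> F (Suc n)" unfolding Gr_def by blast
    note c = mpc[OF a(1)] J.Icarr[OF a(2)] H.hom_closed[OF mpc[OF a(1)]]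
    show "a \<oplus> b \<in> Gr n" if "b \<in> Gr n" for b
    proof -
      obtain g where b: "b \<in> mp n" "g \<in> J" "g \<in> F n" "g \<ominus>\<^bsub>C\<^esub> \<phi> b \<in> F (Suc n)" using \<open>b \<in> Gr n\<close> unfolding Gr_def by blast
      note d = mpc[OF b(1)] J.Icarr[OF b(2)] H.hom_closed[OF mpc[OF b(1)]]
      have "(f \<oplus>\<^bsub>C\<^esub> g) \<ominus>\<^bsub>C\<^esub> \<phi> (a \<oplus> b) = (f \<oplus>\<^bsub>C\<^esub> g) \<ominus>\<^bsub>C\<^esub> (\<phi> a \<oplus>\<^bsub>C\<^esub> \<phi> b)" using c d by simp
      also have "\<dots> = (f \<ominus>\<^bsub>C\<^esub> \<phi> a) \<oplus>\<^bsub>C\<^esub> (g \<ominus>\<^bsub>C\<^esub> \<phi> b)" using c(2,3) d(2,3) by algebra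
      also have "\<dots> \<in> F (Suc n)" by (rule additive_subgroup.a_closed[OF ideal.axioms(1)[OF F_ideal] a(4) b(4)])
      finally show ?thesis unfolding Gr_def
        using ideal_power_add[OF m a(1) b(1)] J.a_closed[OF a(2) b(2)]
          additive_subgroup.a_closed[OF ideal.axioms(1)[OF F_ideal] a(3) b(3)] by blast
    qed
    show "r \<otimes> a \<in> Gr n" if r: "r \<in> carrier R" for r
    proof -
      have "\<phi> r \<otimes>\<^bsub>C\<^esub> f \<ominus>\<^bsub>C\<^esub> \<phi> (r \<otimes> a) = \<phi> r \<otimes>\<^bsub>C\<^esub> f \<ominus>\<^bsub>C\<^esub> \<phi> r \<otimes>\<^bsub>C\<^esub> \<phi> a" using c r by simp
      also have "\<dots> = \<phi> r \<otimes>\<^bsub>C\<^esub> (f \<ominus>\<^bsub>C\<^esub> \<phi> a)" using c(2,3) H.hom_closed[OF r] by algebra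
      also have "\<dots> \<in> F (Suc n)" by (rule ideal.I_l_closed[OF F_ideal a(4) H.hom_closed[OF r]])
      finally show ?thesis unfolding Gr_def
        using ideal.I_l_closed[OF mp_ideal a(1) r] J.I_l_closed[OF a(2) H.hom_closed[OF r]]
          ideal.I_l_closed[OF F_ideal a(3) H.hom_closed[OF r]] by blast
    qed
  qed
  have Gr_Suc: "Gr (Suc n) \<subseteq> Gr n" for n
  proof
    fix a assume "a \<in> Gr (Suc n)"
    then obtain f where a: "a \<in> mp (Suc n)" "f \<in> J" "f \<in> F (Suc n)" "f \<ominus>\<^bsub>C\<^esub> \<phi> a \<in> F (Suc (Suc n))" unfolding Gr_def by blast
    then show "a \<in> Gr n" unfolding Gr_def using ideal_power_Suc_subset[OF m, of n] F_Suc[of n] F_Suc[of "Suc n"] by blast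
  qed
  have Gr_anti: "Gr j \<subseteq> Gr i" if "i \<le> j" for i j by (rule lift_Suc_antimono_le[of Gr, OF Gr_Suc that])
  have Gr_mult: "a \<otimes> y \<in> Gr (i + j)" if a: "a \<in> mp i" and y: "y \<in> Gr j" for a y i j
  proof -
    obtain f where f: "y \<in> mp j" "f \<in> J" "f \<in> F j" "f \<ominus>\<^bsub>C\<^esub> \<phi> y \<in> F (Suc j)" using y unfolding Gr_def by blast
    note c = mpc[OF a] mpc[OF f(1)] J.Icarr[OF f(2)]
    have aF: "\<phi> a \<in> F i" using F_phi_iff[OF c(1)] a by simp
    have "\<phi> a \<otimes>\<^bsub>C\<^esub> f \<ominus>\<^bsub>C\<^esub> \<phi> (a \<otimes> y) = \<phi> a \<otimes>\<^bsub>C\<^esub> f \<ominus>\<^bsub>C\<^esub> \<phi> a \<otimes>\<^bsub>C\<^esub> \<phi> y" using c by simp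
    also have "\<dots> = \<phi> a \<otimes>\<^bsub>C\<^esub> (f \<ominus>\<^bsub>C\<^esub> \<phi> y)" using c(3) H.hom_closed[OF c(1)] H.hom_closed[OF c(2)] by algebra
    also have "\<dots> \<in> F (i + Suc j)" by (rule F_mult[OF aF f(4)])
    finally show ?thesis unfolding Gr_def
      using ideal_power_mult[OF m a f(1)] J.I_l_closed[OF f(2) H.hom_closed[OF c(1)]] F_mult[OF aF f(3)] by auto
  qed
  have Gr_nat: "a \<otimes> y \<in> Gr (nat (i + j))" if "a \<in> mp (nat i)" "y \<in> Gr (nat j)" for a y i j
  proof -
    have "nat (i + j) \<le> nat i + nat j" by auto
    then show ?thesis using Gr_mult[OF that] Gr_anti by blast
  qed
  \<comment> \<open>Negative degrees repeat \<open>Gr 0\<close>, just as the Rees ring repeats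
    \<open>R\<close> there.\<close>
  define GR where "GR = {f \<in> carrier ?A. \<forall>n. f n \<in> Gr (nat n)}"
  have "ideal GR ?A" unfolding GR_def
    by (rule Rees_graded_ideal[of "\<lambda>n. Gr (nat n)"]) (rule Gr_ideal, rule Gr_nat)
  then obtain B where B: "B \<subseteq> carrier ?A" "finite B" "GR = Idl\<^bsub>?A\<^esub> B"
    using noetherian_ring.finetely_gen[OF noetherian_cring.axioms(2)[OF Rees_noetherian]] by blast
  have BGR: "B \<subseteq> GR" using Rees.A.genideal_self[OF B(1)] B(3) by simp
  \<comment> \<open>The index (b, k) stands for the homogeneous component of degree k of the
    generator b, with coefficient \<open>val\<close>. A coefficient that completes it to degree n
    lies in m^(n-k), which is \<open>D\<close>.\<close>
  define P where "P = (SIGMA b:B. {k. b k \<noteq> \<zero>})"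
  define val where "val = (\<lambda>(b :: int \<Rightarrow> 'a, k :: int). b k)"
  define D where "D = (\<lambda>n :: int. \<lambda>(b :: int \<Rightarrow> 'a, k :: int). mp (nat (n - k)))"
  have P: "finite P" unfolding P_def using B(1,2) Rees.finite_supp by (intro finite_SigmaI) auto
  have PGr: "val p \<in> Gr (nat (snd p))" if "p \<in> P" for p
    using that BGR unfolding P_def val_def GR_def by auto
  have valc: "val p \<in> carrier R" if "p \<in> P" for p using ideal.Icarr[OF Gr_ideal PGr[OF that]] .
  have Dn: "D n p = mp (nat (n - snd p))" for n p unfolding D_def by (simp add: case_prod_unfold)
  have Did: "ideal (D n p) R" for n p unfolding Dn by (rule mp_ideal)
  define Y where "Y n = lincomb P val (D n)" for n
  have Y_ideal: "ideal (Y n) R" for n unfolding Y_def by (rule lincomb_ideal[OF P valc Did])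
  have Y_mult: "a \<otimes> y \<in> Y (i + j)" if a: "a \<in> mp (nat i)" and y: "y \<in> Y j" for a y i j
    unfolding Y_def
  proof (rule lincomb_scale[OF P valc y[unfolded Y_def] mpc[OF a]])
    fix p c
    show "D j p \<subseteq> carrier R" unfolding Dn using mpc by blast
    assume "c \<in> D j p"
    then show "a \<otimes> c \<in> D (i + j) p" unfolding Dn using ideal_power_nat_mult[OF m a, of c "j - snd p"] by (simp add: algebra_simps)
  qed
  have BY: "b n \<in> Y n" if b: "b \<in> B" for b n
  proof (cases "b n = \<zero>")
    case True
    then show ?thesis using additive_subgroup.zero_closed[OF ideal.axioms(1)[OF Y_ideal]] by simp
  next
    case False
    then have p: "(b, n) \<in> P" unfolding P_def using b by simp
    have "\<one> \<otimes> val (b, n) \<in> lincomb P val (D n)"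
      by (rule lincomb_single[OF P valc p])
        (auto simp: Dn ideal_power_0 ideal_power_zero[OF m])
    then show ?thesis using valc[OF p] unfolding Y_def val_def by simp
  qed
  have "GR \<subseteq> {f \<in> carrier ?A. \<forall>n. f n \<in> Y n}"
    unfolding B(3) by (rule Rees.A.genideal_minimal[OF Rees_graded_ideal[of Y, OF Y_ideal Y_mult]]) (use BY B(1) in auto)
  then have Gr_Y: "a \<in> Y (int n)" if a: "a \<in> Gr n" for a n
  proof -
    have am: "a \<in> mp n" using a unfolding Gr_def by simp
    have "Rees.mono a (int n) \<in> GR"
      unfolding GR_def Rees.mono_def[symmetric]
      using Rees.mono_closed[of a "int n"] am a additive_subgroup.zero_closed[OF ideal.axioms(1)[OF Gr_ideal]]
      by (auto simp: Rees.mono_def)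
    then have "Rees.mono a (int n) (int n) \<in> Y (int n)" using \<open>GR \<subseteq> _\<close> by blast
    then show ?thesis by (simp add: Rees.mono_def)
  qed
  have "\<forall>p\<in>P. \<exists>f. f \<in> J \<and> f \<in> F (nat (snd p)) \<and> f \<ominus>\<^bsub>C\<^esub> \<phi> (val p) \<in> F (Suc (nat (snd p)))"
    using PGr unfolding Gr_def by blast
  then obtain g where g: "\<And>p. p \<in> P \<Longrightarrow> g p \<in> J" "\<And>p. p \<in> P \<Longrightarrow> g p \<in> F (nat (snd p))"
    "\<And>p. p \<in> P \<Longrightarrow> g p \<ominus>\<^bsub>C\<^esub> \<phi> (val p) \<in> F (Suc (nat (snd p)))" by metis
  have gc: "g p \<in> carrier C" if "p \<in> P" for p using J.Icarr[OF g(1)[OF that]] .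
  have "J = Idl\<^bsub>C\<^esub> (g ` P)"
  proof (rule ideal_generated_if_graded[where k = "\<lambda>p. nat (snd p)", OF P J g(1)])
    fix n f assume f: "f \<in> J" and fn: "f \<in> F n"
    have fc: "f \<in> carrier C" using J.Icarr[OF f] .
    obtain a where a: "a \<in> carrier R" "f \<ominus>\<^bsub>C\<^esub> \<phi> a \<in> F (Suc n)" using F_approx[OF fc] .
    have "f \<ominus>\<^bsub>C\<^esub> \<phi> a \<in> F n" using a(2) F_Suc by blast
    then have "f \<ominus>\<^bsub>C\<^esub> (f \<ominus>\<^bsub>C\<^esub> \<phi> a) \<in> F n" using C.ideal_minus_closed[OF F_ideal fn] by simp
    moreover have "f \<ominus>\<^bsub>C\<^esub> (f \<ominus>\<^bsub>C\<^esub> \<phi> a) = \<phi> a" using fc H.hom_closed[OF a(1)] by algebra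
    ultimately have "a \<in> mp n" using F_phi_iff[OF a(1)] by simp
    then have "a \<in> Gr n" unfolding Gr_def using f fn a(2) by blast
    then obtain c where c: "\<And>p. p \<in> P \<Longrightarrow> c p \<in> D (int n) p" "a = (\<Oplus>p\<in>P. c p \<otimes> val p)"
      using lincombE[OF Gr_Y[unfolded Y_def]] by metis
    have cn: "c p \<in> mp (n - nat (snd p))" if p: "p \<in> P" for p
    proof -
      \<comment> \<open>A component of negative degree is lifted with order 0; its coefficient then
        lies in an even higher power of \<open>m\<close> than required.\<close>
      have "n - nat (snd p) \<le> nat (int n - snd p)" by auto
      then show ?thesis using c(1)[OF p] ideal_power_antimono[OF m] unfolding Dn by blast
    qed
    have cc: "c p \<in> carrier R" if "p \<in> P" for p using mpc[OF cn[OF that]] .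
    have phia: "\<phi> a = (\<Oplus>\<^bsub>C\<^esub>p\<in>P. \<phi> (c p) \<otimes>\<^bsub>C\<^esub> \<phi> (val p))"
    proof -
      have "\<phi> a = (\<Oplus>\<^bsub>C\<^esub>p\<in>P. \<phi> (c p \<otimes> val p))" unfolding c(2)
        by (subst H.hom_finsum) (use cc valc in \<open>auto simp: comp_def\<close>)
      also have "\<dots> = (\<Oplus>\<^bsub>C\<^esub>p\<in>P. \<phi> (c p) \<otimes>\<^bsub>C\<^esub> \<phi> (val p))"
        by (rule C.finsum_cong'[OF refl]) (use cc valc in auto)
      finally show ?thesis .
    qed
    let ?s = "\<Oplus>\<^bsub>C\<^esub>p\<in>P. \<phi> (c p) \<otimes>\<^bsub>C\<^esub> g p"
    let ?d = "\<Oplus>\<^bsub>C\<^esub>p\<in>P. \<phi> (c p) \<otimes>\<^bsub>C\<^esub> (g p \<ominus>\<^bsub>C\<^esub> \<phi> (val p))"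
    have dF: "?d \<in> F (Suc n)"
    proof (rule C.finsum_ideal[OF F_ideal])
      fix p assume p: "p \<in> P"
      have "\<phi> (c p) \<in> F (n - nat (snd p))" using F_phi_iff[OF cc[OF p]] cn[OF p] by simp
      from F_mult[OF this g(3)[OF p]]
      have "\<phi> (c p) \<otimes>\<^bsub>C\<^esub> (g p \<ominus>\<^bsub>C\<^esub> \<phi> (val p)) \<in> F (n - nat (snd p) + Suc (nat (snd p)))" .
      moreover have "Suc n \<le> n - nat (snd p) + Suc (nat (snd p))" by arith
      ultimately show "\<phi> (c p) \<otimes>\<^bsub>C\<^esub> (g p \<ominus>\<^bsub>C\<^esub> \<phi> (val p)) \<in> F (Suc n)"
        using F_antimono by blast
    qed
    have sc: "?s \<in> carrier C" "\<phi> a \<in> carrier C" "?d \<in> carrier C"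
      using cc gc a(1) F_closed[OF dF] by (auto intro!: C.finsum_closed)
    have "?s = (\<Oplus>\<^bsub>C\<^esub>p\<in>P. \<phi> (c p) \<otimes>\<^bsub>C\<^esub> \<phi> (val p) \<oplus>\<^bsub>C\<^esub> \<phi> (c p) \<otimes>\<^bsub>C\<^esub> (g p \<ominus>\<^bsub>C\<^esub> \<phi> (val p)))"
    proof (rule C.finsum_cong'[OF refl])
      fix p assume p: "p \<in> P"
      show "\<phi> (c p) \<otimes>\<^bsub>C\<^esub> g p = \<phi> (c p) \<otimes>\<^bsub>C\<^esub> \<phi> (val p) \<oplus>\<^bsub>C\<^esub> \<phi> (c p) \<otimes>\<^bsub>C\<^esub> (g p \<ominus>\<^bsub>C\<^esub> \<phi> (val p))"
        using H.hom_closed[OF cc[OF p]] gc[OF p] H.hom_closed[OF valc[OF p]] by algebra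
    qed (use cc gc valc in auto)
    also have "\<dots> = \<phi> a \<oplus>\<^bsub>C\<^esub> ?d" unfolding phia by (rule C.finsum_addf) (use cc gc valc in auto)
    finally have eq: "?s = \<phi> a \<oplus>\<^bsub>C\<^esub> ?d" .
    have "f \<ominus>\<^bsub>C\<^esub> ?s = (f \<ominus>\<^bsub>C\<^esub> \<phi> a) \<ominus>\<^bsub>C\<^esub> ?d" unfolding eq by (rule C.minus_add_eq[OF fc sc(2,3)])
    also have "\<dots> \<in> F (Suc n)" by (rule C.ideal_minus_closed[OF F_ideal a(2) dF])
    finally show "\<exists>c. (\<forall>p\<in>P. c p \<in> mp (n - nat (snd p))) \<and> f \<ominus>\<^bsub>C\<^esub> (\<Oplus>\<^bsub>C\<^esub>p\<in>P. \<phi> (c p) \<otimes>\<^bsub>C\<^esub> g p) \<in> F (Suc n)"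
      using cn by (intro exI[of _ c]) simp
  qed
  then show "\<exists>A\<subseteq>carrier C. finite A \<and> J = Idl\<^bsub>C\<^esub> A" using P gc by (intro exI[of _ "g ` P"]) auto
qed

text \<open>The ascending chain condition in the Rees ring of \<open>m\<close>, applied to the ideals \<open>Z L\<close>, replaces the
  Artin-Rees lemma.\<close>

theorem krull_closed:
  assumes H: "ideal H R" and v: "v \<in> carrier R"
    and unit: "\<And>a. a \<in> m \<Longrightarrow> \<one> \<ominus> a \<in> Units R"
    and cl: "\<And>l. \<exists>h\<in>H. v \<ominus> h \<in> mp l"
  shows "v \<in> H"
proof -
  interpret H: ideal H R by fact
  let ?A = "rees_ring R m"
  have mpc: "a \<in> carrier R" if "a \<in> mp n" for a n using ideal_power_closed[OF m that] .
  \<comment> \<open>E n = H + m^n v. The goal is that some v - h with h in H lies in E 1 = H + m v;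
    Nakayama's argument then gives v in H.\<close>
  define E where "E n = {h \<oplus> c \<otimes> v | h c. h \<in> H \<and> c \<in> mp n}" for n
  have EI: "h \<oplus> c \<otimes> v \<in> E n" if "h \<in> H" "c \<in> mp n" for h c n unfolding E_def using that by blast
  have EE: "\<exists>h c. y = h \<oplus> c \<otimes> v \<and> h \<in> H \<and> c \<in> mp n" if "y \<in> E n" for y n using that unfolding E_def mem_Collect_eq .
  have E_ideal: "ideal (E n) R" for n
  proof (rule cring_idealI)
    show "E n \<subseteq> carrier R"
    proof
      fix y assume "y \<in> E n"
      from EE[OF this] obtain h c where y: "y = h \<oplus> c \<otimes> v" "h \<in> H" "c \<in> mp n" by (elim exE conjE)
      show "y \<in> carrier R" unfolding y(1) using H.Icarr[OF y(2)] mpc[OF y(3)] v by simp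
    qed
    have "\<zero> \<oplus> \<zero> \<otimes> v \<in> E n" by (rule EI[OF H.zero_closed ideal_power_zero[OF m]])
    then show "\<zero> \<in> E n" using v by simp
    fix y assume "y \<in> E n"
    from EE[OF this] obtain h c where y: "y = h \<oplus> c \<otimes> v" "h \<in> H" "c \<in> mp n" by (elim exE conjE)
    note c = H.Icarr[OF y(2)] mpc[OF y(3)]
    show "r \<otimes> y \<in> E n" if r: "r \<in> carrier R" for r
    proof -
      have "r \<otimes> y = r \<otimes> h \<oplus> (r \<otimes> c) \<otimes> v" unfolding y(1) using c v r by algebra
      then show ?thesis using EI[OF H.I_l_closed[OF y(2) r] ideal.I_l_closed[OF mp_ideal y(3) r]] by simp
    qed
    fix z assume "z \<in> E n"
    from EE[OF this] obtain h' c' where z: "z = h' \<oplus> c' \<otimes> v" "h' \<in> H" "c' \<in> mp n" by (elim exE conjE)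
    have "y \<oplus> z = (h \<oplus> h') \<oplus> (c \<oplus> c') \<otimes> v"
      unfolding y(1) z(1) using c v H.Icarr[OF z(2)] mpc[OF z(3)] by algebra
    then show "y \<oplus> z \<in> E n" using EI[OF H.a_closed[OF y(2) z(2)] ideal_power_add[OF m y(3) z(3)]] by simp
  qed
  have E_mult: "a \<otimes> y \<in> E (nat (i + j - L))" if a: "a \<in> mp (nat i)" and y: "y \<in> E (nat (j - L))" for a y i j and L :: int
  proof -
    from EE[OF y] obtain h c where y: "y = h \<oplus> c \<otimes> v" "h \<in> H" "c \<in> mp (nat (j - L))" by (elim exE conjE)
    have "a \<otimes> y = a \<otimes> h \<oplus> (a \<otimes> c) \<otimes> v" unfolding y(1) using H.Icarr[OF y(2)] mpc[OF y(3)] v mpc[OF a] by algebra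
    moreover have "a \<otimes> c \<in> mp (nat (i + j - L))" using ideal_power_nat_mult[OF m a y(3)] by (simp add: algebra_simps)
    ultimately show ?thesis using EI[OF H.I_l_closed[OF y(2) mpc[OF a]]] by simp
  qed
  \<comment> \<open>The index \<open>L\<close> delays the condition by \<open>L\<close> degrees, so
    these ideals ascend with \<open>L\<close> and become stationary.\<close>
  define Z where "Z L = {f \<in> carrier ?A. \<forall>n. f n \<in> E (nat (n - int L))}" for L
  have Z_ideal: "ideal (Z L) ?A" for L unfolding Z_def
    by (rule Rees_graded_ideal[of "\<lambda>n. E (nat (n - int L))"]) (rule E_ideal, rule E_mult)
  have Z_Suc: "Z L \<subseteq> Z (Suc L)" for L
  proof -
    have "E (nat (n - int L)) \<subseteq> E (nat (n - int (Suc L)))" for n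
    proof -
      have "nat (n - int (Suc L)) \<le> nat (n - int L)" by auto
      then show ?thesis unfolding E_def using ideal_power_antimono[OF m] by blast
    qed
    then show ?thesis unfolding Z_def by blast
  qed
  have "\<exists>N. \<forall>i\<ge>N. Z i = Z N"
    by (rule noetherian_ring.ideal_acc[of ?A Z, OF noetherian_cring.axioms(2)[OF Rees_noetherian] Z_ideal Z_Suc])
  then obtain N where N: "Z (Suc N) = Z N" by (metis le_SucI order_refl)
  obtain h where h: "h \<in> H" "v \<ominus> h \<in> mp (Suc N)" using cl by blast
  \<comment> \<open>v - h is in m^(N+1), so it may be placed in degree N + 1. There Z (N+1) asks
    only for membership in E 0, which is clear; the equality with Z N improves this to E 1.\<close>
  let ?f = "Rees.mono (v \<ominus> h) (int (Suc N))"
  have "?f n \<in> E (nat (n - int (Suc N)))" for n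
  proof (cases "n = int (Suc N)")
    case True
    have "(\<ominus> h) \<oplus> \<one> \<otimes> v \<in> E 0" by (rule EI) (use h H.a_inv_closed in \<open>auto simp: ideal_power_0\<close>)
    moreover have "(\<ominus> h) \<oplus> \<one> \<otimes> v = v \<ominus> h" using v H.Icarr[OF h(1)] by algebra
    ultimately show ?thesis using True by (simp add: Rees.mono_def)
  next
    case False
    then show ?thesis using additive_subgroup.zero_closed[OF ideal.axioms(1)[OF E_ideal]] by (simp add: Rees.mono_def)
  qed
  moreover have "?f \<in> carrier ?A" by (rule Rees.mono_closed) (simp only: nat_int h(2))
  ultimately have "?f \<in> Z (Suc N)" unfolding Z_def by blast
  then have "?f \<in> Z N" unfolding N .
  then have "\<forall>n. ?f n \<in> E (nat (n - int N))" unfolding Z_def by blast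
  then have "?f (int (Suc N)) \<in> E (nat (int (Suc N) - int N))" by blast
  then have "v \<ominus> h \<in> E 1" by (simp add: Rees.mono_def)
  from EE[OF this] obtain h' c where c: "v \<ominus> h = h' \<oplus> c \<otimes> v" "h' \<in> H" "c \<in> mp 1" by (elim exE conjE)
  have cm: "c \<in> m" using c(3) ideal_power_1[OF m] by simp
  have hc: "h \<in> carrier R" "h' \<in> carrier R" "c \<in> carrier R" using h(1) c(2) H.Icarr ideal.Icarr[OF m cm] by auto
  have "(\<one> \<ominus> c) \<otimes> v = (v \<ominus> h) \<oplus> h \<ominus> c \<otimes> v" using hc v by algebra
  also have "\<dots> = h' \<oplus> h" unfolding c(1) using hc v by algebra
  finally have "(\<one> \<ominus> c) \<otimes> v \<in> H" using H.a_closed[OF c(2) h(1)] by simp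
  then have "inv (\<one> \<ominus> c) \<otimes> ((\<one> \<ominus> c) \<otimes> v) \<in> H" by (rule H.I_l_closed) (use unit[OF cm] in simp)
  then show "v \<in> H" using unit[OF cm] v Units_closed[OF unit[OF cm]] by (simp flip: m_assoc)
qed

end

section \<open>A chart of the blow-up of two elements\<close>

text \<open>The field is the localization of R / I at its nonzero elements. Only a homomorphism into
  a field with kernel \<open>I\<close> is needed afterwards, so the construction is hidden behind
  the existential.\<close>

lemma (in primeideal) fraction_field_exists:
  "\<exists>(K :: ('a set \<times> 'a set) set ring) h. field K \<and> h \<in> ring_hom R K \<and> (\<forall>a\<in>carrier R. h a = \<zero>\<^bsub>K\<^esub> \<longleftrightarrow> a \<in> I)"
proof -
  let ?D = "R Quot I"
  let ?S = "carrier ?D - {\<zero>\<^bsub>?D\<^esub>}"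
  interpret D: domain ?D by (rule quotient_is_domain)
  have "submonoid ?S ?D"
    by (unfold_locales) (use D.integral in auto)
  then interpret loc: localizing ?D ?S
    by (intro localizing.intro localizing_axioms.intro D.is_cring)
  let ?K = "localization ?D ?S"
  have one_nz: "\<one>\<^bsub>?K\<^esub> \<noteq> \<zero>\<^bsub>?K\<^esub>"
    unfolding loc.frac_one loc.frac_zero by (subst loc.frac_eq_iff) auto
  have "Units ?K = carrier ?K - {\<zero>\<^bsub>?K\<^esub>}"
  proof
    show "Units ?K \<subseteq> carrier ?K - {\<zero>\<^bsub>?K\<^esub>}"
    proof
      fix k assume k: "k \<in> Units ?K"
      have "k \<noteq> \<zero>\<^bsub>?K\<^esub>"
      proof
        assume "k = \<zero>\<^bsub>?K\<^esub>"
        then have "\<one>\<^bsub>?K\<^esub> = \<zero>\<^bsub>?K\<^esub>" using loc.L.Units_r_inv[OF k] loc.L.Units_inv_closed[OF k] by simp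
        then show False using one_nz by simp
      qed
      then show "k \<in> carrier ?K - {\<zero>\<^bsub>?K\<^esub>}" using loc.L.Units_closed[OF k] by simp
    qed
    show "carrier ?K - {\<zero>\<^bsub>?K\<^esub>} \<subseteq> Units ?K"
    proof
      fix k assume k: "k \<in> carrier ?K - {\<zero>\<^bsub>?K\<^esub>}"
      then obtain a s where a: "a \<in> carrier ?D" "s \<in> ?S" "k = loc_frac ?D ?S a s" using loc.fracE by blast
      have "a \<noteq> \<zero>\<^bsub>?D\<^esub>"
      proof
        assume "a = \<zero>\<^bsub>?D\<^esub>"
        then have "k = \<zero>\<^bsub>?K\<^esub>" unfolding a(3) loc.frac_zero by (intro loc.frac_eqI) (use a in auto)
        then show False using k by simp
      qed
      then have aS: "a \<in> ?S" using a(1) by simp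
      have sD: "s \<in> carrier ?D" using a(2) by simp
      have "k \<otimes>\<^bsub>?K\<^esub> loc_frac ?D ?S s a = loc_frac ?D ?S (a \<otimes>\<^bsub>?D\<^esub> s) (s \<otimes>\<^bsub>?D\<^esub> a)"
        unfolding a(3) by (rule loc.frac_mult[OF a(1,2) sD aS])
      also have "\<dots> = \<one>\<^bsub>?K\<^esub>" unfolding loc.frac_one
        by (rule loc.frac_eqI) (use a(1) sD loc.S_mult[OF a(2) aS] in \<open>auto simp: D.m_comm\<close>)
      finally have "k \<otimes>\<^bsub>?K\<^esub> loc_frac ?D ?S s a = \<one>\<^bsub>?K\<^esub>" .
      moreover have "loc_frac ?D ?S s a \<in> carrier ?K" by (rule loc.frac_in[OF sD aS])
      ultimately show "k \<in> Units ?K"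
        unfolding Units_def using k loc.L.m_comm[of k "loc_frac ?D ?S s a"]
        by (intro CollectI conjI bexI[of _ "loc_frac ?D ?S s a"]) simp_all
    qed
  qed
  then have "field ?K" by (rule loc.L.cring_fieldI)
  moreover have "localization_map ?D ?S \<circ> (+>) I \<in> ring_hom R ?K"
    by (rule ring_hom_trans[OF rcos_ring_hom loc.H.homh])
  moreover have "\<forall>a\<in>carrier R. (localization_map ?D ?S \<circ> (+>) I) a = \<zero>\<^bsub>?K\<^esub> \<longleftrightarrow> a \<in> I"
  proof
    fix a assume a: "a \<in> carrier R"
    have aD: "I +> a \<in> carrier ?D" using ring_hom_closed[OF rcos_ring_hom a] .
    have z: "\<zero>\<^bsub>?D\<^esub> = I" unfolding FactRing_def by simp
    have "localization_map ?D ?S (I +> a) = \<zero>\<^bsub>?K\<^esub> \<longleftrightarrow> localization_map ?D ?S (I +> a) = localization_map ?D ?S \<zero>\<^bsub>?D\<^esub>"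
      by simp
    also have "\<dots> \<longleftrightarrow> (\<exists>t\<in>?S. t \<otimes>\<^bsub>?D\<^esub> (I +> a) = t \<otimes>\<^bsub>?D\<^esub> \<zero>\<^bsub>?D\<^esub>)"
      by (rule loc.loc_map_eq_iff[OF aD D.zero_closed])
    also have "\<dots> \<longleftrightarrow> I +> a = \<zero>\<^bsub>?D\<^esub>"
      using aD D.integral_iff D.one_closed D.zero_not_one by auto
    also have "\<dots> \<longleftrightarrow> a \<in> I" unfolding z
      using a rcos_const_imp_mem a_coset_join2[OF a] a_subgroup additive_subgroup.a_subgroup by (metis a_rcos_const)
    finally show "(localization_map ?D ?S \<circ> (+>) I) a = \<zero>\<^bsub>?K\<^esub> \<longleftrightarrow> a \<in> I" by simp
  qed
  ultimately show ?thesis by blast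
qed

section \<open>Monic forms\<close>

context cring
begin

text \<open>Divided by x^e, these are the elements of 1 + w R[w] of degree at most e in w = v / x.
  Vanishing of such an element in positive degree is an equation of integral dependence of
  \<open>x\<close> over \<open>v\<close>.\<close>

fun monic_forms :: "'a \<Rightarrow> 'a \<Rightarrow> nat \<Rightarrow> 'a set" where
  "monic_forms x v 0 = {\<one>}"
| "monic_forms x v (Suc e) = {x [^] Suc e \<oplus> v \<otimes> f | f. f \<in> forms R x v e}"

context
  fixes x v assumes xv [simp]: "x \<in> carrier R" "v \<in> carrier R"
begin

lemma monic_SucI: "f \<in> forms R x v e \<Longrightarrow> x [^] Suc e \<oplus> v \<otimes> f \<in> monic_forms x v (Suc e)"
  by auto

lemma monic_SucE:
  assumes "t \<in> monic_forms x v (Suc e)"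
  obtains f where "f \<in> forms R x v e" "t = x [^] Suc e \<oplus> v \<otimes> f"
  using assms by auto

lemma monic_pow: "x [^] e \<in> monic_forms x v e"
proof (cases e)
  case (Suc e')
  have "x [^] Suc e' \<oplus> v \<otimes> \<zero> \<in> monic_forms x v (Suc e')" by (rule monic_SucI[OF forms_zero[OF xv]])
  then show ?thesis using Suc by simp
qed simp

lemma monic_in_forms: "t \<in> monic_forms x v e \<Longrightarrow> t \<in> forms R x v e"
proof (cases e)
  case (Suc e')
  assume "t \<in> monic_forms x v e"
  then obtain f where "f \<in> forms R x v e'" "t = x [^] Suc e' \<oplus> v \<otimes> f" using Suc monic_SucE by metis
  then show ?thesis using Suc forms_add[OF xv forms_pow[OF xv] forms_v[OF xv]] by metis
qed simp

lemma monic_closed: "t \<in> monic_forms x v e \<Longrightarrow> t \<in> carrier R"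
  using monic_in_forms forms_closed[OF xv] by blast

text \<open>Divided by x^(e+1), the sum is t / x^e + w (f / x^e): adding a multiple of w to an
  element of 1 + w R[w] stays in that set.\<close>

lemma monic_shift:
  assumes t: "t \<in> monic_forms x v e" and f: "f \<in> forms R x v e"
  shows "x \<otimes> t \<oplus> v \<otimes> f \<in> monic_forms x v (Suc e)"
proof (cases e)
  case 0
  then have "x \<otimes> t \<oplus> v \<otimes> f = x [^] Suc 0 \<oplus> v \<otimes> f" using t by simp
  then show ?thesis using monic_SucI[of f 0] f 0 by simp
next
  case (Suc d)
  obtain g where g: "g \<in> forms R x v d" "t = x [^] Suc d \<oplus> v \<otimes> g" using t Suc monic_SucE by metis
  have "x \<otimes> t \<oplus> v \<otimes> f = x [^] Suc d \<otimes> x \<oplus> v \<otimes> (x \<otimes> g \<oplus> f)"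
    unfolding g(2) using forms_closed[OF xv g(1)] forms_closed[OF xv f] xv nat_pow_closed[OF xv(1), of "Suc d"] by algebra
  moreover have "x \<otimes> g \<oplus> f \<in> forms R x v e" using forms_add[OF xv forms_x[OF xv g(1)]] f Suc by simp
  ultimately show ?thesis using monic_SucI[of "x \<otimes> g \<oplus> f" e] Suc by simp
qed

lemma monic_mult:
  assumes t: "t \<in> monic_forms x v e" and s: "s \<in> monic_forms x v d"
  shows "t \<otimes> s \<in> monic_forms x v (e + d)"
proof (cases e)
  case 0
  then show ?thesis using t s monic_closed by simp
next
  case (Suc e')
  obtain f where f: "f \<in> forms R x v e'" "t = x [^] Suc e' \<oplus> v \<otimes> f" using t Suc monic_SucE by metis
  have fs: "f \<otimes> s \<in> forms R x v (e' + d)" by (rule forms_mult[OF xv f(1) monic_in_forms[OF s]])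
  have pw: "x [^] j \<otimes> s \<in> monic_forms x v (j + d)" for j :: nat
  proof (induction j)
    case (Suc j)
    have "x \<otimes> (x [^] j \<otimes> s) \<oplus> v \<otimes> \<zero> \<in> monic_forms x v (Suc (j + d))" by (rule monic_shift[OF Suc forms_zero[OF xv]])
    then show ?case using monic_closed[OF s] by (simp add: m_ac)
  qed (use s monic_closed in simp)
  have "x \<otimes> (x [^] e' \<otimes> s) \<oplus> v \<otimes> (f \<otimes> s) \<in> monic_forms x v (Suc (e' + d))"
    by (rule monic_shift[OF pw fs])
  moreover have "x \<otimes> (x [^] e' \<otimes> s) \<oplus> v \<otimes> (f \<otimes> s) = t \<otimes> s"
    unfolding f(2) nat_pow_Suc using forms_closed[OF xv f(1)] monic_closed[OF s] xv nat_pow_closed[OF xv(1), of e'] by algebra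
  ultimately show ?thesis using Suc by simp
qed

end

end

text \<open>\<open>M\<close> is the affine chart \<open>R[v / x]\<close> of the blow-up of \<open>(x, v)\<close>, localized at \<open>1 + w R[w]\<close>.\<close>

locale blowup = noetherian_hom R K h + S: field K for R (structure) and K (structure) and h +
  fixes x v
  assumes x [simp]: "x \<in> carrier R" and v [simp]: "v \<in> carrier R"
    and hx: "h x \<noteq> \<zero>\<^bsub>K\<^esub>"
    and monic_nz: "\<And>e t. t \<in> R.monic_forms x v e \<Longrightarrow> h t \<noteq> \<zero>\<^bsub>K\<^esub>"
begin

abbreviation "Fm \<equiv> forms R x v"
abbreviation "T \<equiv> R.monic_forms x v"

lemmas fc = R.forms_closed[OF x v]
lemmas tc = R.monic_closed[OF x v]

lemma t_unit: "t \<in> T e \<Longrightarrow> h t \<in> Units K"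
  using monic_nz tc S.field_Units by blast

lemma cancel_t:
  assumes "t \<in> T e" "k \<in> carrier K" "l \<in> carrier K" "h t \<otimes>\<^bsub>K\<^esub> k = h t \<otimes>\<^bsub>K\<^esub> l"
  shows "k = l"
  using assms S.m_lcancel[of "h t" k l] monic_nz[OF assms(1)] tc[OF assms(1)] by simp

text \<open>Numerator and denominator are forms of the same degree, so the powers of
  \<open>x\<close> needed to write them as polynomials in w cancel. No fraction with denominator
  \<open>x\<close> alone is mentioned.\<close>

definition "M = {k \<in> carrier K. \<exists>e. \<exists>f\<in>Fm e. \<exists>t\<in>T e. h t \<otimes>\<^bsub>K\<^esub> k = h f}"

definition "w = inv\<^bsub>K\<^esub> (h x) \<otimes>\<^bsub>K\<^esub> h v"

lemma M_I: "k \<in> carrier K \<Longrightarrow> f \<in> Fm e \<Longrightarrow> t \<in> T e \<Longrightarrow> h t \<otimes>\<^bsub>K\<^esub> k = h f \<Longrightarrow> k \<in> M"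
  unfolding M_def by blast

lemma M_E:
  assumes "k \<in> M"
  obtains e f t where "k \<in> carrier K" "f \<in> Fm e" "t \<in> T e" "h t \<otimes>\<^bsub>K\<^esub> k = h f"
  using assms unfolding M_def by blast

lemma quotient_in_M:
  assumes f: "f \<in> Fm e" and t: "t \<in> T e"
  shows "inv\<^bsub>K\<^esub> (h t) \<otimes>\<^bsub>K\<^esub> h f \<in> M" "h t \<otimes>\<^bsub>K\<^esub> (inv\<^bsub>K\<^esub> (h t) \<otimes>\<^bsub>K\<^esub> h f) = h f"
proof -
  note u = t_unit[OF t] and fcf = fc[OF f]
  show e: "h t \<otimes>\<^bsub>K\<^esub> (inv\<^bsub>K\<^esub> (h t) \<otimes>\<^bsub>K\<^esub> h f) = h f"
    using u fcf S.Units_closed[OF u] by (simp flip: S.m_assoc)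
  show "inv\<^bsub>K\<^esub> (h t) \<otimes>\<^bsub>K\<^esub> h f \<in> M"
    by (rule M_I[OF _ f t e]) (use u fcf in simp)
qed

lemma M_subcring: "subcring M K"
proof (rule S.subcringI'[OF S.subringI])
  show "M \<subseteq> carrier K" unfolding M_def by blast
  show "\<one>\<^bsub>K\<^esub> \<in> M" by (rule M_I[where e = 0 and f = \<one> and t = \<one>]) auto
  fix k assume "k \<in> M"
  then obtain e f t where k: "k \<in> carrier K" "f \<in> Fm e" "t \<in> T e" "h t \<otimes>\<^bsub>K\<^esub> k = h f" by (rule M_E)
  note c = fc[OF k(2)] tc[OF k(3)]
  have ht: "h t \<in> carrier K" using c by simp
  show "\<ominus>\<^bsub>K\<^esub> k \<in> M"
  proof (rule M_I[OF _ _ k(3)])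
    show "\<ominus> \<one> \<otimes> f \<in> Fm e" by (rule R.forms_scale[OF x v k(2)]) simp
    have "h t \<otimes>\<^bsub>K\<^esub> \<ominus>\<^bsub>K\<^esub> k = \<ominus>\<^bsub>K\<^esub> (h t \<otimes>\<^bsub>K\<^esub> k)" using ht k(1) by algebra
    then show "h t \<otimes>\<^bsub>K\<^esub> \<ominus>\<^bsub>K\<^esub> k = h (\<ominus> \<one> \<otimes> f)" unfolding k(4) using c by (simp add: R.l_minus)
  qed (use k in simp)
  fix l assume "l \<in> M"
  then obtain d g s where l: "l \<in> carrier K" "g \<in> Fm d" "s \<in> T d" "h s \<otimes>\<^bsub>K\<^esub> l = h g" by (rule M_E)
  note c' = fc[OF l(2)] tc[OF l(3)]
  have hs: "h s \<in> carrier K" using c' by simp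
  have ts: "t \<otimes> s \<in> T (e + d)" by (rule R.monic_mult[OF x v k(3) l(3)])
  show "k \<otimes>\<^bsub>K\<^esub> l \<in> M"
  proof (rule M_I[OF _ _ ts])
    show "f \<otimes> g \<in> Fm (e + d)" by (rule R.forms_mult[OF x v k(2) l(2)])
    have "h (t \<otimes> s) \<otimes>\<^bsub>K\<^esub> (k \<otimes>\<^bsub>K\<^esub> l) = (h t \<otimes>\<^bsub>K\<^esub> h s) \<otimes>\<^bsub>K\<^esub> (k \<otimes>\<^bsub>K\<^esub> l)" using c c' by simp
    also have "\<dots> = (h t \<otimes>\<^bsub>K\<^esub> k) \<otimes>\<^bsub>K\<^esub> (h s \<otimes>\<^bsub>K\<^esub> l)" using ht hs k(1) l(1) by algebra
    also have "\<dots> = h (f \<otimes> g)" unfolding k(4) l(4) using c c' by simp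
    finally show "h (t \<otimes> s) \<otimes>\<^bsub>K\<^esub> (k \<otimes>\<^bsub>K\<^esub> l) = h (f \<otimes> g)" .
  qed (use k l in simp)
  show "k \<oplus>\<^bsub>K\<^esub> l \<in> M"
  proof (rule M_I[OF _ _ ts])
    have "s \<otimes> f \<in> Fm (d + e)" "t \<otimes> g \<in> Fm (e + d)"
      by (rule R.forms_mult[OF x v R.monic_in_forms[OF x v l(3)] k(2)])
        (rule R.forms_mult[OF x v R.monic_in_forms[OF x v k(3)] l(2)])
    then show "s \<otimes> f \<oplus> t \<otimes> g \<in> Fm (e + d)" using R.forms_add[OF x v] by (simp add: add.commute)
    have "h (t \<otimes> s) \<otimes>\<^bsub>K\<^esub> (k \<oplus>\<^bsub>K\<^esub> l) = (h t \<otimes>\<^bsub>K\<^esub> h s) \<otimes>\<^bsub>K\<^esub> (k \<oplus>\<^bsub>K\<^esub> l)" using c c' by simp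
    also have "\<dots> = h s \<otimes>\<^bsub>K\<^esub> (h t \<otimes>\<^bsub>K\<^esub> k) \<oplus>\<^bsub>K\<^esub> h t \<otimes>\<^bsub>K\<^esub> (h s \<otimes>\<^bsub>K\<^esub> l)" using ht hs k(1) l(1) by algebra
    also have "\<dots> = h (s \<otimes> f \<oplus> t \<otimes> g)" unfolding k(4) l(4) using c c' by simp
    finally show "h (t \<otimes> s) \<otimes>\<^bsub>K\<^esub> (k \<oplus>\<^bsub>K\<^esub> l) = h (s \<otimes> f \<oplus> t \<otimes> g)" .
  qed (use k l in simp)
qed

abbreviation "KM \<equiv> K\<lparr>carrier := M\<rparr>"

lemma M_K: "k \<in> M \<Longrightarrow> k \<in> carrier K" unfolding M_def by blast

lemma h_M: "c \<in> carrier R \<Longrightarrow> h c \<in> M"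
  by (rule M_I[where e = 0 and f = c and t = \<one>]) auto

lemma x_unit: "h x \<in> Units K" using hx S.field_Units by simp

lemma w_K [simp]: "w \<in> carrier K" unfolding w_def using x_unit by simp

lemma xw: "h x \<otimes>\<^bsub>K\<^esub> w = h v"
  unfolding w_def using x_unit by (simp flip: S.m_assoc)

lemma w_M: "w \<in> M"
proof (rule M_I[OF w_K])
  show "x \<otimes> \<zero> \<oplus> v \<otimes> \<one> \<in> Fm (Suc 0)" by (rule forms_SucI) simp_all
  show "x [^] Suc 0 \<in> T (Suc 0)" by (rule R.monic_pow[OF x v])
  show "h (x [^] Suc 0) \<otimes>\<^bsub>K\<^esub> w = h (x \<otimes> \<zero> \<oplus> v \<otimes> \<one>)" using xw by simp
qed

sublocale KM: domain KM
  by (rule S.subring_is_domain) (rule subcring.axioms(1)[OF M_subcring])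

lemma KM_hom: "ring_hom_cring R KM h"
  by (intro ring_hom_cring.intro ring_hom_cring_axioms.intro R.is_cring KM.is_cring ring_hom_memI)
    (simp_all add: h_M)

text \<open>For b = f / t one has 1 + w b = (x t + v f) / (x t), and the numerator is again a monic
  form; hence the reciprocal is an admissible fraction.\<close>

lemma KM_unit:
  assumes b: "b \<in> M" shows "\<one>\<^bsub>K\<^esub> \<oplus>\<^bsub>K\<^esub> w \<otimes>\<^bsub>K\<^esub> b \<in> Units KM"
proof -
  obtain e f t where k: "b \<in> carrier K" "f \<in> Fm e" "t \<in> T e" "h t \<otimes>\<^bsub>K\<^esub> b = h f" using b by (rule M_E)
  note c = fc[OF k(2)] tc[OF k(3)]
  define s where "s = x \<otimes> t \<oplus> v \<otimes> f"
  have s: "s \<in> T (Suc e)" unfolding s_def by (rule R.monic_shift[OF x v k(3,2)])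
  have xt: "x \<otimes> t \<in> Fm (Suc e)" by (rule R.forms_x[OF x v R.monic_in_forms[OF x v k(3)]])
  have xtT: "x \<otimes> t \<in> T (Suc e)" using R.monic_shift[OF x v k(3) R.forms_zero[OF x v]] c by simp
  define y where "y = inv\<^bsub>K\<^esub> (h s) \<otimes>\<^bsub>K\<^esub> h (x \<otimes> t)"
  have y: "y \<in> M" "h s \<otimes>\<^bsub>K\<^esub> y = h (x \<otimes> t)" unfolding y_def using quotient_in_M[OF xt s] by auto
  let ?k = "\<one>\<^bsub>K\<^esub> \<oplus>\<^bsub>K\<^esub> w \<otimes>\<^bsub>K\<^esub> b"
  have kK: "?k \<in> carrier K" using k(1) by simp
  have "h (x \<otimes> t) \<otimes>\<^bsub>K\<^esub> ?k = (h x \<otimes>\<^bsub>K\<^esub> h t) \<otimes>\<^bsub>K\<^esub> ?k" using c by simp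
  also have "\<dots> = h x \<otimes>\<^bsub>K\<^esub> h t \<oplus>\<^bsub>K\<^esub> (h x \<otimes>\<^bsub>K\<^esub> w) \<otimes>\<^bsub>K\<^esub> (h t \<otimes>\<^bsub>K\<^esub> b)"
    using hom_closed[OF x] hom_closed[OF c(2)] w_K k(1) by algebra
  also have "\<dots> = h s" unfolding xw k(4) s_def using c by simp
  finally have ks: "h (x \<otimes> t) \<otimes>\<^bsub>K\<^esub> ?k = h s" .
  have "h s \<otimes>\<^bsub>K\<^esub> (?k \<otimes>\<^bsub>K\<^esub> y) = ?k \<otimes>\<^bsub>K\<^esub> (h s \<otimes>\<^bsub>K\<^esub> y)"
    using kK M_K[OF y(1)] tc[OF s] by (simp add: S.m_lcomm)
  also have "\<dots> = h s \<otimes>\<^bsub>K\<^esub> \<one>\<^bsub>K\<^esub>" unfolding y(2) using ks kK c tc[OF s] by (simp add: S.m_comm)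
  finally have "?k \<otimes>\<^bsub>K\<^esub> y = \<one>\<^bsub>K\<^esub>" using cancel_t[OF s] kK M_K[OF y(1)] by simp
  moreover have "?k \<in> M" using subcringE(3,6,7)[OF M_subcring] w_M b by blast
  moreover have "y \<otimes>\<^bsub>K\<^esub> ?k = ?k \<otimes>\<^bsub>K\<^esub> y" using S.m_comm[OF M_K[OF y(1)] kK] .
  ultimately show ?thesis unfolding Units_def using y(1) by auto
qed

text \<open>Subtracting c t, where c is the leading coefficient of f, leaves a multiple of
  \<open>v\<close>, say f - c t = v g'. Since v = w x, this gives f / t = c + w (x g' / t), and the
  factor x restores the degree of g'. In other words, the image of \<open>R\<close> maps onto M / w
  M.\<close>

lemma KM_split:
  assumes k: "k \<in> M" shows "\<exists>c\<in>carrier R. \<exists>b\<in>M. k = h c \<oplus>\<^bsub>K\<^esub> w \<otimes>\<^bsub>K\<^esub> b"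
proof -
  obtain e f t where k: "k \<in> carrier K" "f \<in> Fm e" "t \<in> T e" "h t \<otimes>\<^bsub>K\<^esub> k = h f" using k by (rule M_E)
  show ?thesis
  proof (cases e)
    case 0
    then have "k = h f" "f \<in> carrier R" using k by simp_all
    then show ?thesis using subcringE(2)[OF M_subcring] by (intro bexI[of _ f] bexI[of _ "\<zero>\<^bsub>K\<^esub>"]) simp_all
  next
    case (Suc d)
    obtain c g where c: "c \<in> carrier R" "g \<in> Fm d" "f = c \<otimes> x [^] Suc d \<oplus> v \<otimes> g"
      using R.forms_decomp[OF x v] k(2) Suc by metis
    obtain t' where t': "t' \<in> Fm d" "t = x [^] Suc d \<oplus> v \<otimes> t'" using R.monic_SucE[OF x v] k(3) Suc by metis
    have gd: "g \<ominus> c \<otimes> t' \<in> Fm d" by (rule R.forms_minus[OF x v c(2) R.forms_scale[OF x v t'(1) c(1)]])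
    have xg: "x \<otimes> (g \<ominus> c \<otimes> t') \<in> Fm e" using R.forms_x[OF x v gd] Suc by simp
    define b where "b = inv\<^bsub>K\<^esub> (h t) \<otimes>\<^bsub>K\<^esub> h (x \<otimes> (g \<ominus> c \<otimes> t'))"
    have b: "b \<in> M" "h t \<otimes>\<^bsub>K\<^esub> b = h (x \<otimes> (g \<ominus> c \<otimes> t'))" unfolding b_def using quotient_in_M[OF xg k(3)] by auto
    note cl = fc[OF c(2)] fc[OF t'(1)] tc[OF k(3)] fc[OF gd]
    have feq: "f = c \<otimes> t \<oplus> v \<otimes> (g \<ominus> c \<otimes> t')"
      unfolding c(3) t'(2) using c(1) cl(1,2) v R.nat_pow_closed[OF x, of "Suc d"] by algebra
    have "h t \<otimes>\<^bsub>K\<^esub> (h c \<oplus>\<^bsub>K\<^esub> w \<otimes>\<^bsub>K\<^esub> b) = h t \<otimes>\<^bsub>K\<^esub> h c \<oplus>\<^bsub>K\<^esub> w \<otimes>\<^bsub>K\<^esub> (h t \<otimes>\<^bsub>K\<^esub> b)"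
      using hom_closed[OF cl(3)] hom_closed[OF c(1)] w_K M_K[OF b(1)] by algebra
    also have "\<dots> = h t \<otimes>\<^bsub>K\<^esub> h c \<oplus>\<^bsub>K\<^esub> w \<otimes>\<^bsub>K\<^esub> (h x \<otimes>\<^bsub>K\<^esub> h (g \<ominus> c \<otimes> t'))" unfolding b(2) using cl(4) by simp
    also have "\<dots> = h c \<otimes>\<^bsub>K\<^esub> h t \<oplus>\<^bsub>K\<^esub> (h x \<otimes>\<^bsub>K\<^esub> w) \<otimes>\<^bsub>K\<^esub> h (g \<ominus> c \<otimes> t')"
      using hom_closed[OF cl(3)] hom_closed[OF c(1)] w_K hom_closed[OF x] hom_closed[OF cl(4)] by algebra
    also have "\<dots> = h f" unfolding xw by (subst feq) (use cl c(1) in simp)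
    finally have "h t \<otimes>\<^bsub>K\<^esub> (h c \<oplus>\<^bsub>K\<^esub> w \<otimes>\<^bsub>K\<^esub> b) = h t \<otimes>\<^bsub>K\<^esub> k" unfolding k(4) .
    then have "h c \<oplus>\<^bsub>K\<^esub> w \<otimes>\<^bsub>K\<^esub> b = k" using cancel_t[OF k(3)] k(1) c(1) M_K[OF b(1)] by simp
    then show ?thesis using c(1) b(1) by blast
  qed
qed

text \<open>R[w] is Noetherian by Hilbert's basis theorem, and \<open>M\<close> consists of
  fractions over it: for f / t of degree e, both f / x^e and t / x^e lie in R[w], and t / x^e has
  the inverse x^e / t in \<open>M\<close>.\<close>

lemma KM_noetherian: "noetherian_ring KM"
proof -
  define B where "B = (\<Union>n. pols R K h w n)"
  note adj = noetherian_adjoin_subring[OF w_K, folded B_def]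
  have BK: "B \<subseteq> carrier K" using subcringE(1)[OF adj(1)] .
  have B_cring: "cring (K\<lparr>carrier := B\<rparr>)" using S.subcring_iff[OF BK] adj(1) by simp
  have "f \<in> M" if "f \<in> pols R K h w n" for f n
    using that
  proof (induction n arbitrary: f)
    case 0
    then show ?case using subcringE(2)[OF M_subcring] by simp
  next
    case (Suc n)
    from Suc(2) obtain c g where g: "c \<in> carrier R" "g \<in> pols R K h w n" "f = h c \<oplus>\<^bsub>K\<^esub> w \<otimes>\<^bsub>K\<^esub> g" by (rule pols_SucE)
    show ?case unfolding g(3)
      by (rule subcringE(7)[OF M_subcring h_M[OF g(1)] subcringE(6)[OF M_subcring w_M Suc(1)[OF g(2)]]])
  qed
  then have BM: "B \<subseteq> M" unfolding B_def by blast
  have form_B: "\<exists>b\<in>B. h (x [^] e) \<otimes>\<^bsub>K\<^esub> b = h f" if "f \<in> Fm e" for f e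
    using that
  proof (induction e arbitrary: f)
    case 0
    then show ?case using adj(4) by (intro bexI[of _ "h f"]) auto
  next
    case (Suc e)
    from Suc(2) obtain g k where g: "f = x \<otimes> g \<oplus> v \<otimes> k" "g \<in> Fm e" "k \<in> Fm e" by (rule forms_SucE)
    obtain b where b: "b \<in> B" "h (x [^] e) \<otimes>\<^bsub>K\<^esub> b = h g" using Suc(1)[OF g(2)] by auto
    obtain d where d: "d \<in> B" "h (x [^] e) \<otimes>\<^bsub>K\<^esub> d = h k" using Suc(1)[OF g(3)] by auto
    have cl: "b \<in> carrier K" "d \<in> carrier K" "h (x [^] e) \<in> carrier K" "h x \<in> carrier K" using b d BK by auto
    have "h (x [^] Suc e) \<otimes>\<^bsub>K\<^esub> (b \<oplus>\<^bsub>K\<^esub> w \<otimes>\<^bsub>K\<^esub> d) = (h (x [^] e) \<otimes>\<^bsub>K\<^esub> h x) \<otimes>\<^bsub>K\<^esub> (b \<oplus>\<^bsub>K\<^esub> w \<otimes>\<^bsub>K\<^esub> d)" by simp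
    also have "\<dots> = h x \<otimes>\<^bsub>K\<^esub> (h (x [^] e) \<otimes>\<^bsub>K\<^esub> b) \<oplus>\<^bsub>K\<^esub> (h x \<otimes>\<^bsub>K\<^esub> w) \<otimes>\<^bsub>K\<^esub> (h (x [^] e) \<otimes>\<^bsub>K\<^esub> d)"
      using cl w_K by algebra
    also have "\<dots> = h f" unfolding b(2) d(2) xw g(1) using fc[OF g(2)] fc[OF g(3)] by simp
    finally show ?case
      using subcringE(7)[OF adj(1) b(1) subcringE(6)[OF adj(1) adj(3) d(1)]] by (intro bexI)
  qed
  have hom: "id \<in> ring_hom (K\<lparr>carrier := B\<rparr>) KM"
    by (rule ring_hom_memI) (use BM in auto)
  interpret N: noetherian_hom "K\<lparr>carrier := B\<rparr>" KM id
    by (intro noetherian_hom.intro ring_hom_cring.intro ring_hom_cring_axioms.intro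
        noetherian_hom_axioms.intro B_cring KM.is_cring hom adj(2))
  show ?thesis
  proof (rule N.noetherian_fractions)
    fix k assume "k \<in> carrier KM"
    then have "k \<in> M" by simp
    then obtain e f t where k: "k \<in> carrier K" "f \<in> Fm e" "t \<in> T e" "h t \<otimes>\<^bsub>K\<^esub> k = h f" by (rule M_E)
    have xe: "x [^] e \<in> T e" "x [^] e \<in> Fm e" by (rule R.monic_pow[OF x v]) (rule R.forms_pow[OF x v])
    obtain s where s: "s \<in> B" "h (x [^] e) \<otimes>\<^bsub>K\<^esub> s = h t" using form_B[OF R.monic_in_forms[OF x v k(3)]] by auto
    obtain c where c: "c \<in> B" "h (x [^] e) \<otimes>\<^bsub>K\<^esub> c = h f" using form_B[OF k(2)] by auto
    define y where "y = inv\<^bsub>K\<^esub> (h t) \<otimes>\<^bsub>K\<^esub> h (x [^] e)"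
    have y: "y \<in> M" "h t \<otimes>\<^bsub>K\<^esub> y = h (x [^] e)" unfolding y_def using quotient_in_M[OF xe(2) k(3)] by auto
    have cl: "s \<in> carrier K" "c \<in> carrier K" "y \<in> carrier K" "h (x [^] e) \<in> carrier K" "h t \<in> carrier K"
      using s c BK M_K[OF y(1)] tc[OF k(3)] by auto
    have "h (x [^] e) \<otimes>\<^bsub>K\<^esub> (s \<otimes>\<^bsub>K\<^esub> y) = h t \<otimes>\<^bsub>K\<^esub> y" using s(2) cl by (simp flip: S.m_assoc)
    also have "\<dots> = h (x [^] e) \<otimes>\<^bsub>K\<^esub> \<one>\<^bsub>K\<^esub>" unfolding y(2) using cl by simp
    finally have "s \<otimes>\<^bsub>K\<^esub> y = \<one>\<^bsub>K\<^esub>" by (rule cancel_t[OF xe(1), rotated 2]) (use cl in simp_all)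
    moreover have "y \<otimes>\<^bsub>K\<^esub> s = s \<otimes>\<^bsub>K\<^esub> y" using S.m_comm cl by simp
    ultimately have su: "s \<in> Units KM" unfolding Units_def using y(1) s(1) BM by auto
    have "h (x [^] e) \<otimes>\<^bsub>K\<^esub> (s \<otimes>\<^bsub>K\<^esub> k) = h t \<otimes>\<^bsub>K\<^esub> k" using s(2) cl k(1) by (simp flip: S.m_assoc)
    also have "\<dots> = h (x [^] e) \<otimes>\<^bsub>K\<^esub> c" unfolding k(4) c(2) ..
    finally have "s \<otimes>\<^bsub>K\<^esub> k = c" by (rule cancel_t[OF xe(1), rotated 2]) (use cl k(1) in simp_all)
    then show "\<exists>s\<in>carrier (K\<lparr>carrier := B\<rparr>). \<exists>c\<in>carrier (K\<lparr>carrier := B\<rparr>). id s \<in> Units KM \<and> id s \<otimes>\<^bsub>KM\<^esub> k = id c"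
      using su s(1) c(1) by (intro bexI[of _ s] bexI[of _ c]) simp_all
  qed
qed

end

section \<open>Non-integrality and quintasymptotic primes\<close>

text \<open>It contains 1 exactly when \<open>x\<close> is integral over \<open>v\<close>, and it is
  contained in a prime exactly when integrality fails in the local ring at that prime.\<close>

definition integral_conductor :: "('a, 'm) ring_scheme \<Rightarrow> 'a \<Rightarrow> 'a \<Rightarrow> 'a set" where
  "integral_conductor R v x =
    {a \<in> carrier R. \<exists>e. \<exists>f\<in>forms R x v e. a \<otimes>\<^bsub>R\<^esub> x [^]\<^bsub>R\<^esub> Suc e = v \<otimes>\<^bsub>R\<^esub> f}"

lemma (in cring) integral_conductor_ideal:
  assumes xv: "x \<in> carrier R" "v \<in> carrier R"
  shows "ideal (integral_conductor R v x) R"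
proof (rule cring_idealI)
  note fc = forms_closed[OF xv]
  have I: "a \<in> integral_conductor R v x" if "a \<in> carrier R" "f \<in> forms R x v e" "a \<otimes> x [^] Suc e = v \<otimes> f" for a f e
    unfolding integral_conductor_def using that by blast
  show "integral_conductor R v x \<subseteq> carrier R" unfolding integral_conductor_def by blast
  show "\<zero> \<in> integral_conductor R v x" by (rule I[of \<zero> \<zero> 0]) (use xv in simp_all)
  fix a assume "a \<in> integral_conductor R v x"
  then obtain e f where a: "a \<in> carrier R" "f \<in> forms R x v e" "a \<otimes> x [^] Suc e = v \<otimes> f"
    unfolding integral_conductor_def by blast
  have pc: "x [^] Suc e \<in> carrier R" using xv by simp
  show "r \<otimes> a \<in> integral_conductor R v x" if r: "r \<in> carrier R" for r
  proof (rule I[OF _ forms_scale[OF xv a(2) r]])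
    have "(r \<otimes> a) \<otimes> x [^] Suc e = r \<otimes> (a \<otimes> x [^] Suc e)" using r a(1) pc by (rule m_assoc)
    also have "\<dots> = v \<otimes> (r \<otimes> f)" unfolding a(3) using r fc[OF a(2)] xv by algebra
    finally show "(r \<otimes> a) \<otimes> x [^] Suc e = v \<otimes> (r \<otimes> f)" .
  qed (use r a in simp)
  fix b assume "b \<in> integral_conductor R v x"
  then obtain d g where b: "b \<in> carrier R" "g \<in> forms R x v d" "b \<otimes> x [^] Suc d = v \<otimes> g"
    unfolding integral_conductor_def by blast
  have pd: "x [^] Suc d \<in> carrier R" using xv by simp
  \<comment> \<open>Both relations are raised to the common degree (e + 1) + (d + 1) before they are
    added.\<close>
  have p: "x [^] Suc (e + Suc d) = x [^] Suc e \<otimes> x [^] Suc d" using xv by (simp only: nat_pow_mult add_Suc)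
  have 1: "f \<otimes> x [^] Suc d \<in> forms R x v (e + Suc d)" by (rule forms_mult[OF xv a(2) forms_pow[OF xv]])
  have "g \<otimes> x [^] Suc e \<in> forms R x v (d + Suc e)" by (rule forms_mult[OF xv b(2) forms_pow[OF xv]])
  moreover have "d + Suc e = e + Suc d" by simp
  ultimately have 2: "g \<otimes> x [^] Suc e \<in> forms R x v (e + Suc d)" by metis
  show "a \<oplus> b \<in> integral_conductor R v x"
  proof (rule I[OF _ forms_add[OF xv 1 2]])
    have "(a \<oplus> b) \<otimes> x [^] Suc (e + Suc d) = (a \<otimes> x [^] Suc e) \<otimes> x [^] Suc d \<oplus> (b \<otimes> x [^] Suc d) \<otimes> x [^] Suc e"
      unfolding p using a(1) b(1) pc pd by algebra
    also have "\<dots> = v \<otimes> (f \<otimes> x [^] Suc d \<oplus> g \<otimes> x [^] Suc e)"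
      unfolding a(3) b(3) using fc[OF a(2)] fc[OF b(2)] xv pc pd by algebra
    finally show "(a \<oplus> b) \<otimes> x [^] Suc (e + Suc d) = v \<otimes> (f \<otimes> x [^] Suc d \<oplus> g \<otimes> x [^] Suc e)" .
  qed (use a b in simp)
qed

section \<open>The completed local ring at a prime\<close>

locale local_completion = noetherian_cring R for R (structure) + fixes P
  assumes P: "primeideal P R"
begin

sublocale P: primeideal P R by (rule P)

lemma localizing_complement: "localizing R (carrier R - P)"
  by (intro localizing.intro localizing_axioms.intro is_cring P.complement_submonoid)

abbreviation "A \<equiv> local_ring_at R P"
abbreviation "loc \<equiv> localization_map R (carrier R - P)"
abbreviation "mA \<equiv> local_maximal_ideal R P"
abbreviation "lfrac a s \<equiv> loc_frac R (carrier R - P) a s"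

lemma A_eq: "local_ring_at R P = localization R (carrier R - P)" by (simp add: local_ring_at_def)

sublocale A: noetherian_cring A
  unfolding A_eq by (rule cring.noetherian_cringI[OF localizing.localization_cring[OF localizing_complement]
        localizing.localization_noetherian[OF localizing_complement noetherian_ring_axioms]])

sublocale loc: ring_hom_cring R A loc
  unfolding A_eq by (rule localizing.loc_map_hom[OF localizing_complement])

lemma mA_eq: "mA = {lfrac a s | a s. a \<in> P \<and> s \<in> carrier R - P}"
  unfolding local_maximal_ideal_def A_eq by (rule localizing.mem_extended_ideal_iff[OF localizing_complement P.ideal_axioms])

lemma mA_I: "a \<in> P \<Longrightarrow> s \<in> carrier R - P \<Longrightarrow> lfrac a s \<in> mA"
  unfolding mA_eq by blast

lemma mA_E:
  assumes "y \<in> mA" obtains a s where "a \<in> P" "s \<in> carrier R - P" "y = lfrac a s"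
  using assms unfolding mA_eq by blast

lemma mA_ideal: "ideal mA A"
proof -
  have "loc ` P \<subseteq> carrier A" using P.Icarr by (intro image_subsetI) simp
  then show ?thesis unfolding local_maximal_ideal_def extended_ideal_def by (rule A.genideal_ideal)
qed

lemma A_unit: assumes y: "y \<in> carrier A" "y \<notin> mA" shows "y \<in> Units A"
proof -
  obtain a s where a: "a \<in> carrier R" "s \<in> carrier R - P" "y = lfrac a s"
    using localizing.fracE[OF localizing_complement] y(1) unfolding A_eq by metis
  have aP: "a \<in> carrier R - P" using mA_I[of a s] a y(2) by blast
  have sc: "s \<in> carrier R" using a(2) by simp
  have "y \<otimes>\<^bsub>A\<^esub> lfrac s a = lfrac (a \<otimes> s) (s \<otimes> a)"
    unfolding A_eq a(3) by (rule localizing.frac_mult[OF localizing_complement a(1,2) sc aP])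
  also have "\<dots> = \<one>\<^bsub>A\<^esub>" unfolding A_eq localizing.frac_one[OF localizing_complement]
    by (rule localizing.frac_eqI[OF localizing_complement]) (use a(1) sc localizing.S_mult[OF localizing_complement a(2) aP] localizing.S_one[OF localizing_complement] in \<open>auto simp: m_comm\<close>)
  finally have "y \<otimes>\<^bsub>A\<^esub> lfrac s a = \<one>\<^bsub>A\<^esub>" .
  moreover have fc: "lfrac s a \<in> carrier A" unfolding A_eq by (rule localizing.frac_in[OF localizing_complement sc aP])
  moreover have "lfrac s a \<otimes>\<^bsub>A\<^esub> y = y \<otimes>\<^bsub>A\<^esub> lfrac s a" by (rule A.m_comm[OF fc y(1)])
  ultimately show ?thesis unfolding Units_def using y(1) by (intro CollectI conjI bexI[of _ "lfrac s a"]) simp_all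
qed

lemma one_notin_mA: "\<one>\<^bsub>A\<^esub> \<notin> mA"
proof
  assume "\<one>\<^bsub>A\<^esub> \<in> mA"
  then obtain a s where a: "a \<in> P" "s \<in> carrier R - P" "\<one>\<^bsub>A\<^esub> = lfrac a s" by (rule mA_E)
  have ac: "a \<in> carrier R" using a(1) P.Icarr by simp
  have "lfrac \<one> \<one> = lfrac a s" using a(3) unfolding A_eq localizing.frac_one[OF localizing_complement] .
  then obtain v where v: "v \<in> carrier R - P" "v \<otimes> (\<one> \<otimes> s) = v \<otimes> (a \<otimes> \<one>)"
    using localizing.frac_eq_iff[OF localizing_complement one_closed localizing.S_one[OF localizing_complement] ac a(2)] by blast
  have "v \<otimes> s \<in> P" using v ac a(1,2) P.I_l_closed by simp
  moreover have "v \<otimes> s \<in> carrier R - P" by (rule localizing.S_mult[OF localizing_complement v(1) a(2)])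
  ultimately show False by simp
qed

sublocale adic A mA
  by (intro adic.intro adic_axioms.intro A.noetherian_cring_axioms mA_ideal)

abbreviation "CC \<equiv> completed_local_ring R P"
abbreviation "\<psi> \<equiv> completed_local_map R P"

lemma CC_eq: "completed_local_ring R P = C" by (simp add: completed_local_ring_def)
lemma psi_eq: "\<psi> a = \<phi> (loc a)" by (simp add: completed_local_map_def)

lemma one_minus_unit: assumes a: "a \<in> mA" shows "\<one>\<^bsub>A\<^esub> \<ominus>\<^bsub>A\<^esub> a \<in> Units A"
proof (rule A_unit)
  have ac: "a \<in> carrier A" using ideal.Icarr[OF mA_ideal a] .
  then show "\<one>\<^bsub>A\<^esub> \<ominus>\<^bsub>A\<^esub> a \<in> carrier A" by simp
  show "\<one>\<^bsub>A\<^esub> \<ominus>\<^bsub>A\<^esub> a \<notin> mA"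
  proof
    assume "\<one>\<^bsub>A\<^esub> \<ominus>\<^bsub>A\<^esub> a \<in> mA"
    then have "(\<one>\<^bsub>A\<^esub> \<ominus>\<^bsub>A\<^esub> a) \<oplus>\<^bsub>A\<^esub> a \<in> mA"
      using a additive_subgroup.a_closed[OF ideal.axioms(1)[OF mA_ideal]] by blast
    moreover have "(\<one>\<^bsub>A\<^esub> \<ominus>\<^bsub>A\<^esub> a) \<oplus>\<^bsub>A\<^esub> a = \<one>\<^bsub>A\<^esub>" using ac A.one_closed by algebra
    ultimately show False using one_notin_mA by simp
  qed
qed

lemma mA_power_one: "ideal_power A mA 1 = mA" by (rule A.ideal_power_1[OF mA_ideal])

lemma psi_hom: "ring_hom_cring R C \<psi>"
proof -
  have "\<phi> \<circ> loc \<in> ring_hom R C" by (rule ring_hom_trans[OF loc.homh H.homh])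
  then show ?thesis unfolding completed_local_map_def
    by (intro ring_hom_cring.intro ring_hom_cring_axioms.intro is_cring completion_cring)
qed

sublocale psi: ring_hom_cring R C \<psi> by (rule psi_hom)

sublocale C: noetherian_cring C
  by (rule C.noetherian_cringI[OF completion_noetherian])

lemma loc_unit: "s \<in> carrier R - P \<Longrightarrow> loc s \<in> Units A"
  unfolding A_eq by (rule localizing.loc_map_unit[OF localizing_complement])

lemma psi_unit: assumes s: "s \<in> carrier R - P" shows "\<exists>s'\<in>carrier C. s' \<otimes>\<^bsub>C\<^esub> \<psi> s = \<one>\<^bsub>C\<^esub>"
proof (rule bexI)
  have u: "loc s \<in> Units A" by (rule loc_unit[OF s])
  have ic: "inv\<^bsub>A\<^esub> (loc s) \<in> carrier A" "loc s \<in> carrier A" using u by (auto simp: A.Units_closed)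
  show "\<phi> (inv\<^bsub>A\<^esub> (loc s)) \<in> carrier C" using ic by simp
  have "\<phi> (inv\<^bsub>A\<^esub> (loc s)) \<otimes>\<^bsub>C\<^esub> \<psi> s = \<phi> (inv\<^bsub>A\<^esub> (loc s) \<otimes>\<^bsub>A\<^esub> loc s)" unfolding psi_eq using ic by simp
  also have "\<dots> = \<one>\<^bsub>C\<^esub>" using u by simp
  finally show "\<phi> (inv\<^bsub>A\<^esub> (loc s)) \<otimes>\<^bsub>C\<^esub> \<psi> s = \<one>\<^bsub>C\<^esub>" .
qed

lemma psi_P: assumes a: "a \<in> P" shows "\<psi> a \<in> F 1"
proof -
  have "loc a \<in> mA" unfolding localization_map_def by (rule mA_I[OF a localizing.S_one[OF localizing_complement]])
  moreover have "loc a \<in> carrier A" using a P.Icarr by simp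
  ultimately show ?thesis unfolding psi_eq using F_phi_iff[of "loc a" 1] unfolding mA_power_one by simp
qed

text \<open>The maximal ideal of the local ring generates \<open>F 1\<close>, and in
  \<open>C\<close> the denominators of its elements become invertible, so the numerators from
  \<open>P\<close> suffice.\<close>

lemma F_one_extended: "F 1 = Idl\<^bsub>C\<^esub> (\<psi> ` P)"
proof
  have sub: "\<psi> ` P \<subseteq> carrier C" using psi_P F_closed by blast
  show "Idl\<^bsub>C\<^esub> (\<psi> ` P) \<subseteq> F 1" by (rule C.genideal_minimal[OF F_ideal]) (use psi_P in blast)
  have id: "ideal (Idl\<^bsub>C\<^esub> (\<psi> ` P)) C" by (rule C.genideal_ideal[OF sub])
  show "F 1 \<subseteq> Idl\<^bsub>C\<^esub> (\<psi> ` P)"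
    unfolding F_one_generated
  proof (rule C.genideal_minimal[OF id], rule image_subsetI)
    fix y assume "y \<in> mA"
    then obtain a s where a: "a \<in> P" "s \<in> carrier R - P" "y = lfrac a s" by (rule mA_E)
    have ac: "a \<in> carrier R" and sc: "s \<in> carrier R" using a P.Icarr by auto
    have fc: "lfrac a s \<in> carrier A" unfolding A_eq by (rule localizing.frac_in[OF localizing_complement ac a(2)])
    obtain s' where s': "s' \<in> carrier C" "s' \<otimes>\<^bsub>C\<^esub> \<psi> s = \<one>\<^bsub>C\<^esub>" using psi_unit[OF a(2)] by auto
    have "loc s \<otimes>\<^bsub>A\<^esub> lfrac a s = loc a" unfolding A_eq by (rule localizing.loc_map_frac[OF localizing_complement ac a(2)])
    then have "\<phi> (loc s \<otimes>\<^bsub>A\<^esub> lfrac a s) = \<psi> a" by (simp add: psi_eq)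
    then have e: "\<psi> s \<otimes>\<^bsub>C\<^esub> \<phi> y = \<psi> a" unfolding a(3) psi_eq using fc sc by simp
    have yc: "\<phi> y \<in> carrier C" using fc a(3) by simp
    have "\<phi> y = s' \<otimes>\<^bsub>C\<^esub> (\<psi> s \<otimes>\<^bsub>C\<^esub> \<phi> y)" using s' yc sc by (simp flip: C.m_assoc)
    also have "\<dots> \<in> Idl\<^bsub>C\<^esub> (\<psi> ` P)" unfolding e
      by (rule ideal.I_l_closed[OF id _ s'(1)]) (rule subsetD[OF C.genideal_self[OF sub] imageI[OF a(1)]])
    finally show "\<phi> y \<in> Idl\<^bsub>C\<^esub> (\<psi> ` P)" .
  qed
qed

text \<open>C / F 1 is the residue field of the local ring: modulo \<open>F 1\<close>, c is the
  image of some a outside the maximal ideal, and such an a is a unit.\<close>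

lemma F_one_maximal:
  assumes c: "c \<in> carrier C" "c \<notin> F 1"
  shows "\<exists>c'\<in>carrier C. c \<otimes>\<^bsub>C\<^esub> c' \<ominus>\<^bsub>C\<^esub> \<one>\<^bsub>C\<^esub> \<in> F 1"
proof -
  obtain a where a: "a \<in> carrier A" "c \<ominus>\<^bsub>C\<^esub> \<phi> a \<in> F 1" using F_approx[OF c(1)] .
  have "\<phi> a \<in> carrier C" using a(1) by simp
  then have ceq: "c = (c \<ominus>\<^bsub>C\<^esub> \<phi> a) \<oplus>\<^bsub>C\<^esub> \<phi> a" using c(1) by algebra
  have "a \<notin> mA"
  proof
    assume "a \<in> mA"
    then have "\<phi> a \<in> F 1" using F_phi_iff[OF a(1)] mA_power_one by simp
    then have "(c \<ominus>\<^bsub>C\<^esub> \<phi> a) \<oplus>\<^bsub>C\<^esub> \<phi> a \<in> F 1" by (rule additive_subgroup.a_closed[OF ideal.axioms(1)[OF F_ideal] a(2)])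
    then show False using c(2) ceq by simp
  qed
  then have u: "a \<in> Units A" by (rule A_unit[OF a(1)])
  let ?c' = "\<phi> (inv\<^bsub>A\<^esub> a)"
  have c': "?c' \<in> carrier C" using u by simp
  have "\<phi> a \<otimes>\<^bsub>C\<^esub> ?c' = \<phi> (a \<otimes>\<^bsub>A\<^esub> inv\<^bsub>A\<^esub> a)" using u a(1) by (simp del: A.Units_r_inv)
  then have one: "\<phi> a \<otimes>\<^bsub>C\<^esub> ?c' = \<one>\<^bsub>C\<^esub>" using u by simp
  have "c \<otimes>\<^bsub>C\<^esub> ?c' \<ominus>\<^bsub>C\<^esub> \<phi> a \<otimes>\<^bsub>C\<^esub> ?c' = (c \<ominus>\<^bsub>C\<^esub> \<phi> a) \<otimes>\<^bsub>C\<^esub> ?c'"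
    using c(1) \<open>\<phi> a \<in> carrier C\<close> c' by algebra
  also have "\<dots> \<in> F 1" by (rule ideal.I_r_closed[OF F_ideal a(2) c'])
  finally show ?thesis unfolding one using c' by blast
qed

lemma one_notin_F: "\<one>\<^bsub>C\<^esub> \<notin> F 1"
proof
  assume "\<one>\<^bsub>C\<^esub> \<in> F 1"
  then have "\<phi> \<one>\<^bsub>A\<^esub> \<in> F 1" by simp
  then show False using F_phi_iff[OF A.one_closed] one_notin_mA mA_power_one by simp
qed

lemma F_one_prime: "primeideal (F 1) C"
proof (rule primeidealI[OF F_ideal completion_cring])
  show "carrier C \<noteq> F 1" using one_notin_F C.one_closed by metis
  fix f g assume f: "f \<in> carrier C" and g: "g \<in> carrier C" and fg: "f \<otimes>\<^bsub>C\<^esub> g \<in> F 1"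
  show "f \<in> F 1 \<or> g \<in> F 1"
  proof (rule ccontr)
    assume n: "\<not> ?thesis"
    then obtain f' where f': "f' \<in> carrier C" "f \<otimes>\<^bsub>C\<^esub> f' \<ominus>\<^bsub>C\<^esub> \<one>\<^bsub>C\<^esub> \<in> F 1" using F_one_maximal[OF f] by auto
    have "g = f' \<otimes>\<^bsub>C\<^esub> (f \<otimes>\<^bsub>C\<^esub> g) \<ominus>\<^bsub>C\<^esub> g \<otimes>\<^bsub>C\<^esub> (f \<otimes>\<^bsub>C\<^esub> f' \<ominus>\<^bsub>C\<^esub> \<one>\<^bsub>C\<^esub>)"
      using f g f'(1) by algebra
    moreover have "f' \<otimes>\<^bsub>C\<^esub> (f \<otimes>\<^bsub>C\<^esub> g) \<ominus>\<^bsub>C\<^esub> g \<otimes>\<^bsub>C\<^esub> (f \<otimes>\<^bsub>C\<^esub> f' \<ominus>\<^bsub>C\<^esub> \<one>\<^bsub>C\<^esub>) \<in> F 1"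
      by (rule C.ideal_minus_closed[OF F_ideal ideal.I_l_closed[OF F_ideal fg f'(1)] ideal.I_l_closed[OF F_ideal f'(2) g]])
    ultimately show False using n by simp
  qed
qed

text \<open>The geometric series in -f. \<open>v_complete\<close> only provides a sequence of tails;
  separatedness shows that consecutive tails agree, which turns the recursion into s = 1 - f
  s.\<close>

lemma one_plus_inverse:
  assumes f: "f \<in> F 1" shows "\<exists>s\<in>carrier C. (\<one>\<^bsub>C\<^esub> \<oplus>\<^bsub>C\<^esub> f) \<otimes>\<^bsub>C\<^esub> s = \<one>\<^bsub>C\<^esub>"
proof -
  have fc: "f \<in> carrier C" by (rule F_closed[OF f])
  have nf: "\<ominus>\<^bsub>C\<^esub> f \<in> F 1" using additive_subgroup.a_inv_closed[OF ideal.axioms(1)[OF F_ideal] f] .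
  have "\<exists>s. \<forall>n. s n \<in> carrier C \<and> s n = \<one>\<^bsub>C\<^esub> \<oplus>\<^bsub>C\<^esub> (\<ominus>\<^bsub>C\<^esub> f) \<otimes>\<^bsub>C\<^esub> s (Suc n)"
    by (rule v_complete[OF nf, of "\<lambda>_. \<one>\<^bsub>C\<^esub>"]) (rule C.one_closed)
  then obtain s where ss: "\<forall>n. s n \<in> carrier C \<and> s n = \<one>\<^bsub>C\<^esub> \<oplus>\<^bsub>C\<^esub> (\<ominus>\<^bsub>C\<^esub> f) \<otimes>\<^bsub>C\<^esub> s (Suc n)" by (rule exE)
  have s: "s n \<in> carrier C" "s n = \<one>\<^bsub>C\<^esub> \<oplus>\<^bsub>C\<^esub> (\<ominus>\<^bsub>C\<^esub> f) \<otimes>\<^bsub>C\<^esub> s (Suc n)" for n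
    using spec[OF ss, of n] by (rule conjunct1, rule conjunct2)
  have "s n \<ominus>\<^bsub>C\<^esub> s (Suc n) \<in> F l" for n l
  proof (induction l arbitrary: n)
    case 0
    then show ?case unfolding F_0 using s(1) by simp
  next
    case (Suc l)
    have "s n \<ominus>\<^bsub>C\<^esub> s (Suc n) = (\<one>\<^bsub>C\<^esub> \<oplus>\<^bsub>C\<^esub> (\<ominus>\<^bsub>C\<^esub> f) \<otimes>\<^bsub>C\<^esub> s (Suc n)) \<ominus>\<^bsub>C\<^esub> (\<one>\<^bsub>C\<^esub> \<oplus>\<^bsub>C\<^esub> (\<ominus>\<^bsub>C\<^esub> f) \<otimes>\<^bsub>C\<^esub> s (Suc (Suc n)))"
      using s(2)[of n] s(2)[of "Suc n"] by metis
    also have "\<dots> = (\<ominus>\<^bsub>C\<^esub> f) \<otimes>\<^bsub>C\<^esub> (s (Suc n) \<ominus>\<^bsub>C\<^esub> s (Suc (Suc n)))"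
      using fc s(1)[of "Suc n"] s(1)[of "Suc (Suc n)"] C.one_closed by algebra
    also have "\<dots> \<in> F (1 + l)" by (rule F_mult[OF nf Suc])
    finally show ?case by simp
  qed
  then have "s 0 \<ominus>\<^bsub>C\<^esub> s (Suc 0) = \<zero>\<^bsub>C\<^esub>" by (rule F_zero)
  then have eq: "s 0 = s (Suc 0)" using C.r_right_minus_eq[OF s(1) s(1)] by simp
  have "s 0 = \<one>\<^bsub>C\<^esub> \<oplus>\<^bsub>C\<^esub> (\<ominus>\<^bsub>C\<^esub> f) \<otimes>\<^bsub>C\<^esub> s 0" using s(2)[of 0] eq by metis
  then have "(\<one>\<^bsub>C\<^esub> \<oplus>\<^bsub>C\<^esub> f) \<otimes>\<^bsub>C\<^esub> s 0 = (\<one>\<^bsub>C\<^esub> \<oplus>\<^bsub>C\<^esub> (\<ominus>\<^bsub>C\<^esub> f) \<otimes>\<^bsub>C\<^esub> s 0) \<oplus>\<^bsub>C\<^esub> f \<otimes>\<^bsub>C\<^esub> s 0"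
    using fc s(1)[of 0] by (metis C.l_distr C.l_one C.one_closed)
  also have "\<dots> = \<one>\<^bsub>C\<^esub>" using fc s(1)[of 0] C.one_closed by algebra
  finally show ?thesis using s(1) by blast
qed

text \<open>\<open>C\<close> is local: an element outside \<open>F 1\<close> divides some 1 + f with
  f in \<open>F 1\<close>, hence is a unit. This keeps the sum of the extended ideal and a minimal
  prime inside \<open>F 1\<close>.\<close>

lemma prime_in_F_one:
  assumes z: "primeideal z C" shows "z \<subseteq> F 1"
proof
  fix c assume c: "c \<in> z"
  interpret z: primeideal z C by (rule z)
  have cc: "c \<in> carrier C" using z.Icarr[OF c] .
  show "c \<in> F 1"
  proof (rule ccontr)
    assume "c \<notin> F 1"
    then obtain c' where c': "c' \<in> carrier C" "c \<otimes>\<^bsub>C\<^esub> c' \<ominus>\<^bsub>C\<^esub> \<one>\<^bsub>C\<^esub> \<in> F 1" using F_one_maximal[OF cc] by auto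
    obtain s where s: "s \<in> carrier C" "(\<one>\<^bsub>C\<^esub> \<oplus>\<^bsub>C\<^esub> (c \<otimes>\<^bsub>C\<^esub> c' \<ominus>\<^bsub>C\<^esub> \<one>\<^bsub>C\<^esub>)) \<otimes>\<^bsub>C\<^esub> s = \<one>\<^bsub>C\<^esub>"
      using one_plus_inverse[OF c'(2)] by auto
    have "(\<one>\<^bsub>C\<^esub> \<oplus>\<^bsub>C\<^esub> (c \<otimes>\<^bsub>C\<^esub> c' \<ominus>\<^bsub>C\<^esub> \<one>\<^bsub>C\<^esub>)) \<otimes>\<^bsub>C\<^esub> s = c \<otimes>\<^bsub>C\<^esub> (c' \<otimes>\<^bsub>C\<^esub> s)"
      using cc c'(1) s(1) C.one_closed by algebra
    then have "c \<otimes>\<^bsub>C\<^esub> (c' \<otimes>\<^bsub>C\<^esub> s) = \<one>\<^bsub>C\<^esub>" using s(2) by metis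
    moreover have "c \<otimes>\<^bsub>C\<^esub> (c' \<otimes>\<^bsub>C\<^esub> s) \<in> z" by (rule z.I_r_closed[OF c]) (use c' s in simp)
    ultimately show False using C.primeideal_one[OF z] by simp
  qed
qed

lemma extended_P: "extended_ideal C \<psi> P = F 1"
  unfolding extended_ideal_def F_one_extended ..

text \<open>A form has finitely many coefficients, so one denominator outside \<open>P\<close>
  clears them all; the recursion multiplies the denominators of the two parts.\<close>

lemma loc_forms:
  assumes xv: "x \<in> carrier R" "v \<in> carrier R" and f: "f \<in> forms A (loc x) (loc v) e"
  shows "\<exists>t\<in>carrier R - P. \<exists>g\<in>forms R x v e. loc t \<otimes>\<^bsub>A\<^esub> f = loc g"
  using f
proof (induction e arbitrary: f)
  case 0
  then obtain a s where a: "a \<in> carrier R" "s \<in> carrier R - P" "f = lfrac a s" using localizing.fracE[OF localizing_complement] unfolding A_eq by auto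
  then have "loc s \<otimes>\<^bsub>A\<^esub> f = loc a" using localizing.loc_map_frac[OF localizing_complement a(1,2)] unfolding A_eq by simp
  then show ?case using a by auto
next
  case (Suc e)
  from Suc(2) obtain g k where g: "f = loc x \<otimes>\<^bsub>A\<^esub> g \<oplus>\<^bsub>A\<^esub> loc v \<otimes>\<^bsub>A\<^esub> k" "g \<in> forms A (loc x) (loc v) e" "k \<in> forms A (loc x) (loc v) e"
    by (rule forms_SucE)
  obtain t g' where t: "t \<in> carrier R - P" "g' \<in> forms R x v e" "loc t \<otimes>\<^bsub>A\<^esub> g = loc g'" using Suc(1)[OF g(2)] by auto
  obtain s k' where s: "s \<in> carrier R - P" "k' \<in> forms R x v e" "loc s \<otimes>\<^bsub>A\<^esub> k = loc k'" using Suc(1)[OF g(3)] by auto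
  have lx: "loc x \<in> carrier A" "loc v \<in> carrier A" using xv by simp_all
  have cl: "g \<in> carrier A" "k \<in> carrier A" "g' \<in> carrier R" "k' \<in> carrier R" "t \<in> carrier R" "s \<in> carrier R"
    using A.forms_closed[OF lx g(2)] A.forms_closed[OF lx g(3)] forms_closed[OF xv t(2)] forms_closed[OF xv s(2)] t(1) s(1) by auto
  have lts: "loc t \<in> carrier A" "loc s \<in> carrier A" using cl by simp_all
  have "loc (t \<otimes> s) \<otimes>\<^bsub>A\<^esub> f = (loc t \<otimes>\<^bsub>A\<^esub> loc s) \<otimes>\<^bsub>A\<^esub> (loc x \<otimes>\<^bsub>A\<^esub> g \<oplus>\<^bsub>A\<^esub> loc v \<otimes>\<^bsub>A\<^esub> k)" unfolding g(1) using cl by simp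
  also have "\<dots> = loc x \<otimes>\<^bsub>A\<^esub> (loc s \<otimes>\<^bsub>A\<^esub> (loc t \<otimes>\<^bsub>A\<^esub> g)) \<oplus>\<^bsub>A\<^esub> loc v \<otimes>\<^bsub>A\<^esub> (loc t \<otimes>\<^bsub>A\<^esub> (loc s \<otimes>\<^bsub>A\<^esub> k))"
    using lts lx cl(1,2) by algebra
  also have "\<dots> = loc (x \<otimes> (s \<otimes> g') \<oplus> v \<otimes> (t \<otimes> k'))" unfolding t(3) s(3) using cl xv by simp
  finally have "loc (t \<otimes> s) \<otimes>\<^bsub>A\<^esub> f = loc (x \<otimes> (s \<otimes> g') \<oplus> v \<otimes> (t \<otimes> k'))" .
  moreover have "x \<otimes> (s \<otimes> g') \<oplus> v \<otimes> (t \<otimes> k') \<in> forms R x v (Suc e)"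
    by (rule forms_SucI[OF forms_scale[OF xv t(2) cl(6)] forms_scale[OF xv s(2) cl(5)]])
  ultimately show ?case using localizing.S_mult[OF localizing_complement t(1) s(1)] by blast
qed

text \<open>Only the coefficients are approximated by elements of the local ring; the monomials come
  from there already, and the error stays in the ideal F l.\<close>

lemma forms_approx:
  assumes xv: "x \<in> carrier A" "v \<in> carrier A" and f: "f \<in> forms C (\<phi> x) (\<phi> v) e"
  shows "\<exists>g\<in>forms A x v e. f \<ominus>\<^bsub>C\<^esub> \<phi> g \<in> F l"
  using f
proof (induction e arbitrary: f)
  case 0
  then obtain a where "a \<in> carrier A" "f \<ominus>\<^bsub>C\<^esub> \<phi> a \<in> F l" using F_approx[of f l] by auto
  then show ?case by auto
next
  case (Suc e)
  from Suc(2) obtain g k where g: "f = \<phi> x \<otimes>\<^bsub>C\<^esub> g \<oplus>\<^bsub>C\<^esub> \<phi> v \<otimes>\<^bsub>C\<^esub> k" "g \<in> forms C (\<phi> x) (\<phi> v) e" "k \<in> forms C (\<phi> x) (\<phi> v) e"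
    by (rule forms_SucE)
  obtain g' where g': "g' \<in> forms A x v e" "g \<ominus>\<^bsub>C\<^esub> \<phi> g' \<in> F l" using Suc(1)[OF g(2)] by auto
  obtain k' where k': "k' \<in> forms A x v e" "k \<ominus>\<^bsub>C\<^esub> \<phi> k' \<in> F l" using Suc(1)[OF g(3)] by auto
  have px: "\<phi> x \<in> carrier C" "\<phi> v \<in> carrier C" using xv by simp_all
  have cl: "g \<in> carrier C" "k \<in> carrier C" "g' \<in> carrier A" "k' \<in> carrier A"
    using C.forms_closed[OF px g(2)] C.forms_closed[OF px g(3)] A.forms_closed[OF xv g'(1)] A.forms_closed[OF xv k'(1)] by auto
  have pg: "\<phi> g' \<in> carrier C" "\<phi> k' \<in> carrier C" using cl by simp_all
  have "f \<ominus>\<^bsub>C\<^esub> \<phi> (x \<otimes>\<^bsub>A\<^esub> g' \<oplus>\<^bsub>A\<^esub> v \<otimes>\<^bsub>A\<^esub> k') =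
    (\<phi> x \<otimes>\<^bsub>C\<^esub> g \<oplus>\<^bsub>C\<^esub> \<phi> v \<otimes>\<^bsub>C\<^esub> k) \<ominus>\<^bsub>C\<^esub> (\<phi> x \<otimes>\<^bsub>C\<^esub> \<phi> g' \<oplus>\<^bsub>C\<^esub> \<phi> v \<otimes>\<^bsub>C\<^esub> \<phi> k')"
    unfolding g(1) using xv cl by simp
  also have "\<dots> = \<phi> x \<otimes>\<^bsub>C\<^esub> (g \<ominus>\<^bsub>C\<^esub> \<phi> g') \<oplus>\<^bsub>C\<^esub> \<phi> v \<otimes>\<^bsub>C\<^esub> (k \<ominus>\<^bsub>C\<^esub> \<phi> k')" using px cl(1,2) pg by algebra
  also have "\<dots> \<in> F l"
    by (rule additive_subgroup.a_closed[OF ideal.axioms(1)[OF F_ideal]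
          ideal.I_l_closed[OF F_ideal g'(2) px(1)] ideal.I_l_closed[OF F_ideal k'(2) px(2)]])
  finally show ?case using forms_SucI[OF g'(1) k'(1)] by blast
qed

text \<open>If such a form vanished in \<open>C\<close>, approximating its coefficients would put
  x^(d+1) into the closure of v (x, v)^d in the local ring. That ideal is closed by Krull's
  intersection theorem, and clearing denominators yields an element of the conductor outside
  \<open>P\<close>.\<close>

lemma monic_forms_nonzero:
  assumes xv: "x \<in> carrier R" "v \<in> carrier R" and sub: "integral_conductor R v x \<subseteq> P"
    and t: "t \<in> C.monic_forms (\<psi> x) (\<psi> v) e"
  shows "t \<noteq> \<zero>\<^bsub>C\<^esub>"
proof
  assume t0: "t = \<zero>\<^bsub>C\<^esub>"
  show False
  proof (cases e)
    case 0
    then have "\<one>\<^bsub>C\<^esub> = \<zero>\<^bsub>C\<^esub>" using t t0 by simp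
    then show False using one_notin_F additive_subgroup.zero_closed[OF ideal.axioms(1)[OF F_ideal]] by simp
  next
    case (Suc d)
    have px: "\<psi> x \<in> carrier C" "\<psi> v \<in> carrier C" using xv by simp_all
    have lx: "loc x \<in> carrier A" "loc v \<in> carrier A" using xv by simp_all
    obtain f where f: "f \<in> forms C (\<psi> x) (\<psi> v) d" "t = \<psi> x [^]\<^bsub>C\<^esub> Suc d \<oplus>\<^bsub>C\<^esub> \<psi> v \<otimes>\<^bsub>C\<^esub> f"
      using C.monic_SucE[OF px] t Suc by metis
    have fc: "f \<in> carrier C" by (rule C.forms_closed[OF px f(1)])
    let ?H = "{loc v \<otimes>\<^bsub>A\<^esub> f | f. f \<in> forms A (loc x) (loc v) d}"
    have "loc x [^]\<^bsub>A\<^esub> Suc d \<in> ?H"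
    proof (rule krull_closed[OF A.vforms_ideal[OF lx] _ one_minus_unit])
      show "loc x [^]\<^bsub>A\<^esub> Suc d \<in> carrier A" using lx by simp
      fix l
      obtain g where g: "g \<in> forms A (loc x) (loc v) d" "f \<ominus>\<^bsub>C\<^esub> \<phi> g \<in> F l"
        using forms_approx[OF lx] f(1) unfolding psi_eq by blast
      have gc: "g \<in> carrier A" by (rule A.forms_closed[OF lx g(1)])
      \<comment> \<open>The sign moves v g to the other side: a vanishing monic form reads x^(d+1) =
        v (-f).\<close>
      let ?g = "\<ominus>\<^bsub>A\<^esub> \<one>\<^bsub>A\<^esub> \<otimes>\<^bsub>A\<^esub> g"
      have gf: "?g \<in> forms A (loc x) (loc v) d" by (rule A.forms_scale[OF lx g(1)]) simp
      have e1: "loc x [^]\<^bsub>A\<^esub> Suc d \<ominus>\<^bsub>A\<^esub> loc v \<otimes>\<^bsub>A\<^esub> ?g = loc x [^]\<^bsub>A\<^esub> Suc d \<oplus>\<^bsub>A\<^esub> loc v \<otimes>\<^bsub>A\<^esub> g"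
        using A.nat_pow_closed[OF lx(1), of "Suc d"] lx(2) gc A.one_closed by algebra
      have pc: "\<psi> x [^]\<^bsub>C\<^esub> Suc d \<in> carrier C" using px by simp
      have pg: "\<phi> g \<in> carrier C" using gc by simp
      have "\<phi> (loc x [^]\<^bsub>A\<^esub> Suc d \<oplus>\<^bsub>A\<^esub> loc v \<otimes>\<^bsub>A\<^esub> g) = \<psi> x [^]\<^bsub>C\<^esub> Suc d \<oplus>\<^bsub>C\<^esub> \<psi> v \<otimes>\<^bsub>C\<^esub> \<phi> g"
        unfolding psi_eq using lx gc by (simp add: H.ring.hom_nat_pow)
      also have "\<dots> = t \<ominus>\<^bsub>C\<^esub> \<psi> v \<otimes>\<^bsub>C\<^esub> (f \<ominus>\<^bsub>C\<^esub> \<phi> g)" unfolding f(2) using pc px(2) fc pg by algebra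
      also have "\<dots> \<in> F l" unfolding t0
        by (rule C.ideal_minus_closed[OF F_ideal additive_subgroup.zero_closed[OF ideal.axioms(1)[OF F_ideal]]
              ideal.I_l_closed[OF F_ideal g(2) px(2)]])
      finally have "loc x [^]\<^bsub>A\<^esub> Suc d \<oplus>\<^bsub>A\<^esub> loc v \<otimes>\<^bsub>A\<^esub> g \<in> mp l"
        by (rule F_phi_iff[THEN iffD1, rotated]) (use lx gc in simp)
      then show "\<exists>h\<in>?H. loc x [^]\<^bsub>A\<^esub> Suc d \<ominus>\<^bsub>A\<^esub> h \<in> mp l"
        using gf unfolding e1[symmetric] by blast
    qed
    then obtain g where g: "g \<in> forms A (loc x) (loc v) d" "loc x [^]\<^bsub>A\<^esub> Suc d = loc v \<otimes>\<^bsub>A\<^esub> g" by blast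
    have gc: "g \<in> carrier A" by (rule A.forms_closed[OF lx g(1)])
    obtain s k where s: "s \<in> carrier R - P" "k \<in> forms R x v d" "loc s \<otimes>\<^bsub>A\<^esub> g = loc k" using loc_forms[OF xv g(1)] by auto
    have sc: "s \<in> carrier R" "k \<in> carrier R" using s(1) forms_closed[OF xv s(2)] by auto
    have "loc (s \<otimes> x [^] Suc d) = loc s \<otimes>\<^bsub>A\<^esub> loc x [^]\<^bsub>A\<^esub> Suc d" using sc xv by (simp add: loc.ring.hom_nat_pow)
    also have "\<dots> = loc v \<otimes>\<^bsub>A\<^esub> (loc s \<otimes>\<^bsub>A\<^esub> g)" unfolding g(2) using sc gc lx by (simp add: A.m_lcomm)
    also have "\<dots> = loc (v \<otimes> k)" unfolding s(3) using sc xv by simp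
    finally obtain r where r: "r \<in> carrier R - P" "r \<otimes> (s \<otimes> x [^] Suc d) = r \<otimes> (v \<otimes> k)"
      using localizing.loc_map_eq_iff[OF localizing_complement, of "s \<otimes> x [^] Suc d" "v \<otimes> k"] sc xv by auto
    have rc: "r \<in> carrier R" using r(1) by simp
    have "(r \<otimes> s) \<otimes> x [^] Suc d = r \<otimes> (s \<otimes> x [^] Suc d)" using rc sc(1) nat_pow_closed[OF xv(1)] by (rule m_assoc)
    also have "\<dots> = v \<otimes> (r \<otimes> k)" unfolding r(2) using rc sc xv by (simp add: m_lcomm)
    finally have "r \<otimes> s \<in> integral_conductor R v x"
      unfolding integral_conductor_def using forms_scale[OF xv s(2) rc] rc sc by blast
    then have "r \<otimes> s \<in> P" using sub by blast
    then show False using localizing.S_mult[OF localizing_complement r(1) s(1)] by simp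
  qed
qed

lemma integral_conductor_quintasymptotic:
  assumes u: "u \<in> carrier R" and x: "x \<in> carrier R" and n: "n > 0"
    and v: "v = u [^] (n::nat)"
    and min: "P \<in> minimal_primes_over R (integral_conductor R v x)"
  shows "P \<in> quintasymptotic_primes R (PIdl u)"
proof -
  have vc: "v \<in> carrier R" using u v by simp
  note xv = x vc
  have px: "\<psi> x \<in> carrier C" "\<psi> v \<in> carrier C" using xv by simp_all
  have sub: "integral_conductor R v x \<subseteq> P" using min unfolding minimal_primes_over_def by blast
  \<comment> \<open>v belongs to its own conductor, with e = 0 and f = x; so u lies in
    \<open>P\<close>.\<close>
  have "v \<otimes> x [^] Suc 0 = v \<otimes> x" "x \<in> forms R x v 0" using x by simp_all
  then have "v \<in> integral_conductor R v x" unfolding integral_conductor_def using vc by blast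
  then have vP: "v \<in> P" using sub by blast
  then have uP: "u \<in> P" using primeideal_pow[OF P u] v by simp
  have uc: "\<psi> u \<in> carrier C" using u by simp
  define T where "T = (\<Union>e. C.monic_forms (\<psi> x) (\<psi> v) e)"
  have TI: "t \<in> T" if "t \<in> C.monic_forms (\<psi> x) (\<psi> v) e" for t e unfolding T_def using that by blast
  obtain z0 where z0: "primeideal z0 C" "{\<zero>\<^bsub>C\<^esub>} \<subseteq> z0" "z0 \<inter> T = {}"
  proof (rule C.prime_avoiding[OF C.zeroideal])
    show "T \<subseteq> carrier C" unfolding T_def using C.monic_closed[OF px] by blast
    show "\<one>\<^bsub>C\<^esub> \<in> T" by (rule TI[of _ 0]) simp
    show "a \<otimes>\<^bsub>C\<^esub> b \<in> T" if "a \<in> T" "b \<in> T" for a b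
      using that C.monic_mult[OF px] unfolding T_def by blast
    show "{\<zero>\<^bsub>C\<^esub>} \<inter> T = {}" unfolding T_def using monic_forms_nonzero[OF xv sub] by blast
  qed
  \<comment> \<open>A minimal prime below z0 avoids \<open>T\<close> as well.\<close>
  obtain z where zmin: "z \<in> minimal_primes_over C {\<zero>\<^bsub>C\<^esub>}" and zz0: "z \<subseteq> z0"
    using C.minimal_prime_exists[OF z0(1,2)] by blast
  have z: "primeideal z C" using zmin unfolding minimal_primes_over_def by blast
  interpret z: primeideal z C by (rule z)
  have zT: "t \<notin> z" if "t \<in> C.monic_forms (\<psi> x) (\<psi> v) e" for t e using zz0 z0(3) TI[OF that] by blast
  have xz: "\<psi> x [^]\<^bsub>C\<^esub> e \<notin> z" for e :: nat by (rule zT[OF C.monic_pow[OF px]])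
  have key: "\<exists>i::nat. \<exists>f\<in>carrier C. \<psi> a [^]\<^bsub>C\<^esub> i \<ominus>\<^bsub>C\<^esub> \<psi> v \<otimes>\<^bsub>C\<^esub> f \<in> z" if a: "a \<in> P" for a
  proof (cases "\<psi> v \<in> z")
    case True
    have ac: "a \<in> carrier R" using a P.Icarr by simp
    obtain t k where t: "t \<in> carrier R - P" "t \<otimes> a [^] (k::nat) \<in> integral_conductor R v x"
      using minimal_prime_nilpotent[OF min integral_conductor_ideal[OF xv] a] by blast
    obtain e f where f: "f \<in> forms R x v e" "(t \<otimes> a [^] k) \<otimes> x [^] Suc e = v \<otimes> f"
      using t(2) unfolding integral_conductor_def by blast
    have cl: "t \<in> carrier R" "f \<in> carrier R" using t(1) forms_closed[OF xv f(1)] by auto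
    obtain s where s: "s \<in> carrier C" "s \<otimes>\<^bsub>C\<^esub> \<psi> t = \<one>\<^bsub>C\<^esub>" using psi_unit[OF t(1)] by auto
    have pc: "\<psi> t \<in> carrier C" "\<psi> a [^]\<^bsub>C\<^esub> k \<in> carrier C" "\<psi> x [^]\<^bsub>C\<^esub> Suc e \<in> carrier C" "\<psi> f \<in> carrier C" using cl ac x by auto
    have "\<psi> ((t \<otimes> a [^] k) \<otimes> x [^] Suc e) = (\<psi> t \<otimes>\<^bsub>C\<^esub> \<psi> a [^]\<^bsub>C\<^esub> k) \<otimes>\<^bsub>C\<^esub> \<psi> x [^]\<^bsub>C\<^esub> Suc e"
      using cl ac x by (simp add: psi.ring.hom_nat_pow)
    moreover have "\<psi> (v \<otimes> f) = \<psi> v \<otimes>\<^bsub>C\<^esub> \<psi> f" using cl vc by simp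
    ultimately have "(\<psi> t \<otimes>\<^bsub>C\<^esub> \<psi> a [^]\<^bsub>C\<^esub> k) \<otimes>\<^bsub>C\<^esub> \<psi> x [^]\<^bsub>C\<^esub> Suc e = \<psi> v \<otimes>\<^bsub>C\<^esub> \<psi> f" using f(2) by metis
    moreover have "\<psi> v \<otimes>\<^bsub>C\<^esub> \<psi> f \<in> z" by (rule z.I_r_closed[OF True pc(4)])
    ultimately have "(\<psi> t \<otimes>\<^bsub>C\<^esub> \<psi> a [^]\<^bsub>C\<^esub> k) \<otimes>\<^bsub>C\<^esub> \<psi> x [^]\<^bsub>C\<^esub> Suc e \<in> z" by simp
    then have "\<psi> t \<otimes>\<^bsub>C\<^esub> \<psi> a [^]\<^bsub>C\<^esub> k \<in> z" using z.I_prime[OF _ pc(3)] xz pc by blast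
    then have "s \<otimes>\<^bsub>C\<^esub> (\<psi> t \<otimes>\<^bsub>C\<^esub> \<psi> a [^]\<^bsub>C\<^esub> k) \<in> z" by (rule z.I_l_closed[OF _ s(1)])
    moreover have "s \<otimes>\<^bsub>C\<^esub> (\<psi> t \<otimes>\<^bsub>C\<^esub> \<psi> a [^]\<^bsub>C\<^esub> k) = (s \<otimes>\<^bsub>C\<^esub> \<psi> t) \<otimes>\<^bsub>C\<^esub> \<psi> a [^]\<^bsub>C\<^esub> k"
      using C.m_assoc[OF s(1) pc(1,2)] by simp
    ultimately have "\<psi> a [^]\<^bsub>C\<^esub> k \<in> z" using s(2) pc(2) by simp
    then have "\<psi> a [^]\<^bsub>C\<^esub> k \<ominus>\<^bsub>C\<^esub> \<psi> v \<otimes>\<^bsub>C\<^esub> \<zero>\<^bsub>C\<^esub> \<in> z" using pc(2) px(2) by (simp add: a_minus_def)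
    then show ?thesis using C.zero_closed by blast
  next
    case False
    obtain K :: "((nat \<Rightarrow> ('a \<times> 'a) set set) set \<times> (nat \<Rightarrow> ('a \<times> 'a) set set) set) set ring" and h
      where K: "field K" and h: "h \<in> ring_hom C K" and ker: "\<And>a. a \<in> carrier C \<Longrightarrow> h a = \<zero>\<^bsub>K\<^esub> \<longleftrightarrow> a \<in> z"
      using z.fraction_field_exists by blast
    interpret K: field K by (rule K)
    interpret hK: ring_hom_cring C K h
      by (intro ring_hom_cring.intro ring_hom_cring_axioms.intro completion_cring K.is_cring h)
    interpret B: blowup C K h "\<psi> x" "\<psi> v"
    proof (intro blowup.intro noetherian_hom.intro blowup_axioms.intro noetherian_hom_axioms.intro)
      show "ring_hom_cring C K h" by unfold_locales
      show "noetherian_ring C" by (rule completion_noetherian)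
      show "field K" by (rule K)
      show "\<psi> x \<in> carrier C" "\<psi> v \<in> carrier C" using px by auto
      show "h (\<psi> x) \<noteq> \<zero>\<^bsub>K\<^esub>" using ker[OF px(1)] xz[of 1] px(1) by simp
      show "h t \<noteq> \<zero>\<^bsub>K\<^esub>" if "t \<in> C.monic_forms (\<psi> x) (\<psi> v) e" for e t
        using ker[OF C.monic_closed[OF px that]] zT[OF that] by simp
    qed
    \<comment> \<open>In \<open>K\<close> the relation t a^k x^(e+1) = v f becomes a^k = w (f / x^e)
      / t. One factor x is spent on v = w x; the remaining x^e matches the degree of f, so the
      cofactor of w lies in \<open>M\<close>.\<close>
    have G_pow: "\<exists>j::nat. \<exists>b\<in>B.M. h g [^]\<^bsub>K\<^esub> j = B.w \<otimes>\<^bsub>K\<^esub> b" if g: "g \<in> \<psi> ` P" for g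
    proof -
      obtain a where a: "a \<in> P" "g = \<psi> a" using g by (rule imageE)
      have ac: "a \<in> carrier R" using a P.Icarr by simp
      obtain t k where t: "t \<in> carrier R - P" "t \<otimes> a [^] (k::nat) \<in> integral_conductor R v x"
        using minimal_prime_nilpotent[OF min integral_conductor_ideal[OF xv] a(1)] by blast
      obtain e f where f: "f \<in> forms R x v e" "(t \<otimes> a [^] k) \<otimes> x [^] Suc e = v \<otimes> f"
        using t(2) unfolding integral_conductor_def by blast
      have cl: "t \<in> carrier R" "f \<in> carrier R" using t(1) forms_closed[OF xv f(1)] by auto
      obtain s where s: "s \<in> carrier C" "s \<otimes>\<^bsub>C\<^esub> \<psi> t = \<one>\<^bsub>C\<^esub>" using psi_unit[OF t(1)] by auto
      have pc: "\<psi> t \<in> carrier C" "\<psi> a [^]\<^bsub>C\<^esub> k \<in> carrier C" "\<psi> x [^]\<^bsub>C\<^esub> Suc e \<in> carrier C" "\<psi> f \<in> carrier C"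
        "\<psi> x [^]\<^bsub>C\<^esub> e \<in> carrier C" using cl ac x by auto
      have "\<psi> ((t \<otimes> a [^] k) \<otimes> x [^] Suc e) = (\<psi> t \<otimes>\<^bsub>C\<^esub> \<psi> a [^]\<^bsub>C\<^esub> k) \<otimes>\<^bsub>C\<^esub> (\<psi> x [^]\<^bsub>C\<^esub> e \<otimes>\<^bsub>C\<^esub> \<psi> x)"
        using cl ac x by (simp add: psi.ring.hom_nat_pow)
      moreover have "\<psi> (v \<otimes> f) = \<psi> v \<otimes>\<^bsub>C\<^esub> \<psi> f" using cl vc by simp
      ultimately have eqC: "(\<psi> t \<otimes>\<^bsub>C\<^esub> \<psi> a [^]\<^bsub>C\<^esub> k) \<otimes>\<^bsub>C\<^esub> (\<psi> x [^]\<^bsub>C\<^esub> e \<otimes>\<^bsub>C\<^esub> \<psi> x) = \<psi> v \<otimes>\<^bsub>C\<^esub> \<psi> f" using f(2) by metis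
      have pf: "\<psi> f \<in> forms C (\<psi> x) (\<psi> v) e" by (rule psi.forms_hom[OF xv f(1)])
      have pe: "\<psi> x [^]\<^bsub>C\<^esub> e \<in> C.monic_forms (\<psi> x) (\<psi> v) e" by (rule C.monic_pow[OF px])
      define q where "q = inv\<^bsub>K\<^esub> (h (\<psi> x [^]\<^bsub>C\<^esub> e)) \<otimes>\<^bsub>K\<^esub> h (\<psi> f)"
      have q: "q \<in> B.M" "h (\<psi> x [^]\<^bsub>C\<^esub> e) \<otimes>\<^bsub>K\<^esub> q = h (\<psi> f)" unfolding q_def using B.quotient_in_M[OF pf pe] by auto
      have qK: "q \<in> carrier K" by (rule B.M_K[OF q(1)])
      define b where "b = h s \<otimes>\<^bsub>K\<^esub> q"
      have bM: "b \<in> B.M" unfolding b_def by (rule subcringE(6)[OF B.M_subcring B.h_M[OF s(1)] q(1)])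
      have hc: "h s \<in> carrier K" "h (\<psi> t) \<in> carrier K" "h (\<psi> a [^]\<^bsub>C\<^esub> k) \<in> carrier K" "h (\<psi> x [^]\<^bsub>C\<^esub> e) \<in> carrier K"
        "h (\<psi> x) \<in> carrier K" "h (\<psi> v) \<in> carrier K" "h (\<psi> f) \<in> carrier K"
        using s(1) pc px by simp_all
      have hs: "h s \<otimes>\<^bsub>K\<^esub> h (\<psi> t) = \<one>\<^bsub>K\<^esub>" using hK.hom_mult[OF s(1) pc(1)] s(2) by simp
      have "h ((\<psi> t \<otimes>\<^bsub>C\<^esub> \<psi> a [^]\<^bsub>C\<^esub> k) \<otimes>\<^bsub>C\<^esub> (\<psi> x [^]\<^bsub>C\<^esub> e \<otimes>\<^bsub>C\<^esub> \<psi> x)) = h (\<psi> v \<otimes>\<^bsub>C\<^esub> \<psi> f)" using eqC by simp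
      then have hK: "(h (\<psi> t) \<otimes>\<^bsub>K\<^esub> h (\<psi> a [^]\<^bsub>C\<^esub> k)) \<otimes>\<^bsub>K\<^esub> (h (\<psi> x [^]\<^bsub>C\<^esub> e) \<otimes>\<^bsub>K\<^esub> h (\<psi> x)) = h (\<psi> v) \<otimes>\<^bsub>K\<^esub> h (\<psi> f)"
        using pc px by simp
      have "(h (\<psi> x [^]\<^bsub>C\<^esub> e) \<otimes>\<^bsub>K\<^esub> h (\<psi> x)) \<otimes>\<^bsub>K\<^esub> h (\<psi> a [^]\<^bsub>C\<^esub> k)
        = (h s \<otimes>\<^bsub>K\<^esub> h (\<psi> t)) \<otimes>\<^bsub>K\<^esub> ((h (\<psi> x [^]\<^bsub>C\<^esub> e) \<otimes>\<^bsub>K\<^esub> h (\<psi> x)) \<otimes>\<^bsub>K\<^esub> h (\<psi> a [^]\<^bsub>C\<^esub> k))"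
        unfolding hs using hc by simp
      also have "\<dots> = h s \<otimes>\<^bsub>K\<^esub> ((h (\<psi> t) \<otimes>\<^bsub>K\<^esub> h (\<psi> a [^]\<^bsub>C\<^esub> k)) \<otimes>\<^bsub>K\<^esub> (h (\<psi> x [^]\<^bsub>C\<^esub> e) \<otimes>\<^bsub>K\<^esub> h (\<psi> x)))"
        using hc by algebra
      also have "\<dots> = h s \<otimes>\<^bsub>K\<^esub> ((h (\<psi> x) \<otimes>\<^bsub>K\<^esub> B.w) \<otimes>\<^bsub>K\<^esub> (h (\<psi> x [^]\<^bsub>C\<^esub> e) \<otimes>\<^bsub>K\<^esub> q))" unfolding hK B.xw q(2) ..
      also have "\<dots> = (h (\<psi> x [^]\<^bsub>C\<^esub> e) \<otimes>\<^bsub>K\<^esub> h (\<psi> x)) \<otimes>\<^bsub>K\<^esub> (B.w \<otimes>\<^bsub>K\<^esub> b)"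
        unfolding b_def using hc qK B.w_K by algebra
      finally have eqK: "(h (\<psi> x [^]\<^bsub>C\<^esub> e) \<otimes>\<^bsub>K\<^esub> h (\<psi> x)) \<otimes>\<^bsub>K\<^esub> h (\<psi> a [^]\<^bsub>C\<^esub> k)
        = (h (\<psi> x [^]\<^bsub>C\<^esub> e) \<otimes>\<^bsub>K\<^esub> h (\<psi> x)) \<otimes>\<^bsub>K\<^esub> (B.w \<otimes>\<^bsub>K\<^esub> b)" .
      have "h (\<psi> x [^]\<^bsub>C\<^esub> e) \<otimes>\<^bsub>K\<^esub> h (\<psi> x) \<noteq> \<zero>\<^bsub>K\<^esub>"
      proof -
        have "h (\<psi> x [^]\<^bsub>C\<^esub> e) \<otimes>\<^bsub>K\<^esub> h (\<psi> x) = h (\<psi> x [^]\<^bsub>C\<^esub> Suc e)" using pc px by simp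
        then show ?thesis using ker[OF pc(3)] xz[of "Suc e"] by simp
      qed
      then have "h (\<psi> a [^]\<^bsub>C\<^esub> k) = B.w \<otimes>\<^bsub>K\<^esub> b"
        using K.m_lcancel[of "h (\<psi> x [^]\<^bsub>C\<^esub> e) \<otimes>\<^bsub>K\<^esub> h (\<psi> x)"] eqK hc B.M_K[OF bM] by simp
      then have "h g [^]\<^bsub>K\<^esub> k = B.w \<otimes>\<^bsub>K\<^esub> b" unfolding a(2) using ac by (simp add: hK.ring.hom_nat_pow)
      then show ?thesis using bM by blast
    qed
    interpret cc: complete_core C B.KM h "\<psi> v" "\<psi> x" B.w "\<psi> ` P"
    proof (intro complete_core.intro noetherian_hom.intro complete_core_axioms.intro noetherian_hom_axioms.intro)
      show "ring_hom_cring C B.KM h" by (rule B.KM_hom)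
      show "noetherian_ring C" by (rule completion_noetherian)
      show "domain B.KM" by (rule B.KM.domain_axioms)
      show "noetherian_ring B.KM" by (rule B.KM_noetherian)
      show "\<psi> v \<in> carrier C" "\<psi> x \<in> carrier C" using px by auto
      show "B.w \<in> carrier B.KM" using B.w_M by simp
      show "h (\<psi> x) \<otimes>\<^bsub>B.KM\<^esub> B.w = h (\<psi> v)" using B.xw by simp
      show "h (\<psi> v) \<noteq> \<zero>\<^bsub>B.KM\<^esub>" using ker[OF px(2)] False by simp
      show "\<one>\<^bsub>B.KM\<^esub> \<oplus>\<^bsub>B.KM\<^esub> B.w \<otimes>\<^bsub>B.KM\<^esub> b \<in> Units B.KM" if "b \<in> carrier B.KM" for b
        using B.KM_unit[of b] that by simp
      show "\<exists>c\<in>carrier C. \<exists>b\<in>carrier B.KM. k = h c \<oplus>\<^bsub>B.KM\<^esub> B.w \<otimes>\<^bsub>B.KM\<^esub> b" if "k \<in> carrier B.KM" for k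
        using B.KM_split[of k] that by simp
      show "\<exists>s. \<forall>n. s n \<in> carrier C \<and> s n = a n \<oplus>\<^bsub>C\<^esub> \<psi> v \<otimes>\<^bsub>C\<^esub> s (Suc n)" if "\<And>n. a n \<in> carrier C" for a :: "nat \<Rightarrow> _"
        by (rule v_complete[OF psi_P[OF vP] that])
      show "\<psi> ` P \<subseteq> carrier C" using psi_P F_closed by blast
      \<comment> \<open>\<open>B.KM\<close> and \<open>K\<close> differ only in the carrier, so
        powers agree by definition.\<close>
      show "\<exists>j::nat. \<exists>b\<in>carrier B.KM. h a [^]\<^bsub>B.KM\<^esub> j = B.w \<otimes>\<^bsub>B.KM\<^esub> b" if "a \<in> \<psi> ` P" for a
        using G_pow[OF that] by (simp add: nat_pow_def)
      show "\<exists>c'\<in>carrier C. c \<otimes>\<^bsub>C\<^esub> c' \<ominus>\<^bsub>C\<^esub> \<one>\<^bsub>C\<^esub> \<in> Idl\<^bsub>C\<^esub> (\<psi> ` P)" if "c \<in> carrier C" "c \<notin> Idl\<^bsub>C\<^esub> (\<psi> ` P)" for c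
        using F_one_maximal[of c] that unfolding F_one_extended .
    qed
    obtain i :: nat and f where f: "f \<in> carrier C" "h (\<psi> a [^]\<^bsub>C\<^esub> i) = h (\<psi> v \<otimes>\<^bsub>C\<^esub> f)"
      using cc.power_in_v[of "\<psi> a"] a by blast
    have ac: "\<psi> a [^]\<^bsub>C\<^esub> i \<in> carrier C" using a P.Icarr by simp
    have vf: "\<psi> v \<otimes>\<^bsub>C\<^esub> f \<in> carrier C" using f(1) px by simp
    have "h (\<psi> a [^]\<^bsub>C\<^esub> i \<ominus>\<^bsub>C\<^esub> \<psi> v \<otimes>\<^bsub>C\<^esub> f) = h (\<psi> a [^]\<^bsub>C\<^esub> i) \<ominus>\<^bsub>K\<^esub> h (\<psi> v \<otimes>\<^bsub>C\<^esub> f)"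
      unfolding a_minus_def using hK.hom_add[OF ac C.a_inv_closed[OF vf]] hK.hom_a_inv[OF vf] by simp
    also have "\<dots> = \<zero>\<^bsub>K\<^esub>" unfolding f(2) using hK.hom_closed[OF vf] K.r_right_minus_eq by blast
    finally have "\<psi> a [^]\<^bsub>C\<^esub> i \<ominus>\<^bsub>C\<^esub> \<psi> v \<otimes>\<^bsub>C\<^esub> f \<in> z" using ker ac vf C.minus_closed by blast
    then show ?thesis using f(1) by blast
  qed
  let ?E = "extended_ideal C \<psi> (PIdl u)"
  have uself: "u \<in> (PIdl u)" by (rule cgenideal_self[OF u])
  have uPI: "(PIdl u) \<subseteq> P" by (rule cgenideal_minimal[OF P.ideal_axioms uP])
  have Esub: "\<psi> ` (PIdl u) \<subseteq> carrier C" using uPI psi_P F_closed by blast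
  have E: "ideal ?E C" unfolding extended_ideal_def by (rule C.genideal_ideal[OF Esub])
  have uE: "\<psi> u \<in> ?E" unfolding extended_ideal_def by (rule subsetD[OF C.genideal_self[OF Esub] imageI[OF uself]])
  have EF: "?E \<subseteq> F 1" unfolding extended_ideal_def
    by (rule C.genideal_minimal[OF F_ideal]) (use uPI psi_P in blast)
  have zF: "z \<subseteq> F 1" by (rule prime_in_F_one[OF z])
  have sumI: "a \<oplus>\<^bsub>C\<^esub> b \<in> ?E <+>\<^bsub>C\<^esub> z" if "a \<in> ?E" "b \<in> z" for a b
    unfolding set_add_def' using that by blast
  have Ez: "?E <+>\<^bsub>C\<^esub> z \<subseteq> F 1"
    unfolding set_add_def' using EF zF additive_subgroup.a_closed[OF ideal.axioms(1)[OF F_ideal]] by blast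
  have zE: "b \<in> ?E <+>\<^bsub>C\<^esub> z" if "b \<in> z" for b
    using sumI[OF additive_subgroup.zero_closed[OF ideal.axioms(1)[OF E]] that] z.Icarr[OF that] by simp
  have uEz: "\<psi> u \<in> ?E <+>\<^bsub>C\<^esub> z" using sumI[OF uE z.zero_closed] uc by simp
  have "F 1 \<in> minimal_primes_over C (?E <+>\<^bsub>C\<^esub> z)"
    unfolding minimal_primes_over_def
  proof (intro CollectI conjI allI impI)
    show "primeideal (F 1) C" by (rule F_one_prime)
    show "?E <+>\<^bsub>C\<^esub> z \<subseteq> F 1" by (rule Ez)
    \<comment> \<open>Such a \<open>Q\<close> contains the image of u, hence that of v = u^n because
      n > 0. It also contains z, so \<open>key\<close> puts a power of every element of
      \<open>P\<close> into it.\<close>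
    fix Q assume Q: "primeideal Q C \<and> ?E <+>\<^bsub>C\<^esub> z \<subseteq> Q \<and> Q \<subseteq> F 1"
    interpret Q: primeideal Q C using Q by blast
    have "\<psi> v = \<psi> u [^]\<^bsub>C\<^esub> n" unfolding v using u by (simp add: psi.ring.hom_nat_pow)
    also have "\<dots> = \<psi> u [^]\<^bsub>C\<^esub> Suc (n - 1)" using n by simp
    also have "\<dots> \<in> Q" by (rule C.ideal_pow_closed[OF Q.ideal_axioms]) (use uEz Q in blast)
    finally have vQ: "\<psi> v \<in> Q" .
    have "\<psi> a \<in> Q" if a: "a \<in> P" for a
    proof -
      have ac: "\<psi> a \<in> carrier C" using a P.Icarr by simp
      obtain i :: nat and f where f: "f \<in> carrier C" "\<psi> a [^]\<^bsub>C\<^esub> i \<ominus>\<^bsub>C\<^esub> \<psi> v \<otimes>\<^bsub>C\<^esub> f \<in> z" using key[OF a] by auto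
      have "\<psi> a [^]\<^bsub>C\<^esub> i = (\<psi> a [^]\<^bsub>C\<^esub> i \<ominus>\<^bsub>C\<^esub> \<psi> v \<otimes>\<^bsub>C\<^esub> f) \<oplus>\<^bsub>C\<^esub> \<psi> v \<otimes>\<^bsub>C\<^esub> f"
        using C.nat_pow_closed[OF ac, of i] px(2) f(1) by algebra
      also have "\<dots> \<in> Q"
        by (rule Q.a_closed[OF _ Q.I_r_closed[OF vQ f(1)]]) (use zE[OF f(2)] Q in blast)
      finally show ?thesis by (rule C.primeideal_pow[OF Q.primeideal_axioms ac])
    qed
    then have "F 1 \<subseteq> Q" unfolding F_one_extended by (intro C.genideal_minimal[OF Q.ideal_axioms]) blast
    then show "Q = F 1" using Q by blast
  qed
  then have "extended_ideal CC \<psi> P \<in> minimal_primes_over CC (extended_ideal CC \<psi> (PIdl u) <+>\<^bsub>CC\<^esub> z)"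
    unfolding CC_eq extended_P .
  moreover have "z \<in> minimal_primes_over CC {\<zero>\<^bsub>CC\<^esub>}" using zmin unfolding CC_eq .
  ultimately show ?thesis unfolding quintasymptotic_primes_def using P uPI by blast
qed

end

text \<open>The element 1 lies in the conductor only if \<open>x\<close> is integral over u^n; so
  under the hypothesis the conductor is proper and has a minimal prime.\<close>

theorem (in noetherian_cring) quintasymptotic_prime_over_conductor:
  assumes u: "u \<in> carrier R" and x: "x \<in> carrier R" and n: "n > 0"
    and not_integral: "\<not> integral_over R (u [^] (n::nat)) x"
  obtains P where "P \<in> quintasymptotic_primes R (PIdl u)" "integral_conductor R (u [^] n) x \<subseteq> P"
proof -
  let ?J = "integral_conductor R (u [^] n) x"
  have v: "u [^] n \<in> carrier R" using u by simp
  note J = integral_conductor_ideal[OF x v]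
  have "\<one> \<notin> ?J"
  proof
    assume "\<one> \<in> ?J"
    then obtain e f where f: "f \<in> forms R x (u [^] n) e" "\<one> \<otimes> x [^] Suc e = u [^] n \<otimes> f"
      unfolding integral_conductor_def by blast
    then have "x [^] Suc e = u [^] n \<otimes> f" using x by simp
    then show False using not_integral f(1) unfolding integral_over_def by blast
  qed
  then obtain Q where Q: "primeideal Q R" "?J \<subseteq> Q"
    using prime_avoiding[OF J, of "{\<one>}"] by auto
  obtain P where Pmin: "P \<in> minimal_primes_over R ?J" using minimal_prime_exists[OF Q] by blast
  then have prime: "primeideal P R" "?J \<subseteq> P" unfolding minimal_primes_over_def by auto
  interpret local_completion R P
    by (intro local_completion.intro local_completion_axioms.intro noetherian_cring_axioms prime(1))
  show thesis by (rule that[OF integral_conductor_quintasymptotic[OF u x n refl Pmin] prime(2)])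
qed

text \<open>An equation of integral dependence of s x may thus be read with forms in x itself, which
  places s^(e+1) in the conductor of x.\<close>

lemma (in cring) forms_multiple:
  assumes xv: "x \<in> carrier R" "v \<in> carrier R" and s: "s \<in> carrier R"
  shows "forms R (s \<otimes> x) v e \<subseteq> forms R x v e"
proof (induction e)
  case (Suc e)
  show ?case
  proof
    fix f assume "f \<in> forms R (s \<otimes> x) v (Suc e)"
    then obtain g h where f: "f = (s \<otimes> x) \<otimes> g \<oplus> v \<otimes> h" "g \<in> forms R (s \<otimes> x) v e" "h \<in> forms R (s \<otimes> x) v e"
      by (rule forms_SucE)
    have gh: "g \<in> forms R x v e" "h \<in> forms R x v e" using f(2,3) Suc by auto
    have "f = x \<otimes> (s \<otimes> g) \<oplus> v \<otimes> h"
      unfolding f(1) using xv s forms_closed[OF xv gh(1)] forms_closed[OF xv gh(2)] by algebra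
    also have "\<dots> \<in> forms R x v (Suc e)" by (rule forms_SucI[OF forms_scale[OF xv gh(1) s] gh(2)])
    finally show "f \<in> forms R x v (Suc e)" .
  qed
qed simp

lemma (in cring) ideal_power_power:
  assumes J: "ideal J R"
  shows "ideal_power R (ideal_power R J n) i = ideal_power R J (n * i)"
proof -
  interpret I: comm_monoid "ideals_set R" by (rule ideals_set_is_comm_monoid)
  show ?thesis unfolding ideal_power_def by (rule I.nat_pow_pow) (use J in \<open>simp add: ideals_set_def\<close>)
qed

section \<open>Integral closure of powers in the Rees ring\<close>

context rees
begin

lemma u_pow_closed: "rees_u R [^]\<^bsub>A\<^esub> (n::nat) \<in> carrier A"
  using rees_u_closed by simp

lemma u_pow_coeff:
  assumes f: "f \<in> carrier A"
  shows "(rees_u R [^]\<^bsub>A\<^esub> n \<otimes>\<^bsub>A\<^esub> f) k = f (k + int n)"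
  unfolding rees_u_pow using mono_coeff_mult[OF mono_Ip0[OF one_closed, of "- int n"] f] f by simp

lemma u_pow_regular:
  assumes f: "f \<in> carrier A" and z: "rees_u R [^]\<^bsub>A\<^esub> (n::nat) \<otimes>\<^bsub>A\<^esub> f = \<zero>\<^bsub>A\<^esub>"
  shows "f = \<zero>\<^bsub>A\<^esub>"
proof
  fix k
  have "f k = (rees_u R [^]\<^bsub>A\<^esub> n \<otimes>\<^bsub>A\<^esub> f) (k - int n)" using u_pow_coeff[OF f, of n "k - int n"] by simp
  then show "f k = \<zero>\<^bsub>A\<^esub> k" unfolding z by (simp add: A_zero)
qed

lemma const_coeff_mult:
  assumes x: "x \<in> carrier R" and f: "f \<in> carrier A"
  shows "(rees_const R x \<otimes>\<^bsub>A\<^esub> f) k = x \<otimes> f k"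
  unfolding rees_const_mono using mono_coeff_mult[OF mono_Ip0[OF x, of 0] f] by simp

text \<open>Multiplication by u^n shifts degrees: the coefficient of u^n g in degree m is that of g
  in degree m + n. So each factor u^n of a monomial raises the power of \<open>I\<close> by n, and m
  has to vary in the induction.\<close>

lemma forms_coeff:
  assumes x: "x \<in> carrier R" and f: "f \<in> forms A (rees_const R x) (rees_u R [^]\<^bsub>A\<^esub> n) e"
  shows "\<exists>c. (\<forall>i\<le>e. c i \<in> ideal_power R I (m + n * i)) \<and> f (int m) = (\<Oplus>i\<in>{..e}. c i \<otimes> x [^] (e - i))"
  using f
proof (induction e arbitrary: f m)
  case 0
  then have fA: "f \<in> carrier A" by simp
  have "(\<Oplus>i\<in>{..0::nat}. f (int m) \<otimes> x [^] (0 - i)) = f (int m)"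
    by (subst finsum_0) (use fA x in auto)
  moreover have "f (int m) \<in> ideal_power R I m" using coeff_Ip[OF fA, of "int m"] by simp
  ultimately show ?case by (intro exI[of _ "\<lambda>_. f (int m)"]) simp
next
  case (Suc e)
  have X: "rees_const R x \<in> carrier A" using x by simp
  note V = u_pow_closed[of n]
  obtain c g where c: "c \<in> carrier A" "g \<in> forms A (rees_const R x) (rees_u R [^]\<^bsub>A\<^esub> n) e"
    "f = c \<otimes>\<^bsub>A\<^esub> rees_const R x [^]\<^bsub>A\<^esub> Suc e \<oplus>\<^bsub>A\<^esub> rees_u R [^]\<^bsub>A\<^esub> n \<otimes>\<^bsub>A\<^esub> g"
    by (rule A.forms_decomp[OF X V Suc(2)])
  have gA: "g \<in> carrier A" by (rule A.forms_closed[OF X V c(2)])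
  obtain d where d: "\<forall>i\<le>e. d i \<in> ideal_power R I (m + n + n * i)" "g (int (m + n)) = (\<Oplus>i\<in>{..e}. d i \<otimes> x [^] (e - i))"
    using Suc(1)[OF c(2), of "m + n"] by auto
  have dc: "d i \<in> carrier R" if "i \<le> e" for i using d(1) that ideal_power_closed[OF I] by blast
  have pw: "rees_const R x [^]\<^bsub>A\<^esub> Suc e = rees_const R (x [^] Suc e)" using x by (simp add: H.ring.hom_nat_pow)
  have xe: "x [^] Suc e \<in> carrier R" using x by simp
  have "c \<otimes>\<^bsub>A\<^esub> rees_const R (x [^] Suc e) = rees_const R (x [^] Suc e) \<otimes>\<^bsub>A\<^esub> c"
    by (rule A.m_comm[OF c(1)]) (use xe in simp)
  then have "f (int m) = x [^] Suc e \<otimes> c (int m) \<oplus> g (int m + int n)"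
    unfolding c(3) pw A_add u_pow_coeff[OF gA] using const_coeff_mult[OF xe c(1)] by simp
  also have "g (int m + int n) = (\<Oplus>i\<in>{..e}. d i \<otimes> x [^] (e - i))" using d(2) by simp
  finally have fm: "f (int m) = x [^] Suc e \<otimes> c (int m) \<oplus> (\<Oplus>i\<in>{..e}. d i \<otimes> x [^] (e - i))" .
  let ?c = "\<lambda>i. case i of 0 \<Rightarrow> c (int m) | Suc j \<Rightarrow> d j"
  have cc: "?c i \<in> carrier R" if "i \<le> Suc e" for i using that dc c(1) by (cases i) auto
  have "(\<Oplus>i\<in>{..Suc e}. ?c i \<otimes> x [^] (Suc e - i)) = (\<Oplus>i\<in>{..e}. ?c (Suc i) \<otimes> x [^] (Suc e - Suc i)) \<oplus> ?c 0 \<otimes> x [^] (Suc e - 0)"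
    by (rule finsum_Suc2) (use cc x in auto)
  also have "\<dots> = f (int m)"
    unfolding fm using m_comm[OF coeff_closed[OF c(1)] xe, of "int m"] a_comm[OF finsum_closed m_closed[OF xe coeff_closed[OF c(1)]], of "\<lambda>i. d i \<otimes> x [^] (e - i)" "{..e}" "int m"] dc x
    by simp
  finally have "f (int m) = (\<Oplus>i\<in>{..Suc e}. ?c i \<otimes> x [^] (Suc e - i))" ..
  moreover have "?c i \<in> ideal_power R I (m + n * i)" if "i \<le> Suc e" for i
  proof (cases i)
    case 0
    then show ?thesis using coeff_Ip[OF c(1), of "int m"] by simp
  next
    case (Suc j)
    then have "d j \<in> ideal_power R I (m + n + n * j)" using d(1) that by simp
    then show ?thesis using Suc by (simp add: algebra_simps)
  qed
  ultimately show ?case by blast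
qed

text \<open>An element c of I^(n i) is u^(n i) times the homogeneous element c t^(n i); thus an
  equation over I^n becomes one over u^n. Conversely, comparing coefficients of degree 0 in an
  equation over u^n expresses x^(e+1) by the coefficient of f in degree n, which
  \<open>forms_coeff\<close> expands.\<close>

lemma integral_closure_iff:
  assumes x: "x \<in> carrier R"
  shows "x \<in> integral_closure R (ideal_power R I n) \<longleftrightarrow> integral_over A (rees_u R [^]\<^bsub>A\<^esub> n) (rees_const R x)"
proof
  let ?X = "rees_const R x" and ?V = "rees_u R [^]\<^bsub>A\<^esub> n"
  have X: "?X \<in> carrier A" using x by simp
  note V = u_pow_closed[of n]
  assume "x \<in> integral_closure R (ideal_power R I n)"
  then obtain k c where k: "k \<ge> 1" and c: "\<And>i. i \<in> {1..k} \<Longrightarrow> c i \<in> ideal_power R I (n * i)"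
    and eq: "x [^] k \<oplus> (\<Oplus>i\<in>{1..k}. c i \<otimes> x [^] (k - i)) = \<zero>"
    unfolding integral_closure_def ideal_power_power[OF I] by blast
  have cc: "c i \<in> carrier R" if "i \<in> {1..k}" for i using ideal_power_closed[OF I c[OF that]] .
  let ?J = "{?V \<otimes>\<^bsub>A\<^esub> f | f. f \<in> forms A ?X ?V (k - 1)}"
  have J: "ideal ?J A" by (rule A.vforms_ideal[OF X V])
  have VI: "?V [^]\<^bsub>A\<^esub> i \<in> forms A ?X ?V i" for i :: nat
  proof (induction i)
    case (Suc i)
    then show ?case using A.forms_v[OF X V Suc] A.m_comm[OF V A.nat_pow_closed[OF V]] by simp
  qed simp
  have term_J: "rees_const R (c i \<otimes> x [^] (k - i)) \<in> ?J" if i: "i \<in> {1..k}" for i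
  proof -
    have ci: "c i \<in> Ip (int (n * i))" unfolding nat_int by (rule c[OF i])
    define d where "d = mono (c i) (int (n * i))"
    have d: "d \<in> carrier A" unfolding d_def by (rule mono_closed[OF ci])
    have "?V [^]\<^bsub>A\<^esub> i \<otimes>\<^bsub>A\<^esub> d = mono \<one> (- int (n * i)) \<otimes>\<^bsub>A\<^esub> mono (c i) (int (n * i))"
      unfolding d_def using A.nat_pow_pow[OF rees_u_closed, of n i] rees_u_pow[of "n * i"] by metis
    also have "\<dots> = mono (\<one> \<otimes> c i) (- int (n * i) + int (n * i))"
      by (rule mono_mult_mono[OF _ ci]) (simp add: ideal_power_0)
    also have "\<dots> = rees_const R (c i)" unfolding rees_const_mono using cc[OF i] by simp
    finally have Vd: "?V [^]\<^bsub>A\<^esub> i \<otimes>\<^bsub>A\<^esub> d = rees_const R (c i)" .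
    \<comment> \<open>One factor \<open>?V\<close> is split off, which uses i \<ge> 1; the others
      form, with the power of \<open>?X\<close>, a form of degree (i - 1) + (k - i) = k - 1.\<close>
    define f where "f = d \<otimes>\<^bsub>A\<^esub> (?V [^]\<^bsub>A\<^esub> (i - 1) \<otimes>\<^bsub>A\<^esub> ?X [^]\<^bsub>A\<^esub> (k - i))"
    have "?V [^]\<^bsub>A\<^esub> (i - 1) \<otimes>\<^bsub>A\<^esub> ?X [^]\<^bsub>A\<^esub> (k - i) \<in> forms A ?X ?V (i - 1 + (k - i))"
      by (rule A.forms_mult[OF X V VI A.forms_pow[OF X V]])
    moreover have "i - 1 + (k - i) = k - 1" using i by simp
    ultimately have f: "f \<in> forms A ?X ?V (k - 1)" unfolding f_def using A.forms_scale[OF X V _ d] by simp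
    have Vi: "?V [^]\<^bsub>A\<^esub> i = ?V [^]\<^bsub>A\<^esub> (i - 1) \<otimes>\<^bsub>A\<^esub> ?V" using i A.nat_pow_Suc[of ?V "i - 1"] by simp
    have "?V \<otimes>\<^bsub>A\<^esub> f = ((?V [^]\<^bsub>A\<^esub> (i - 1) \<otimes>\<^bsub>A\<^esub> ?V) \<otimes>\<^bsub>A\<^esub> d) \<otimes>\<^bsub>A\<^esub> ?X [^]\<^bsub>A\<^esub> (k - i)"
      unfolding f_def using V X d A.nat_pow_closed[OF V, of "i - 1"] A.nat_pow_closed[OF X, of "k - i"] by algebra
    also have "\<dots> = rees_const R (c i) \<otimes>\<^bsub>A\<^esub> ?X [^]\<^bsub>A\<^esub> (k - i)" unfolding Vi[symmetric] Vd ..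
    also have "\<dots> = rees_const R (c i \<otimes> x [^] (k - i))" using cc[OF i] x by (simp add: H.ring.hom_nat_pow)
    finally show ?thesis using f by force
  qed
  have "rees_const R (\<Oplus>i\<in>{1..k}. c i \<otimes> x [^] (k - i)) = (\<Oplus>\<^bsub>A\<^esub>i\<in>{1..k}. rees_const R (c i \<otimes> x [^] (k - i)))"
    by (subst H.hom_finsum) (use cc x in \<open>auto simp: comp_def\<close>)
  also have "\<dots> \<in> ?J" by (rule A.finsum_ideal[OF J term_J])
  finally have sum: "rees_const R (\<Oplus>i\<in>{1..k}. c i \<otimes> x [^] (k - i)) \<in> ?J" .
  have sc: "(\<Oplus>i\<in>{1..k}. c i \<otimes> x [^] (k - i)) \<in> carrier R" by (rule finsum_closed) (use cc x in auto)
  have xk: "x [^] k \<in> carrier R" using x by simp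
  have "(\<Oplus>i\<in>{1..k}. c i \<otimes> x [^] (k - i)) \<oplus> x [^] k = \<zero>" using eq a_comm[OF sc xk] by metis
  then have "rees_const R (\<Oplus>i\<in>{1..k}. c i \<otimes> x [^] (k - i)) \<oplus>\<^bsub>A\<^esub> rees_const R (x [^] k) = \<zero>\<^bsub>A\<^esub>"
    using H.hom_add[OF sc xk] H.hom_zero by metis
  then have "rees_const R (\<Oplus>i\<in>{1..k}. c i \<otimes> x [^] (k - i)) \<oplus>\<^bsub>A\<^esub> rees_const R (x [^] k) \<in> ?J"
    using additive_subgroup.zero_closed[OF ideal.axioms(1)[OF J]] by simp
  then have "rees_const R (x [^] k) \<in> ?J" by (rule A.ideal_add_cancel[OF J sum, rotated]) (use x in simp)
  moreover have "rees_const R (x [^] k) = ?X [^]\<^bsub>A\<^esub> Suc (k - 1)" using x k by (simp add: H.ring.hom_nat_pow del: nat_pow_Suc A.nat_pow_Suc)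
  ultimately show "integral_over A ?V ?X" unfolding integral_over_def by auto
next
  let ?X = "rees_const R x" and ?V = "rees_u R [^]\<^bsub>A\<^esub> n"
  have X: "?X \<in> carrier A" using x by simp
  note V = u_pow_closed[of n]
  assume "integral_over A ?V ?X"
  then obtain e f where f: "f \<in> forms A ?X ?V e" "?X [^]\<^bsub>A\<^esub> Suc e = ?V \<otimes>\<^bsub>A\<^esub> f" unfolding integral_over_def by blast
  have fA: "f \<in> carrier A" by (rule A.forms_closed[OF X V f(1)])
  obtain c where c: "\<forall>i\<le>e. c i \<in> ideal_power R I (n + n * i)" "f (int n) = (\<Oplus>i\<in>{..e}. c i \<otimes> x [^] (e - i))"
    using forms_coeff[OF x f(1), of n] by blast
  have cc: "c i \<in> carrier R" if "i \<le> e" for i using c(1) that ideal_power_closed[OF I] by blast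
  have xe: "x [^] Suc e \<in> carrier R" using x by simp
  have "?X [^]\<^bsub>A\<^esub> Suc e = rees_const R (x [^] Suc e)" using x by (simp add: H.ring.hom_nat_pow)
  then have "(?X [^]\<^bsub>A\<^esub> Suc e) 0 = x [^] Suc e" by (simp add: rees_const_def)
  moreover have "(?V \<otimes>\<^bsub>A\<^esub> f) 0 = f (int n)" using u_pow_coeff[OF fA, of n 0] by simp
  ultimately have xf: "x [^] Suc e = f (int n)" using f(2) by metis
  \<comment> \<open>\<open>forms_coeff\<close> counts coefficients from 0, an equation of integral
    dependence from 1; the sign brings all terms to one side.\<close>
  let ?c = "\<lambda>i. \<ominus> (c (i - 1))"
  have fc: "(\<lambda>i. c i \<otimes> x [^] (e - i)) \<in> {..e} \<rightarrow> carrier R" using cc x by auto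
  have "(\<Oplus>i\<in>{1..Suc e}. ?c i \<otimes> x [^] (Suc e - i)) = (\<Oplus>i\<in>Suc ` {..e}. ?c i \<otimes> x [^] (Suc e - i))"
    by (simp only: image_Suc_atMost)
  also have "\<dots> = (\<Oplus>i\<in>{..e}. ?c (Suc i) \<otimes> x [^] (Suc e - Suc i))"
  proof (rule finsum_reindex)
    show "(\<lambda>i. ?c i \<otimes> x [^] (Suc e - i)) \<in> Suc ` {..e} \<rightarrow> carrier R"
    proof (rule Pi_I)
      fix i assume "i \<in> Suc ` {..e}"
      then obtain j where "i = Suc j" "j \<le> e" by auto
      then show "?c i \<otimes> x [^] (Suc e - i) \<in> carrier R" using cc[of j] x by simp
    qed
  qed simp
  also have "\<dots> = (\<Oplus>i\<in>{..e}. (\<ominus> \<one>) \<otimes> (c i \<otimes> x [^] (e - i)))"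
    by (rule finsum_cong'[OF refl]) (use cc x in \<open>auto simp: l_minus\<close>)
  also have "\<dots> = (\<ominus> \<one>) \<otimes> (\<Oplus>i\<in>{..e}. c i \<otimes> x [^] (e - i))"
    by (rule finsum_rdistr[symmetric]) (use fc in auto)
  also have "\<dots> = \<ominus> (x [^] Suc e)" unfolding c(2)[symmetric] xf[symmetric] using xe by (simp add: l_minus)
  finally have "x [^] Suc e \<oplus> (\<Oplus>i\<in>{1..Suc e}. ?c i \<otimes> x [^] (Suc e - i)) = \<zero>" using xe by (simp add: r_neg)
  moreover have "?c i \<in> ideal_power R I (n * i)" if "i \<in> {1..Suc e}" for i
  proof -
    have "c (i - 1) \<in> ideal_power R I (n + n * (i - 1))" using c(1) that by auto
    moreover have "n + n * (i - 1) = n * i" using that by (cases i) auto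
    ultimately show ?thesis using ideal_power_uminus[OF I] by metis
  qed
  ultimately show "x \<in> integral_closure R (ideal_power R I n)"
    unfolding integral_closure_def ideal_power_power[OF I] using x
    by (intro CollectI conjI exI[of _ "Suc e"] exI[of _ ?c]) auto
qed

end

theorem theorem3p1:
  fixes R :: "('a, 'm) ring_scheme" and I S :: "'a set"
  assumes "cring R" and "noetherian_ring R" and "\<one>\<^bsub>R\<^esub> \<noteq> \<zero>\<^bsub>R\<^esub>"
    and "ideal I R"
    and "submonoid S R"
    and "S \<subseteq> carrier R - \<Union> (A_star_star R I)"
  shows "\<forall>n::nat. n > 0 \<longrightarrow>
    contracted_ideal R (localization_map R S)
      (extended_ideal (localization R S) (localization_map R S)
        (integral_closure R (ideal_power R I n)))
    = integral_closure R (ideal_power R I n)"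
proof (intro allI impI)
  fix n :: nat assume n: "n > 0"
  interpret R: cring R by fact
  interpret rees R I by (intro rees.intro rees_axioms.intro assms)
  interpret L: localizing R S by (intro localizing.intro localizing_axioms.intro assms)
  interpret A: noetherian_cring "rees_ring R I" by (rule A.noetherian_cringI[OF rees_noetherian[OF assms(2)]])
  interpret N: noetherian_hom R "rees_ring R I" "rees_const R"
    by (intro noetherian_hom.intro rees_const_hom noetherian_hom_axioms.intro assms)
  let ?A = "rees_ring R I" and ?v = "rees_u R [^]\<^bsub>rees_ring R I\<^esub> n"
  let ?J = "integral_closure R (ideal_power R I n)"
  have Jsub: "?J \<subseteq> carrier R" unfolding integral_closure_def by blast
  \<comment> \<open>The description of an extended ideal by fractions starts from an ideal. The
    integral closure of I^n is one, being the contraction of an ideal of the Rees ring, where u^n is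
    regular.\<close>
  have "ideal {y \<in> carrier ?A. integral_over ?A ?v y} ?A"
    by (rule A.integral_over_ideal[OF u_pow_closed u_pow_regular])
  from N.ideal_vimage[OF this]
  have "ideal {x \<in> carrier R. rees_const R x \<in> {y \<in> carrier ?A. integral_over ?A ?v y}} R" .
  moreover have "{x \<in> carrier R. rees_const R x \<in> {y \<in> carrier ?A. integral_over ?A ?v y}} = ?J"
    using integral_closure_iff Jsub by auto
  ultimately have J: "ideal ?J R" by simp
  show "contracted_ideal R (localization_map R S) (extended_ideal (localization R S) (localization_map R S) ?J) = ?J"
  proof
    show "?J \<subseteq> contracted_ideal R (localization_map R S) (extended_ideal (localization R S) (localization_map R S) ?J)"
    proof
      fix x assume x: "x \<in> ?J"
      have "loc_frac R S x \<one>\<^bsub>R\<^esub> \<in> extended_ideal (localization R S) (localization_map R S) ?J"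
        unfolding L.mem_extended_ideal_iff[OF J] using x L.S_one by blast
      then show "x \<in> contracted_ideal R (localization_map R S) (extended_ideal (localization R S) (localization_map R S) ?J)"
        unfolding contracted_ideal_def localization_map_def using x Jsub by blast
    qed
    show "contracted_ideal R (localization_map R S) (extended_ideal (localization R S) (localization_map R S) ?J) \<subseteq> ?J"
    proof
      fix x assume "x \<in> contracted_ideal R (localization_map R S) (extended_ideal (localization R S) (localization_map R S) ?J)"
      then have x: "x \<in> carrier R" and "localization_map R S x \<in> extended_ideal (localization R S) (localization_map R S) ?J"
        unfolding contracted_ideal_def by auto
      then obtain j s where j: "j \<in> ?J" "s \<in> S" "loc_frac R S x \<one>\<^bsub>R\<^esub> = loc_frac R S j s"
        unfolding L.mem_extended_ideal_iff[OF J] localization_map_def by blast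
      have jc: "j \<in> carrier R" using j(1) Jsub by blast
      obtain t where t: "t \<in> S" "t \<otimes>\<^bsub>R\<^esub> (x \<otimes>\<^bsub>R\<^esub> s) = t \<otimes>\<^bsub>R\<^esub> (j \<otimes>\<^bsub>R\<^esub> \<one>\<^bsub>R\<^esub>)"
        using L.frac_eq_iff[OF x L.S_one jc j(2)] j(3) by blast
      \<comment> \<open>x / 1 = j / s means t x s = t j for some t in \<open>S\<close>; so q = t s
        is an element of \<open>S\<close> that multiplies x into the integral closure.\<close>
      define q where "q = t \<otimes>\<^bsub>R\<^esub> s"
      have qS: "q \<in> S" unfolding q_def by (rule L.S_mult[OF t(1) j(2)])
      have qc: "q \<in> carrier R" by (rule L.S_closed[OF qS])
      have "q \<otimes>\<^bsub>R\<^esub> x = t \<otimes>\<^bsub>R\<^esub> (x \<otimes>\<^bsub>R\<^esub> s)"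
        unfolding q_def using L.S_closed[OF t(1)] L.S_closed[OF j(2)] x by (simp add: R.m_ac)
      also have "\<dots> \<in> ?J" unfolding t(2) using ideal.I_l_closed[OF J j(1) L.S_closed[OF t(1)]] jc by simp
      finally have "integral_over ?A ?v (rees_const R (q \<otimes>\<^bsub>R\<^esub> x))"
        using integral_closure_iff[of "q \<otimes>\<^bsub>R\<^esub> x" n] qc x by simp
      moreover have Q: "rees_const R q \<in> carrier ?A" and Xc: "rees_const R x \<in> carrier ?A" using qc x by simp_all
      moreover have "rees_const R (q \<otimes>\<^bsub>R\<^esub> x) = rees_const R q \<otimes>\<^bsub>?A\<^esub> rees_const R x" using qc x by simp
      ultimately obtain e f where f: "f \<in> forms ?A (rees_const R q \<otimes>\<^bsub>?A\<^esub> rees_const R x) ?v e"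
        "(rees_const R q \<otimes>\<^bsub>?A\<^esub> rees_const R x) [^]\<^bsub>?A\<^esub> Suc e = ?v \<otimes>\<^bsub>?A\<^esub> f"
        unfolding integral_over_def by auto
      have f': "f \<in> forms ?A (rees_const R x) ?v e" using A.forms_multiple[OF Xc u_pow_closed Q] f(1) by blast
      have "rees_const R q [^]\<^bsub>?A\<^esub> Suc e \<otimes>\<^bsub>?A\<^esub> rees_const R x [^]\<^bsub>?A\<^esub> Suc e = ?v \<otimes>\<^bsub>?A\<^esub> f"
        using f(2) A.nat_pow_distrib[OF Q Xc, of "Suc e"] by metis
      \<comment> \<open>Only a power of q is seen to lie in the conductor; primality removes the
        exponent afterwards.\<close>
      then have cond: "rees_const R q [^]\<^bsub>?A\<^esub> Suc e \<in> integral_conductor ?A ?v (rees_const R x)"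
        unfolding integral_conductor_def using f' A.nat_pow_closed[OF Q, of "Suc e"] by blast
      show "x \<in> ?J"
      proof (rule ccontr)
        assume "x \<notin> ?J"
        then have "\<not> integral_over ?A ?v (rees_const R x)" using integral_closure_iff[OF x] by simp
        then obtain P where P: "P \<in> quintasymptotic_primes ?A (PIdl\<^bsub>?A\<^esub> (rees_u R))"
          "integral_conductor ?A ?v (rees_const R x) \<subseteq> P"
          using A.quintasymptotic_prime_over_conductor[OF rees_u_closed Xc n] by blast
        have prime: "primeideal P ?A" using P(1) unfolding quintasymptotic_primes_def by blast
        have "rees_const R q \<in> P" by (rule A.primeideal_pow[OF prime Q, of "Suc e"]) (use cond P(2) in blast)
        then have "q \<in> contracted_ideal R (rees_const R) P" unfolding contracted_ideal_def using qc by simp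
        moreover have "contracted_ideal R (rees_const R) P \<in> A_star_star R I" unfolding A_star_star_def using P(1) by blast
        ultimately show False using assms(6) qS by blast
      qed
    qed
  qed
qed

end
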